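(* Let $k$ be a non-zero commutative ring, $H$ a Hopf algebra over $k$, $\sigma : H\times H\to k$ a two-cocycle of $H$, $M$ a left $H$-comodule, $T(M)$ its tensor algebra (a left $H$-comodule algebra), and $R\subset T(M)$ an $H$-subcomodule; let $(R)$ be the two-sided ideal of $T(M)$ generated by $R$. Then the natural map ${}_\sigma M \to {}_\sigma(T(M)/(R))$ induces an isomorphism $$T({}_\sigma M)/(\xi_\infty^{-1}(R)) \overset{\cong}{\longrightarrow} {}_\sigma(T(M)/(R))$$ of left ${}_\sigma H_{\sigma^{-1}}$-comodule algebras, where $(\xi_\infty^{-1}(R))$ is the two-sided ideal of $T({}_\sigma M)$ generated by $\xi_\infty^{-1}(R)$.
   Context: Unadorned tensor products are over $k$; Sweedler notation is used: $\Delta(x)=\sum x_1\otimes x_2$, and a left coaction $M\to H\otimes M$ is written $m\mapsto \sum m_{-1}\otimes m_0$. The tensor product of left $H$-comodules $M,N$ carries the coaction $m\otimes n\mapsto \sum m_{-1}n_{-1}\otimes m_0\otimes n_0$. A two-cocycle of $H$ is a convolution-invertible bilinear form $\sigma:H\times H\to k$ with $\sum\sigma(x_1,y_1)\sigma(x_2y_2,z)=\sum\sigma(y_1,z_1)\sigma(x,y_2z_2)$ for all $x,y,z\in H$; $\sigma^{-1}$ is its convolution inverse. The Hopf algebra ${}_\sigma H_{\sigma^{-1}}$ is $H$ as a coalgebra, with product $x\star_\sigma y=\sum\sigma(x_1,y_1)\,x_2y_2\,\sigma^{-1}(x_3,y_3)$. For a left $H$-comodule $M$, ${}_\sigma M$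 denotes $M$ viewed as a left ${}_\sigma H_{\sigma^{-1}}$-comodule (same coaction). For a left $H$-comodule algebra $A$, ${}_\sigma A$ is the left ${}_\sigma H_{\sigma^{-1}}$-comodule algebra with underlying comodule $A$, product $a*_\sigma b=\sum\sigma(a_{-1},b_{-1})\,a_0b_0$ and unit $\sigma(1,1)^{-1}1_A$. An $H$-subcomodule of a left $H$-comodule $Q$ is a $k$-submodule $P\subset Q$ such that the coaction $Q\to H\otimes Q$ maps $P$ into the natural image of $H\otimes P$. Then $(R)$ is an $H$-subcomodule of $T(M)$ and $T(M)/(R)$ is a left $H$-comodule algebra. The map $\xi_\infty=\bigoplus_{r\ge0}\xi_r: T({}_\sigma M)\to {}_\sigma T(M)$ is the linear isomorphism defined by $\xi_0(1)=\sigma(1,1)^{-1}$, $\xi_1=\mathrm{id}_M$, and, for $r\ge2$, $\xi_r(x_1\otimes\cdots\otimes x_r)=x_1*_\sigma x_2*_\sigma\cdots*_\sigma x_r$ (product in ${}_\sigma T(M)$) for $x_1,\dots,x_r\in M$. *)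

theory Defs
  imports "HOL-Algebra.Module" "HOL-Algebra.QuotRing"
begin

section \<open>Linear maps, free modules and quotients\<close>

definition linear_map ::
  "('k, 'z) ring_scheme \<Rightarrow> ('k, 'a, 'y) module_scheme \<Rightarrow> ('k, 'b, 'x) module_scheme \<Rightarrow> ('a \<Rightarrow> 'b) \<Rightarrow> bool"
  where "linear_map k M N f \<longleftrightarrow>
    f \<in> carrier M \<rightarrow> carrier N \<and>
    (\<forall>x\<in>carrier M. \<forall>y\<in>carrier M. f (x \<oplus>\<^bsub>M\<^esub> y) = f x \<oplus>\<^bsub>N\<^esub> f y) \<and>
    (\<forall>c\<in>carrier k. \<forall>x\<in>carrier M. f (c \<odot>\<^bsub>M\<^esub> x) = c \<odot>\<^bsub>N\<^esub> f x)"

definition self_module :: "('k, 'z) ring_scheme \<Rightarrow> ('k, 'k) module"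
  where "self_module k =
    \<lparr>carrier = carrier k, mult = mult k, one = one k, zero = zero k, add = add k, smult = mult k\<rparr>"

text \<open>The free module on a set \<open>X\<close>: finitely supported functions vanishing outside \<open>X\<close>.
  Only its module structure is meaningful.\<close>

definition free_module :: "('k, 'z) ring_scheme \<Rightarrow> 'x set \<Rightarrow> ('k, 'x \<Rightarrow> 'k) module"
  where "free_module k X =
    \<lparr>carrier = {u. (\<forall>x. u x \<in> carrier k) \<and> (\<forall>x. x \<notin> X \<longrightarrow> u x = \<zero>\<^bsub>k\<^esub>) \<and> finite {x. u x \<noteq> \<zero>\<^bsub>k\<^esub>}},
     mult = undefined, one = undefined,
     zero = (\<lambda>x. \<zero>\<^bsub>k\<^esub>), add = (\<lambda>u v x. u x \<oplus>\<^bsub>k\<^esub> v x), smult = (\<lambda>c u x. c \<otimes>\<^bsub>k\<^esub> u x)\<rparr>"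

definition free_gen :: "('k, 'z) ring_scheme \<Rightarrow> 'x \<Rightarrow> 'x \<Rightarrow> 'k"
  where "free_gen k x = (\<lambda>y. if y = x then \<one>\<^bsub>k\<^esub> else \<zero>\<^bsub>k\<^esub>)"

definition submodule_span :: "('k, 'z) ring_scheme \<Rightarrow> ('k, 'a, 'y) module_scheme \<Rightarrow> 'a set \<Rightarrow> 'a set"
  where "submodule_span k N S = \<Inter>{P. submodule P k N \<and> S \<subseteq> P}"

text \<open>The library's \<^const>\<open>FactRing\<close>, together with the induced scalar multiplication.
  It serves both for quotients of modules by submodules (the ring multiplication being
  meaningless then) and for quotients of algebras by two-sided ideals.\<close>

definition quotient :: "('k, 'a, 'y) module_scheme \<Rightarrow> 'a set \<Rightarrow> ('k, 'a set) module"
  where "quotient N P =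
    \<lparr>carrier = carrier (N Quot P), mult = mult (N Quot P), one = one (N Quot P),
     zero = zero (N Quot P), add = add (N Quot P),
     smult = (\<lambda>c A. \<Union>a\<in>A. P +>\<^bsub>N\<^esub> (c \<odot>\<^bsub>N\<^esub> a))\<rparr>"

text \<open>If \<open>f\<close> is a function on \<open>X\<close>, its linear extension to the free module on \<open>X\<close> and, when that
  extension kills the submodule in question, the induced map on the quotient, evaluated on
  a coset by means of an arbitrary representative.\<close>

definition free_lift ::
  "('k, 'z) ring_scheme \<Rightarrow> ('k, 'n, 'y) module_scheme \<Rightarrow> ('x \<Rightarrow> 'n) \<Rightarrow> ('x \<Rightarrow> 'k) \<Rightarrow> 'n"
  where "free_lift k N f u = (\<Oplus>\<^bsub>N\<^esub>x\<in>{x. u x \<noteq> \<zero>\<^bsub>k\<^esub>}. u x \<odot>\<^bsub>N\<^esub> f x)"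

definition coset_lift ::
  "('k, 'z) ring_scheme \<Rightarrow> ('k, 'n, 'y) module_scheme \<Rightarrow> ('x \<Rightarrow> 'n) \<Rightarrow> ('x \<Rightarrow> 'k) set \<Rightarrow> 'n"
  where "coset_lift k N f U = free_lift k N f (SOME u. u \<in> U)"


section \<open>Tensor products\<close>

type_synonym ('k, 'a, 'b) tensors = "('a \<times> 'b \<Rightarrow> 'k) set"

definition tensor_relations ::
  "('k, 'z) ring_scheme \<Rightarrow> ('k, 'a, 'y) module_scheme \<Rightarrow> ('k, 'b, 'x) module_scheme \<Rightarrow> ('a \<times> 'b \<Rightarrow> 'k) set"
  where "tensor_relations k P Q =
    (let F = free_module k (carrier P \<times> carrier Q); g = free_gen k in
      {g (x \<oplus>\<^bsub>P\<^esub> x', y) \<ominus>\<^bsub>F\<^esub> (g (x, y) \<oplus>\<^bsub>F\<^esub> g (x', y)) | x x' y.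
          x \<in> carrier P \<and> x' \<in> carrier P \<and> y \<in> carrier Q} \<union>
      {g (x, y \<oplus>\<^bsub>Q\<^esub> y') \<ominus>\<^bsub>F\<^esub> (g (x, y) \<oplus>\<^bsub>F\<^esub> g (x, y')) | x y y'.
          x \<in> carrier P \<and> y \<in> carrier Q \<and> y' \<in> carrier Q} \<union>
      {g (c \<odot>\<^bsub>P\<^esub> x, y) \<ominus>\<^bsub>F\<^esub> c \<odot>\<^bsub>F\<^esub> g (x, y) | c x y.
          c \<in> carrier k \<and> x \<in> carrier P \<and> y \<in> carrier Q} \<union>
      {g (x, c \<odot>\<^bsub>Q\<^esub> y) \<ominus>\<^bsub>F\<^esub> c \<odot>\<^bsub>F\<^esub> g (x, y) | c x y.
          c \<in> carrier k \<and> x \<in> carrier P \<and> y \<in> carrier Q})"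

definition tensor_null ::
  "('k, 'z) ring_scheme \<Rightarrow> ('k, 'a, 'y) module_scheme \<Rightarrow> ('k, 'b, 'x) module_scheme \<Rightarrow> ('a \<times> 'b \<Rightarrow> 'k) set"
  where "tensor_null k P Q =
    submodule_span k (free_module k (carrier P \<times> carrier Q)) (tensor_relations k P Q)"

definition tensor ::
  "('k, 'z) ring_scheme \<Rightarrow> ('k, 'a, 'y) module_scheme \<Rightarrow> ('k, 'b, 'x) module_scheme \<Rightarrow>
    ('k, ('k, 'a, 'b) tensors) module"
  where "tensor k P Q = quotient (free_module k (carrier P \<times> carrier Q)) (tensor_null k P Q)"

definition pure_tensor ::
  "('k, 'z) ring_scheme \<Rightarrow> ('k, 'a, 'y) module_scheme \<Rightarrow> ('k, 'b, 'x) module_scheme \<Rightarrow> 'a \<Rightarrow> 'b \<Rightarrow>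
    ('k, 'a, 'b) tensors"
  where "pure_tensor k P Q x y =
    tensor_null k P Q +>\<^bsub>free_module k (carrier P \<times> carrier Q)\<^esub> free_gen k (x, y)"

text \<open>For a bilinear \<open>f\<close> with values in \<open>N\<close>, the linear map with \<open>x \<otimes> y \<mapsto> f x y\<close>. Sweedler notation
  is rendered with it: \<open>\<Sum> f x\<^sub>1 x\<^sub>2\<close> is \<open>tensor_lift k N f\<close> applied to the coproduct of \<open>x\<close>.\<close>

definition tensor_lift ::
  "('k, 'z) ring_scheme \<Rightarrow> ('k, 'n, 'y) module_scheme \<Rightarrow> ('a \<Rightarrow> 'b \<Rightarrow> 'n) \<Rightarrow> ('k, 'a, 'b) tensors \<Rightarrow> 'n"
  where "tensor_lift k N f t = coset_lift k N (\<lambda>(x, y). f x y) t"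


section \<open>Algebras, coalgebras, Hopf algebras\<close>

text \<open>The library's locale \<^locale>\<open>algebra\<close> is restricted to commutative algebras.\<close>

locale k_algebra = module k A + ring A for k and A +
  assumes smult_mult_left: "\<lbrakk>c \<in> carrier k; a \<in> carrier A; b \<in> carrier A\<rbrakk>
      \<Longrightarrow> (c \<odot>\<^bsub>A\<^esub> a) \<otimes>\<^bsub>A\<^esub> b = c \<odot>\<^bsub>A\<^esub> (a \<otimes>\<^bsub>A\<^esub> b)"
    and smult_mult_right: "\<lbrakk>c \<in> carrier k; a \<in> carrier A; b \<in> carrier A\<rbrakk>
      \<Longrightarrow> a \<otimes>\<^bsub>A\<^esub> (c \<odot>\<^bsub>A\<^esub> b) = c \<odot>\<^bsub>A\<^esub> (a \<otimes>\<^bsub>A\<^esub> b)"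

definition k_algebra_hom ::
  "('k, 'z) ring_scheme \<Rightarrow> ('k, 'a, 'y) module_scheme \<Rightarrow> ('k, 'b, 'x) module_scheme \<Rightarrow> ('a \<Rightarrow> 'b) set"
  where "k_algebra_hom k A B = {f \<in> ring_hom A B. linear_map k A B f}"

record ('k, 'c) coalgebra = "('k, 'c) module" +
  comult :: "'c \<Rightarrow> ('k, 'c, 'c) tensors"
  counit :: "'c \<Rightarrow> 'k"

locale coalgebra = module k C for k and C :: "('k, 'c, 'z) coalgebra_scheme" +
  assumes comult_linear: "linear_map k C (tensor k C C) (comult C)"
    and counit_linear: "linear_map k C (self_module k) (counit C)"
    and coassoc: "x \<in> carrier C \<Longrightarrow>
      tensor_lift k (tensor k C (tensor k C C))
        (\<lambda>a x3. tensor_lift k (tensor k C (tensor k C C))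
          (\<lambda>x1 x2. pure_tensor k C (tensor k C C) x1 (pure_tensor k C C x2 x3)) (comult C a)) (comult C x)
      = tensor_lift k (tensor k C (tensor k C C))
        (\<lambda>x1 b. pure_tensor k C (tensor k C C) x1 (comult C b)) (comult C x)"
    and counit_left: "x \<in> carrier C \<Longrightarrow>
      tensor_lift k C (\<lambda>x1 x2. counit C x1 \<odot>\<^bsub>C\<^esub> x2) (comult C x) = x"
    and counit_right: "x \<in> carrier C \<Longrightarrow>
      tensor_lift k C (\<lambda>x1 x2. counit C x2 \<odot>\<^bsub>C\<^esub> x1) (comult C x) = x"

locale bialgebra = coalgebra k H + k_algebra k H for k and H :: "('k, 'h, 'z) coalgebra_scheme" +
  assumes comult_one: "comult H \<one>\<^bsub>H\<^esub> = pure_tensor k H H \<one>\<^bsub>H\<^esub> \<one>\<^bsub>H\<^esub>"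
    and comult_mult: "\<lbrakk>x \<in> carrier H; y \<in> carrier H\<rbrakk> \<Longrightarrow>
      comult H (x \<otimes>\<^bsub>H\<^esub> y) =
        tensor_lift k (tensor k H H) (\<lambda>x1 x2. tensor_lift k (tensor k H H)
          (\<lambda>y1 y2. pure_tensor k H H (x1 \<otimes>\<^bsub>H\<^esub> y1) (x2 \<otimes>\<^bsub>H\<^esub> y2)) (comult H y)) (comult H x)"
    and counit_one: "counit H \<one>\<^bsub>H\<^esub> = \<one>\<^bsub>k\<^esub>"
    and counit_mult: "\<lbrakk>x \<in> carrier H; y \<in> carrier H\<rbrakk> \<Longrightarrow>
      counit H (x \<otimes>\<^bsub>H\<^esub> y) = counit H x \<otimes>\<^bsub>k\<^esub> counit H y"

text \<open>The antipode is unique, so that its existence is a property of the bialgebra.\<close>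

locale hopf_algebra = bialgebra k H for k and H +
  assumes antipode: "\<exists>S. linear_map k H H S \<and> (\<forall>x\<in>carrier H.
      tensor_lift k H (\<lambda>x1 x2. S x1 \<otimes>\<^bsub>H\<^esub> x2) (comult H x) = counit H x \<odot>\<^bsub>H\<^esub> \<one>\<^bsub>H\<^esub> \<and>
      tensor_lift k H (\<lambda>x1 x2. x1 \<otimes>\<^bsub>H\<^esub> S x2) (comult H x) = counit H x \<odot>\<^bsub>H\<^esub> \<one>\<^bsub>H\<^esub>)"


section \<open>Comodules and comodule algebras\<close>

record ('k, 'h, 'm) comodule = "('k, 'm) module" +
  coact :: "'m \<Rightarrow> ('k, 'h, 'm) tensors"

locale left_comodule = H: coalgebra k H + module k M
  for k and H and M :: "('k, 'h, 'm, 'z) comodule_scheme" +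
  assumes coact_linear: "linear_map k M (tensor k H M) (coact M)"
    and coact_coassoc: "m \<in> carrier M \<Longrightarrow>
      tensor_lift k (tensor k H (tensor k H M))
        (\<lambda>h m0. tensor_lift k (tensor k H (tensor k H M))
          (\<lambda>h1 h2. pure_tensor k H (tensor k H M) h1 (pure_tensor k H M h2 m0)) (comult H h)) (coact M m)
      = tensor_lift k (tensor k H (tensor k H M))
        (\<lambda>h m0. pure_tensor k H (tensor k H M) h (coact M m0)) (coact M m)"
    and coact_counit: "m \<in> carrier M \<Longrightarrow>
      tensor_lift k M (\<lambda>h m0. counit H h \<odot>\<^bsub>M\<^esub> m0) (coact M m) = m"

definition colinear_map ::
  "('k, 'z) ring_scheme \<Rightarrow> ('k, 'h, 'y) module_scheme \<Rightarrow> ('k, 'h, 'a, 'x) comodule_scheme \<Rightarrow>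
    ('k, 'h, 'b, 'w) comodule_scheme \<Rightarrow> ('a \<Rightarrow> 'b) \<Rightarrow> bool"
  where "colinear_map k H M N f \<longleftrightarrow> linear_map k M N f \<and>
    (\<forall>m\<in>carrier M. coact N (f m) =
      tensor_lift k (tensor k H N) (\<lambda>h m0. pure_tensor k H N h (f m0)) (coact M m))"

text \<open>The natural map from \<open>H \<otimes> P\<close> to \<open>H \<otimes> Q\<close> need not be injective.\<close>

definition subcomodule ::
  "('k, 'z) ring_scheme \<Rightarrow> ('k, 'h, 'y) module_scheme \<Rightarrow> ('k, 'h, 'q, 'x) comodule_scheme \<Rightarrow> 'q set \<Rightarrow> bool"
  where "subcomodule k H Q P \<longleftrightarrow> submodule P k Q \<and>
    coact Q ` P \<subseteq> tensor_lift k (tensor k H Q) (pure_tensor k H Q) ` carrier (tensor k H (Q\<lparr>carrier := P\<rparr>))"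

locale left_comodule_algebra =
  H: bialgebra k H + left_comodule k H A + k_algebra k A
  for k and H and A :: "('k, 'h, 'a, 'z) comodule_scheme" +
  assumes coact_one: "coact A \<one>\<^bsub>A\<^esub> = pure_tensor k H A \<one>\<^bsub>H\<^esub> \<one>\<^bsub>A\<^esub>"
    and coact_mult: "\<lbrakk>a \<in> carrier A; b \<in> carrier A\<rbrakk> \<Longrightarrow>
      coact A (a \<otimes>\<^bsub>A\<^esub> b) =
        tensor_lift k (tensor k H A) (\<lambda>h a0. tensor_lift k (tensor k H A)
          (\<lambda>g b0. pure_tensor k H A (h \<otimes>\<^bsub>H\<^esub> g) (a0 \<otimes>\<^bsub>A\<^esub> b0)) (coact A b)) (coact A a)"

definition comodule_algebra_iso ::
  "('k, 'z) ring_scheme \<Rightarrow> ('k, 'h, 'y) coalgebra_scheme \<Rightarrow> ('k, 'h, 'a, 'x) comodule_scheme \<Rightarrow>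
    ('k, 'h, 'b, 'w) comodule_scheme \<Rightarrow> ('a \<Rightarrow> 'b) \<Rightarrow> bool"
  where "comodule_algebra_iso k H A B f \<longleftrightarrow>
    left_comodule_algebra k H A \<and> left_comodule_algebra k H B \<and>
    f \<in> k_algebra_hom k A B \<and> colinear_map k H A B f \<and> bij_betw f (carrier A) (carrier B)"

definition with_coact ::
  "('k, 'a, 'z) module_scheme \<Rightarrow> ('a \<Rightarrow> ('k, 'h, 'a) tensors) \<Rightarrow> ('k, 'h, 'a) comodule"
  where "with_coact A \<delta> =
    \<lparr>carrier = carrier A, mult = mult A, one = one A, zero = zero A, add = add A, smult = smult A,
     coact = \<delta>\<rparr>"

definition quotient_comodule_algebra ::
  "('k, 'z) ring_scheme \<Rightarrow> ('k, 'h, 'y) module_scheme \<Rightarrow> ('k, 'h, 'a, 'x) comodule_scheme \<Rightarrow> 'a set \<Rightarrow>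
    ('k, 'h, 'a set) comodule"
  where "quotient_comodule_algebra k H A I =
    with_coact (quotient A I)
      (\<lambda>X. tensor_lift k (tensor k H (quotient A I))
        (\<lambda>h a0. pure_tensor k H (quotient A I) h (I +>\<^bsub>A\<^esub> a0)) (coact A (SOME a. a \<in> X)))"


section \<open>The tensor algebra\<close>

text \<open>\<open>T(M)\<close> is the quotient of the free module on all finite words in \<open>M\<close> by the multilinearity
  relations. These relations are homogeneous in the length of words, so this is the direct sum of
  the tensor powers \<open>M\<^sup>\<otimes>\<^sup>r\<close>, the class of the word \<open>[x\<^sub>1, \<dots>, x\<^sub>r]\<close> being \<open>x\<^sub>1 \<otimes> \<dots> \<otimes> x\<^sub>r\<close>.\<close>

definition word_relations ::
  "('k, 'z) ring_scheme \<Rightarrow> ('k, 'm, 'y) module_scheme \<Rightarrow> ('m list \<Rightarrow> 'k) set"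
  where "word_relations k M =
    (let F = free_module k (lists (carrier M)); g = free_gen k in
      {g (u @ (x \<oplus>\<^bsub>M\<^esub> y) # v) \<ominus>\<^bsub>F\<^esub> (g (u @ x # v) \<oplus>\<^bsub>F\<^esub> g (u @ y # v)) | u v x y.
          u \<in> lists (carrier M) \<and> v \<in> lists (carrier M) \<and> x \<in> carrier M \<and> y \<in> carrier M} \<union>
      {g (u @ (c \<odot>\<^bsub>M\<^esub> x) # v) \<ominus>\<^bsub>F\<^esub> c \<odot>\<^bsub>F\<^esub> g (u @ x # v) | u v c x.
          u \<in> lists (carrier M) \<and> v \<in> lists (carrier M) \<and> c \<in> carrier k \<and> x \<in> carrier M})"

definition word_null ::
  "('k, 'z) ring_scheme \<Rightarrow> ('k, 'm, 'y) module_scheme \<Rightarrow> ('m list \<Rightarrow> 'k) set"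
  where "word_null k M =
    submodule_span k (free_module k (lists (carrier M))) (word_relations k M)"

definition word_class ::
  "('k, 'z) ring_scheme \<Rightarrow> ('k, 'm, 'y) module_scheme \<Rightarrow> 'm list \<Rightarrow> ('m list \<Rightarrow> 'k) set"
  where "word_class k M w =
    word_null k M +>\<^bsub>free_module k (lists (carrier M))\<^esub> free_gen k w"

text \<open>The multiplication is the bilinear extension of concatenation.\<close>

definition tensor_algebra ::
  "('k, 'z) ring_scheme \<Rightarrow> ('k, 'm, 'y) module_scheme \<Rightarrow> ('k, ('m list \<Rightarrow> 'k) set) module"
  where "tensor_algebra k M =
    (let V = quotient (free_module k (lists (carrier M))) (word_null k M) in
      V\<lparr>mult := \<lambda>A B. coset_lift k V (\<lambda>u. coset_lift k V (\<lambda>v. word_class k M (u @ v)) B) A,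
        one := word_class k M []\<rparr>)"

text \<open>The coaction
  \<open>x\<^sub>1 \<otimes> \<dots> \<otimes> x\<^sub>r \<mapsto> \<Sum> (x\<^sub>1)\<^sub>-\<^sub>1 \<cdots> (x\<^sub>r)\<^sub>-\<^sub>1 \<otimes> ((x\<^sub>1)\<^sub>0 \<otimes> \<dots> \<otimes> (x\<^sub>r)\<^sub>0)\<close> on words.\<close>

primrec word_coact ::
  "('k, 'z) ring_scheme \<Rightarrow> ('k, 'h, 'y) module_scheme \<Rightarrow> ('k, 'h, 'm, 'x) comodule_scheme \<Rightarrow> 'm list \<Rightarrow>
    ('k, 'h, ('m list \<Rightarrow> 'k) set) tensors"
  where
    "word_coact k H M [] = pure_tensor k H (tensor_algebra k M) \<one>\<^bsub>H\<^esub> \<one>\<^bsub>tensor_algebra k M\<^esub>"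
  | "word_coact k H M (x # w) =
      tensor_lift k (tensor k H (tensor_algebra k M)) (\<lambda>h x0.
        tensor_lift k (tensor k H (tensor_algebra k M)) (\<lambda>g t0.
          pure_tensor k H (tensor_algebra k M) (h \<otimes>\<^bsub>H\<^esub> g) (word_class k M [x0] \<otimes>\<^bsub>tensor_algebra k M\<^esub> t0))
        (word_coact k H M w)) (coact M x)"

definition tensor_comodule_algebra ::
  "('k, 'z) ring_scheme \<Rightarrow> ('k, 'h, 'y) module_scheme \<Rightarrow> ('k, 'h, 'm, 'x) comodule_scheme \<Rightarrow>
    ('k, 'h, ('m list \<Rightarrow> 'k) set) comodule"
  where "tensor_comodule_algebra k H M =
    with_coact (tensor_algebra k M)
      (coset_lift k (tensor k H (tensor_algebra k M)) (word_coact k H M))"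


section \<open>Two-cocycles and twisting\<close>

definition bilinear_form ::
  "('k, 'z) ring_scheme \<Rightarrow> ('k, 'h, 'y) module_scheme \<Rightarrow> ('h \<Rightarrow> 'h \<Rightarrow> 'k) \<Rightarrow> bool"
  where "bilinear_form k H \<sigma> \<longleftrightarrow>
    (\<forall>x\<in>carrier H. linear_map k H (self_module k) (\<sigma> x)) \<and>
    (\<forall>y\<in>carrier H. linear_map k H (self_module k) (\<lambda>x. \<sigma> x y))"

text \<open>The convolution product of bilinear forms; its unit is \<open>(x, y) \<mapsto> \<epsilon>(x) \<epsilon>(y)\<close>.\<close>

definition convolution ::
  "('k, 'z) ring_scheme \<Rightarrow> ('k, 'h, 'y) coalgebra_scheme \<Rightarrow> ('h \<Rightarrow> 'h \<Rightarrow> 'k) \<Rightarrow> ('h \<Rightarrow> 'h \<Rightarrow> 'k) \<Rightarrow>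
    'h \<Rightarrow> 'h \<Rightarrow> 'k"
  where "convolution k H \<sigma> \<tau> x y =
    tensor_lift k (self_module k) (\<lambda>x1 x2. tensor_lift k (self_module k)
      (\<lambda>y1 y2. \<sigma> x1 y1 \<otimes>\<^bsub>k\<^esub> \<tau> x2 y2) (comult H y)) (comult H x)"

definition convolution_inverse ::
  "('k, 'z) ring_scheme \<Rightarrow> ('k, 'h, 'y) coalgebra_scheme \<Rightarrow> ('h \<Rightarrow> 'h \<Rightarrow> 'k) \<Rightarrow> ('h \<Rightarrow> 'h \<Rightarrow> 'k) \<Rightarrow> bool"
  where "convolution_inverse k H \<sigma> \<tau> \<longleftrightarrow> bilinear_form k H \<tau> \<and>
    (\<forall>x\<in>carrier H. \<forall>y\<in>carrier H.
      convolution k H \<sigma> \<tau> x y = counit H x \<otimes>\<^bsub>k\<^esub> counit H y \<and>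
      convolution k H \<tau> \<sigma> x y = counit H x \<otimes>\<^bsub>k\<^esub> counit H y)"

definition two_cocycle ::
  "('k, 'z) ring_scheme \<Rightarrow> ('k, 'h, 'y) coalgebra_scheme \<Rightarrow> ('h \<Rightarrow> 'h \<Rightarrow> 'k) \<Rightarrow> bool"
  where "two_cocycle k H \<sigma> \<longleftrightarrow> bilinear_form k H \<sigma> \<and> (\<exists>\<tau>. convolution_inverse k H \<sigma> \<tau>) \<and>
    (\<forall>x\<in>carrier H. \<forall>y\<in>carrier H. \<forall>z\<in>carrier H.
      tensor_lift k (self_module k) (\<lambda>x1 x2. tensor_lift k (self_module k)
        (\<lambda>y1 y2. \<sigma> x1 y1 \<otimes>\<^bsub>k\<^esub> \<sigma> (x2 \<otimes>\<^bsub>H\<^esub> y2) z) (comult H y)) (comult H x)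
      = tensor_lift k (self_module k) (\<lambda>y1 y2. tensor_lift k (self_module k)
        (\<lambda>z1 z2. \<sigma> y1 z1 \<otimes>\<^bsub>k\<^esub> \<sigma> x (y2 \<otimes>\<^bsub>H\<^esub> z2)) (comult H z)) (comult H y))"

text \<open>The convolution inverse is unique on \<open>carrier H\<close>, arbitrary elsewhere.\<close>

definition cocycle_inv ::
  "('k, 'z) ring_scheme \<Rightarrow> ('k, 'h, 'y) coalgebra_scheme \<Rightarrow> ('h \<Rightarrow> 'h \<Rightarrow> 'k) \<Rightarrow> 'h \<Rightarrow> 'h \<Rightarrow> 'k"
  where "cocycle_inv k H \<sigma> = (SOME \<tau>. convolution_inverse k H \<sigma> \<tau>)"

text \<open>The Hopf algebra \<open>\<^sub>\<sigma>H\<^sub>\<sigma>\<^sub>-\<^sub>1\<close>. For every \<open>H\<close>-comodule \<open>M\<close>, the comodule \<open>\<^sub>\<sigma>M\<close> over it is \<open>M\<close> itself: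
  the two Hopf algebras have the same coalgebra, and tensor products do not involve the ring
  multiplication of \<open>H\<close>.\<close>

definition cocycle_twist ::
  "('k, 'z) ring_scheme \<Rightarrow> ('h \<Rightarrow> 'h \<Rightarrow> 'k) \<Rightarrow> ('k, 'h, 'y) coalgebra_scheme \<Rightarrow> ('k, 'h, 'y) coalgebra_scheme"
  where "cocycle_twist k \<sigma> H = H\<lparr>mult := \<lambda>x y.
    tensor_lift k H (\<lambda>x1 x'. tensor_lift k H (\<lambda>x2 x3.
      tensor_lift k H (\<lambda>y1 y'. tensor_lift k H (\<lambda>y2 y3.
        (\<sigma> x1 y1 \<otimes>\<^bsub>k\<^esub> cocycle_inv k H \<sigma> x3 y3) \<odot>\<^bsub>H\<^esub> (x2 \<otimes>\<^bsub>H\<^esub> y2))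
      (comult H y')) (comult H y)) (comult H x')) (comult H x)\<rparr>"

definition comodule_algebra_twist ::
  "('k, 'z) ring_scheme \<Rightarrow> ('k, 'h, 'y) coalgebra_scheme \<Rightarrow> ('h \<Rightarrow> 'h \<Rightarrow> 'k) \<Rightarrow>
    ('k, 'h, 'a, 'x) comodule_scheme \<Rightarrow> ('k, 'h, 'a, 'x) comodule_scheme"
  where "comodule_algebra_twist k H \<sigma> A = A\<lparr>
    mult := \<lambda>a b. tensor_lift k A (\<lambda>h a0. tensor_lift k A
      (\<lambda>g b0. \<sigma> h g \<odot>\<^bsub>A\<^esub> (a0 \<otimes>\<^bsub>A\<^esub> b0)) (coact A b)) (coact A a),
    one := inv\<^bsub>k\<^esub> (\<sigma> \<one>\<^bsub>H\<^esub> \<one>\<^bsub>H\<^esub>) \<odot>\<^bsub>A\<^esub> \<one>\<^bsub>A\<^esub>\<rparr>"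

text \<open>The map \<open>\<xi>\<^sub>\<infinity>\<close> on words; the twisted product being associative, the bracketing is immaterial.\<close>

fun xi_word ::
  "('k, 'z) ring_scheme \<Rightarrow> ('k, 'h, 'y) coalgebra_scheme \<Rightarrow> ('h \<Rightarrow> 'h \<Rightarrow> 'k) \<Rightarrow>
    ('k, 'h, 'm, 'x) comodule_scheme \<Rightarrow> 'm list \<Rightarrow> ('m list \<Rightarrow> 'k) set"
  where
    "xi_word k H \<sigma> M [] =
      inv\<^bsub>k\<^esub> (\<sigma> \<one>\<^bsub>H\<^esub> \<one>\<^bsub>H\<^esub>) \<odot>\<^bsub>tensor_comodule_algebra k H M\<^esub> \<one>\<^bsub>tensor_comodule_algebra k H M\<^esub>"
  | "xi_word k H \<sigma> M [x] = word_class k M [x]"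
  | "xi_word k H \<sigma> M (x # y # w) =
      word_class k M [x] \<otimes>\<^bsub>comodule_algebra_twist k H \<sigma> (tensor_comodule_algebra k H M)\<^esub>
        xi_word k H \<sigma> M (y # w)"

definition xi ::
  "('k, 'z) ring_scheme \<Rightarrow> ('k, 'h, 'y) coalgebra_scheme \<Rightarrow> ('h \<Rightarrow> 'h \<Rightarrow> 'k) \<Rightarrow>
    ('k, 'h, 'm, 'x) comodule_scheme \<Rightarrow> ('m list \<Rightarrow> 'k) set \<Rightarrow> ('m list \<Rightarrow> 'k) set"
  where "xi k H \<sigma> M = coset_lift k (tensor_algebra k M) (xi_word k H \<sigma> M)"

end

theory Submission
imports Defs
begin

text \<open>The twist by \<open>\<sigma>\<close> replaces a product \<open>a b\<close> by \<open>\<Sum> \<sigma>(a\<^sub>-\<^sub>1, b\<^sub>-\<^sub>1) a\<^sub>0 b\<^sub>0\<close>: it convolves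
  the multiplication with \<open>\<sigma>\<close>. Convolution with \<open>\<tau> = \<sigma>\<^sup>-\<^sup>1\<close> undoes it. The isomorphism is therefore
  to be expected already before dividing by relations, and the point is to carry ideals through
  maps that are multiplicative only up to a convolution.

  The comparison map \<open>\<xi>\<close> from \<open>T(\<^sub>\<sigma>M)\<close> to \<open>\<^sub>\<sigma>T(M)\<close> is determined by its value at \<open>1\<close> and by
  \<open>\<xi>(x t) = \<Sum> \<sigma>(x\<^sub>-\<^sub>1, \<xi>(t)\<^sub>-\<^sub>1) x\<^sub>0 \<xi>(t)\<^sub>0\<close> for \<open>x\<close> in \<open>M\<close>. It is multiplicative because the twisted
  product is associative (lemma \<open>\<xi>_mult\<close>), which is the cocycle identity, and it is colinear because the
  coaction is multiplicative for the twisted products (lemma \<open>\<xi>_colinear\<close>). Its inverse \<open>\<eta>\<close> is given by the same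
  recursion with \<open>\<tau>\<close> in place of \<open>\<sigma>\<close>, and with the coaction of \<open>T(\<^sub>\<sigma>M)\<close> in place of that
  of \<open>T(M)\<close>; colinearity of \<open>\<xi>\<close> and \<open>\<eta>\<close> is what makes the two convolutions cancel
  (lemmas \<open>\<xi>_\<eta>\<close> and \<open>\<eta>_\<xi>\<close>).

  Let \<open>I = (R)\<close> and \<open>J = (\<xi>\<^sup>-\<^sup>1(R))\<close>. The composite \<open>\<Theta>\<close> of \<open>\<xi>\<close> with the projection modulo \<open>I\<close> is an algebra
  map into the twisted quotient and kills \<open>\<xi>\<^sup>-\<^sup>1(R)\<close>, so it factors through a surjection \<open>\<Phi>\<close> defined on the quotient
  by \<open>J\<close>. For injectivity it has to be shown that \<open>\<eta>\<close> maps \<open>I\<close> into \<open>J\<close> (lemma \<open>idI_\<eta>\<close>). The composite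
  \<open>\<theta>\<close> of \<open>\<eta>\<close> with the projection modulo \<open>J\<close> kills \<open>R\<close>, but it is no algebra map on \<open>T(M)\<close>: it satisfies
  \<open>\<theta>(a b) = \<Sum> \<tau>(a\<^sub>-\<^sub>1, b\<^sub>-\<^sub>1) \<theta>(a\<^sub>0) \<theta>(b\<^sub>0)\<close>. Its kernel is an ideal nevertheless (lemma
  \<open>twisted_kernel_ideal\<close>), because \<open>\<theta>\<close> is colinear, so that \<open>\<Sum> a\<^sub>-\<^sub>1 \<otimes> \<theta>(a\<^sub>0)\<close> vanishes together with \<open>\<theta>(a)\<close>.

  Over a commutative ring the map from \<open>H \<otimes> I\<close> to \<open>H \<otimes> T(M)\<close> need not be injective. A coideal condition on \<open>I\<close> is
  therefore always expressed by the vanishing of \<open>\<Sum> i\<^sub>-\<^sub>1 \<otimes> \<pi>(i\<^sub>0)\<close> in \<open>H \<otimes> T(M)/I\<close>, where \<open>\<pi>\<close> is the projection;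
  this is all that is required for the coaction to descend.

  Two devices organise the calculations. Sweedler sums are nested lifts of bilinear maps through
  tensor products, and most of them are instances of a convolution \<open>\<Sum> p(F(a\<^sub>-\<^sub>1, b\<^sub>-\<^sub>1), G(a\<^sub>0, b\<^sub>0))\<close>
  of maps in one, two or three variables along a bilinear pairing \<open>p\<close>. Coassociativity enters mainly through the associativity
  of convolution for compatible pairings (lemmas \<open>conv1_assoc\<close>, \<open>conv2_assoc\<close>, \<open>conv3_assoc\<close>);
  the cocycle identity for \<open>\<tau>\<close>, the associativity of the twisted products and the bialgebra axioms
  of the twist are then short computations. The tensor algebra is used through its structure under left multiplication
  by generators: linear maps out of \<open>T(M)\<close> may be defined (lemma \<open>fold_act\<close>) and compared (lemma
  \<open>act_eqI\<close>) by recursion on \<open>t \<mapsto> x t\<close>.\<close>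

section \<open>Linear maps\<close>

lemma linear_mapI:
  assumes "\<And>x. x \<in> carrier M \<Longrightarrow> f x \<in> carrier N"
    and "\<And>x y. x \<in> carrier M \<Longrightarrow> y \<in> carrier M \<Longrightarrow> f (x \<oplus>\<^bsub>M\<^esub> y) = f x \<oplus>\<^bsub>N\<^esub> f y"
    and "\<And>c x. c \<in> carrier k \<Longrightarrow> x \<in> carrier M \<Longrightarrow> f (c \<odot>\<^bsub>M\<^esub> x) = c \<odot>\<^bsub>N\<^esub> f x"
  shows "linear_map k M N f"
  using assms by (auto simp: linear_map_def)

lemma linear_closed: "linear_map k M N f \<Longrightarrow> x \<in> carrier M \<Longrightarrow> f x \<in> carrier N"
  and linear_add: "linear_map k M N f \<Longrightarrow> x \<in> carrier M \<Longrightarrow> y \<in> carrier M \<Longrightarrow>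
    f (x \<oplus>\<^bsub>M\<^esub> y) = f x \<oplus>\<^bsub>N\<^esub> f y"
  and linear_smult: "linear_map k M N f \<Longrightarrow> c \<in> carrier k \<Longrightarrow> x \<in> carrier M \<Longrightarrow>
    f (c \<odot>\<^bsub>M\<^esub> x) = c \<odot>\<^bsub>N\<^esub> f x"
  by (auto simp: linear_map_def)

lemma linear_id: "linear_map k M M (\<lambda>x. x)"
  by (simp add: linear_map_def)

lemma linear_comp:
  "linear_map k N P L \<Longrightarrow> linear_map k M N f \<Longrightarrow> linear_map k M P (\<lambda>x. L (f x))"
  by (auto simp: linear_map_def Pi_iff)

lemma linear_cong:
  assumes "linear_map k M N f" "module k M" "\<And>x. x \<in> carrier M \<Longrightarrow> g x = f x"
  shows "linear_map k M N g"
proof -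
  interpret M: module k M by fact
  show ?thesis using assms by (auto simp: linear_map_def Pi_iff)
qed

lemma linear_zero:
  assumes "module k M" "module k N" "linear_map k M N f"
  shows "f \<zero>\<^bsub>M\<^esub> = \<zero>\<^bsub>N\<^esub>"
proof -
  interpret M: module k M by fact
  interpret N: module k N by fact
  have "f (\<zero>\<^bsub>k\<^esub> \<odot>\<^bsub>M\<^esub> \<zero>\<^bsub>M\<^esub>) = \<zero>\<^bsub>k\<^esub> \<odot>\<^bsub>N\<^esub> f \<zero>\<^bsub>M\<^esub>"
    by (rule linear_smult[OF assms(3)]) auto
  then show ?thesis
    using linear_closed[OF assms(3) M.M.zero_closed] by simp
qed

lemma linear_uminus:
  assumes "module k M" "module k N" "linear_map k M N f" "x \<in> carrier M"
  shows "f (\<ominus>\<^bsub>M\<^esub> x) = \<ominus>\<^bsub>N\<^esub> f x"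
proof -
  interpret M: module k M by fact
  interpret N: module k N by fact
  have "f x \<oplus>\<^bsub>N\<^esub> f (\<ominus>\<^bsub>M\<^esub> x) = \<zero>\<^bsub>N\<^esub>"
    using assms linear_zero[OF assms(1-3)]
    by (simp flip: linear_add[OF assms(3)] add: M.M.r_neg)
  then show ?thesis
    using assms linear_closed[OF assms(3)]
    by (metis M.M.a_inv_closed N.M.minus_equality N.M.a_comm)
qed

lemma linear_minus:
  assumes "module k M" "module k N" "linear_map k M N f" "x \<in> carrier M" "y \<in> carrier M"
  shows "f (x \<ominus>\<^bsub>M\<^esub> y) = f x \<ominus>\<^bsub>N\<^esub> f y"
proof -
  interpret M: module k M by fact
  show ?thesis
    using assms by (simp add: a_minus_def linear_add[OF assms(3)] linear_uminus[OF assms(1-3)])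
qed

text \<open>Equality of linear maps may thus be tested on generators.\<close>

lemma equalizer_submodule:
  assumes "module k M" "module k N" "linear_map k M N f" "linear_map k M N g"
  shows "submodule {x \<in> carrier M. f x = g x} k M"
proof -
  interpret M: module k M by fact
  show ?thesis
    by (rule M.submoduleI)
      (auto simp: linear_zero[OF assms(1,2)] linear_uminus[OF assms(1,2)] assms(3,4)
        linear_add[OF assms(3)] linear_add[OF assms(4)] linear_smult[OF assms(3)] linear_smult[OF assms(4)])
qed

lemma submodule_subset: "submodule P k N \<Longrightarrow> P \<subseteq> carrier N"
  unfolding submodule_def using subgroup.subset by fastforce

lemma submodule_zero: "module k N \<Longrightarrow> submodule P k N \<Longrightarrow> \<zero>\<^bsub>N\<^esub> \<in> P"
  unfolding submodule_def using subgroup.one_closed by fastforce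

lemma zero_linear:
  assumes "module k M" "module k N"
  shows "linear_map k M N (\<lambda>_. \<zero>\<^bsub>N\<^esub>)"
proof -
  interpret N: module k N by fact
  show ?thesis by (rule linear_mapI) auto
qed

lemma kernel_submodule:
  assumes "module k M" "module k N" "linear_map k M N f"
  shows "submodule {x \<in> carrier M. f x = \<zero>\<^bsub>N\<^esub>} k M"
  using equalizer_submodule[OF assms zero_linear[OF assms(1,2)]] .

lemma submodule_span:
  assumes "module k N" "S \<subseteq> carrier N"
  shows "submodule (submodule_span k N S) k N" "S \<subseteq> submodule_span k N S"
    "\<And>P. submodule P k N \<Longrightarrow> S \<subseteq> P \<Longrightarrow> submodule_span k N S \<subseteq> P"
proof -
  interpret N: module k N by fact
  have c: "submodule (carrier N) k N" by (rule N.carrier_is_submodule)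
  show "submodule (submodule_span k N S) k N"
    unfolding submodule_span_def
  proof (rule N.submoduleI)
    show "\<Inter> {P. submodule P k N \<and> S \<subseteq> P} \<subseteq> carrier N" using c assms by blast
  qed (use N.submoduleE submodule_zero[OF assms(1)] in auto)
qed (auto simp: submodule_span_def)

text \<open>Only the additive group and the scalar multiplication of a record matter for being a module.
  This is what allows passing between an algebra, its comodule structures and its twists, which are
  different records on the same module.\<close>

lemma module_cong:
  fixes A :: "('k, 'a, 'y) module_scheme" and B :: "('k, 'a, 'x) module_scheme"
  assumes "module k A" "carrier B = carrier A" "zero B = zero A" "add B = add A" "smult B = smult A"
  shows "module k B"
proof -
  interpret A: module k A by fact
  have "abelian_group B"
  proof (rule abelian_groupI)
    fix x assume "x \<in> carrier B"
    then show "\<exists>y\<in>carrier B. y \<oplus>\<^bsub>B\<^esub> x = \<zero>\<^bsub>B\<^esub>"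
      using assms by (intro bexI[of _ "\<ominus>\<^bsub>A\<^esub> x"]) (auto simp: A.M.l_neg)
  qed (use assms in \<open>auto simp: A.M.a_ac\<close>)
  then show ?thesis
    using assms
    by (intro moduleI) (auto simp: A.R.is_cring A.smult_l_distr A.smult_r_distr A.smult_assoc1)
qed

lemma finsum_struct_cong:
  assumes "carrier B = carrier A" "zero B = zero A" "add B = add A"
  shows "finsum B f S = finsum A f S"
  unfolding finsum_def finprod_def using assms by simp

section \<open>Free modules\<close>

lemma free_module_simps:
  "u \<in> carrier (free_module k X) \<longleftrightarrow>
    (\<forall>x. u x \<in> carrier k) \<and> (\<forall>x. x \<notin> X \<longrightarrow> u x = \<zero>\<^bsub>k\<^esub>) \<and> finite {x. u x \<noteq> \<zero>\<^bsub>k\<^esub>}"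
  "\<zero>\<^bsub>free_module k X\<^esub> = (\<lambda>x. \<zero>\<^bsub>k\<^esub>)"
  "u \<oplus>\<^bsub>free_module k X\<^esub> v = (\<lambda>x. u x \<oplus>\<^bsub>k\<^esub> v x)"
  "c \<odot>\<^bsub>free_module k X\<^esub> u = (\<lambda>x. c \<otimes>\<^bsub>k\<^esub> u x)"
  by (auto simp: free_module_def)

context cring
begin

lemma free_module_module: "module R (free_module R X)"
proof (rule moduleI)
  show "cring R" by (rule is_cring)
  show "abelian_group (free_module R X)"
  proof (rule abelian_groupI)
    fix u v assume u: "u \<in> carrier (free_module R X)" and v: "v \<in> carrier (free_module R X)"
    then have "finite ({x. u x \<noteq> \<zero>} \<union> {x. v x \<noteq> \<zero>})" by (simp add: free_module_simps)
    then have "finite {x. u x \<oplus> v x \<noteq> \<zero>}" by (rule rev_finite_subset) auto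
    then show "u \<oplus>\<^bsub>free_module R X\<^esub> v \<in> carrier (free_module R X)"
      using u v by (simp add: free_module_simps)
  next
    fix u assume u: "u \<in> carrier (free_module R X)"
    then have "finite {x. u x \<noteq> \<zero>}" by (simp add: free_module_simps)
    then have "finite {x. \<ominus> u x \<noteq> \<zero>}" by (rule rev_finite_subset) auto
    then show "\<exists>v\<in>carrier (free_module R X). v \<oplus>\<^bsub>free_module R X\<^esub> u = \<zero>\<^bsub>free_module R X\<^esub>"
      using u by (intro bexI[of _ "\<lambda>x. \<ominus> u x"]) (auto simp: free_module_simps l_neg)
  qed (auto simp: free_module_simps a_ac)
next
  fix c u assume c: "c \<in> carrier R" and u: "u \<in> carrier (free_module R X)"
  then have "finite {x. u x \<noteq> \<zero>}" by (simp add: free_module_simps)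
  then have "finite {x. c \<otimes> u x \<noteq> \<zero>}" by (rule rev_finite_subset) (use c in auto)
  then show "c \<odot>\<^bsub>free_module R X\<^esub> u \<in> carrier (free_module R X)"
    using c u by (auto simp: free_module_simps)
qed (auto simp: free_module_simps l_distr r_distr m_assoc)

lemma free_gen_closed: "x \<in> X \<Longrightarrow> free_gen R x \<in> carrier (free_module R X)"
proof -
  assume "x \<in> X"
  moreover have "finite {y. free_gen R x y \<noteq> \<zero>}"
    by (rule finite_subset[of _ "{x}"]) (auto simp: free_gen_def)
  ultimately show ?thesis by (auto simp: free_module_simps free_gen_def)
qed

text \<open>By induction on a finite set containing the support.\<close>

lemma free_module_span:
  assumes S: "submodule S R (free_module R X)" and g: "\<And>x. x \<in> X \<Longrightarrow> free_gen R x \<in> S"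
  shows "carrier (free_module R X) \<subseteq> S"
proof
  interpret F: module R "free_module R X" by (rule free_module_module)
  have "u \<in> S" if "finite A" "u \<in> carrier (free_module R X)" "{x. u x \<noteq> \<zero>} \<subseteq> A" for A u
    using that
  proof (induction A arbitrary: u rule: finite_induct)
    case empty
    then have "u = \<zero>\<^bsub>free_module R X\<^esub>" by (auto simp: free_module_simps)
    then show ?case using submodule_zero[OF F.module_axioms S] by simp
  next
    case (insert a A)
    have ux: "\<And>x. u x \<in> carrier R" using insert.prems(1) by (simp add: free_module_simps)
    have uin: "u(a := \<zero>) \<in> S"
    proof (rule insert.IH)
      have "finite {x. u x \<noteq> \<zero>}" using insert.prems(1) by (simp add: free_module_simps)
      then have "finite {x. (u(a := \<zero>)) x \<noteq> \<zero>}" by (rule rev_finite_subset) auto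
      then show "u(a := \<zero>) \<in> carrier (free_module R X)"
        using insert.prems(1) by (auto simp: free_module_simps)
    qed (use insert.prems in auto)
    show ?case
    proof (cases "a \<in> X")
      case True
      have "u = u(a := \<zero>) \<oplus>\<^bsub>free_module R X\<^esub> u a \<odot>\<^bsub>free_module R X\<^esub> free_gen R a"
        using ux by (auto simp: free_module_simps free_gen_def fun_eq_iff)
      moreover have "\<dots> \<in> S"
        using uin ux F.submoduleE[OF S] g[OF True] by blast
      ultimately show ?thesis by simp
    next
      case False
      then have "u a = \<zero>" using insert.prems(1) by (simp add: free_module_simps)
      then have "u(a := \<zero>) = u" by (auto simp: fun_eq_iff)
      then show ?thesis using uin by simp
    qed
  qed
  then show "u \<in> S" if "u \<in> carrier (free_module R X)" for u
    using that by (auto simp: free_module_simps)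
qed

context
  fixes N :: "('a, 'n, 'y) module_scheme" and f :: "'x \<Rightarrow> 'n" and X
  assumes N: "module R N" and f: "\<And>x. x \<in> X \<Longrightarrow> f x \<in> carrier N"
begin

interpretation N: module R N by (rule N)

text \<open>Sums attached to different elements can thus be taken over a common index set, which gives
  additivity.\<close>

lemma free_lift_eq:
  assumes u: "u \<in> carrier (free_module R X)" and S: "finite S" "{x. u x \<noteq> \<zero>} \<subseteq> S" "S \<subseteq> X"
  shows "free_lift R N f u = (\<Oplus>\<^bsub>N\<^esub>x\<in>S. u x \<odot>\<^bsub>N\<^esub> f x)"
  unfolding free_lift_def
proof (rule N.M.add.finprod_mono_neutral_cong_left)
  show "u i \<odot>\<^bsub>N\<^esub> f i = \<zero>\<^bsub>N\<^esub>" if "i \<in> S - {x. u x \<noteq> \<zero>}" for i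
    using that S f by auto
  show "(\<lambda>x. u x \<odot>\<^bsub>N\<^esub> f x) \<in> S \<rightarrow> carrier N"
    using S f u by (auto simp: free_module_simps)
qed (use S in auto)

lemma free_lift_linear: "linear_map R (free_module R X) N (free_lift R N f)"
proof (rule linear_mapI)
  interpret F: module R "free_module R X" by (rule free_module_module)
  fix u assume u: "u \<in> carrier (free_module R X)"
  then have ux: "\<And>x. u x \<in> carrier R" and su: "{x. u x \<noteq> \<zero>} \<subseteq> X" "finite {x. u x \<noteq> \<zero>}"
    by (auto simp: free_module_simps)
  show "free_lift R N f u \<in> carrier N"
    unfolding free_lift_def using ux su f by (intro N.M.finsum_closed) auto
  { fix v assume v: "v \<in> carrier (free_module R X)"
    then have vx: "\<And>x. v x \<in> carrier R" and sv: "{x. v x \<noteq> \<zero>} \<subseteq> X" "finite {x. v x \<noteq> \<zero>}"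
      by (auto simp: free_module_simps)
    let ?S = "{x. u x \<noteq> \<zero>} \<union> {x. v x \<noteq> \<zero>}"
    have "free_lift R N f (u \<oplus>\<^bsub>free_module R X\<^esub> v)
        = (\<Oplus>\<^bsub>N\<^esub>x\<in>?S. (u x \<oplus> v x) \<odot>\<^bsub>N\<^esub> f x)"
      using su sv u v F.M.a_closed[OF u v] by (subst free_lift_eq[where S = ?S]) (auto simp: free_module_simps(2-))
    also have "\<dots> = (\<Oplus>\<^bsub>N\<^esub>x\<in>?S. u x \<odot>\<^bsub>N\<^esub> f x \<oplus>\<^bsub>N\<^esub> v x \<odot>\<^bsub>N\<^esub> f x)"
      using su sv ux vx f by (intro N.M.finsum_cong') (auto simp: N.smult_l_distr subset_iff)
    also have "\<dots> = (\<Oplus>\<^bsub>N\<^esub>x\<in>?S. u x \<odot>\<^bsub>N\<^esub> f x) \<oplus>\<^bsub>N\<^esub> (\<Oplus>\<^bsub>N\<^esub>x\<in>?S. v x \<odot>\<^bsub>N\<^esub> f x)"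
      using su sv ux vx f by (intro N.M.finsum_addf) (auto simp: Pi_iff subset_iff)
    also have "\<dots> = free_lift R N f u \<oplus>\<^bsub>N\<^esub> free_lift R N f v"
      using su sv u v by (subst (1 2) free_lift_eq[where S = ?S]) auto
    finally show "free_lift R N f (u \<oplus>\<^bsub>free_module R X\<^esub> v) = free_lift R N f u \<oplus>\<^bsub>N\<^esub> free_lift R N f v" .
  }
  fix c assume c: "c \<in> carrier R"
  let ?S = "{x. u x \<noteq> \<zero>}"
  have "free_lift R N f (c \<odot>\<^bsub>free_module R X\<^esub> u) = (\<Oplus>\<^bsub>N\<^esub>x\<in>?S. (c \<otimes> u x) \<odot>\<^bsub>N\<^esub> f x)"
    using su u c F.smult_closed[OF c u]
    by (subst free_lift_eq[where S = ?S]) (auto simp: free_module_simps(2-))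
  also have "\<dots> = (\<Oplus>\<^bsub>N\<^esub>x\<in>?S. c \<odot>\<^bsub>N\<^esub> (u x \<odot>\<^bsub>N\<^esub> f x))"
    using su ux c f by (intro N.M.finsum_cong') (auto simp: N.smult_assoc1 subset_iff)
  also have "\<dots> = c \<odot>\<^bsub>N\<^esub> free_lift R N f u"
    unfolding free_lift_def using su ux c f
    by (intro N.finsum_smult_ldistr[symmetric]) (auto simp: subset_iff)
  finally show "free_lift R N f (c \<odot>\<^bsub>free_module R X\<^esub> u) = c \<odot>\<^bsub>N\<^esub> free_lift R N f u" .
qed

lemma free_lift_gen: "x \<in> X \<Longrightarrow> free_lift R N f (free_gen R x) = f x"
proof -
  assume x: "x \<in> X"
  have "free_lift R N f (free_gen R x) = (\<Oplus>\<^bsub>N\<^esub>y\<in>{x}. free_gen R x y \<odot>\<^bsub>N\<^esub> f y)"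
    using x by (intro free_lift_eq free_gen_closed) (auto simp: free_gen_def)
  also have "\<dots> = f x"
    using f[OF x] by (subst N.M.finsum_insert) (auto simp: free_gen_def)
  finally show ?thesis .
qed

end

end

section \<open>Quotient modules\<close>

lemma quotient_simps:
  "carrier (quotient N P) = carrier (N Quot P)" "mult (quotient N P) = mult (N Quot P)"
  "one (quotient N P) = one (N Quot P)" "zero (quotient N P) = P"
  "add (quotient N P) = set_add N"
  "c \<odot>\<^bsub>quotient N P\<^esub> A = (\<Union>a\<in>A. P +>\<^bsub>N\<^esub> (c \<odot>\<^bsub>N\<^esub> a))"
  by (auto simp: quotient_def FactRing_def)

context
  fixes k :: "('k, 'z) ring_scheme" and N :: "('k, 'n, 'y) module_scheme" and P
  assumes N: "module k N" and P: "submodule P k N"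
begin

interpretation N: module k N by (rule N)

interpretation P: abelian_subgroup P N
  using P by (intro abelian_subgroupI3 additive_subgroup.intro)
    (auto simp: submodule_def N.M.abelian_group_axioms)

lemma quotient_carrier: "carrier (quotient N P) = (\<lambda>x. P +>\<^bsub>N\<^esub> x) ` carrier N"
  by (auto simp: quotient_simps FactRing_simps)

lemma quotient_elim:
  assumes "A \<in> carrier (quotient N P)"
  obtains x where "x \<in> carrier N" "A = P +>\<^bsub>N\<^esub> x"
  using assms by (auto simp: quotient_carrier)

lemma quotient_smult:
  assumes "c \<in> carrier k" "x \<in> carrier N"
  shows "c \<odot>\<^bsub>quotient N P\<^esub> (P +>\<^bsub>N\<^esub> x) = P +>\<^bsub>N\<^esub> (c \<odot>\<^bsub>N\<^esub> x)"
proof -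
  have "P +>\<^bsub>N\<^esub> (c \<odot>\<^bsub>N\<^esub> a) = P +>\<^bsub>N\<^esub> (c \<odot>\<^bsub>N\<^esub> x)" if "a \<in> P +>\<^bsub>N\<^esub> x" for a
  proof -
    obtain h where h: "h \<in> P" "a = h \<oplus>\<^bsub>N\<^esub> x"
      using \<open>a \<in> _\<close> by (auto simp: a_r_coset_def r_coset_def)
    have "c \<odot>\<^bsub>N\<^esub> a = c \<odot>\<^bsub>N\<^esub> h \<oplus>\<^bsub>N\<^esub> c \<odot>\<^bsub>N\<^esub> x"
      using h assms by (simp add: N.smult_r_distr)
    moreover have "c \<odot>\<^bsub>N\<^esub> h \<in> P" using N.submoduleE(4)[OF P] h assms by blast
    ultimately have "c \<odot>\<^bsub>N\<^esub> a \<in> P +>\<^bsub>N\<^esub> (c \<odot>\<^bsub>N\<^esub> x)"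
      by (auto simp: a_r_coset_def r_coset_def)
    then show ?thesis
      using assms P.a_repr_independence'[of "c \<odot>\<^bsub>N\<^esub> a" "c \<odot>\<^bsub>N\<^esub> x"] by simp
  qed
  then have "(\<Union>a\<in>P +>\<^bsub>N\<^esub> x. P +>\<^bsub>N\<^esub> (c \<odot>\<^bsub>N\<^esub> a)) = P +>\<^bsub>N\<^esub> (c \<odot>\<^bsub>N\<^esub> x)"
    using P.a_rcos_self[OF assms(2)] by blast
  then show ?thesis by (simp only: quotient_simps)
qed

lemma quotient_linear: "linear_map k N (quotient N P) (\<lambda>x. P +>\<^bsub>N\<^esub> x)"
proof (rule linear_mapI)
  fix x y assume "x \<in> carrier N" "y \<in> carrier N"
  then show "P +>\<^bsub>N\<^esub> (x \<oplus>\<^bsub>N\<^esub> y) = (P +>\<^bsub>N\<^esub> x) \<oplus>\<^bsub>quotient N P\<^esub> (P +>\<^bsub>N\<^esub> y)"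
    by (simp add: quotient_simps P.a_rcos_sum)
next
  fix x assume "x \<in> carrier N" then show "P +>\<^bsub>N\<^esub> x \<in> carrier (quotient N P)"
    unfolding quotient_carrier by (rule imageI)
next
  fix c x assume "c \<in> carrier k" "x \<in> carrier N"
  then show "P +>\<^bsub>N\<^esub> (c \<odot>\<^bsub>N\<^esub> x) = c \<odot>\<^bsub>quotient N P\<^esub> (P +>\<^bsub>N\<^esub> x)"
    by (rule quotient_smult[symmetric])
qed

lemma quotient_module: "module k (quotient N P)"
proof -
  note q = quotient_smult linear_add[OF quotient_linear, symmetric]
  have el: "\<exists>x\<in>carrier N. A = P +>\<^bsub>N\<^esub> x" if "A \<in> carrier (quotient N P)" for A
    using that by (auto elim: quotient_elim)
  have cl: "P +>\<^bsub>N\<^esub> x \<in> carrier (quotient N P)" if "x \<in> carrier N" for x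
    using linear_closed[OF quotient_linear that] .
  have zero: "\<zero>\<^bsub>quotient N P\<^esub> = P +>\<^bsub>N\<^esub> \<zero>\<^bsub>N\<^esub>"
    using P.a_rcos_const[OF P.zero_closed] by (simp add: quotient_simps)
  show ?thesis
  proof (intro moduleI abelian_groupI)
    fix A B C assume ABC: "A \<in> carrier (quotient N P)" "B \<in> carrier (quotient N P)"
      "C \<in> carrier (quotient N P)"
    then obtain x y z where "x \<in> carrier N" "A = P +>\<^bsub>N\<^esub> x" "y \<in> carrier N" "B = P +>\<^bsub>N\<^esub> y"
      "z \<in> carrier N" "C = P +>\<^bsub>N\<^esub> z" using el by metis
    then show "A \<oplus>\<^bsub>quotient N P\<^esub> B \<oplus>\<^bsub>quotient N P\<^esub> C
        = A \<oplus>\<^bsub>quotient N P\<^esub> (B \<oplus>\<^bsub>quotient N P\<^esub> C)"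
      by (simp add: q N.M.a_assoc)
  next
    fix A B assume ABC: "A \<in> carrier (quotient N P)" "B \<in> carrier (quotient N P)"
    then obtain x y where xy: "x \<in> carrier N" "A = P +>\<^bsub>N\<^esub> x" "y \<in> carrier N" "B = P +>\<^bsub>N\<^esub> y"
      using el by metis
    then show "A \<oplus>\<^bsub>quotient N P\<^esub> B = B \<oplus>\<^bsub>quotient N P\<^esub> A"
      "A \<oplus>\<^bsub>quotient N P\<^esub> B \<in> carrier (quotient N P)"
      by (simp_all add: q cl N.M.a_comm)
    fix a assume "a \<in> carrier k"
    with xy show "a \<odot>\<^bsub>quotient N P\<^esub> (A \<oplus>\<^bsub>quotient N P\<^esub> B)
        = a \<odot>\<^bsub>quotient N P\<^esub> A \<oplus>\<^bsub>quotient N P\<^esub> a \<odot>\<^bsub>quotient N P\<^esub> B"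
      by (simp add: q N.smult_r_distr)
  next
    fix A assume "A \<in> carrier (quotient N P)"
    then obtain x where x: "x \<in> carrier N" "A = P +>\<^bsub>N\<^esub> x" using el by metis
    then show "\<zero>\<^bsub>quotient N P\<^esub> \<oplus>\<^bsub>quotient N P\<^esub> A = A" "\<one>\<^bsub>k\<^esub> \<odot>\<^bsub>quotient N P\<^esub> A = A"
      by (simp_all add: q zero)
    from x show "\<exists>B\<in>carrier (quotient N P). B \<oplus>\<^bsub>quotient N P\<^esub> A = \<zero>\<^bsub>quotient N P\<^esub>"
      by (intro bexI[of _ "P +>\<^bsub>N\<^esub> (\<ominus>\<^bsub>N\<^esub> x)"]) (simp_all add: q zero cl N.M.l_neg)
    fix a assume a: "a \<in> carrier k"
    with x show "a \<odot>\<^bsub>quotient N P\<^esub> A \<in> carrier (quotient N P)"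
      by (simp add: q cl)
    fix b assume b: "b \<in> carrier k"
    with x a show "(a \<oplus>\<^bsub>k\<^esub> b) \<odot>\<^bsub>quotient N P\<^esub> A
        = a \<odot>\<^bsub>quotient N P\<^esub> A \<oplus>\<^bsub>quotient N P\<^esub> b \<odot>\<^bsub>quotient N P\<^esub> A"
      by (simp add: q N.smult_l_distr)
    from x a b show "a \<otimes>\<^bsub>k\<^esub> b \<odot>\<^bsub>quotient N P\<^esub> A = a \<odot>\<^bsub>quotient N P\<^esub> (b \<odot>\<^bsub>quotient N P\<^esub> A)"
      by (simp add: q N.smult_assoc1)
  next
    show "\<zero>\<^bsub>quotient N P\<^esub> \<in> carrier (quotient N P)" by (simp add: zero cl)
    show "cring k" by (rule N.R.is_cring)
  qed
qed

lemma coset_eq_iff: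
  assumes "x \<in> carrier N" "y \<in> carrier N"
  shows "P +>\<^bsub>N\<^esub> x = P +>\<^bsub>N\<^esub> y \<longleftrightarrow> x \<ominus>\<^bsub>N\<^esub> y \<in> P"
proof -
  have "P +>\<^bsub>N\<^esub> x = P +>\<^bsub>N\<^esub> y \<longleftrightarrow> x \<in> P +>\<^bsub>N\<^esub> y"
    using assms P.a_rcos_self P.a_repr_independence' by metis
  also have "\<dots> \<longleftrightarrow> x \<ominus>\<^bsub>N\<^esub> y \<in> P"
    using P.a_rcos_module[OF assms(2,1)] by (simp add: a_minus_def)
  finally show ?thesis .
qed

lemma coset_eq_zero_iff:
  assumes "x \<in> carrier N"
  shows "P +>\<^bsub>N\<^esub> x = P \<longleftrightarrow> x \<in> P"
  using assms P.a_rcos_self P.a_rcos_const by metis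

lemma coset_rep:
  assumes "x \<in> carrier N"
  shows "(SOME a. a \<in> P +>\<^bsub>N\<^esub> x) \<in> carrier N" "P +>\<^bsub>N\<^esub> (SOME a. a \<in> P +>\<^bsub>N\<^esub> x) = P +>\<^bsub>N\<^esub> x"
proof -
  have *: "(SOME a. a \<in> P +>\<^bsub>N\<^esub> x) \<in> P +>\<^bsub>N\<^esub> x"
    using P.a_rcos_self[OF assms] by (rule someI)
  then show "(SOME a. a \<in> P +>\<^bsub>N\<^esub> x) \<in> carrier N"
    using assms P.a_elemrcos_carrier by blast
  show "P +>\<^bsub>N\<^esub> (SOME a. a \<in> P +>\<^bsub>N\<^esub> x) = P +>\<^bsub>N\<^esub> x"
    using P.a_repr_independence'[OF * assms] by simp
qed

text \<open>Cosets are evaluated through a chosen representative; the choice is immaterial for a linear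
  map that kills \<open>P\<close>.\<close>

lemma quotient_lift:
  fixes L :: "'n \<Rightarrow> 'b" and Q :: "('k, 'b, 'w) module_scheme"
  assumes Q: "module k Q" and L: "linear_map k N Q L" and ker: "\<And>x. x \<in> P \<Longrightarrow> L x = \<zero>\<^bsub>Q\<^esub>"
  shows "x \<in> carrier N \<Longrightarrow> L (SOME a. a \<in> P +>\<^bsub>N\<^esub> x) = L x"
    "linear_map k (quotient N P) Q (\<lambda>A. L (SOME a. a \<in> A))"
proof -
  interpret Q: module k Q by (rule Q)
  show *: "L (SOME a. a \<in> P +>\<^bsub>N\<^esub> x) = L x" if "x \<in> carrier N" for x
  proof -
    let ?a = "SOME a. a \<in> P +>\<^bsub>N\<^esub> x"
    have "?a \<ominus>\<^bsub>N\<^esub> x \<in> P" using coset_rep[OF that] coset_eq_iff that by blast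
    then have "L ?a \<ominus>\<^bsub>Q\<^esub> L x = \<zero>\<^bsub>Q\<^esub>"
      using ker linear_minus[OF N Q L coset_rep(1)[OF that] that] by simp
    then have "L ?a \<oplus>\<^bsub>Q\<^esub> (\<ominus>\<^bsub>Q\<^esub> L x) = \<zero>\<^bsub>Q\<^esub>" by (simp add: a_minus_def)
    then have "\<ominus>\<^bsub>Q\<^esub> (\<ominus>\<^bsub>Q\<^esub> L x) = L ?a"
      using linear_closed[OF L] coset_rep(1)[OF that] that by (intro Q.M.minus_equality) auto
    then show ?thesis
      using linear_closed[OF L] that by simp
  qed
  show "linear_map k (quotient N P) Q (\<lambda>A. L (SOME a. a \<in> A))"
  proof (rule linear_mapI)
    fix A assume "A \<in> carrier (quotient N P)"
    then obtain x where x: "x \<in> carrier N" "A = P +>\<^bsub>N\<^esub> x" by (auto elim: quotient_elim)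
    show "L (SOME a. a \<in> A) \<in> carrier Q"
      using x by (simp add: * linear_closed[OF L])
    show "L (SOME a. a \<in> c \<odot>\<^bsub>quotient N P\<^esub> A) = c \<odot>\<^bsub>Q\<^esub> L (SOME a. a \<in> A)" if "c \<in> carrier k" for c
      using x that by (simp add: * quotient_smult linear_smult[OF L])
    fix B assume "B \<in> carrier (quotient N P)"
    then obtain y where y: "y \<in> carrier N" "B = P +>\<^bsub>N\<^esub> y" by (auto elim: quotient_elim)
    show "L (SOME a. a \<in> A \<oplus>\<^bsub>quotient N P\<^esub> B) = L (SOME a. a \<in> A) \<oplus>\<^bsub>Q\<^esub> L (SOME a. a \<in> B)"
      using x y by (simp add: * linear_add[OF quotient_linear, symmetric] linear_add[OF L])
  qed
qed

end

section \<open>Modules given by generators and relations\<close>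

text \<open>The fold that defines a finite sum looks at the summands on the index set only, whatever
  their values.\<close>

lemma finsum_ext:
  fixes N :: "('b, 'c) ring_scheme"
  assumes eq: "\<And>x. x \<in> A \<Longrightarrow> f x = g x"
  shows "finsum N f A = finsum N g A"
proof -
  have *: "(B, z) \<in> foldSetD D G e"
    if "(B, z) \<in> foldSetD D F e" "B \<subseteq> A" "\<And>x. x \<in> A \<Longrightarrow> F x = G x" for D e F G B z
    using that
  proof (induction rule: foldSetD.induct)
    case (insertI x B y)
    then have "F x y = G x y" by simp
    with insertI show ?case by (metis foldSetD.insertI insert_subset)
  qed (auto intro: foldSetD.emptyI)
  have "(A, z) \<in> foldSetD D (h \<circ> f) e \<longleftrightarrow> (A, z) \<in> foldSetD D (h \<circ> g) e"
    for D :: "'b set" and h e z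
    using *[of A z D "h \<circ> f" e "h \<circ> g"] *[of A z D "h \<circ> g" e "h \<circ> f"] eq by auto
  then show ?thesis
    unfolding finsum_def finprod_def foldD_def by simp
qed

lemma free_lift_ext:
  assumes eq: "\<And>x. x \<in> X \<Longrightarrow> f x = g x" and u: "u \<in> carrier (free_module k X)"
  shows "free_lift k N f u = free_lift k N g u"
  unfolding free_lift_def
proof (rule finsum_ext)
  fix x assume "x \<in> {x. u x \<noteq> \<zero>\<^bsub>k\<^esub>}"
  then have "x \<in> X" using u unfolding free_module_simps by blast
  then show "u x \<odot>\<^bsub>N\<^esub> f x = u x \<odot>\<^bsub>N\<^esub> g x" by (simp add: eq)
qed

context
  fixes k :: "('k, 'z) ring_scheme" and X :: "'x set" and rel :: "('x \<Rightarrow> 'k) set"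
  assumes k: "cring k" and rel: "rel \<subseteq> carrier (free_module k X)"
begin

interpretation cring k by (rule k)

abbreviation (input) "gm_F \<equiv> free_module k X"
abbreviation (input) "gm_S \<equiv> submodule_span k (free_module k X) rel"

lemmas gm_span = submodule_span[OF free_module_module rel]

lemma presented_module: "module k (quotient gm_F gm_S)"
  by (rule quotient_module[OF free_module_module gm_span(1)])

lemma presented_gen: "x \<in> X \<Longrightarrow> gm_S +>\<^bsub>gm_F\<^esub> free_gen k x \<in> carrier (quotient gm_F gm_S)"
  by (rule linear_closed[OF quotient_linear[OF free_module_module gm_span(1)] free_gen_closed])

lemma presented_rel:
  assumes "a \<ominus>\<^bsub>gm_F\<^esub> b \<in> rel" "a \<in> carrier gm_F" "b \<in> carrier gm_F"
  shows "gm_S +>\<^bsub>gm_F\<^esub> a = gm_S +>\<^bsub>gm_F\<^esub> b"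
  using coset_eq_iff[OF free_module_module gm_span(1) assms(2,3)] assms(1) gm_span(2) by blast

lemma presented_induct:
  assumes W: "submodule W k (quotient gm_F gm_S)"
    and g: "\<And>x. x \<in> X \<Longrightarrow> gm_S +>\<^bsub>gm_F\<^esub> free_gen k x \<in> W"
  shows "carrier (quotient gm_F gm_S) \<subseteq> W"
proof -
  interpret F: module k gm_F by (rule free_module_module)
  interpret Q: module k "quotient gm_F gm_S" by (rule presented_module)
  note pi = quotient_linear[OF free_module_module gm_span(1)]
  have "submodule {u \<in> carrier gm_F. gm_S +>\<^bsub>gm_F\<^esub> u \<in> W} k gm_F"
    using Q.submoduleE[OF W] submodule_zero[OF Q.module_axioms W]
    by (intro F.submoduleI)
      (auto simp: linear_zero[OF F.module_axioms Q.module_axioms pi]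
        linear_uminus[OF F.module_axioms Q.module_axioms pi] linear_add[OF pi] linear_smult[OF pi])
  then have "carrier gm_F \<subseteq> {u \<in> carrier gm_F. gm_S +>\<^bsub>gm_F\<^esub> u \<in> W}"
    by (rule free_module_span) (simp add: g free_gen_closed)
  then show ?thesis
    by (auto simp: quotient_carrier[OF free_module_module gm_span(1)])
qed

lemma presented_eqI:
  assumes "module k N" "linear_map k (quotient gm_F gm_S) N L" "linear_map k (quotient gm_F gm_S) N L'"
    and "\<And>x. x \<in> X \<Longrightarrow> L (gm_S +>\<^bsub>gm_F\<^esub> free_gen k x) = L' (gm_S +>\<^bsub>gm_F\<^esub> free_gen k x)"
    and "t \<in> carrier (quotient gm_F gm_S)"
  shows "L t = L' t"
  using presented_induct[OF equalizer_submodule[OF presented_module assms(1-3)]] assms(4,5) presented_gen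
  by auto

lemma presented_ext:
  assumes "\<And>x. x \<in> X \<Longrightarrow> f x = g x" "A \<in> carrier (quotient gm_F gm_S)"
  shows "coset_lift k N f A = coset_lift k N g A"
proof -
  obtain u where "u \<in> carrier gm_F" "A = gm_S +>\<^bsub>gm_F\<^esub> u"
    using quotient_elim[OF free_module_module gm_span(1) assms(2)] .
  then have "(SOME u. u \<in> A) \<in> carrier gm_F"
    using coset_rep(1)[OF free_module_module gm_span(1)] by simp
  then show ?thesis
    unfolding coset_lift_def using assms(1) free_lift_ext by metis
qed

context
  fixes N :: "('k, 'n, 'y) module_scheme" and f :: "'x \<Rightarrow> 'n"
  assumes N: "module k N" and f: "\<And>x. x \<in> X \<Longrightarrow> f x \<in> carrier N"
    and kill: "\<And>r. r \<in> rel \<Longrightarrow> free_lift k N f r = \<zero>\<^bsub>N\<^esub>"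
begin

lemma presented_kill: "x \<in> gm_S \<Longrightarrow> free_lift k N f x = \<zero>\<^bsub>N\<^esub>"
proof -
  assume x: "x \<in> gm_S"
  have "gm_S \<subseteq> {u \<in> carrier gm_F. free_lift k N f u = \<zero>\<^bsub>N\<^esub>}"
    by (rule gm_span(3)[OF kernel_submodule[OF free_module_module N free_lift_linear[OF N f]]])
      (use rel kill in auto)
  with x show ?thesis by blast
qed

lemma presented_lift_linear: "linear_map k (quotient gm_F gm_S) N (coset_lift k N f)"
  unfolding coset_lift_def
  by (rule quotient_lift(2)[OF free_module_module gm_span(1) N free_lift_linear[OF N f] presented_kill])

lemma presented_lift_gen: "x \<in> X \<Longrightarrow> coset_lift k N f (gm_S +>\<^bsub>gm_F\<^esub> free_gen k x) = f x"
  unfolding coset_lift_def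
  using quotient_lift(1)[OF free_module_module gm_span(1) N free_lift_linear[OF N f] presented_kill free_gen_closed]
    free_lift_gen[OF N f] by simp

end

end

section \<open>Tensor products\<close>

text \<open>Linearity is required only for arguments in the carriers: values elsewhere are arbitrary.\<close>

definition bilinear_map ::
  "('k, 'z) ring_scheme \<Rightarrow> ('k, 'a, 'y) module_scheme \<Rightarrow> ('k, 'b, 'x) module_scheme \<Rightarrow>
    ('k, 'n, 'w) module_scheme \<Rightarrow> ('a \<Rightarrow> 'b \<Rightarrow> 'n) \<Rightarrow> bool"
  where "bilinear_map k P Q N f \<longleftrightarrow>
    (\<forall>x\<in>carrier P. linear_map k Q N (f x)) \<and> (\<forall>y\<in>carrier Q. linear_map k P N (\<lambda>x. f x y))"

lemma bilinearI:
  "(\<And>x. x \<in> carrier P \<Longrightarrow> linear_map k Q N (\<lambda>y. f x y)) \<Longrightarrow>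
    (\<And>y. y \<in> carrier Q \<Longrightarrow> linear_map k P N (\<lambda>x. f x y)) \<Longrightarrow> bilinear_map k P Q N f"
  by (simp add: bilinear_map_def)

lemma bilinear_left: "bilinear_map k P Q N f \<Longrightarrow> y \<in> carrier Q \<Longrightarrow> linear_map k P N (\<lambda>x. f x y)"
  and bilinear_right: "bilinear_map k P Q N f \<Longrightarrow> x \<in> carrier P \<Longrightarrow> linear_map k Q N (\<lambda>y. f x y)"
  by (simp_all add: bilinear_map_def)

lemma bilinear_closed:
  "bilinear_map k P Q N f \<Longrightarrow> x \<in> carrier P \<Longrightarrow> y \<in> carrier Q \<Longrightarrow> f x y \<in> carrier N"
  using linear_closed[OF bilinear_right] .

lemma bilinear_in_left:
  "bilinear_map k P Q N f \<Longrightarrow> linear_map k X P E \<Longrightarrow> y \<in> carrier Q \<Longrightarrow> linear_map k X N (\<lambda>x. f (E x) y)"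
  using linear_comp[OF bilinear_left] .

lemma bilinear_in_right:
  "bilinear_map k P Q N f \<Longrightarrow> linear_map k X Q E \<Longrightarrow> x \<in> carrier P \<Longrightarrow> linear_map k X N (\<lambda>y. f x (E y))"
  using linear_comp[OF bilinear_right] .

context
  fixes k :: "('k, 'z) ring_scheme" and P :: "('k, 'a, 'y) module_scheme"
    and Q :: "('k, 'b, 'x) module_scheme"
  assumes P: "module k P" and Q: "module k Q"
begin

interpretation P: module k P by (rule P)
interpretation Q: module k Q by (rule Q)
interpretation F: module k "free_module k (carrier P \<times> carrier Q)"
  by (rule P.R.free_module_module)

lemma tensor_relations_subset:
  "tensor_relations k P Q \<subseteq> carrier (free_module k (carrier P \<times> carrier Q))"
  unfolding tensor_relations_def Let_def
  by (auto simp: P.R.free_gen_closed)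

lemma tensor_module: "module k (tensor k P Q)"
  unfolding tensor_def tensor_null_def
  by (rule presented_module[OF P.R.is_cring tensor_relations_subset])

lemma pure_tensor_bilinear: "bilinear_map k P Q (tensor k P Q) (pure_tensor k P Q)"
proof -
  let ?F = "free_module k (carrier P \<times> carrier Q)"
  have S: "submodule (tensor_null k P Q) k ?F"
    unfolding tensor_null_def by (rule submodule_span(1)[OF F.module_axioms tensor_relations_subset])
  note pi = quotient_linear[OF F.module_axioms S, folded tensor_def]
  note gen = P.R.free_gen_closed[of _ "carrier P \<times> carrier Q"]
  note rel = presented_rel[OF P.R.is_cring tensor_relations_subset, folded tensor_null_def]
  have "pure_tensor k P Q (x \<oplus>\<^bsub>P\<^esub> x') y = pure_tensor k P Q x y \<oplus>\<^bsub>tensor k P Q\<^esub> pure_tensor k P Q x' y"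
    if "x \<in> carrier P" "x' \<in> carrier P" "y \<in> carrier Q" for x x' y
    unfolding pure_tensor_def
    by (insert that, subst linear_add[OF pi, symmetric]; (rule rel)?) (auto simp: gen tensor_relations_def Let_def)
  moreover have "pure_tensor k P Q x (y \<oplus>\<^bsub>Q\<^esub> y') = pure_tensor k P Q x y \<oplus>\<^bsub>tensor k P Q\<^esub> pure_tensor k P Q x y'"
    if "x \<in> carrier P" "y \<in> carrier Q" "y' \<in> carrier Q" for x y y'
    unfolding pure_tensor_def
    by (insert that, subst linear_add[OF pi, symmetric]; (rule rel)?) (auto simp: gen tensor_relations_def Let_def)
  moreover have "pure_tensor k P Q (c \<odot>\<^bsub>P\<^esub> x) y = c \<odot>\<^bsub>tensor k P Q\<^esub> pure_tensor k P Q x y"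
    if "x \<in> carrier P" "y \<in> carrier Q" "c \<in> carrier k" for x y c
    unfolding pure_tensor_def
    by (insert that, subst linear_smult[OF pi, symmetric]; (rule rel)?) (auto simp: gen tensor_relations_def Let_def)
  moreover have "pure_tensor k P Q x (c \<odot>\<^bsub>Q\<^esub> y) = c \<odot>\<^bsub>tensor k P Q\<^esub> pure_tensor k P Q x y"
    if "x \<in> carrier P" "y \<in> carrier Q" "c \<in> carrier k" for x y c
    unfolding pure_tensor_def
    by (insert that, subst linear_smult[OF pi, symmetric]; (rule rel)?) (auto simp: gen tensor_relations_def Let_def)
  moreover have "pure_tensor k P Q x y \<in> carrier (tensor k P Q)" if "x \<in> carrier P" "y \<in> carrier Q" for x y
    unfolding pure_tensor_def using that linear_closed[OF pi gen] by simp
  ultimately show ?thesis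
    by (intro bilinearI linear_mapI) auto
qed

text \<open>A rewriting principle: under a lift, the integrand need only be changed on the carriers.
  Together with the lemmas on compositions and interchange of lifts below it makes Sweedler calculus
  available.\<close>

lemma tensor_ext:
  assumes "\<And>x y. x \<in> carrier P \<Longrightarrow> y \<in> carrier Q \<Longrightarrow> f x y = g x y" "t \<in> carrier (tensor k P Q)"
  shows "tensor_lift k N f t = tensor_lift k N g t"
  unfolding tensor_lift_def
  by (rule presented_ext[OF P.R.is_cring tensor_relations_subset])
    (use assms in \<open>auto simp: tensor_def tensor_null_def\<close>)

lemma tensor_eqI:
  assumes "module k N" "linear_map k (tensor k P Q) N L" "linear_map k (tensor k P Q) N L'"
    and "\<And>x y. x \<in> carrier P \<Longrightarrow> y \<in> carrier Q \<Longrightarrow> L (pure_tensor k P Q x y) = L' (pure_tensor k P Q x y)"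
    and "t \<in> carrier (tensor k P Q)"
  shows "L t = L' t"
  by (rule presented_eqI[OF P.R.is_cring tensor_relations_subset, folded tensor_null_def, folded tensor_def, OF assms(1-3) _ assms(5)])
    (use assms(4) in \<open>auto simp: pure_tensor_def\<close>)

context
  fixes N :: "('k, 'n, 'w) module_scheme" and f :: "'a \<Rightarrow> 'b \<Rightarrow> 'n"
  assumes N: "module k N" and f: "bilinear_map k P Q N f"
begin

interpretation N: module k N by (rule N)

lemma tensor_lift_kill:
  assumes "r \<in> tensor_relations k P Q"
  shows "free_lift k N (\<lambda>(x, y). f x y) r = \<zero>\<^bsub>N\<^esub>"
proof -
  let ?X = "carrier P \<times> carrier Q" and ?f = "\<lambda>(x, y). f x y"
  have fc: "p \<in> ?X \<Longrightarrow> ?f p \<in> carrier N" for p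
    using bilinear_closed[OF f] by auto
  note lin = P.R.free_lift_linear[OF N fc] and gen = P.R.free_lift_gen[OF N fc]
  note simps = linear_minus[OF F.module_axioms N lin] linear_add[OF lin] linear_smult[OF lin] gen
    linear_add[OF bilinear_left[OF f]] linear_add[OF bilinear_right[OF f]]
    linear_smult[OF bilinear_left[OF f]] linear_smult[OF bilinear_right[OF f]] bilinear_closed[OF f]
    P.R.free_gen_closed a_minus_def[of N] N.M.r_neg
  show ?thesis
    using assms unfolding tensor_relations_def Let_def
    by (auto simp: simps)
qed

lemma tensor_lift_linear: "linear_map k (tensor k P Q) N (tensor_lift k N f)"
  unfolding tensor_lift_def tensor_def tensor_null_def
  by (rule presented_lift_linear[OF P.R.is_cring tensor_relations_subset N])
    (use bilinear_closed[OF f] tensor_lift_kill in auto)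

lemma tensor_lift_pure:
  assumes "x \<in> carrier P" "y \<in> carrier Q"
  shows "tensor_lift k N f (pure_tensor k P Q x y) = f x y"
  unfolding tensor_lift_def pure_tensor_def tensor_null_def
  by (subst presented_lift_gen[OF P.R.is_cring tensor_relations_subset N])
    (use bilinear_closed[OF f] tensor_lift_kill assms in auto)

end

end

section \<open>Linearity of iterated lifts\<close>

lemma linear_sum:
  assumes "module k N" "linear_map k M N f" "linear_map k M N g"
  shows "linear_map k M N (\<lambda>x. f x \<oplus>\<^bsub>N\<^esub> g x)"
proof -
  interpret N: module k N by fact
  show ?thesis
    by (rule linear_mapI)
      (simp_all add: linear_closed[OF assms(2)] linear_closed[OF assms(3)] linear_add[OF assms(2)]
        linear_add[OF assms(3)] linear_smult[OF assms(2)] linear_smult[OF assms(3)] N.M.a_ac N.smult_r_distr)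
qed

lemma linear_scale:
  assumes "module k N" "linear_map k M N f" "c \<in> carrier k"
  shows "linear_map k M N (\<lambda>x. c \<odot>\<^bsub>N\<^esub> f x)"
proof -
  interpret N: module k N by fact
  have "c \<odot>\<^bsub>N\<^esub> (d \<odot>\<^bsub>N\<^esub> f x) = d \<odot>\<^bsub>N\<^esub> (c \<odot>\<^bsub>N\<^esub> f x)" if "d \<in> carrier k" "x \<in> carrier M" for d x
    using that assms linear_closed[OF assms(2)]
    by (simp flip: N.smult_assoc1 add: N.R.m_comm)
  then show ?thesis
    using assms(3)
    by (intro linear_mapI)
      (simp_all add: linear_closed[OF assms(2)] linear_add[OF assms(2)] linear_smult[OF assms(2)] N.smult_r_distr)
qed

lemma bilinear_scale:
  "module k N \<Longrightarrow> bilinear_map k P Q N f \<Longrightarrow> c \<in> carrier k \<Longrightarrow>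
    bilinear_map k P Q N (\<lambda>x y. c \<odot>\<^bsub>N\<^esub> f x y)"
  by (auto simp: bilinear_map_def intro: linear_scale)

lemma linear_lift_arg:
  assumes "linear_map k X (tensor k P Q) E" "module k P" "module k Q" "module k N"
    "bilinear_map k P Q N f"
  shows "linear_map k X N (\<lambda>x. tensor_lift k N f (E x))"
  using linear_comp[OF tensor_lift_linear[OF assms(2-5)] assms(1)] .

lemma tensor_lift_closed:
  assumes "module k P" "module k Q" "module k N" "bilinear_map k P Q N f" "t \<in> carrier (tensor k P Q)"
  shows "tensor_lift k N f t \<in> carrier N"
  using linear_closed[OF tensor_lift_linear[OF assms(1-4)] assms(5)] .

text \<open>By this rule and the lemma \<open>linear_lift_arg\<close> the linearity of nested Sweedler
  sums is decided by backward chaining; the collections of rules named \<open>R\<close>,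
  \<open>H_rules\<close> and the like feed such a search.\<close>

lemma linear_lift_param:
  assumes t: "t \<in> carrier (tensor k P Q)"
    and P: "module k P" and Q: "module k Q" and N: "module k N" and X: "module k X"
    and lin: "\<And>a b. a \<in> carrier P \<Longrightarrow> b \<in> carrier Q \<Longrightarrow> linear_map k X N (\<lambda>x. f x a b)"
    and bil: "\<And>x. x \<in> carrier X \<Longrightarrow> bilinear_map k P Q N (\<lambda>a b. f x a b)"
  shows "linear_map k X N (\<lambda>x. tensor_lift k N (\<lambda>a b. f x a b) t)"
proof (rule linear_mapI)
  interpret N: module k N by (rule N)
  interpret X: module k X by (rule X)
  note TL = tensor_lift_linear[OF P Q N]
  fix x assume x: "x \<in> carrier X"
  show "tensor_lift k N (f x) t \<in> carrier N"
    by (rule tensor_lift_closed[OF P Q N bil[OF x] t])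
  show "tensor_lift k N (f (c \<odot>\<^bsub>X\<^esub> x)) t = c \<odot>\<^bsub>N\<^esub> tensor_lift k N (f x) t" if c: "c \<in> carrier k" for c
    by (rule tensor_eqI[OF P Q N TL[OF bil] linear_scale[OF N TL[OF bil[OF x]] c] _ t])
      (use x c lin in \<open>auto simp: tensor_lift_pure[OF P Q N bil] linear_smult[OF lin]\<close>)
  fix y assume y: "y \<in> carrier X"
  show "tensor_lift k N (f (x \<oplus>\<^bsub>X\<^esub> y)) t = tensor_lift k N (f x) t \<oplus>\<^bsub>N\<^esub> tensor_lift k N (f y) t"
    by (rule tensor_eqI[OF P Q N TL[OF bil] linear_sum[OF N TL[OF bil[OF x]] TL[OF bil[OF y]]] _ t])
      (use x y lin in \<open>auto simp: tensor_lift_pure[OF P Q N bil] linear_add[OF lin]\<close>)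
qed

lemma tensor_lift_comp:
  assumes P: "module k P" and Q: "module k Q" and N: "module k N" and N': "module k N'"
    and L: "linear_map k N N' L" and f: "bilinear_map k P Q N f" and t: "t \<in> carrier (tensor k P Q)"
  shows "L (tensor_lift k N f t) = tensor_lift k N' (\<lambda>a b. L (f a b)) t"
proof -
  have Lf: "bilinear_map k P Q N' (\<lambda>a b. L (f a b))"
    by (intro bilinearI linear_comp[OF L] bilinear_left[OF f] bilinear_right[OF f])
  show ?thesis
    by (rule tensor_eqI[OF P Q N' linear_comp[OF L tensor_lift_linear[OF P Q N f]] tensor_lift_linear[OF P Q N' Lf] _ t])
      (simp add: tensor_lift_pure[OF P Q N f] tensor_lift_pure[OF P Q N' Lf])
qed

lemma tensor_lift_pure_id:
  assumes P: "module k P" and Q: "module k Q" and t: "t \<in> carrier (tensor k P Q)"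
  shows "tensor_lift k (tensor k P Q) (pure_tensor k P Q) t = t"
  by (rule tensor_eqI[OF P Q tensor_module[OF P Q]
        tensor_lift_linear[OF P Q tensor_module[OF P Q] pure_tensor_bilinear[OF P Q]] linear_id _ t])
    (simp add: tensor_lift_pure[OF P Q tensor_module[OF P Q] pure_tensor_bilinear[OF P Q]])

text \<open>Fubini: Sweedler sums over independent elements may be interchanged. By linearity it
  suffices to consider pure tensors.\<close>

lemma tensor_lift_swap:
  assumes P: "module k P" and Q: "module k Q" and P': "module k P'" and Q': "module k Q'" and N: "module k N"
    and 1: "\<And>a b. a \<in> carrier P \<Longrightarrow> b \<in> carrier Q \<Longrightarrow> bilinear_map k P' Q' N (\<lambda>c d. f a b c d)"
    and 2: "\<And>c d. c \<in> carrier P' \<Longrightarrow> d \<in> carrier Q' \<Longrightarrow> bilinear_map k P Q N (\<lambda>a b. f a b c d)"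
    and t: "t \<in> carrier (tensor k P Q)" and s: "s \<in> carrier (tensor k P' Q')"
  shows "tensor_lift k N (\<lambda>a b. tensor_lift k N (\<lambda>c d. f a b c d) s) t =
    tensor_lift k N (\<lambda>c d. tensor_lift k N (\<lambda>a b. f a b c d) t) s"
proof -
  have *: "bilinear_map k P Q N (\<lambda>a b. tensor_lift k N (\<lambda>c d. f a b c d) s)"
    by (intro bilinearI linear_lift_param[OF s P' Q' N] P Q 1 bilinear_left[OF 2] bilinear_right[OF 2])
  have "linear_map k (tensor k P Q) N (\<lambda>t. tensor_lift k N (\<lambda>c d. tensor_lift k N (\<lambda>a b. f a b c d) t) s)"
    by (assumption | rule bilinearI s t P Q P' Q' N tensor_module linear_lift_param linear_lift_arg linear_id
        bilinear_left[OF 1] bilinear_right[OF 1] bilinear_left[OF 2] bilinear_right[OF 2])+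
  then show ?thesis
  proof (rule tensor_eqI[OF P Q N tensor_lift_linear[OF P Q N *] _ _ t])
    fix x y assume xy: "x \<in> carrier P" "y \<in> carrier Q"
    show "tensor_lift k N (\<lambda>a b. tensor_lift k N (f a b) s) (pure_tensor k P Q x y) =
      tensor_lift k N (\<lambda>c d. tensor_lift k N (\<lambda>a b. f a b c d) (pure_tensor k P Q x y)) s"
      unfolding tensor_lift_pure[OF P Q N * xy]
      by (rule tensor_ext[OF P' Q' _ s]) (simp add: tensor_lift_pure[OF P Q N 2] xy)
  qed
qed

section \<open>Convolution\<close>

text \<open>For \<open>\<delta>(a) = \<Sum> a\<^sub>-\<^sub>1 \<otimes> a\<^sub>0\<close> the three
  convolutions are the sums \<open>\<Sum> p (F a\<^sub>-\<^sub>1) (G a\<^sub>0)\<close>, \<open>\<Sum> p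
  (F a\<^sub>-\<^sub>1 b\<^sub>-\<^sub>1) (G a\<^sub>0 b\<^sub>0)\<close> and \<open>\<Sum> p (F
  a\<^sub>-\<^sub>1 b\<^sub>-\<^sub>1 c\<^sub>-\<^sub>1) (G a\<^sub>0 b\<^sub>0 c\<^sub>0)\<close>. The
  pairing \<open>p\<close> is a parameter because values are multiplied in \<open>k\<close>, act as
  scalars from either side, or are put next to each other by \<open>\<otimes>\<close>. Each convolution
  is defined from the previous one, so that its properties follow by treating one variable at a time.\<close>

definition conv1 where
  "conv1 k N \<delta> p F G a = tensor_lift k N (\<lambda>h a0. p (F h) (G a0)) (\<delta> a)"

definition conv2 where
  "conv2 k N \<delta> \<delta>' p F G a b = tensor_lift k N (\<lambda>h a0. conv1 k N \<delta>' p (F h) (G a0) b) (\<delta> a)"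

definition conv3 where
  "conv3 k N \<delta> p F G a b c = tensor_lift k N (\<lambda>h a0. conv2 k N \<delta> \<delta> p (F h) (G a0) b c) (\<delta> a)"

definition trilinear_map where
  "trilinear_map k P Q S N f \<longleftrightarrow> (\<forall>x\<in>carrier P. bilinear_map k Q S N (f x)) \<and>
    (\<forall>y\<in>carrier Q. \<forall>z\<in>carrier S. linear_map k P N (\<lambda>x. f x y z))"

lemma trilinearI:
  "(\<And>x. x \<in> carrier P \<Longrightarrow> bilinear_map k Q S N (\<lambda>y z. f x y z)) \<Longrightarrow>
    (\<And>y z. y \<in> carrier Q \<Longrightarrow> z \<in> carrier S \<Longrightarrow> linear_map k P N (\<lambda>x. f x y z)) \<Longrightarrow> trilinear_map k P Q S N f"
  by (simp add: trilinear_map_def)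

lemma trilinear_1: "trilinear_map k P Q S N f \<Longrightarrow> x \<in> carrier P \<Longrightarrow> bilinear_map k Q S N (f x)"
  and trilinear_2: "trilinear_map k P Q S N f \<Longrightarrow> y \<in> carrier Q \<Longrightarrow> z \<in> carrier S \<Longrightarrow> linear_map k P N (\<lambda>x. f x y z)"
  by (simp_all add: trilinear_map_def)

text \<open>Coassociativity at a single element. For the tensor algebra it is proved by induction, where
  the induction hypothesis concerns one element only.\<close>

definition coassociative_at where
  "coassociative_at k H A \<delta> a \<longleftrightarrow>
    tensor_lift k (tensor k H (tensor k H A))
      (\<lambda>h a0. tensor_lift k (tensor k H (tensor k H A))
        (\<lambda>h1 h2. pure_tensor k H (tensor k H A) h1 (pure_tensor k H A h2 a0)) (comult H h)) (\<delta> a)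
    = tensor_lift k (tensor k H (tensor k H A))
      (\<lambda>h a0. pure_tensor k H (tensor k H A) h (\<delta> a0)) (\<delta> a)"

text \<open>A linear map \<open>\<delta>\<close> from \<open>A\<close> to \<open>H \<otimes> A\<close>,
  without the comodule axioms: the linearity of convolutions rests on this alone, and the coaction on
  the tensor algebra can be handled by convolutions before its axioms are established.\<close>

locale comodule_map =
  fixes k :: "('k, 'z) ring_scheme" and H :: "('k, 'h, 'y) coalgebra_scheme"
    and A :: "('k, 'a, 'x) module_scheme" and \<delta>
  assumes H: "module k H" and A: "module k A"
    and comult: "linear_map k H (tensor k H H) (comult H)"
    and \<delta>: "linear_map k A (tensor k H A) \<delta>"
begin

text \<open>The two iterated coactions are elements of \<open>H \<otimes> (H \<otimes> A)\<close>; apply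
  the linear map induced by \<open>f\<close> to both.\<close>

lemma sweedler_coassoc:
  assumes co: "coassociative_at k H A \<delta> a" and a: "a \<in> carrier A" and N: "module k N"
    and f: "trilinear_map k H H A N f"
  shows "tensor_lift k N (\<lambda>h a0. tensor_lift k N (\<lambda>h1 h2. f h1 h2 a0) (comult H h)) (\<delta> a) =
    tensor_lift k N (\<lambda>h a0. tensor_lift k N (\<lambda>h2 a1. f h h2 a1) (\<delta> a0)) (\<delta> a)"
proof -
  let ?HA = "tensor k H A"
  let ?HHA = "tensor k H ?HA"
  let ?L = "\<lambda>h1 t. tensor_lift k N (\<lambda>h2 a0. f h1 h2 a0) t"
  note HA = tensor_module[OF H A] and HHA = tensor_module[OF H tensor_module[OF H A]]
  note R = bilinearI H A HA HHA N linear_closed[OF \<delta>] linear_closed[OF comult]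
    bilinear_left[OF trilinear_1[OF f]] bilinear_right[OF trilinear_1[OF f]] trilinear_2[OF f]
    linear_lift_param linear_lift_arg linear_comp[OF \<delta>] linear_comp[OF comult] linear_id
    bilinear_in_left[OF pure_tensor_bilinear] bilinear_in_right[OF pure_tensor_bilinear]
    bilinear_closed[OF pure_tensor_bilinear] a
  have L: "bilinear_map k H ?HA N ?L" by (assumption | rule R)+
  note pure = tensor_lift_pure[OF H HA N L] tensor_lift_pure[OF H A N trilinear_1[OF f]]
  have p1: "bilinear_map k H H ?HHA (\<lambda>h1 h2. pure_tensor k H ?HA h1 (pure_tensor k H A h2 a0))"
    if "a0 \<in> carrier A" for a0 by (insert that, (assumption | rule R)+)
  have p2: "bilinear_map k H A ?HHA (\<lambda>h a0. tensor_lift k ?HHA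
      (\<lambda>h1 h2. pure_tensor k H ?HA h1 (pure_tensor k H A h2 a0)) (comult H h))" by (assumption | rule R)+
  have p3: "bilinear_map k H A ?HHA (\<lambda>h a0. pure_tensor k H ?HA h (\<delta> a0))" by (assumption | rule R)+
  note TL = tensor_lift_linear[OF H HA N L]
  have "tensor_lift k N ?L (tensor_lift k ?HHA (\<lambda>h a0. tensor_lift k ?HHA
      (\<lambda>h1 h2. pure_tensor k H ?HA h1 (pure_tensor k H A h2 a0)) (comult H h)) (\<delta> a))
    = tensor_lift k N (\<lambda>h a0. tensor_lift k N ?L (tensor_lift k ?HHA
      (\<lambda>h1 h2. pure_tensor k H ?HA h1 (pure_tensor k H A h2 a0)) (comult H h))) (\<delta> a)"
    by (rule tensor_lift_comp[OF H A HHA N TL p2]) (assumption | rule R)+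
  also have "\<dots> = tensor_lift k N (\<lambda>h a0. tensor_lift k N
      (\<lambda>h1 h2. tensor_lift k N ?L (pure_tensor k H ?HA h1 (pure_tensor k H A h2 a0))) (comult H h)) (\<delta> a)"
    by (intro tensor_ext[OF H A] tensor_lift_comp[OF H H HHA N TL p1]; (assumption | rule R)+)
  also have "\<dots> = tensor_lift k N (\<lambda>h a0. tensor_lift k N (\<lambda>h1 h2. f h1 h2 a0) (comult H h)) (\<delta> a)"
    by (intro tensor_ext[OF H A] tensor_ext[OF H H] R)
      (simp_all add: pure bilinear_closed[OF pure_tensor_bilinear[OF H A]])
  finally have l: "tensor_lift k N ?L (tensor_lift k ?HHA (\<lambda>h a0. tensor_lift k ?HHA
      (\<lambda>h1 h2. pure_tensor k H ?HA h1 (pure_tensor k H A h2 a0)) (comult H h)) (\<delta> a)) = \<dots>" .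
  have "tensor_lift k N ?L (tensor_lift k ?HHA (\<lambda>h a0. pure_tensor k H ?HA h (\<delta> a0)) (\<delta> a))
    = tensor_lift k N (\<lambda>h a0. tensor_lift k N ?L (pure_tensor k H ?HA h (\<delta> a0))) (\<delta> a)"
    by (rule tensor_lift_comp[OF H A HHA N TL p3]) (assumption | rule R)+
  also have "\<dots> = tensor_lift k N (\<lambda>h a0. ?L h (\<delta> a0)) (\<delta> a)"
    by (intro tensor_ext[OF H A] R) (simp add: pure linear_closed[OF \<delta>])
  finally show ?thesis
    using l co unfolding coassociative_at_def by simp
qed

end

definition pairing where
  "pairing k N1 N2 N p \<longleftrightarrow> module k N1 \<and> module k N2 \<and> module k N \<and> bilinear_map k N1 N2 N p"

lemma pairingD:
  "pairing k N1 N2 N p \<Longrightarrow> module k N1" "pairing k N1 N2 N p \<Longrightarrow> module k N2"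
  "pairing k N1 N2 N p \<Longrightarrow> module k N" "pairing k N1 N2 N p \<Longrightarrow> bilinear_map k N1 N2 N p"
  by (simp_all add: pairing_def)

text \<open>The pairings that occur when bracketing a triple product in the two possible ways.\<close>

definition associative_pairings where
  "associative_pairings k N1 N2 N3 N12 N23 N q p q' p' \<longleftrightarrow>
    pairing k N1 N2 N12 q \<and> pairing k N12 N3 N p \<and> pairing k N2 N3 N23 q' \<and> pairing k N1 N23 N p' \<and>
    (\<forall>x\<in>carrier N1. \<forall>y\<in>carrier N2. \<forall>z\<in>carrier N3. p (q x y) z = p' x (q' y z))"

context comodule_map
begin

lemmas H_rules = bilinearI H A linear_closed[OF \<delta>] linear_closed[OF comult] linear_lift_param linear_lift_arg
  linear_comp[OF \<delta>] linear_comp[OF comult] linear_id tensor_module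

context
  fixes N1 :: "('k, 'n1, 'w1) module_scheme" and N2 :: "('k, 'n2, 'w2) module_scheme"
    and N :: "('k, 'n, 'v) module_scheme" and p
  assumes p: "pairing k N1 N2 N p"
begin

lemmas p_rules = H_rules pairingD(1-3)[OF p] bilinear_in_left[OF pairingD(4)[OF p]]
  bilinear_in_right[OF pairingD(4)[OF p]]

lemma conv1_linear:
  assumes F: "linear_map k H N1 F" and G: "linear_map k A N2 G"
  shows "linear_map k A N (conv1 k N \<delta> p F G)"
  unfolding conv1_def
  by (assumption | rule p_rules linear_comp[OF F] linear_comp[OF G] linear_closed[OF F] linear_closed[OF G])+

lemma conv1_left:
  assumes a: "a \<in> carrier A" and X: "module k X"
    and U1: "\<And>h. h \<in> carrier H \<Longrightarrow> linear_map k X N1 (\<lambda>x. U x h)"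
    and U2: "\<And>x. x \<in> carrier X \<Longrightarrow> linear_map k H N1 (\<lambda>h. U x h)"
    and V: "linear_map k A N2 V"
  shows "linear_map k X N (\<lambda>x. conv1 k N \<delta> p (\<lambda>h. U x h) V a)"
  unfolding conv1_def
  by (assumption | rule p_rules U1 U2 linear_comp[OF V] linear_closed[OF V] linear_closed[OF U2] a X)+

lemma conv1_right:
  assumes a: "a \<in> carrier A" and X: "module k X"
    and U: "linear_map k H N1 U"
    and V1: "\<And>b. b \<in> carrier A \<Longrightarrow> linear_map k X N2 (\<lambda>x. V x b)"
    and V2: "\<And>x. x \<in> carrier X \<Longrightarrow> linear_map k A N2 (\<lambda>b. V x b)"
  shows "linear_map k X N (\<lambda>x. conv1 k N \<delta> p U (\<lambda>b. V x b) a)"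
  unfolding conv1_def
  by (assumption | rule p_rules V1 V2 linear_comp[OF U] linear_closed[OF U] linear_closed[OF V2] a X)+

lemma conv1_lift_left:
  assumes a: "a \<in> carrier A" and t: "t \<in> carrier (tensor k P Q)" and P: "module k P" and Q: "module k Q"
    and U1: "\<And>h. h \<in> carrier H \<Longrightarrow> bilinear_map k P Q N1 (\<lambda>x y. U x y h)"
    and U2: "\<And>x y. x \<in> carrier P \<Longrightarrow> y \<in> carrier Q \<Longrightarrow> linear_map k H N1 (\<lambda>h. U x y h)"
    and V: "linear_map k A N2 V"
  shows "conv1 k N \<delta> p (\<lambda>h. tensor_lift k N1 (\<lambda>x y. U x y h) t) V a
    = tensor_lift k N (\<lambda>x y. conv1 k N \<delta> p (\<lambda>h. U x y h) V a) t"
proof -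
  note R = p_rules bilinear_left[OF U1] bilinear_right[OF U1] U2 linear_comp[OF V] linear_closed[OF V]
    linear_closed[OF U2] a t P Q
  have "conv1 k N \<delta> p (\<lambda>h. tensor_lift k N1 (\<lambda>x y. U x y h) t) V a
    = tensor_lift k N (\<lambda>h a0. tensor_lift k N (\<lambda>x y. p (U x y h) (V a0)) t) (\<delta> a)"
    unfolding conv1_def
    by (rule tensor_ext[OF H A] tensor_lift_comp[OF P Q pairingD(1,3)[OF p], where L = "\<lambda>n. p n _"] | assumption | rule R)+
  also have "\<dots> = tensor_lift k N (\<lambda>x y. conv1 k N \<delta> p (\<lambda>h. U x y h) V a) t"
    unfolding conv1_def
    by (rule tensor_lift_swap | assumption | rule R)+
  finally show ?thesis .
qed

lemma conv1_lift_right: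
  assumes a: "a \<in> carrier A" and t: "t \<in> carrier (tensor k P Q)" and P: "module k P" and Q: "module k Q"
    and U: "linear_map k H N1 U"
    and V1: "\<And>b. b \<in> carrier A \<Longrightarrow> bilinear_map k P Q N2 (\<lambda>x y. V x y b)"
    and V2: "\<And>x y. x \<in> carrier P \<Longrightarrow> y \<in> carrier Q \<Longrightarrow> linear_map k A N2 (\<lambda>b. V x y b)"
  shows "conv1 k N \<delta> p U (\<lambda>b. tensor_lift k N2 (\<lambda>x y. V x y b) t) a
    = tensor_lift k N (\<lambda>x y. conv1 k N \<delta> p U (\<lambda>b. V x y b) a) t"
proof -
  note R = p_rules bilinear_left[OF V1] bilinear_right[OF V1] V2 linear_comp[OF U] linear_closed[OF U]
    linear_closed[OF V2] a t P Q
  have "conv1 k N \<delta> p U (\<lambda>b. tensor_lift k N2 (\<lambda>x y. V x y b) t) a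
    = tensor_lift k N (\<lambda>h a0. tensor_lift k N (\<lambda>x y. p (U h) (V x y a0)) t) (\<delta> a)"
    unfolding conv1_def
    by (rule tensor_ext[OF H A] tensor_lift_comp[OF P Q pairingD(2,3)[OF p], where L = "p _"] | assumption | rule R)+
  also have "\<dots> = tensor_lift k N (\<lambda>x y. conv1 k N \<delta> p U (\<lambda>b. V x y b) a) t"
    unfolding conv1_def
    by (rule tensor_lift_swap | assumption | rule R)+
  finally show ?thesis .
qed

end

text \<open>Coassociativity turns \<open>\<Sum> (F(a\<^sub>-\<^sub>2) G(a\<^sub>-\<^sub>1))
  K(a\<^sub>0)\<close> from the sum over \<open>\<Delta>(a\<^sub>-\<^sub>1) \<otimes> a\<^sub>0\<close>
  into the sum over \<open>a\<^sub>-\<^sub>1 \<otimes> \<delta>(a\<^sub>0)\<close>. The same argument,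
  one variable at a time, proves associativity for two and three variables.\<close>

lemma conv1_assoc:
  assumes co: "coassociative_at k H A \<delta> a" and a: "a \<in> carrier A"
    and ap: "associative_pairings k N1 N2 N3 N12 N23 N q p q' p'"
    and F: "linear_map k H N1 F" and G: "linear_map k H N2 G" and K: "linear_map k A N3 K"
  shows "conv1 k N \<delta> p (conv1 k N12 (comult H) q F G) K a = conv1 k N \<delta> p' F (conv1 k N23 \<delta> q' G K) a"
proof -
  from ap have P: "pairing k N1 N2 N12 q" "pairing k N12 N3 N p" "pairing k N2 N3 N23 q'" "pairing k N1 N23 N p'"
    and eq: "\<And>x y z. x \<in> carrier N1 \<Longrightarrow> y \<in> carrier N2 \<Longrightarrow> z \<in> carrier N3 \<Longrightarrow> p (q x y) z = p' x (q' y z)"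
    by (auto simp: associative_pairings_def)
  note N = pairingD(1,2)[OF P(1)] pairingD(2)[OF P(2)] pairingD(3)[OF P(1)] pairingD(3)[OF P(3)] pairingD(3)[OF P(2)]
  note b = pairingD(4)[OF P(1)] pairingD(4)[OF P(2)] pairingD(4)[OF P(3)] pairingD(4)[OF P(4)]
  note R = H_rules N a bilinear_in_left[OF b(1)] bilinear_in_left[OF b(2)] bilinear_in_left[OF b(3)]
    bilinear_in_left[OF b(4)] bilinear_in_right[OF b(1)] bilinear_in_right[OF b(2)] bilinear_in_right[OF b(3)]
    bilinear_in_right[OF b(4)] linear_closed[OF F] linear_closed[OF G] linear_closed[OF K]
    linear_comp[OF F] linear_comp[OF G] linear_comp[OF K] bilinear_closed[OF b(1)] bilinear_closed[OF b(3)]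
    trilinearI tensor_lift_closed
  have "conv1 k N \<delta> p (conv1 k N12 (comult H) q F G) K a
    = tensor_lift k N (\<lambda>h a0. tensor_lift k N (\<lambda>h1 h2. p (q (F h1) (G h2)) (K a0)) (comult H h)) (\<delta> a)"
    unfolding conv1_def
    by (intro tensor_ext[OF H A] tensor_lift_comp[OF H H N(4,6), where L = "\<lambda>n. p n _"]; (assumption | rule R)+)
  also have "\<dots> = tensor_lift k N (\<lambda>h a0. tensor_lift k N (\<lambda>h2 a1. p (q (F h) (G h2)) (K a1)) (\<delta> a0)) (\<delta> a)"
    by (rule sweedler_coassoc[OF co a N(6)]; (assumption | rule R)+)
  also have "\<dots> = tensor_lift k N (\<lambda>h a0. tensor_lift k N (\<lambda>h2 a1. p' (F h) (q' (G h2) (K a1))) (\<delta> a0)) (\<delta> a)"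
    by (intro tensor_ext[OF H A] R) (auto simp: eq linear_closed[OF F] linear_closed[OF G] linear_closed[OF K])
  also have "\<dots> = conv1 k N \<delta> p' F (conv1 k N23 \<delta> q' G K) a"
    unfolding conv1_def
    by (intro tensor_ext[OF H A] tensor_lift_comp[OF H A N(5,6), where L = "p' _", symmetric]; (assumption | rule R)+)
  finally show ?thesis .
qed

lemma H_comodule_map: "comodule_map k H H (comult H)"
  by (rule comodule_map.intro[OF H H comult comult])

end

locale comodule_map_pair = A: comodule_map k H A \<delta> + B: comodule_map k H B \<delta>'
  for k :: "('k, 'z) ring_scheme" and H :: "('k, 'h, 'y) coalgebra_scheme"
    and A :: "('k, 'a, 'x) module_scheme" and \<delta> and B :: "('k, 'b, 'w) module_scheme" and \<delta>'
begin

interpretation HH: comodule_map k H H "comult H" by (rule A.H_comodule_map)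

context
  fixes N1 :: "('k, 'n1, 'w1) module_scheme" and N2 :: "('k, 'n2, 'w2) module_scheme"
    and N :: "('k, 'n, 'v) module_scheme" and p
  assumes p: "pairing k N1 N2 N p"
begin

lemmas p2_rules = A.H_rules B.H_rules pairingD(1-3)[OF p] linear_comp[OF B.conv1_linear[OF p]] B.conv1_left[OF p] B.conv1_right[OF p]
  linear_closed[OF B.conv1_linear[OF p]]

lemma conv2_bilinear:
  assumes F: "bilinear_map k H H N1 F" and G: "bilinear_map k A B N2 G"
  shows "bilinear_map k A B N (conv2 k N \<delta> \<delta>' p F G)"
  unfolding conv2_def
  by (assumption | rule p2_rules bilinear_left[OF F] bilinear_right[OF F] bilinear_left[OF G] bilinear_right[OF G])+

lemma conv2_left:
  assumes a: "a \<in> carrier A" and b: "b \<in> carrier B" and X: "module k X"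
    and U1: "\<And>h g. h \<in> carrier H \<Longrightarrow> g \<in> carrier H \<Longrightarrow> linear_map k X N1 (\<lambda>x. U x h g)"
    and U2: "\<And>x. x \<in> carrier X \<Longrightarrow> bilinear_map k H H N1 (\<lambda>h g. U x h g)"
    and V: "bilinear_map k A B N2 V"
  shows "linear_map k X N (\<lambda>x. conv2 k N \<delta> \<delta>' p (\<lambda>h g. U x h g) V a b)"
  unfolding conv2_def
  by (assumption | rule p2_rules U1 bilinear_left[OF U2] bilinear_right[OF U2] bilinear_left[OF V] bilinear_right[OF V] a b X)+

lemma conv2_right:
  assumes a: "a \<in> carrier A" and b: "b \<in> carrier B" and X: "module k X"
    and U: "bilinear_map k H H N1 U"
    and V1: "\<And>h g. h \<in> carrier A \<Longrightarrow> g \<in> carrier B \<Longrightarrow> linear_map k X N2 (\<lambda>x. V x h g)"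
    and V2: "\<And>x. x \<in> carrier X \<Longrightarrow> bilinear_map k A B N2 (\<lambda>h g. V x h g)"
  shows "linear_map k X N (\<lambda>x. conv2 k N \<delta> \<delta>' p U (\<lambda>h g. V x h g) a b)"
  unfolding conv2_def
  by (assumption | rule p2_rules V1 bilinear_left[OF V2] bilinear_right[OF V2] bilinear_left[OF U] bilinear_right[OF U] a b X)+

lemma conv2_lift_left:
  assumes a: "a \<in> carrier A" and b: "b \<in> carrier B"
    and t: "t \<in> carrier (tensor k P Q)" and P: "module k P" and Q: "module k Q"
    and U1: "\<And>h g. h \<in> carrier H \<Longrightarrow> g \<in> carrier H \<Longrightarrow> bilinear_map k P Q N1 (\<lambda>x y. U x y h g)"
    and U2: "\<And>x y. x \<in> carrier P \<Longrightarrow> y \<in> carrier Q \<Longrightarrow> bilinear_map k H H N1 (\<lambda>h g. U x y h g)"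
    and V: "bilinear_map k A B N2 V"
  shows "conv2 k N \<delta> \<delta>' p (\<lambda>h g. tensor_lift k N1 (\<lambda>x y. U x y h g) t) V a b
    = tensor_lift k N (\<lambda>x y. conv2 k N \<delta> \<delta>' p (\<lambda>h g. U x y h g) V a b) t"
proof -
  note R = p2_rules bilinear_left[OF U1] bilinear_right[OF U1] bilinear_left[OF U2] bilinear_right[OF U2]
    bilinear_left[OF V] bilinear_right[OF V] a b t P Q
  have "conv2 k N \<delta> \<delta>' p (\<lambda>h g. tensor_lift k N1 (\<lambda>x y. U x y h g) t) V a b
    = tensor_lift k N (\<lambda>h a0. tensor_lift k N (\<lambda>x y. conv1 k N \<delta>' p (\<lambda>g. U x y h g) (V a0) b) t) (\<delta> a)"
    unfolding conv2_def
    by (rule tensor_ext[OF A.H A.A] B.conv1_lift_left[OF p] | assumption | rule R)+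
  also have "\<dots> = tensor_lift k N (\<lambda>x y. conv2 k N \<delta> \<delta>' p (\<lambda>h g. U x y h g) V a b) t"
    unfolding conv2_def
    by (rule tensor_lift_swap | assumption | rule R)+
  finally show ?thesis .
qed

lemma conv2_lift_right:
  assumes a: "a \<in> carrier A" and b: "b \<in> carrier B"
    and t: "t \<in> carrier (tensor k P Q)" and P: "module k P" and Q: "module k Q"
    and U: "bilinear_map k H H N1 U"
    and V1: "\<And>c d. c \<in> carrier A \<Longrightarrow> d \<in> carrier B \<Longrightarrow> bilinear_map k P Q N2 (\<lambda>x y. V x y c d)"
    and V2: "\<And>x y. x \<in> carrier P \<Longrightarrow> y \<in> carrier Q \<Longrightarrow> bilinear_map k A B N2 (\<lambda>c d. V x y c d)"
  shows "conv2 k N \<delta> \<delta>' p U (\<lambda>c d. tensor_lift k N2 (\<lambda>x y. V x y c d) t) a b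
    = tensor_lift k N (\<lambda>x y. conv2 k N \<delta> \<delta>' p U (\<lambda>c d. V x y c d) a b) t"
proof -
  note R = p2_rules bilinear_left[OF V1] bilinear_right[OF V1] bilinear_left[OF V2] bilinear_right[OF V2]
    bilinear_left[OF U] bilinear_right[OF U] a b t P Q
  have "conv2 k N \<delta> \<delta>' p U (\<lambda>c d. tensor_lift k N2 (\<lambda>x y. V x y c d) t) a b
    = tensor_lift k N (\<lambda>h a0. tensor_lift k N (\<lambda>x y. conv1 k N \<delta>' p (U h) (\<lambda>d. V x y a0 d) b) t) (\<delta> a)"
    unfolding conv2_def
    by (rule tensor_ext[OF A.H A.A] B.conv1_lift_right[OF p] | assumption | rule R)+
  also have "\<dots> = tensor_lift k N (\<lambda>x y. conv2 k N \<delta> \<delta>' p U (\<lambda>c d. V x y c d) a b) t"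
    unfolding conv2_def
    by (rule tensor_lift_swap | assumption | rule R)+
  finally show ?thesis .
qed

end

end

lemma associative_pairingsD:
  assumes "associative_pairings k N1 N2 N3 N12 N23 N q p q' p'"
  shows "pairing k N1 N2 N12 q" "pairing k N12 N3 N p" "pairing k N2 N3 N23 q'" "pairing k N1 N23 N p'"
    "\<And>x y z. x \<in> carrier N1 \<Longrightarrow> y \<in> carrier N2 \<Longrightarrow> z \<in> carrier N3 \<Longrightarrow> p (q x y) z = p' x (q' y z)"
  using assms by (auto simp: associative_pairings_def)

context comodule_map_pair
begin

interpretation HH: comodule_map_pair k H H "comult H" H "comult H"
  by (rule comodule_map_pair.intro[OF A.H_comodule_map A.H_comodule_map])

text \<open>The first variable contributes an outer Sweedler sum over convolutions in the second
  variable, to which the associativity in one variable applies.\<close>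

lemma conv2_assoc:
  assumes coa: "coassociative_at k H A \<delta> a" and a: "a \<in> carrier A"
    and cob: "coassociative_at k H B \<delta>' b" and b: "b \<in> carrier B"
    and ap: "associative_pairings k N1 N2 N3 N12 N23 N q p q' p'"
    and F: "bilinear_map k H H N1 F" and G: "bilinear_map k H H N2 G" and K: "bilinear_map k A B N3 K"
  shows "conv2 k N \<delta> \<delta>' p (conv2 k N12 (comult H) (comult H) q F G) K a b
    = conv2 k N \<delta> \<delta>' p' F (conv2 k N23 \<delta> \<delta>' q' G K) a b"
proof -
  note P = associative_pairingsD(1-4)[OF ap]
  note R = A.H_rules B.H_rules pairingD(1-3)[OF P(1)] pairingD(1-3)[OF P(2)] pairingD(1-3)[OF P(3)] pairingD(3)[OF P(4)]
    bilinear_left[OF F] bilinear_right[OF F] bilinear_left[OF G] bilinear_right[OF G]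
    bilinear_left[OF K] bilinear_right[OF K] a b trilinearI
    linear_comp[OF B.conv1_linear[OF P(2)]] linear_comp[OF B.conv1_linear[OF P(3)]]
    linear_comp[OF B.conv1_linear[OF P(4)]] linear_comp[OF HH.A.conv1_linear[OF P(1)]]
    B.conv1_left[OF P(2)] B.conv1_left[OF P(3)] B.conv1_left[OF P(4)] HH.A.conv1_left[OF P(1)]
    B.conv1_right[OF P(2)] B.conv1_right[OF P(3)] B.conv1_right[OF P(4)] HH.A.conv1_right[OF P(1)]
  have u1: "conv2 k N12 (comult H) (comult H) q F G h
      = (\<lambda>g. tensor_lift k N12 (\<lambda>h1 h2. conv1 k N12 (comult H) q (F h1) (G h2) g) (comult H h))" for h
    by (rule ext) (simp add: conv2_def)
  have u2: "conv2 k N23 \<delta> \<delta>' q' G K a0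
      = (\<lambda>c. tensor_lift k N23 (\<lambda>h1 h2. conv1 k N23 \<delta>' q' (G h1) (K h2) c) (\<delta> a0))" for a0
    by (rule ext) (simp add: conv2_def)
  have "conv2 k N \<delta> \<delta>' p (conv2 k N12 (comult H) (comult H) q F G) K a b
    = tensor_lift k N (\<lambda>h a0. tensor_lift k N
        (\<lambda>h1 h2. conv1 k N \<delta>' p (conv1 k N12 (comult H) q (F h1) (G h2)) (K a0) b) (comult H h)) (\<delta> a)"
    unfolding conv2_def[of k N \<delta> \<delta>'] u1
    by (rule tensor_ext[OF A.H A.A] B.conv1_lift_left[OF P(2)] | assumption | rule R)+
  also have "\<dots> = tensor_lift k N (\<lambda>h a0. tensor_lift k N
        (\<lambda>h1 h2. conv1 k N \<delta>' p' (F h1) (conv1 k N23 \<delta>' q' (G h2) (K a0)) b) (comult H h)) (\<delta> a)"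
    by (rule tensor_ext[OF A.H A.A] tensor_ext[OF A.H A.H] B.conv1_assoc[OF cob b ap] | assumption | rule R)+
  also have "\<dots> = tensor_lift k N (\<lambda>h a0. tensor_lift k N
        (\<lambda>h2 a1. conv1 k N \<delta>' p' (F h) (conv1 k N23 \<delta>' q' (G h2) (K a1)) b) (\<delta> a0)) (\<delta> a)"
    by (rule A.sweedler_coassoc[OF coa a] | assumption | rule R)+
  also have "\<dots> = conv2 k N \<delta> \<delta>' p' F (conv2 k N23 \<delta> \<delta>' q' G K) a b"
    unfolding conv2_def[of k N \<delta> \<delta>'] u2
    by (rule tensor_ext[OF A.H A.A] B.conv1_lift_right[OF P(4), symmetric] | assumption | rule R)+
  finally show ?thesis .
qed

end

context comodule_map
begin

interpretation HH: comodule_map k H H "comult H" by (rule H_comodule_map)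
interpretation AA: comodule_map_pair k H A \<delta> A \<delta>
  by (rule comodule_map_pair.intro[OF comodule_map_axioms comodule_map_axioms])
interpretation HHH: comodule_map_pair k H H "comult H" H "comult H"
  by (rule comodule_map_pair.intro[OF H_comodule_map H_comodule_map])

lemma conv3_trilinear:
  assumes p: "pairing k N1 N2 N p" and F: "trilinear_map k H H H N1 F" and G: "trilinear_map k A A A N2 G"
  shows "trilinear_map k A A A N (conv3 k N \<delta> p F G)"
  unfolding conv3_def
  by (assumption | rule trilinearI bilinear_left[OF AA.conv2_bilinear[OF p]] bilinear_right[OF AA.conv2_bilinear[OF p]]
    bilinear_closed[OF AA.conv2_bilinear[OF p]] H_rules pairingD(1-3)[OF p]
    AA.conv2_left[OF p] AA.conv2_right[OF p] trilinear_1[OF F] trilinear_1[OF G] trilinear_2[OF F] trilinear_2[OF G]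
    bilinear_left[OF trilinear_1[OF F]] bilinear_right[OF trilinear_1[OF F]]
    bilinear_left[OF trilinear_1[OF G]] bilinear_right[OF trilinear_1[OF G]])+

text \<open>As for two variables, with the associativity of the inner convolution in two variables.\<close>

lemma conv3_assoc:
  assumes coa: "\<And>a. a \<in> carrier A \<Longrightarrow> coassociative_at k H A \<delta> a"
    and a: "a \<in> carrier A" and b: "b \<in> carrier A" and c: "c \<in> carrier A"
    and ap: "associative_pairings k N1 N2 N3 N12 N23 N q p q' p'"
    and F: "trilinear_map k H H H N1 F" and G: "trilinear_map k H H H N2 G" and K: "trilinear_map k A A A N3 K"
  shows "conv3 k N \<delta> p (conv3 k N12 (comult H) q F G) K a b c
    = conv3 k N \<delta> p' F (conv3 k N23 \<delta> q' G K) a b c"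
proof -
  note P = associative_pairingsD(1-4)[OF ap]
  note R = trilinear_1[OF F] trilinear_1[OF G] trilinear_1[OF K]
    bilinear_left[OF AA.conv2_bilinear[OF P(2)]] bilinear_right[OF AA.conv2_bilinear[OF P(2)]]
    bilinear_left[OF AA.conv2_bilinear[OF P(3)]] bilinear_right[OF AA.conv2_bilinear[OF P(3)]]
    bilinear_left[OF AA.conv2_bilinear[OF P(4)]] bilinear_right[OF AA.conv2_bilinear[OF P(4)]]
    bilinear_left[OF HHH.conv2_bilinear[OF P(1)]] bilinear_right[OF HHH.conv2_bilinear[OF P(1)]]
    AA.conv2_bilinear[OF P(2)] AA.conv2_bilinear[OF P(3)] AA.conv2_bilinear[OF P(4)] HHH.conv2_bilinear[OF P(1)]
    H_rules pairingD(1-3)[OF P(1)] pairingD(1-3)[OF P(2)] pairingD(1-3)[OF P(3)] pairingD(3)[OF P(4)]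
    trilinear_2[OF F] trilinear_2[OF G] trilinear_2[OF K] a b c trilinearI
    AA.conv2_left[OF P(2)] AA.conv2_left[OF P(3)] AA.conv2_left[OF P(4)] HHH.conv2_left[OF P(1)]
    AA.conv2_right[OF P(2)] AA.conv2_right[OF P(3)] AA.conv2_right[OF P(4)] HHH.conv2_right[OF P(1)]
  have u1: "conv3 k N12 (comult H) q F G h
      = (\<lambda>g g'. tensor_lift k N12 (\<lambda>h1 h2. conv2 k N12 (comult H) (comult H) q (F h1) (G h2) g g') (comult H h))" for h
    by (intro ext) (simp add: conv3_def)
  have u2: "conv3 k N23 \<delta> q' G K a0
      = (\<lambda>c d. tensor_lift k N23 (\<lambda>h1 h2. conv2 k N23 \<delta> \<delta> q' (G h1) (K h2) c d) (\<delta> a0))" for a0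
    by (intro ext) (simp add: conv3_def)
  have "conv3 k N \<delta> p (conv3 k N12 (comult H) q F G) K a b c
    = tensor_lift k N (\<lambda>h a0. tensor_lift k N
        (\<lambda>h1 h2. conv2 k N \<delta> \<delta> p (conv2 k N12 (comult H) (comult H) q (F h1) (G h2)) (K a0) b c) (comult H h)) (\<delta> a)"
    unfolding conv3_def[of k N \<delta>] u1
    by (rule tensor_ext[OF H A] AA.conv2_lift_left[OF P(2)] | assumption | rule R)+
  also have "\<dots> = tensor_lift k N (\<lambda>h a0. tensor_lift k N
        (\<lambda>h1 h2. conv2 k N \<delta> \<delta> p' (F h1) (conv2 k N23 \<delta> \<delta> q' (G h2) (K a0)) b c) (comult H h)) (\<delta> a)"
    by (rule tensor_ext[OF H A] tensor_ext[OF H H] AA.conv2_assoc[OF coa[OF b] b coa[OF c] c ap] | assumption | rule R)+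
  also have "\<dots> = tensor_lift k N (\<lambda>h a0. tensor_lift k N
        (\<lambda>h2 a1. conv2 k N \<delta> \<delta> p' (F h) (conv2 k N23 \<delta> \<delta> q' (G h2) (K a1)) b c) (\<delta> a0)) (\<delta> a)"
    by (rule sweedler_coassoc[OF coa[OF a] a] | assumption | rule R)+
  also have "\<dots> = conv3 k N \<delta> p' F (conv3 k N23 \<delta> q' G K) a b c"
    unfolding conv3_def[of k N \<delta>] u2
    by (rule tensor_ext[OF H A] AA.conv2_lift_right[OF P(4), symmetric] | assumption | rule R)+
  finally show ?thesis .
qed

end

section \<open>Scalars and counits in convolutions\<close>

text \<open>Scalars written on the right, since \<open>\<tau>\<close> acts on the last coproduct leg and
  is convolved from the right.\<close>

definition smult_right where "smult_right N n c = c \<odot>\<^bsub>N\<^esub> n"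

lemma self_module_simps:
  "carrier (self_module k) = carrier k" "\<zero>\<^bsub>self_module k\<^esub> = \<zero>\<^bsub>k\<^esub>" "add (self_module k) = add k"
  "smult (self_module k) = mult k"
  by (simp_all add: self_module_def)

lemma self_module_module: "cring k \<Longrightarrow> module k (self_module k)"
proof -
  assume "cring k"
  then interpret cring k .
  show ?thesis
    by (intro moduleI abelian_groupI)
      (auto simp: self_module_simps is_cring l_distr r_distr m_assoc a_ac intro!: bexI[of _ "\<ominus>\<^bsub>k\<^esub> _"] l_neg)
qed

lemma module_cring: "module k N \<Longrightarrow> cring k"
  by (rule module.axioms(1))

lemma pairing_smult:
  assumes "module k N"
  shows "pairing k (self_module k) N N (smult N)"
proof -
  interpret N: module k N by fact
  show ?thesis
    unfolding pairing_def
    by (intro conjI assms self_module_module N.R.is_cring bilinearI linear_mapI)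
      (auto simp: self_module_simps N.smult_l_distr N.smult_r_distr N.smult_assoc1 N.R.m_comm
        simp flip: N.smult_assoc1)
qed

lemma pairing_smult_right:
  assumes "module k N"
  shows "pairing k N (self_module k) N (smult_right N)"
proof -
  interpret N: module k N by fact
  show ?thesis
    unfolding pairing_def smult_right_def
    by (intro conjI assms self_module_module N.R.is_cring bilinearI linear_mapI)
      (auto simp: self_module_simps N.smult_l_distr N.smult_r_distr N.R.m_comm
        simp flip: N.smult_assoc1)
qed

lemma pairing_pure: "module k P \<Longrightarrow> module k Q \<Longrightarrow> pairing k P Q (tensor k P Q) (pure_tensor k P Q)"
  by (simp add: pairing_def tensor_module pure_tensor_bilinear)

lemma pairing_scalars: "cring k \<Longrightarrow> pairing k (self_module k) (self_module k) (self_module k) (mult k)"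
  using pairing_smult[OF self_module_module] by (simp add: self_module_simps)

lemma associative_scalar_scalar:
  "module k N \<Longrightarrow> associative_pairings k (self_module k) (self_module k) N (self_module k) N N
    (mult k) (smult N) (smult N) (smult N)"
  unfolding associative_pairings_def
  by (auto intro!: pairing_smult pairing_scalars module_cring simp: self_module_simps module.smult_assoc1)

lemma associative_scalar_middle:
  assumes "module k N"
  shows "associative_pairings k (self_module k) N (self_module k) N N N
    (smult N) (smult_right N) (smult_right N) (smult N)"
proof -
  interpret N: module k N by fact
  show ?thesis
    unfolding associative_pairings_def
    by (auto intro!: pairing_smult pairing_smult_right assms
        simp: self_module_simps smult_right_def N.R.m_comm simp flip: N.smult_assoc1)
qed

lemma associative_right_scalars:
  assumes "module k N"
  shows "associative_pairings k N (self_module k) (self_module k) N (self_module k) N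
    (smult_right N) (smult_right N) (mult k) (smult_right N)"
proof -
  interpret N: module k N by fact
  show ?thesis
    unfolding associative_pairings_def
    by (auto intro!: pairing_scalars pairing_smult_right N.R.is_cring assms
        simp: self_module_simps smult_right_def N.R.m_comm simp flip: N.smult_assoc1)
qed

lemma pure_tensor_smult_left:
  "module k P \<Longrightarrow> module k Q \<Longrightarrow> c \<in> carrier k \<Longrightarrow> x \<in> carrier P \<Longrightarrow> y \<in> carrier Q \<Longrightarrow>
    pure_tensor k P Q (c \<odot>\<^bsub>P\<^esub> x) y = c \<odot>\<^bsub>tensor k P Q\<^esub> pure_tensor k P Q x y"
  using linear_smult[OF bilinear_left[OF pure_tensor_bilinear]] .

lemma pure_tensor_smult_right:
  "module k P \<Longrightarrow> module k Q \<Longrightarrow> c \<in> carrier k \<Longrightarrow> x \<in> carrier P \<Longrightarrow> y \<in> carrier Q \<Longrightarrow>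
    pure_tensor k P Q x (c \<odot>\<^bsub>Q\<^esub> y) = c \<odot>\<^bsub>tensor k P Q\<^esub> pure_tensor k P Q x y"
  using linear_smult[OF bilinear_right[OF pure_tensor_bilinear]] .

lemma associative_scalar_pure:
  "module k P \<Longrightarrow> module k Q \<Longrightarrow> associative_pairings k (self_module k) P Q P (tensor k P Q) (tensor k P Q)
    (smult P) (pure_tensor k P Q) (pure_tensor k P Q) (smult (tensor k P Q))"
  unfolding associative_pairings_def
  by (auto intro!: pairing_smult pairing_pure tensor_module simp: self_module_simps pure_tensor_smult_left)

lemma associative_pure_middle:
  "module k P \<Longrightarrow> module k Q \<Longrightarrow> associative_pairings k P (self_module k) Q P Q (tensor k P Q)
    (smult_right P) (pure_tensor k P Q) (smult Q) (pure_tensor k P Q)"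
  unfolding associative_pairings_def
  by (auto intro!: pairing_smult pairing_smult_right pairing_pure tensor_module
      simp: smult_right_def self_module_simps pure_tensor_smult_left pure_tensor_smult_right)

lemma associative_pure_scalar:
  "module k P \<Longrightarrow> module k Q \<Longrightarrow> associative_pairings k P Q (self_module k) (tensor k P Q) Q (tensor k P Q)
    (pure_tensor k P Q) (smult_right (tensor k P Q)) (smult_right Q) (pure_tensor k P Q)"
  unfolding associative_pairings_def
  by (auto intro!: pairing_smult_right pairing_pure tensor_module
      simp: smult_right_def self_module_simps pure_tensor_smult_right)

text \<open>The axioms of a left comodule with the coaction as a separate argument, so that one module
  may be considered with several coactions.\<close>

locale coaction = C: coalgebra k H + A: module k A
  for k :: "('k, 'z) ring_scheme" and H :: "('k, 'h, 'y) coalgebra_scheme"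
    and A :: "('k, 'a, 'x) module_scheme" +
  fixes \<delta> :: "'a \<Rightarrow> ('k, 'h, 'a) tensors"
  assumes coaction_linear: "linear_map k A (tensor k H A) \<delta>"
    and coaction_coassoc: "a \<in> carrier A \<Longrightarrow> coassociative_at k H A \<delta> a"
    and coaction_counit: "a \<in> carrier A \<Longrightarrow>
      tensor_lift k A (\<lambda>h a0. counit H h \<odot>\<^bsub>A\<^esub> a0) (\<delta> a) = a"
begin

sublocale comodule_map k H A \<delta>
  by (rule comodule_map.intro[OF C.module_axioms A.module_axioms C.comult_linear coaction_linear])

interpretation HH: comodule_map k H H "comult H" by (rule H_comodule_map)

lemma scalars: "module k (self_module k)"
  by (rule self_module_module[OF module_cring[OF A.module_axioms]])

lemma coaction_closed: "a \<in> carrier A \<Longrightarrow> \<delta> a \<in> carrier (tensor k H A)"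
  by (rule linear_closed[OF coaction_linear])

lemma counit_closed: "h \<in> carrier H \<Longrightarrow> counit H h \<in> carrier k"
  using linear_closed[OF C.counit_linear] by (simp add: self_module_simps)

context
  fixes N :: "('k, 'n, 'v) module_scheme"
  assumes N: "module k N"
begin

lemmas s_rules = H_rules scalars N pairingD(1-3)[OF pairing_smult[OF N]]
  bilinear_in_left[OF pairingD(4)[OF pairing_smult[OF N]]]
  bilinear_in_right[OF pairingD(4)[OF pairing_smult[OF N]]]
  bilinear_in_left[OF pairingD(4)[OF pairing_smult[OF scalars]]]
  bilinear_in_right[OF pairingD(4)[OF pairing_smult[OF scalars]]]
  linear_comp[OF C.counit_linear] linear_closed[OF C.counit_linear]

lemma conv1_counit:
  assumes a: "a \<in> carrier A" and G: "linear_map k A N G"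
  shows "conv1 k N \<delta> (smult N) (counit H) G a = G a"
proof -
  have "conv1 k N \<delta> (smult N) (counit H) G a = tensor_lift k N (\<lambda>h a0. G (counit H h \<odot>\<^bsub>A\<^esub> a0)) (\<delta> a)"
    unfolding conv1_def
    by (rule tensor_ext[OF H A _ coaction_closed[OF a]]) (simp add: linear_smult[OF G] counit_closed)
  also have "\<dots> = G (tensor_lift k A (\<lambda>h a0. counit H h \<odot>\<^bsub>A\<^esub> a0) (\<delta> a))"
    by (rule tensor_lift_comp[OF H A A N G _ coaction_closed[OF a], symmetric])
      (assumption | rule s_rules bilinear_in_left[OF pairingD(4)[OF pairing_smult[OF A]]]
        bilinear_in_right[OF pairingD(4)[OF pairing_smult[OF A]]])+
  finally show ?thesis by (simp add: coaction_counit a)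
qed

lemma conv1_scale_left:
  assumes a: "a \<in> carrier A" and c: "c \<in> carrier k" and F: "linear_map k H (self_module k) F" and G: "linear_map k A N G"
  shows "conv1 k N \<delta> (smult N) (\<lambda>h. c \<otimes>\<^bsub>k\<^esub> F h) G a = c \<odot>\<^bsub>N\<^esub> conv1 k N \<delta> (smult N) F G a"
proof -
  interpret N: module k N by (rule N)
  have "conv1 k N \<delta> (smult N) (\<lambda>h. c \<otimes>\<^bsub>k\<^esub> F h) G a = tensor_lift k N (\<lambda>h a0. c \<odot>\<^bsub>N\<^esub> (F h \<odot>\<^bsub>N\<^esub> G a0)) (\<delta> a)"
    unfolding conv1_def
    by (rule tensor_ext[OF H A _ coaction_closed[OF a]])
      (use linear_closed[OF F] linear_closed[OF G] c in \<open>simp add: self_module_simps N.smult_assoc1\<close>)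
  also have "\<dots> = c \<odot>\<^bsub>N\<^esub> conv1 k N \<delta> (smult N) F G a"
    unfolding conv1_def
    by (rule tensor_lift_comp[OF H A N N _ _ coaction_closed[OF a], where L = "\<lambda>n. c \<odot>\<^bsub>N\<^esub> n", symmetric])
      (assumption | rule linear_scale[OF N _ c] s_rules linear_comp[OF F] linear_comp[OF G] linear_closed[OF F] linear_closed[OF G])+
  finally show ?thesis .
qed

end

end

locale coaction_pair = A: coaction k H A \<delta> + B: coaction k H B \<delta>'
  for k :: "('k, 'z) ring_scheme" and H :: "('k, 'h, 'y) coalgebra_scheme"
    and A :: "('k, 'a, 'x) module_scheme" and \<delta> and B :: "('k, 'b, 'w) module_scheme" and \<delta>'
begin

sublocale comodule_map_pair k H A \<delta> B \<delta>' ..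

context
  fixes N :: "('k, 'n, 'v) module_scheme"
  assumes N: "module k N"
begin

interpretation N: module k N by (rule N)

lemma conv2_counit:
  assumes a: "a \<in> carrier A" and b: "b \<in> carrier B" and G: "bilinear_map k A B N G"
  shows "conv2 k N \<delta> \<delta>' (smult N) (\<lambda>x y. counit H x \<otimes>\<^bsub>k\<^esub> counit H y) G a b = G a b"
proof -
  have "conv2 k N \<delta> \<delta>' (smult N) (\<lambda>x y. counit H x \<otimes>\<^bsub>k\<^esub> counit H y) G a b
    = conv1 k N \<delta> (smult N) (counit H) (\<lambda>a. G a b) a"
    unfolding conv2_def conv1_def[of k N \<delta>]
    by (rule tensor_ext[OF A.H A.A _ A.coaction_closed[OF a]])
      (simp add: B.conv1_scale_left[OF N b] B.conv1_counit[OF N b] A.counit_closed A.C.counit_linear bilinear_right[OF G])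
  then show ?thesis by (simp add: A.conv1_counit[OF N a bilinear_left[OF G b]])
qed

lemma conv2_scale_left:
  assumes a: "a \<in> carrier A" and b: "b \<in> carrier B" and c: "c \<in> carrier k"
    and F: "bilinear_map k H H (self_module k) F" and G: "bilinear_map k A B N G"
  shows "conv2 k N \<delta> \<delta>' (smult N) (\<lambda>x y. c \<otimes>\<^bsub>k\<^esub> F x y) G a b = c \<odot>\<^bsub>N\<^esub> conv2 k N \<delta> \<delta>' (smult N) F G a b"
proof -
  have "conv2 k N \<delta> \<delta>' (smult N) (\<lambda>x y. c \<otimes>\<^bsub>k\<^esub> F x y) G a b =
     tensor_lift k N (\<lambda>h a0. c \<odot>\<^bsub>N\<^esub> conv1 k N \<delta>' (smult N) (F h) (G a0) b) (\<delta> a)"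
    unfolding conv2_def
    by (rule tensor_ext[OF A.H A.A _ A.coaction_closed[OF a]])
      (simp add: B.conv1_scale_left[OF N b c] bilinear_right[OF F] bilinear_right[OF G])
  also have "\<dots> = c \<odot>\<^bsub>N\<^esub> conv2 k N \<delta> \<delta>' (smult N) F G a b"
    unfolding conv2_def
    by (rule tensor_lift_comp[OF A.H A.A N N _ _ A.coaction_closed[OF a], where L = "\<lambda>n. c \<odot>\<^bsub>N\<^esub> n", symmetric])
     (assumption | rule linear_scale[OF N _ c] linear_id bilinearI B.conv1_left[OF pairing_smult[OF N] b]
        B.conv1_right[OF pairing_smult[OF N] b] A.A A.H
        bilinear_left[OF F] bilinear_right[OF F] bilinear_left[OF G] bilinear_right[OF G])+
  finally show ?thesis .
qed

end

end

context coaction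
begin

interpretation AA: coaction_pair k H A \<delta> A \<delta>
  by (rule coaction_pair.intro[OF coaction_axioms coaction_axioms])

context
  fixes N :: "('k, 'n, 'v) module_scheme"
  assumes N: "module k N"
begin

text \<open>A form in two variables becomes a form in three variables by inserting
  \<open>\<epsilon>\<close> in the remaining slot, and the counit axiom removes it again. This is how
  cocycle identities are brought into the convolution algebra of trilinear forms.\<close>

lemma conv3_counit_left:
  assumes abc: "a \<in> carrier A" "b \<in> carrier A" "c \<in> carrier A"
    and s: "bilinear_map k H H (self_module k) s" and G: "trilinear_map k A A A N G"
  shows "conv3 k N \<delta> (smult N) (\<lambda>x y z. counit H x \<otimes>\<^bsub>k\<^esub> s y z) G a b c
    = conv2 k N \<delta> \<delta> (smult N) s (G a) b c"
proof -
  have "conv3 k N \<delta> (smult N) (\<lambda>x y z. counit H x \<otimes>\<^bsub>k\<^esub> s y z) G a b c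
    = conv1 k N \<delta> (smult N) (counit H) (\<lambda>a. conv2 k N \<delta> \<delta> (smult N) s (G a) b c) a"
    unfolding conv3_def conv1_def
    by (rule tensor_ext[OF H A _ coaction_closed[OF abc(1)]])
      (simp add: AA.conv2_scale_left[OF N abc(2,3)] counit_closed s trilinear_1[OF G])
  also have "\<dots> = conv2 k N \<delta> \<delta> (smult N) s (G a) b c"
    by (rule conv1_counit[OF N abc(1)])
      (assumption | rule AA.conv2_right[OF pairing_smult[OF N] abc(2,3) A s] trilinear_1[OF G] trilinear_2[OF G])+
  finally show ?thesis .
qed

lemma conv3_counit_right:
  assumes abc: "a \<in> carrier A" "b \<in> carrier A" "c \<in> carrier A"
    and s: "bilinear_map k H H (self_module k) s" and G: "trilinear_map k A A A N G"
  shows "conv3 k N \<delta> (smult N) (\<lambda>x y z. s x y \<otimes>\<^bsub>k\<^esub> counit H z) G a b c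
    = conv2 k N \<delta> \<delta> (smult N) s (\<lambda>a b. G a b c) a b"
  unfolding conv3_def conv2_def
proof (rule tensor_ext[OF H A _ coaction_closed[OF abc(1)]])
  interpret N: module k N by (rule N)
  fix h a0 assume ha: "h \<in> carrier H" "a0 \<in> carrier A"
  have "tensor_lift k N (\<lambda>g b0. conv1 k N \<delta> (smult N) (\<lambda>z. s h g \<otimes>\<^bsub>k\<^esub> counit H z) (G a0 b0) c) (\<delta> b)
    = tensor_lift k N (\<lambda>g b0. s h g \<odot>\<^bsub>N\<^esub> G a0 b0 c) (\<delta> b)"
    by (rule tensor_ext[OF H A _ coaction_closed[OF abc(2)]])
      (use ha bilinear_closed[OF s] in \<open>simp add: conv1_scale_left[OF N abc(3)] conv1_counit[OF N abc(3)] counit_closed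
        C.counit_linear bilinear_right[OF trilinear_1[OF G]] self_module_simps\<close>)
  then show "tensor_lift k N (\<lambda>g b0. conv1 k N \<delta> (smult N) (\<lambda>z. s h g \<otimes>\<^bsub>k\<^esub> counit H z) (G a0 b0) c) (\<delta> b)
    = conv1 k N \<delta> (smult N) (s h) (\<lambda>b. G a0 b c) b"
    by (simp add: conv1_def)
qed

end

end

context coalgebra
begin

lemma self_coaction: "coaction k C C (comult C)"
  by (unfold_locales) (auto simp: comult_linear coassociative_at_def coassoc counit_left)

interpretation self: coaction k C C "comult C" by (rule self_coaction)
interpretation self2: coaction_pair k C C "comult C" C "comult C" by (rule coaction_pair.intro[OF self_coaction self_coaction])

context
  fixes N :: "('k, 'n, 'v) module_scheme"
  assumes N: "module k N"
begin

lemmas r_rules = self.H_rules self.scalars N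
  bilinear_in_left[OF pairingD(4)[OF pairing_smult_right[OF N]]]
  bilinear_in_right[OF pairingD(4)[OF pairing_smult_right[OF N]]]
  linear_comp[OF counit_linear] linear_closed[OF counit_linear]

lemma conv1_counit_right:
  assumes a: "a \<in> carrier C" and G: "linear_map k C N G"
  shows "conv1 k N (comult C) (smult_right N) G (counit C) a = G a"
proof -
  have "conv1 k N (comult C) (smult_right N) G (counit C) a = tensor_lift k N (\<lambda>h a0. G (counit C a0 \<odot>\<^bsub>C\<^esub> h)) (comult C a)"
    unfolding conv1_def smult_right_def
    by (rule tensor_ext[OF self.H self.A _ self.coaction_closed[OF a]]) (simp add: linear_smult[OF G] self.counit_closed)
  also have "\<dots> = G (tensor_lift k C (\<lambda>h a0. counit C a0 \<odot>\<^bsub>C\<^esub> h) (comult C a))"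
    by (rule tensor_lift_comp[OF self.H self.A self.A N G _ self.coaction_closed[OF a], symmetric])
      (assumption | rule r_rules bilinear_in_left[OF pairingD(4)[OF pairing_smult[OF self.A]]]
        bilinear_in_right[OF pairingD(4)[OF pairing_smult[OF self.A]]])+
  finally show ?thesis by (simp add: counit_right a)
qed

lemma conv1_scale_right:
  assumes a: "a \<in> carrier C" and c: "c \<in> carrier k" and F: "linear_map k C (self_module k) F" and G: "linear_map k C N G"
  shows "conv1 k N (comult C) (smult_right N) G (\<lambda>h. c \<otimes>\<^bsub>k\<^esub> F h) a = c \<odot>\<^bsub>N\<^esub> conv1 k N (comult C) (smult_right N) G F a"
proof -
  interpret N: module k N by (rule N)
  have "conv1 k N (comult C) (smult_right N) G (\<lambda>h. c \<otimes>\<^bsub>k\<^esub> F h) a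
      = tensor_lift k N (\<lambda>h a0. c \<odot>\<^bsub>N\<^esub> (smult_right N (G h) (F a0))) (comult C a)"
    unfolding conv1_def
    by (rule tensor_ext[OF self.H self.A _ self.coaction_closed[OF a]])
      (use linear_closed[OF F] linear_closed[OF G] c in \<open>simp add: self_module_simps smult_right_def N.smult_assoc1\<close>)
  also have "\<dots> = c \<odot>\<^bsub>N\<^esub> conv1 k N (comult C) (smult_right N) G F a"
    unfolding conv1_def
    by (rule tensor_lift_comp[OF self.H self.A N N _ _ self.coaction_closed[OF a], where L = "\<lambda>n. c \<odot>\<^bsub>N\<^esub> n", symmetric])
      (assumption | rule linear_scale[OF N _ c] r_rules linear_comp[OF F] linear_comp[OF G] linear_closed[OF F] linear_closed[OF G])+
  finally show ?thesis .
qed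

lemma conv2_counit_right:
  assumes a: "a \<in> carrier C" and b: "b \<in> carrier C" and G: "bilinear_map k C C N G"
  shows "conv2 k N (comult C) (comult C) (smult_right N) G (\<lambda>x y. counit C x \<otimes>\<^bsub>k\<^esub> counit C y) a b = G a b"
proof -
  interpret N: module k N by (rule N)
  have "conv2 k N (comult C) (comult C) (smult_right N) G (\<lambda>x y. counit C x \<otimes>\<^bsub>k\<^esub> counit C y) a b
    = conv1 k N (comult C) (smult_right N) (\<lambda>a. G a b) (counit C) a"
    unfolding conv2_def conv1_def[of k N "comult C" "smult_right N" "\<lambda>a. G a b"]
    by (rule tensor_ext[OF self.H self.A _ self.coaction_closed[OF a]])
      (simp add: conv1_scale_right[OF b] conv1_counit_right[OF b] self.counit_closed counit_linear bilinear_right[OF G]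
        smult_right_def)
  then show ?thesis by (simp add: conv1_counit_right[OF a bilinear_left[OF G b]])
qed

lemma conv2_scale_right:
  assumes a: "a \<in> carrier C" and b: "b \<in> carrier C" and c: "c \<in> carrier k"
    and F: "bilinear_map k C C (self_module k) F" and G: "bilinear_map k C C N G"
  shows "conv2 k N (comult C) (comult C) (smult_right N) G (\<lambda>x y. c \<otimes>\<^bsub>k\<^esub> F x y) a b
    = c \<odot>\<^bsub>N\<^esub> conv2 k N (comult C) (comult C) (smult_right N) G F a b"
proof -
  have "conv2 k N (comult C) (comult C) (smult_right N) G (\<lambda>x y. c \<otimes>\<^bsub>k\<^esub> F x y) a b =
     tensor_lift k N (\<lambda>h a0. c \<odot>\<^bsub>N\<^esub> conv1 k N (comult C) (smult_right N) (G h) (F a0) b) (comult C a)"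
    unfolding conv2_def
    by (rule tensor_ext[OF self.H self.A _ self.coaction_closed[OF a]])
      (simp add: conv1_scale_right[OF b c] bilinear_right[OF F] bilinear_right[OF G])
  also have "\<dots> = c \<odot>\<^bsub>N\<^esub> conv2 k N (comult C) (comult C) (smult_right N) G F a b"
    unfolding conv2_def
    by (rule tensor_lift_comp[OF self.H self.A N N _ _ self.coaction_closed[OF a], where L = "\<lambda>n. c \<odot>\<^bsub>N\<^esub> n", symmetric])
     (assumption | rule linear_scale[OF N _ c] linear_id bilinearI self.conv1_left[OF pairing_smult_right[OF N] b]
        self.conv1_right[OF pairing_smult_right[OF N] b] self.A self.H
        bilinear_left[OF F] bilinear_right[OF F] bilinear_left[OF G] bilinear_right[OF G])+
  finally show ?thesis .
qed

lemma conv3_counit_left_right: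
  assumes abc: "a \<in> carrier C" "b \<in> carrier C" "c \<in> carrier C"
    and s: "bilinear_map k C C (self_module k) s" and G: "trilinear_map k C C C N G"
  shows "conv3 k N (comult C) (smult_right N) G (\<lambda>x y z. counit C x \<otimes>\<^bsub>k\<^esub> s y z) a b c
    = conv2 k N (comult C) (comult C) (smult_right N) (G a) s b c"
proof -
  have "conv3 k N (comult C) (smult_right N) G (\<lambda>x y z. counit C x \<otimes>\<^bsub>k\<^esub> s y z) a b c
    = conv1 k N (comult C) (smult_right N) (\<lambda>a. conv2 k N (comult C) (comult C) (smult_right N) (G a) s b c) (counit C) a"
    unfolding conv3_def conv1_def[of k N "comult C" "smult_right N" "\<lambda>a. conv2 _ _ _ _ _ (G a) _ _ _"]
    by (rule tensor_ext[OF self.H self.A _ self.coaction_closed[OF abc(1)]])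
      (simp add: conv2_scale_right[OF abc(2,3)] self.counit_closed s trilinear_1[OF G] smult_right_def)
  also have "\<dots> = conv2 k N (comult C) (comult C) (smult_right N) (G a) s b c"
    by (rule conv1_counit_right[OF abc(1)])
      (assumption | rule self2.conv2_left[OF pairing_smult_right[OF N] abc(2,3) self.A _ _ s] trilinear_1[OF G] trilinear_2[OF G])+
  finally show ?thesis .
qed

lemma conv3_counit_right_right:
  assumes abc: "a \<in> carrier C" "b \<in> carrier C" "c \<in> carrier C"
    and s: "bilinear_map k C C (self_module k) s" and G: "trilinear_map k C C C N G"
  shows "conv3 k N (comult C) (smult_right N) G (\<lambda>x y z. s x y \<otimes>\<^bsub>k\<^esub> counit C z) a b c
    = conv2 k N (comult C) (comult C) (smult_right N) (\<lambda>a b. G a b c) s a b"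
  unfolding conv3_def conv2_def
proof (rule tensor_ext[OF self.H self.A _ self.coaction_closed[OF abc(1)]])
  interpret N: module k N by (rule N)
  fix h a0 assume ha: "h \<in> carrier C" "a0 \<in> carrier C"
  have "tensor_lift k N (\<lambda>g b0. conv1 k N (comult C) (smult_right N) (G h g) (\<lambda>z. s a0 b0 \<otimes>\<^bsub>k\<^esub> counit C z) c) (comult C b)
    = tensor_lift k N (\<lambda>g b0. s a0 b0 \<odot>\<^bsub>N\<^esub> G h g c) (comult C b)"
    by (rule tensor_ext[OF self.H self.A _ self.coaction_closed[OF abc(2)]])
      (use ha bilinear_closed[OF s] in \<open>simp add: conv1_scale_right[OF abc(3)] conv1_counit_right[OF abc(3)]
        counit_linear bilinear_right[OF trilinear_1[OF G]] self_module_simps\<close>)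
  then show "tensor_lift k N (\<lambda>g b0. conv1 k N (comult C) (smult_right N) (G h g) (\<lambda>z. s a0 b0 \<otimes>\<^bsub>k\<^esub> counit C z) c) (comult C b)
    = conv1 k N (comult C) (smult_right N) (\<lambda>g. G h g c) (s a0) b"
    by (simp add: conv1_def smult_right_def)
qed

end

end

section \<open>Coactions on algebras\<close>

lemma (in k_algebra) mult_bilinear: "bilinear_map k A A A (mult A)"
  by (intro bilinearI linear_mapI)
    (auto simp: l_distr r_distr smult_mult_left smult_mult_right)

lemma (in k_algebra) self_module: "module k A"
  by unfold_locales

locale coaction_algebra = H: bialgebra k H + coaction k H A \<delta> + AA: k_algebra k A
  for k :: "('k, 'z) ring_scheme" and H :: "('k, 'h, 'y) coalgebra_scheme"
    and A :: "('k, 'a, 'x) module_scheme" and \<delta> +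
  assumes coaction_mult: "\<lbrakk>a \<in> carrier A; b \<in> carrier A\<rbrakk> \<Longrightarrow>
      \<delta> (a \<otimes>\<^bsub>A\<^esub> b) = tensor_lift k (tensor k H A) (\<lambda>h a0. tensor_lift k (tensor k H A)
          (\<lambda>g b0. pure_tensor k H A (h \<otimes>\<^bsub>H\<^esub> g) (a0 \<otimes>\<^bsub>A\<^esub> b0)) (\<delta> b)) (\<delta> a)"
    and coaction_one: "\<delta> \<one>\<^bsub>A\<^esub> = pure_tensor k H A \<one>\<^bsub>H\<^esub> \<one>\<^bsub>A\<^esub>"
begin

lemmas H_mult = bilinear_in_left[OF H.mult_bilinear] bilinear_in_right[OF H.mult_bilinear] bilinear_closed[OF H.mult_bilinear]
lemmas A_mult = bilinear_in_left[OF AA.mult_bilinear] bilinear_in_right[OF AA.mult_bilinear] bilinear_closed[OF AA.mult_bilinear]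

lemmas m_rules = H_rules H_mult A_mult tensor_module[OF H A]
  bilinear_in_left[OF pure_tensor_bilinear[OF H A]] bilinear_in_right[OF pure_tensor_bilinear[OF H A]]

text \<open>Multiplicativity of the coaction in the form \<open>\<Sum> f((a b)\<^sub>-\<^sub>1, (a
  b)\<^sub>0) = \<Sum> f(a\<^sub>-\<^sub>1 b\<^sub>-\<^sub>1, a\<^sub>0 b\<^sub>0)\<close>, for
  arbitrary bilinear \<open>f\<close>.\<close>

lemma lift_coaction_mult:
  assumes N: "module k N" and f: "bilinear_map k H A N f" and ab: "a \<in> carrier A" "b \<in> carrier A"
  shows "tensor_lift k N f (\<delta> (a \<otimes>\<^bsub>A\<^esub> b))
    = tensor_lift k N (\<lambda>h a0. tensor_lift k N (\<lambda>g b0. f (h \<otimes>\<^bsub>H\<^esub> g) (a0 \<otimes>\<^bsub>A\<^esub> b0)) (\<delta> b)) (\<delta> a)"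
proof -
  let ?HA = "tensor k H A"
  note HA = tensor_module[OF H A]
  note L = tensor_lift_linear[OF H A N f]
  have "tensor_lift k N f (\<delta> (a \<otimes>\<^bsub>A\<^esub> b)) = tensor_lift k N (\<lambda>h a0. tensor_lift k N f (tensor_lift k ?HA
          (\<lambda>g b0. pure_tensor k H A (h \<otimes>\<^bsub>H\<^esub> g) (a0 \<otimes>\<^bsub>A\<^esub> b0)) (\<delta> b))) (\<delta> a)"
    unfolding coaction_mult[OF ab]
    by (rule tensor_lift_comp[OF H A HA N L]) (assumption | rule ab m_rules)+
  also have "\<dots> = tensor_lift k N (\<lambda>h a0. tensor_lift k N (\<lambda>g b0. tensor_lift k N f (pure_tensor k H A (h \<otimes>\<^bsub>H\<^esub> g) (a0 \<otimes>\<^bsub>A\<^esub> b0))) (\<delta> b)) (\<delta> a)"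
    by (rule tensor_ext[OF H A] tensor_lift_comp[OF H A HA N L] | assumption | rule ab m_rules)+
  also have "\<dots> = tensor_lift k N (\<lambda>h a0. tensor_lift k N (\<lambda>g b0. f (h \<otimes>\<^bsub>H\<^esub> g) (a0 \<otimes>\<^bsub>A\<^esub> b0)) (\<delta> b)) (\<delta> a)"
    by (rule tensor_ext[OF H A] tensor_lift_pure[OF H A N f] | assumption | rule ab m_rules)+
  finally show ?thesis .
qed

interpretation AAp: coaction_pair k H A \<delta> A \<delta>
  by (rule coaction_pair.intro[OF coaction_axioms coaction_axioms])

context
  fixes N1 :: "('k, 'n1, 'w1) module_scheme" and N2 :: "('k, 'n2, 'w2) module_scheme"
    and N :: "('k, 'n, 'w) module_scheme" and p
  assumes p: "pairing k N1 N2 N p"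
begin

lemma conv1_mult:
  assumes F: "linear_map k H N1 F" and G: "linear_map k A N2 G" and ab: "a \<in> carrier A" "b \<in> carrier A"
  shows "conv1 k N \<delta> p F G (a \<otimes>\<^bsub>A\<^esub> b) = conv2 k N \<delta> \<delta> p (\<lambda>h g. F (h \<otimes>\<^bsub>H\<^esub> g)) (\<lambda>a b. G (a \<otimes>\<^bsub>A\<^esub> b)) a b"
  unfolding conv1_def conv2_def
  by (rule lift_coaction_mult[OF pairingD(3)[OF p] _ ab])
    (assumption | rule p_rules[OF p] linear_comp[OF F] linear_comp[OF G] linear_closed[OF F] linear_closed[OF G])+

text \<open>Since the coaction is multiplicative, a product in the argument splits into two variables;
  this is where convolutions in three variables arise.\<close>

lemma conv2_mult_left:
  assumes F: "bilinear_map k H H N1 F" and G: "bilinear_map k A A N2 G"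
    and abc: "a \<in> carrier A" "b \<in> carrier A" "c \<in> carrier A"
  shows "conv2 k N \<delta> \<delta> p F G (a \<otimes>\<^bsub>A\<^esub> b) c
    = conv3 k N \<delta> p (\<lambda>x y z. F (x \<otimes>\<^bsub>H\<^esub> y) z) (\<lambda>a b c. G (a \<otimes>\<^bsub>A\<^esub> b) c) a b c"
  unfolding conv3_def conv2_def
  by (rule lift_coaction_mult[OF pairingD(3)[OF p] _ abc(1,2)])
    (assumption | rule abc m_rules conv1_left[OF p] conv1_right[OF p] linear_comp[OF conv1_linear[OF p]] pairingD(1-3)[OF p]
      bilinear_left[OF F] bilinear_right[OF F] bilinear_left[OF G] bilinear_right[OF G])+

lemma conv2_mult_right:
  assumes F: "bilinear_map k H H N1 F" and G: "bilinear_map k A A N2 G"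
    and abc: "a \<in> carrier A" "b \<in> carrier A" "c \<in> carrier A"
  shows "conv2 k N \<delta> \<delta> p F G a (b \<otimes>\<^bsub>A\<^esub> c)
    = conv3 k N \<delta> p (\<lambda>x y z. F x (y \<otimes>\<^bsub>H\<^esub> z)) (\<lambda>a b c. G a (b \<otimes>\<^bsub>A\<^esub> c)) a b c"
  unfolding conv3_def conv2_def[of k N \<delta> \<delta> p F G]
  by (rule tensor_ext[OF H A _ coaction_closed[OF abc(1)]])
    (simp add: conv1_mult[OF bilinear_right[OF F] bilinear_right[OF G] abc(2,3)])

end

lemma trilinear_mult_left:
  "bilinear_map k A A N f \<Longrightarrow> trilinear_map k A A A N (\<lambda>a b c. f (a \<otimes>\<^bsub>A\<^esub> b) c)"
  by (rule trilinearI bilinearI | assumption | rule A_mult linear_id | erule bilinear_right bilinear_in_left)+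

lemma trilinear_mult_right:
  "bilinear_map k A A N f \<Longrightarrow> trilinear_map k A A A N (\<lambda>a b c. f a (b \<otimes>\<^bsub>A\<^esub> c))"
  by (rule trilinearI bilinearI | assumption | rule A_mult linear_id | erule bilinear_left bilinear_in_right)+

end

context comodule_map
begin

lemma conv2_cong:
  assumes "\<And>x y. x \<in> carrier H \<Longrightarrow> y \<in> carrier H \<Longrightarrow> F x y = F' x y"
    "\<And>x y. x \<in> carrier A \<Longrightarrow> y \<in> carrier A \<Longrightarrow> G x y = G' x y"
    and "a \<in> carrier A" "b \<in> carrier A"
  shows "conv2 k N \<delta> \<delta> p F G a b = conv2 k N \<delta> \<delta> p F' G' a b"
  unfolding conv2_def conv1_def
  by (rule tensor_ext[OF H A])+ (use assms in \<open>auto intro: linear_closed[OF \<delta>]\<close>)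

lemma conv3_cong:
  assumes "\<And>x y z. x \<in> carrier H \<Longrightarrow> y \<in> carrier H \<Longrightarrow> z \<in> carrier H \<Longrightarrow> F x y z = F' x y z"
    "\<And>x y z. x \<in> carrier A \<Longrightarrow> y \<in> carrier A \<Longrightarrow> z \<in> carrier A \<Longrightarrow> G x y z = G' x y z"
    and "a \<in> carrier A" "b \<in> carrier A" "c \<in> carrier A"
  shows "conv3 k N \<delta> p F G a b c = conv3 k N \<delta> p F' G' a b c"
  unfolding conv3_def
  by (rule tensor_ext[OF H A] conv2_cong)+ (use assms in \<open>auto intro: linear_closed[OF \<delta>]\<close>)

end

context bialgebra
begin

lemma self_coaction_algebra: "coaction_algebra k H H (comult H)"
proof -
  interpret coaction k H H "comult H" by (rule self_coaction)
  show ?thesis by unfold_locales (simp_all add: comult_mult comult_one)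
qed

end

section \<open>Two-cocycles\<close>

locale cocycle = bialgebra k H
  for k :: "('k, 'z) ring_scheme" and H :: "('k, 'h, 'y) coalgebra_scheme" +
  fixes \<sigma>
  assumes two_cocycle: "two_cocycle k H \<sigma>"
begin

abbreviation "\<tau> \<equiv> cocycle_inv k H \<sigma>"
abbreviation "\<Delta> \<equiv> comult H"
abbreviation "\<epsilon> \<equiv> counit H"
abbreviation "K \<equiv> self_module k"

interpretation self: coaction_algebra k H H \<Delta> by (rule self_coaction_algebra)
interpretation selfp: coaction_pair k H H \<Delta> H \<Delta>
  by (rule coaction_pair.intro[OF self_coaction self_coaction])

lemma K: "module k K" by (rule self.scalars)

lemma sigma: "bilinear_map k H H K \<sigma>"
  using two_cocycle by (auto simp: two_cocycle_def bilinear_form_def bilinear_map_def)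

lemma inverse: "convolution_inverse k H \<sigma> \<tau>"
  unfolding cocycle_inv_def using two_cocycle by (intro someI_ex[of "convolution_inverse k H \<sigma>"]) (simp add: two_cocycle_def)

lemma tau: "bilinear_map k H H K \<tau>"
  using inverse by (auto simp: convolution_inverse_def bilinear_form_def bilinear_map_def)

lemma convolution_conv2: "convolution k H s t x y = conv2 k K \<Delta> \<Delta> (mult k) s t x y"
  by (simp add: convolution_def conv2_def conv1_def)

lemma sigma_tau: "x \<in> carrier H \<Longrightarrow> y \<in> carrier H \<Longrightarrow> conv2 k K \<Delta> \<Delta> (mult k) \<sigma> \<tau> x y = \<epsilon> x \<otimes>\<^bsub>k\<^esub> \<epsilon> y"
  and tau_sigma: "x \<in> carrier H \<Longrightarrow> y \<in> carrier H \<Longrightarrow> conv2 k K \<Delta> \<Delta> (mult k) \<tau> \<sigma> x y = \<epsilon> x \<otimes>\<^bsub>k\<^esub> \<epsilon> y"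
  using inverse by (simp_all add: convolution_inverse_def convolution_conv2)

lemma pK: "pairing k K K K (mult k)"
  by (rule pairing_scalars[OF module_cring[OF K]])

lemmas K_mult = bilinear_in_left[OF pairingD(4)[OF pK]] bilinear_in_right[OF pairingD(4)[OF pK]] bilinear_closed[OF pairingD(4)[OF pK]]
lemmas tri_rules = trilinearI bilinearI self.H_mult linear_id linear_comp[OF counit_linear] linear_closed[OF counit_linear] K_mult

lemma trilinear_counit_right:
  assumes s: "bilinear_map k H H K s"
  shows "trilinear_map k H H H K (\<lambda>x y z. s x y \<otimes>\<^bsub>k\<^esub> \<epsilon> z)"
  by (assumption | rule tri_rules bilinear_left[OF s] bilinear_right[OF s] bilinear_closed[OF s])+

lemma trilinear_counit_left:
  assumes s: "bilinear_map k H H K s"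
  shows "trilinear_map k H H H K (\<lambda>x y z. \<epsilon> x \<otimes>\<^bsub>k\<^esub> s y z)"
  by (assumption | rule tri_rules bilinear_left[OF s] bilinear_right[OF s] bilinear_closed[OF s])+

lemma counit2: "bilinear_map k H H K (\<lambda>x y. \<epsilon> x \<otimes>\<^bsub>k\<^esub> \<epsilon> y)"
  by (assumption | rule tri_rules)+

end

context cocycle
begin

interpretation self: coaction_algebra k H H \<Delta> by (rule self_coaction_algebra)
interpretation selfp: coaction_pair k H H \<Delta> H \<Delta>
  by (rule coaction_pair.intro[OF self_coaction self_coaction])

subsection \<open>The cocycle identity\<close>

abbreviation "C3 \<equiv> conv3 k K \<Delta> (mult k)"
abbreviation "on12 s \<equiv> \<lambda>x y z. s x y \<otimes>\<^bsub>k\<^esub> \<epsilon> z"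
abbreviation "on23 s \<equiv> \<lambda>x y z. \<epsilon> x \<otimes>\<^bsub>k\<^esub> s y z"
abbreviation "mult12 s \<equiv> \<lambda>x y z. s (x \<otimes>\<^bsub>H\<^esub> y) z"
abbreviation "mult23 s \<equiv> \<lambda>x y z. s x (y \<otimes>\<^bsub>H\<^esub> z)"
abbreviation "eps3 \<equiv> \<lambda>x y z. (\<epsilon> x \<otimes>\<^bsub>k\<^esub> \<epsilon> y) \<otimes>\<^bsub>k\<^esub> \<epsilon> z"

lemmas tri = trilinear_counit_right[OF sigma] trilinear_counit_left[OF sigma] trilinear_counit_right[OF tau]
  trilinear_counit_left[OF tau] self.trilinear_mult_left[OF sigma] self.trilinear_mult_right[OF sigma]
  self.trilinear_mult_left[OF tau] self.trilinear_mult_right[OF tau]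
  self.conv3_trilinear[OF pK] trilinear_counit_right[OF counit2]

lemma scalars_assoc: "associative_pairings k K K K K K K (mult k) (mult k) (mult k) (mult k)"
  using associative_scalar_scalar[OF K] by (simp add: self_module_simps)

lemma C3_assoc:
  "\<lbrakk>x \<in> carrier H; y \<in> carrier H; z \<in> carrier H; trilinear_map k H H H K F; trilinear_map k H H H K G;
    trilinear_map k H H H K E\<rbrakk> \<Longrightarrow> C3 (C3 F G) E x y z = C3 F (C3 G E) x y z"
  by (rule self.conv3_assoc[OF self.coaction_coassoc _ _ _ scalars_assoc])

lemma counit_carrier: "x \<in> carrier H \<Longrightarrow> \<epsilon> x \<in> carrier k"
  by (rule self.counit_closed)

lemma conv2_smult_right_scalars:
  assumes s: "bilinear_map k H H K s" and t: "bilinear_map k H H K t" and xy: "x \<in> carrier H" "y \<in> carrier H"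
  shows "conv2 k K \<Delta> \<Delta> (smult_right K) s t x y = conv2 k K \<Delta> \<Delta> (mult k) s t x y"
  unfolding conv2_def conv1_def
  by (rule tensor_ext[OF self.H self.A] self.coaction_closed xy | assumption)+
    (use bilinear_closed[OF s] bilinear_closed[OF t] xy in
      \<open>simp_all add: smult_right_def self_module_simps R.m_comm self.coaction_closed\<close>)

lemma conv3_smult_right_scalars:
  assumes s: "trilinear_map k H H H K s" and t: "trilinear_map k H H H K t"
    and xyz: "x \<in> carrier H" "y \<in> carrier H" "z \<in> carrier H"
  shows "conv3 k K \<Delta> (smult_right K) s t x y z = C3 s t x y z"
  unfolding conv3_def
  by (rule tensor_ext[OF self.H self.A] self.coaction_closed xyz conv2_smult_right_scalars trilinear_1[OF s] trilinear_1[OF t] | assumption)+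

text \<open>The trilinear forms on \<open>H\<close> form a monoid under \<open>C3\<close>, with unit
  \<open>eps3\<close>.\<close>

lemma C3_left_one:
  assumes "trilinear_map k H H H K F" "x \<in> carrier H" "y \<in> carrier H" "z \<in> carrier H"
  shows "C3 eps3 F x y z = F x y z"
proof -
  have F: "bilinear_map k H H K (\<lambda>x y. F x y z)"
    using assms by (intro bilinearI) (auto intro: trilinear_2 bilinear_left[OF trilinear_1])
  show ?thesis
    using self.conv3_counit_right[OF K assms(2-4) counit2 assms(1)] selfp.conv2_counit[OF K assms(2,3) F]
    by (simp add: self_module_simps)
qed

lemma C3_right_one:
  assumes "trilinear_map k H H H K F" "x \<in> carrier H" "y \<in> carrier H" "z \<in> carrier H"
  shows "C3 F eps3 x y z = F x y z"
proof -
  have F: "bilinear_map k H H K (\<lambda>x y. F x y z)"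
    using assms by (intro bilinearI) (auto intro: trilinear_2 bilinear_left[OF trilinear_1])
  have "C3 F eps3 x y z = conv3 k K \<Delta> (smult_right K) F eps3 x y z"
    by (rule conv3_smult_right_scalars[symmetric]) (rule assms tri)+
  then show ?thesis
    using conv3_counit_right_right[OF K assms(2-4) counit2 assms(1)] conv2_counit_right[OF K assms(2,3) F]
    by simp
qed

lemma conv2_scale_right_scalars:
  assumes s: "bilinear_map k H H K s" and t: "bilinear_map k H H K t" and xy: "x \<in> carrier H" "y \<in> carrier H"
    and c: "c \<in> carrier k"
  shows "conv2 k K \<Delta> \<Delta> (mult k) s (\<lambda>x y. c \<otimes>\<^bsub>k\<^esub> t x y) x y = c \<otimes>\<^bsub>k\<^esub> conv2 k K \<Delta> \<Delta> (mult k) s t x y"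
proof -
  have "bilinear_map k H H K (\<lambda>x y. c \<otimes>\<^bsub>k\<^esub> t x y)"
    using bilinear_scale[OF K t c] by (simp add: self_module_simps)
  then show ?thesis
    using conv2_scale_right[OF K xy c t s] s t xy
    by (simp add: conv2_smult_right_scalars self_module_simps)
qed

lemma C3_on12:
  assumes st: "bilinear_map k H H K s" "bilinear_map k H H K t"
    and xyz: "x \<in> carrier H" "y \<in> carrier H" "z \<in> carrier H"
  shows "C3 (on12 s) (on12 t) x y z = conv2 k K \<Delta> \<Delta> (mult k) s t x y \<otimes>\<^bsub>k\<^esub> \<epsilon> z"
proof -
  have "C3 (on12 s) (on12 t) x y z = conv2 k K \<Delta> \<Delta> (mult k) s (\<lambda>x y. t x y \<otimes>\<^bsub>k\<^esub> \<epsilon> z) x y"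
    using self.conv3_counit_right[OF K xyz st(1) trilinear_counit_right[OF st(2)]] by (simp add: self_module_simps)
  also have "\<dots> = conv2 k K \<Delta> \<Delta> (mult k) s (\<lambda>x y. \<epsilon> z \<otimes>\<^bsub>k\<^esub> t x y) x y"
    by (rule self.conv2_cong) (use xyz bilinear_closed[OF st(2)] counit_carrier in \<open>auto simp: self_module_simps R.m_comm\<close>)
  also have "\<dots> = conv2 k K \<Delta> \<Delta> (mult k) s t x y \<otimes>\<^bsub>k\<^esub> \<epsilon> z"
    using conv2_scale_right_scalars[OF st xyz(1,2) counit_carrier[OF xyz(3)]]
      bilinear_closed[OF selfp.conv2_bilinear[OF pK st] xyz(1,2)] counit_carrier[OF xyz(3)]
    by (simp add: self_module_simps R.m_comm)
  finally show ?thesis .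
qed

lemma C3_on23:
  assumes st: "bilinear_map k H H K s" "bilinear_map k H H K t"
    and xyz: "x \<in> carrier H" "y \<in> carrier H" "z \<in> carrier H"
  shows "C3 (on23 s) (on23 t) x y z = \<epsilon> x \<otimes>\<^bsub>k\<^esub> conv2 k K \<Delta> \<Delta> (mult k) s t y z"
  using self.conv3_counit_left[OF K xyz st(1) trilinear_counit_left[OF st(2)]]
    conv2_scale_right_scalars[OF st xyz(2,3) counit_carrier[OF xyz(1)]]
  by (simp add: self_module_simps)

text \<open>The defining identity of a two-cocycle reads \<open>(\<sigma> \<otimes> \<epsilon>) *
  \<sigma>(\<mu> \<otimes> 1) = (\<epsilon> \<otimes> \<sigma>) * \<sigma>(1 \<otimes> \<mu>)\<close> in
  the convolution monoid of trilinear forms, where \<open>\<mu>\<close> is the multiplication of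
  \<open>H\<close>.\<close>

lemma sigma_cocycle:
  assumes xyz: "x \<in> carrier H" "y \<in> carrier H" "z \<in> carrier H"
  shows "C3 (on12 \<sigma>) (mult12 \<sigma>) x y z = C3 (on23 \<sigma>) (mult23 \<sigma>) x y z"
proof -
  have "C3 (on12 \<sigma>) (mult12 \<sigma>) x y z = conv2 k K \<Delta> \<Delta> (mult k) \<sigma> (\<lambda>x y. \<sigma> (x \<otimes>\<^bsub>H\<^esub> y) z) x y"
    using self.conv3_counit_right[OF K xyz sigma self.trilinear_mult_left[OF sigma]] by (simp add: self_module_simps)
  also have "\<dots> = conv2 k K \<Delta> \<Delta> (mult k) \<sigma> (\<lambda>y z. \<sigma> x (y \<otimes>\<^bsub>H\<^esub> z)) y z"
    using two_cocycle xyz by (simp add: two_cocycle_def conv2_def conv1_def)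
  also have "\<dots> = C3 (on23 \<sigma>) (mult23 \<sigma>) x y z"
    using self.conv3_counit_left[OF K xyz sigma self.trilinear_mult_right[OF sigma]] by (simp add: self_module_simps)
  finally show ?thesis .
qed

text \<open>Inverting each of the factors shows that \<open>\<tau>(\<mu> \<otimes> 1) * (\<tau>
  \<otimes> \<epsilon>)\<close> and \<open>\<tau>(1 \<otimes> \<mu>) * (\<epsilon> \<otimes>
  \<tau>)\<close> are inverses of the two sides of the cocycle identity for \<open>\<sigma>\<close>.
  Inverses in a monoid are unique.\<close>

lemma tau_cocycle:
  assumes xyz: "x \<in> carrier H" "y \<in> carrier H" "z \<in> carrier H"
  shows "C3 (mult12 \<tau>) (on12 \<tau>) x y z = C3 (mult23 \<tau>) (on23 \<tau>) x y z"
proof -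
  let ?L = "C3 (on12 \<sigma>) (mult12 \<sigma>)" and ?R = "C3 (on23 \<sigma>) (mult23 \<sigma>)"
  let ?L' = "C3 (mult12 \<tau>) (on12 \<tau>)" and ?R' = "C3 (mult23 \<tau>) (on23 \<tau>)"
  have e1: "C3 (mult12 \<sigma>) (mult12 \<tau>) x y z = eps3 x y z"
    if "x \<in> carrier H" "y \<in> carrier H" "z \<in> carrier H" for x y z
    using that self.conv2_mult_left[OF pK sigma tau that] by (simp add: sigma_tau counit_mult)
  have e2: "C3 (mult23 \<tau>) (mult23 \<sigma>) x y z = eps3 x y z"
    if "x \<in> carrier H" "y \<in> carrier H" "z \<in> carrier H" for x y z
    using that self.conv2_mult_right[OF pK tau sigma that] by (simp add: tau_sigma counit_mult R.m_assoc counit_carrier)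
  have e3: "C3 (on12 \<sigma>) (on12 \<tau>) x y z = eps3 x y z" "C3 (on23 \<tau>) (on23 \<sigma>) x y z = eps3 x y z"
    if "x \<in> carrier H" "y \<in> carrier H" "z \<in> carrier H" for x y z
    using that by (simp_all add: C3_on12 C3_on23 sigma tau sigma_tau tau_sigma R.m_assoc counit_carrier)
  have LL': "C3 ?L ?L' x y z = eps3 x y z" if h: "x \<in> carrier H" "y \<in> carrier H" "z \<in> carrier H" for x y z
  proof -
    have "C3 ?L ?L' x y z = C3 (on12 \<sigma>) (C3 (mult12 \<sigma>) ?L') x y z"
      by (rule C3_assoc) (rule tri h)+
    also have "\<dots> = C3 (on12 \<sigma>) (on12 \<tau>) x y z"
    proof (rule self.conv3_cong[OF _ _ h])
      fix x y z assume h: "x \<in> carrier H" "y \<in> carrier H" "z \<in> carrier H"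
      have "C3 (mult12 \<sigma>) ?L' x y z = C3 (C3 (mult12 \<sigma>) (mult12 \<tau>)) (on12 \<tau>) x y z"
        by (rule C3_assoc[symmetric]) (rule tri h)+
      also have "\<dots> = C3 eps3 (on12 \<tau>) x y z"
        by (rule self.conv3_cong[OF _ _ h]) (simp_all add: e1)
      also have "\<dots> = on12 \<tau> x y z" by (rule C3_left_one) (rule tri h)+
      finally show "C3 (mult12 \<sigma>) ?L' x y z = on12 \<tau> x y z" .
    qed simp
    finally show ?thesis by (simp add: e3 h)
  qed
  have R'R: "C3 ?R' ?R x y z = eps3 x y z" if h: "x \<in> carrier H" "y \<in> carrier H" "z \<in> carrier H" for x y z
  proof -
    have "C3 ?R' ?R x y z = C3 (mult23 \<tau>) (C3 (on23 \<tau>) ?R) x y z"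
      by (rule C3_assoc) (rule tri h)+
    also have "\<dots> = C3 (mult23 \<tau>) (mult23 \<sigma>) x y z"
    proof (rule self.conv3_cong[OF _ _ h])
      fix x y z assume h: "x \<in> carrier H" "y \<in> carrier H" "z \<in> carrier H"
      have "C3 (on23 \<tau>) ?R x y z = C3 (C3 (on23 \<tau>) (on23 \<sigma>)) (mult23 \<sigma>) x y z"
        by (rule C3_assoc[symmetric]) (rule tri h)+
      also have "\<dots> = C3 eps3 (mult23 \<sigma>) x y z"
        by (rule self.conv3_cong[OF _ _ h]) (simp_all add: e3)
      also have "\<dots> = mult23 \<sigma> x y z" by (rule C3_left_one) (rule tri h)+
      finally show "C3 (on23 \<tau>) ?R x y z = mult23 \<sigma> x y z" .
    qed simp
    finally show ?thesis by (simp add: e2 h)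
  qed
  \<comment> \<open>The two sides \<open>?L\<close> and \<open>?R\<close> agree, \<open>?L'\<close> is a
    right inverse and \<open>?R'\<close> a left inverse of it.\<close>
  have "?L' x y z = C3 eps3 ?L' x y z" by (rule C3_left_one[symmetric]) (rule tri xyz)+
  also have "\<dots> = C3 (C3 ?R' ?R) ?L' x y z" by (rule self.conv3_cong[OF _ _ xyz]) (simp_all add: R'R)
  also have "\<dots> = C3 ?R' (C3 ?R ?L') x y z" by (rule C3_assoc) (rule tri xyz)+
  also have "\<dots> = C3 ?R' eps3 x y z"
  proof (rule self.conv3_cong[OF _ _ xyz])
    fix x y z assume h: "x \<in> carrier H" "y \<in> carrier H" "z \<in> carrier H"
    have "C3 ?R ?L' x y z = C3 ?L ?L' x y z"
      by (rule self.conv3_cong[OF _ _ h]) (simp_all add: sigma_cocycle)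
    then show "C3 ?R ?L' x y z = eps3 x y z" by (simp add: LL' h)
  qed simp
  also have "\<dots> = ?R' x y z" by (rule C3_right_one) (rule tri xyz)+
  finally show ?thesis .
qed

end

context comodule_map
begin

lemma conv1_cong:
  assumes "\<And>x. x \<in> carrier H \<Longrightarrow> F x = F' x" "\<And>x. x \<in> carrier A \<Longrightarrow> G x = G' x" and "a \<in> carrier A"
  shows "conv1 k N \<delta> p F G a = conv1 k N \<delta> p F' G' a"
  unfolding conv1_def
  by (rule tensor_ext[OF H A]) (use assms in \<open>auto intro: linear_closed[OF \<delta>]\<close>)

end

context coaction_pair
begin

context
  fixes N :: "('k, 'n, 'v) module_scheme" and N' :: "('k, 'n1, 'v1) module_scheme" and L
  assumes N: "module k N" and N': "module k N'" and L: "linear_map k N N' L"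
begin

lemma conv2_comp:
  assumes ab: "a \<in> carrier A" "b \<in> carrier B"
    and p: "pairing k N1 N2 N p"
    and F: "bilinear_map k H H N1 F" and G: "bilinear_map k A B N2 G"
  shows "L (conv2 k N \<delta> \<delta>' p F G a b) = conv2 k N' \<delta> \<delta>' (\<lambda>x y. L (p x y)) F G a b"
proof -
  note R = A.H_rules B.H_rules bilinear_closed[OF F] bilinear_closed[OF G] ab pairingD(1-3)[OF p] B.conv1_left[OF p] B.conv1_right[OF p]
    bilinear_left[OF F] bilinear_right[OF F] bilinear_left[OF G] bilinear_right[OF G]
    bilinear_in_left[OF pairingD(4)[OF p]] bilinear_in_right[OF pairingD(4)[OF p]]
  have "L (conv2 k N \<delta> \<delta>' p F G a b) = tensor_lift k N' (\<lambda>h a0. L (conv1 k N \<delta>' p (F h) (G a0) b)) (\<delta> a)"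
    unfolding conv2_def
    by (rule tensor_lift_comp[OF A.H A.A N N' L]) (assumption | rule R)+
  also have "\<dots> = conv2 k N' \<delta> \<delta>' (\<lambda>x y. L (p x y)) F G a b"
    unfolding conv2_def conv1_def
    by (rule tensor_ext[OF A.H A.A] tensor_lift_comp[OF A.H B.A N N' L] | assumption | rule R)+
  finally show ?thesis .
qed

lemma conv2_smult_comp:
  assumes ab: "a \<in> carrier A" "b \<in> carrier B"
    and F: "bilinear_map k H H (self_module k) F" and G: "bilinear_map k A B N G"
  shows "L (conv2 k N \<delta> \<delta>' (smult N) F G a b) = conv2 k N' \<delta> \<delta>' (smult N') F (\<lambda>x y. L (G x y)) a b"
proof -
  have "conv2 k N' \<delta> \<delta>' (\<lambda>x y. L (x \<odot>\<^bsub>N\<^esub> y)) F G a b = conv2 k N' \<delta> \<delta>' (smult N') F (\<lambda>x y. L (G x y)) a b"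
    unfolding conv2_def conv1_def
    by (rule tensor_ext[OF A.H A.A] tensor_ext[OF A.H B.A])+
      (use ab bilinear_closed[OF F] bilinear_closed[OF G] in
        \<open>simp_all add: linear_smult[OF L] self_module_simps A.coaction_closed B.coaction_closed\<close>)
  then show ?thesis using conv2_comp[OF ab pairing_smult[OF N] F G] by simp
qed

end

end

context bialgebra
begin

interpretation self: coaction_algebra k H H "comult H" by (rule self_coaction_algebra)
interpretation selfp: coaction_pair k H H "comult H" H "comult H"
  by (rule coaction_pair.intro[OF self_coaction self_coaction])

lemma conv2_smult_right_comp:
  fixes N :: "('k, 'n, 'v) module_scheme" and N' :: "('k, 'n1, 'v1) module_scheme"
  assumes N: "module k N" and N': "module k N'" and L: "linear_map k N N' L"
    and xy: "x \<in> carrier H" "y \<in> carrier H"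
    and F: "bilinear_map k H H (self_module k) F" and G: "bilinear_map k H H N G"
  shows "L (conv2 k N (comult H) (comult H) (smult_right N) G F x y)
    = conv2 k N' (comult H) (comult H) (smult_right N') (\<lambda>x y. L (G x y)) F x y"
proof -
  have "conv2 k N' (comult H) (comult H) (\<lambda>x y. L (smult_right N x y)) G F x y
      = conv2 k N' (comult H) (comult H) (smult_right N') (\<lambda>x y. L (G x y)) F x y"
    unfolding conv2_def conv1_def
    by (rule tensor_ext[OF self.H self.A])+
      (use xy bilinear_closed[OF F] bilinear_closed[OF G] in
        \<open>simp_all add: smult_right_def linear_smult[OF L] self_module_simps self.coaction_closed\<close>)
  then show ?thesis using selfp.conv2_comp[OF N N' L xy pairing_smult_right[OF N] G F] by simp
qed

end

context coaction_algebra
begin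

context
  fixes N1 :: "('k, 'n1, 'w1) module_scheme" and N2 :: "('k, 'n2, 'w2) module_scheme"
    and N :: "('k, 'n, 'w) module_scheme" and p
  assumes p: "pairing k N1 N2 N p"
begin

lemma conv1_one:
  assumes F: "linear_map k H N1 F" and G: "linear_map k A N2 G"
  shows "conv1 k N \<delta> p F G \<one>\<^bsub>A\<^esub> = p (F \<one>\<^bsub>H\<^esub>) (G \<one>\<^bsub>A\<^esub>)"
proof -
  have "bilinear_map k H A N (\<lambda>h a0. p (F h) (G a0))"
    by (assumption | rule p_rules[OF p] linear_comp[OF F] linear_comp[OF G] linear_closed[OF F] linear_closed[OF G])+
  then show ?thesis
    unfolding conv1_def coaction_one
    by (rule tensor_lift_pure[OF H A pairingD(3)[OF p] _ H.one_closed AA.one_closed])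
qed

lemma conv2_one_right:
  assumes F: "bilinear_map k H H N1 F" and G: "bilinear_map k A A N2 G" and a: "a \<in> carrier A"
  shows "conv2 k N \<delta> \<delta> p F G a \<one>\<^bsub>A\<^esub> = conv1 k N \<delta> p (\<lambda>x. F x \<one>\<^bsub>H\<^esub>) (\<lambda>a. G a \<one>\<^bsub>A\<^esub>) a"
  unfolding conv2_def conv1_def[of _ _ _ _ "\<lambda>x. F x \<one>\<^bsub>H\<^esub>"]
  by (rule tensor_ext[OF H A _ coaction_closed[OF a]]) (rule conv1_one[OF bilinear_right[OF F] bilinear_right[OF G]])

lemma conv2_one_left:
  assumes F: "bilinear_map k H H N1 F" and G: "bilinear_map k A A N2 G" and a: "a \<in> carrier A"
  shows "conv2 k N \<delta> \<delta> p F G \<one>\<^bsub>A\<^esub> a = conv1 k N \<delta> p (F \<one>\<^bsub>H\<^esub>) (G \<one>\<^bsub>A\<^esub>) a"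
proof -
  have "bilinear_map k H A N (\<lambda>h a0. conv1 k N \<delta> p (F h) (G a0) a)"
    by (assumption | rule bilinearI conv1_left[OF p a] conv1_right[OF p a] H A bilinear_left[OF F] bilinear_right[OF F]
      bilinear_left[OF G] bilinear_right[OF G])+
  then show ?thesis
    unfolding conv2_def coaction_one
    by (rule tensor_lift_pure[OF H A pairingD(3)[OF p] _ H.one_closed AA.one_closed])
qed

end

end

context cocycle
begin

interpretation self: coaction_algebra k H H \<Delta> by (rule self_coaction_algebra)
interpretation selfp: coaction_pair k H H \<Delta> H \<Delta>
  by (rule coaction_pair.intro[OF self_coaction self_coaction])

subsection \<open>Normalisation\<close>

lemma closed11: "\<sigma> \<one>\<^bsub>H\<^esub> \<one>\<^bsub>H\<^esub> \<in> carrier k" "\<tau> \<one>\<^bsub>H\<^esub> \<one>\<^bsub>H\<^esub> \<in> carrier k"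
  using bilinear_closed[OF sigma one_closed one_closed] bilinear_closed[OF tau one_closed one_closed]
  by (simp_all add: self_module_simps)

lemma sigma_tau_one: "\<sigma> \<one>\<^bsub>H\<^esub> \<one>\<^bsub>H\<^esub> \<otimes>\<^bsub>k\<^esub> \<tau> \<one>\<^bsub>H\<^esub> \<one>\<^bsub>H\<^esub> = \<one>\<^bsub>k\<^esub>"
  using sigma_tau[OF one_closed one_closed]
  by (simp add: self.conv2_one_left[OF pK sigma tau] self.conv1_one[OF pK bilinear_right[OF sigma] bilinear_right[OF tau]]
      counit_one)

lemma tau_one_one: "\<tau> \<one>\<^bsub>H\<^esub> \<one>\<^bsub>H\<^esub> = inv\<^bsub>k\<^esub> (\<sigma> \<one>\<^bsub>H\<^esub> \<one>\<^bsub>H\<^esub>)"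
  using sigma_tau_one closed11 R.m_comm by (metis R.comm_inv_char)

lemma conv1_scale_scalars:
  assumes "x \<in> carrier H" "c \<in> carrier k" "linear_map k H K u" "linear_map k H K v"
  shows "conv1 k K \<Delta> (mult k) u (\<lambda>h. c \<otimes>\<^bsub>k\<^esub> v h) x = c \<otimes>\<^bsub>k\<^esub> conv1 k K \<Delta> (mult k) u v x"
proof -
  have flip: "conv1 k K \<Delta> (mult k) u w x = conv1 k K \<Delta> (smult_right K) u w x" if "linear_map k H K w" for w
    unfolding conv1_def
    by (rule tensor_ext[OF self.H self.A _ self.coaction_closed[OF assms(1)]])
      (use linear_closed[OF assms(3)] linear_closed[OF that] in \<open>simp add: smult_right_def self_module_simps R.m_comm\<close>)
  have "linear_map k H K (\<lambda>h. c \<otimes>\<^bsub>k\<^esub> v h)"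
    using linear_scale[OF K assms(4,2)] by (simp add: self_module_simps)
  then show ?thesis
    using conv1_scale_right[OF K assms(1,2,4,3)] assms(4) by (simp add: flip self_module_simps)
qed

text \<open>In the convolution algebra of linear forms on \<open>H\<close>, the hypotheses say that
  \<open>u\<close> has the left inverse \<open>v\<close> and that \<open>u * u = c u\<close>. Cancelling
  \<open>u\<close> gives \<open>u = c \<epsilon>\<close>.\<close>

lemma idempotent_form:
  assumes u: "linear_map k H K u" and v: "linear_map k H K v" and c: "c \<in> carrier k"
    and inv: "\<And>x. x \<in> carrier H \<Longrightarrow> conv1 k K \<Delta> (mult k) v u x = \<epsilon> x"
    and idem: "\<And>x. x \<in> carrier H \<Longrightarrow> conv1 k K \<Delta> (mult k) u u x = c \<otimes>\<^bsub>k\<^esub> u x"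
    and x: "x \<in> carrier H"
  shows "u x = c \<otimes>\<^bsub>k\<^esub> \<epsilon> x"
proof -
  have "u x = conv1 k K \<Delta> (mult k) \<epsilon> u x"
    using self.conv1_counit[OF K x u] by (simp add: self_module_simps)
  also have "\<dots> = conv1 k K \<Delta> (mult k) (conv1 k K \<Delta> (mult k) v u) u x"
    by (rule self.conv1_cong[OF _ _ x]) (simp_all add: inv)
  also have "\<dots> = conv1 k K \<Delta> (mult k) v (conv1 k K \<Delta> (mult k) u u) x"
    by (rule self.conv1_assoc[OF self.coaction_coassoc[OF x] x scalars_assoc v u u])
  also have "\<dots> = conv1 k K \<Delta> (mult k) v (\<lambda>x. c \<otimes>\<^bsub>k\<^esub> u x) x"
    by (rule self.conv1_cong[OF _ _ x]) (simp_all add: idem)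
  also have "\<dots> = c \<otimes>\<^bsub>k\<^esub> \<epsilon> x"
    by (simp add: conv1_scale_scalars[OF x c v u] inv x)
  finally show ?thesis .
qed

text \<open>The cocycle identity at \<open>(x, 1, 1)\<close> says that \<open>u = \<sigma>(-, 1)\<close>
  satisfies \<open>u * u = \<sigma>(1, 1) u\<close>.\<close>

lemma sigma_one_right:
  assumes "x \<in> carrier H" shows "\<sigma> x \<one>\<^bsub>H\<^esub> = \<sigma> \<one>\<^bsub>H\<^esub> \<one>\<^bsub>H\<^esub> \<otimes>\<^bsub>k\<^esub> \<epsilon> x"
proof (rule idempotent_form[OF bilinear_left[OF sigma one_closed] bilinear_left[OF tau one_closed] closed11(1) _ _ assms])
  fix x assume x: "x \<in> carrier H"
  show "conv1 k K \<Delta> (mult k) (\<lambda>x. \<tau> x \<one>\<^bsub>H\<^esub>) (\<lambda>x. \<sigma> x \<one>\<^bsub>H\<^esub>) x = \<epsilon> x"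
    using tau_sigma[OF x one_closed] self.conv2_one_right[OF pK tau sigma x] by (simp add: counit_one counit_carrier x)
  have b: "bilinear_map k H H K (\<lambda>a b. \<sigma> (a \<otimes>\<^bsub>H\<^esub> b) \<one>\<^bsub>H\<^esub>)" "bilinear_map k H H K (\<lambda>a b. \<sigma> x (a \<otimes>\<^bsub>H\<^esub> b))"
    by (assumption | rule bilinearI linear_id self.H_mult one_closed x bilinear_in_left[OF sigma] bilinear_in_right[OF sigma])+
  have "conv1 k K \<Delta> (mult k) (\<lambda>x. \<sigma> x \<one>\<^bsub>H\<^esub>) (\<lambda>x. \<sigma> x \<one>\<^bsub>H\<^esub>) x
    = conv2 k K \<Delta> \<Delta> (mult k) \<sigma> (\<lambda>a b. \<sigma> (a \<otimes>\<^bsub>H\<^esub> b) \<one>\<^bsub>H\<^esub>) x \<one>\<^bsub>H\<^esub>"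
    unfolding self.conv2_one_right[OF pK sigma b(1) x] by (rule self.conv1_cong[OF _ _ x]) simp_all
  also have "\<dots> = conv2 k K \<Delta> \<Delta> (mult k) \<sigma> (\<lambda>a b. \<sigma> x (a \<otimes>\<^bsub>H\<^esub> b)) \<one>\<^bsub>H\<^esub> \<one>\<^bsub>H\<^esub>"
    using two_cocycle x by (simp add: two_cocycle_def conv2_def conv1_def)
  also have "\<dots> = \<sigma> \<one>\<^bsub>H\<^esub> \<one>\<^bsub>H\<^esub> \<otimes>\<^bsub>k\<^esub> \<sigma> x \<one>\<^bsub>H\<^esub>"
    by (simp add: self.conv2_one_left[OF pK sigma b(2)] self.conv1_one[OF pK bilinear_right[OF sigma] bilinear_right[OF b(2)]])
  finally show "conv1 k K \<Delta> (mult k) (\<lambda>x. \<sigma> x \<one>\<^bsub>H\<^esub>) (\<lambda>x. \<sigma> x \<one>\<^bsub>H\<^esub>) x = \<sigma> \<one>\<^bsub>H\<^esub> \<one>\<^bsub>H\<^esub> \<otimes>\<^bsub>k\<^esub> \<sigma> x \<one>\<^bsub>H\<^esub>" .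
qed

text \<open>Symmetrically, from the cocycle identity at \<open>(1, 1, x)\<close>.\<close>

lemma sigma_one_left:
  assumes "x \<in> carrier H" shows "\<sigma> \<one>\<^bsub>H\<^esub> x = \<sigma> \<one>\<^bsub>H\<^esub> \<one>\<^bsub>H\<^esub> \<otimes>\<^bsub>k\<^esub> \<epsilon> x"
proof (rule idempotent_form[OF bilinear_right[OF sigma one_closed] bilinear_right[OF tau one_closed] closed11(1) _ _ assms])
  fix x assume x: "x \<in> carrier H"
  show "conv1 k K \<Delta> (mult k) (\<lambda>x. \<tau> \<one>\<^bsub>H\<^esub> x) (\<lambda>x. \<sigma> \<one>\<^bsub>H\<^esub> x) x = \<epsilon> x"
    using tau_sigma[OF one_closed x] self.conv2_one_left[OF pK tau sigma x] by (simp add: counit_one counit_carrier x)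
  have b: "bilinear_map k H H K (\<lambda>a b. \<sigma> (a \<otimes>\<^bsub>H\<^esub> b) x)" "bilinear_map k H H K (\<lambda>a b. \<sigma> \<one>\<^bsub>H\<^esub> (a \<otimes>\<^bsub>H\<^esub> b))"
    by (assumption | rule bilinearI linear_id self.H_mult one_closed x bilinear_in_left[OF sigma] bilinear_in_right[OF sigma])+
  have "conv1 k K \<Delta> (mult k) (\<sigma> \<one>\<^bsub>H\<^esub>) (\<sigma> \<one>\<^bsub>H\<^esub>) x
    = conv2 k K \<Delta> \<Delta> (mult k) \<sigma> (\<lambda>a b. \<sigma> \<one>\<^bsub>H\<^esub> (a \<otimes>\<^bsub>H\<^esub> b)) \<one>\<^bsub>H\<^esub> x"
    unfolding self.conv2_one_left[OF pK sigma b(2) x] by (rule self.conv1_cong[OF _ _ x]) simp_all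
  also have "\<dots> = conv2 k K \<Delta> \<Delta> (mult k) \<sigma> (\<lambda>a b. \<sigma> (a \<otimes>\<^bsub>H\<^esub> b) x) \<one>\<^bsub>H\<^esub> \<one>\<^bsub>H\<^esub>"
    using two_cocycle x by (simp add: two_cocycle_def conv2_def conv1_def)
  also have "\<dots> = \<sigma> \<one>\<^bsub>H\<^esub> \<one>\<^bsub>H\<^esub> \<otimes>\<^bsub>k\<^esub> \<sigma> \<one>\<^bsub>H\<^esub> x"
    by (simp add: self.conv2_one_left[OF pK sigma b(1)] self.conv1_one[OF pK bilinear_right[OF sigma] bilinear_right[OF b(1)]])
  finally show "conv1 k K \<Delta> (mult k) (\<lambda>x. \<sigma> \<one>\<^bsub>H\<^esub> x) (\<lambda>x. \<sigma> \<one>\<^bsub>H\<^esub> x) x = \<sigma> \<one>\<^bsub>H\<^esub> \<one>\<^bsub>H\<^esub> \<otimes>\<^bsub>k\<^esub> \<sigma> \<one>\<^bsub>H\<^esub> x" .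
qed

lemma inverse_of_scaled_counit:
  assumes v: "linear_map k H K v" and x: "x \<in> carrier H"
    and u: "\<And>x. x \<in> carrier H \<Longrightarrow> u x = \<sigma> \<one>\<^bsub>H\<^esub> \<one>\<^bsub>H\<^esub> \<otimes>\<^bsub>k\<^esub> \<epsilon> x"
    and inv: "conv1 k K \<Delta> (mult k) u v x = \<epsilon> x"
  shows "v x = \<tau> \<one>\<^bsub>H\<^esub> \<one>\<^bsub>H\<^esub> \<otimes>\<^bsub>k\<^esub> \<epsilon> x"
proof -
  have vx: "v x \<in> carrier k" using linear_closed[OF v x] by (simp add: self_module_simps)
  have "\<epsilon> x = conv1 k K \<Delta> (mult k) (\<lambda>x. \<sigma> \<one>\<^bsub>H\<^esub> \<one>\<^bsub>H\<^esub> \<otimes>\<^bsub>k\<^esub> \<epsilon> x) v x"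
    unfolding inv[symmetric] by (rule self.conv1_cong[OF _ _ x]) (simp_all add: u)
  also have "\<dots> = \<sigma> \<one>\<^bsub>H\<^esub> \<one>\<^bsub>H\<^esub> \<otimes>\<^bsub>k\<^esub> v x"
    using self.conv1_scale_left[OF K x closed11(1) counit_linear v] self.conv1_counit[OF K x v]
    by (simp add: self_module_simps)
  finally have "\<tau> \<one>\<^bsub>H\<^esub> \<one>\<^bsub>H\<^esub> \<otimes>\<^bsub>k\<^esub> \<epsilon> x = (\<tau> \<one>\<^bsub>H\<^esub> \<one>\<^bsub>H\<^esub> \<otimes>\<^bsub>k\<^esub> \<sigma> \<one>\<^bsub>H\<^esub> \<one>\<^bsub>H\<^esub>) \<otimes>\<^bsub>k\<^esub> v x"
    using closed11 vx by (simp add: R.m_assoc)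
  then show ?thesis
    using closed11 vx sigma_tau_one by (simp add: R.m_comm)
qed

lemma tau_one_right: "x \<in> carrier H \<Longrightarrow> \<tau> x \<one>\<^bsub>H\<^esub> = \<tau> \<one>\<^bsub>H\<^esub> \<one>\<^bsub>H\<^esub> \<otimes>\<^bsub>k\<^esub> \<epsilon> x"
  using sigma_tau[of x "\<one>\<^bsub>H\<^esub>"] self.conv2_one_right[OF pK sigma tau]
  by (intro inverse_of_scaled_counit[OF bilinear_left[OF tau one_closed] _ sigma_one_right])
    (simp_all add: counit_one counit_carrier)

lemma tau_one_left: "x \<in> carrier H \<Longrightarrow> \<tau> \<one>\<^bsub>H\<^esub> x = \<tau> \<one>\<^bsub>H\<^esub> \<one>\<^bsub>H\<^esub> \<otimes>\<^bsub>k\<^esub> \<epsilon> x"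
  using sigma_tau[of "\<one>\<^bsub>H\<^esub>" x] self.conv2_one_left[OF pK sigma tau]
  by (intro inverse_of_scaled_counit[OF bilinear_right[OF tau one_closed] _ sigma_one_left])
    (simp_all add: counit_one counit_carrier)

end

section \<open>Records with the same underlying module\<close>

text \<open>Twisting, forming quotient comodule algebras and adding a coaction all change the record but
  not the underlying module. Since tensor products, lifts and linearity depend on the module alone, they
  may be identified along this relation.\<close>

definition same_module ::
  "('k, 'a, 'y) module_scheme \<Rightarrow> ('k, 'a, 'x) module_scheme \<Rightarrow> bool"
  where "same_module B A \<longleftrightarrow> carrier B = carrier A \<and> zero B = zero A \<and> add B = add A \<and> smult B = smult A"

context
  fixes B :: "('k, 'a, 'y) module_scheme" and A :: "('k, 'a, 'x) module_scheme"
  assumes eq: "same_module B A"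
begin

lemma same_module_carrier: "carrier B = carrier A"
  using eq by (simp add: same_module_def)

lemma same_module_module: "module k A \<Longrightarrow> module k B"
  using eq by (intro module_cong[of k A B]) (simp_all add: same_module_def)

lemma same_module_linear_dom: "linear_map k B N f \<longleftrightarrow> linear_map k A N f"
  using eq by (simp add: linear_map_def same_module_def)

lemma same_module_linear_cod: "linear_map k N B f \<longleftrightarrow> linear_map k N A f"
  using eq by (simp add: linear_map_def same_module_def)

lemma same_module_tensor_left: "tensor k B Q = tensor k A Q"
  and same_module_tensor_right: "tensor k Q B = tensor k Q A"
  and same_module_pure_left: "pure_tensor k B Q = pure_tensor k A Q"
  and same_module_pure_right: "pure_tensor k Q B = pure_tensor k Q A"
  using eq
  by (simp_all add: tensor_def pure_tensor_def tensor_null_def tensor_relations_def same_module_def fun_eq_iff)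

lemma same_module_tensor_lift: "tensor_lift k B = tensor_lift k A"
  using eq
  by (simp add: tensor_lift_def coset_lift_def free_lift_def same_module_def fun_eq_iff finsum_struct_cong[of B A])

end

section \<open>The twisted bialgebra\<close>

context cocycle
begin

interpretation self: coaction_algebra k H H \<Delta> by (rule self_coaction_algebra)
interpretation selfp: coaction_pair k H H \<Delta> H \<Delta>
  by (rule coaction_pair.intro[OF self_coaction self_coaction])

abbreviation "H' \<equiv> cocycle_twist k \<sigma> H"
abbreviation star (infixl "\<star>" 70) where "x \<star> y \<equiv> mult H' x y"

lemma same_twist: "same_module H' H"
  by (simp add: same_module_def cocycle_twist_def)

lemma twist_simps [simp]:
  "carrier H' = carrier H" "add H' = add H" "zero H' = zero H" "smult H' = smult H" "one H' = one H"
  "comult H' = comult H" "counit H' = counit H"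
  by (simp_all add: cocycle_twist_def)

lemmas twist_module_simps = same_module_linear_dom[OF same_twist] same_module_linear_cod[OF same_twist]
  same_module_tensor_left[OF same_twist] same_module_tensor_right[OF same_twist]
  same_module_pure_left[OF same_twist] same_module_pure_right[OF same_twist] same_module_tensor_lift[OF same_twist]

text \<open>The partially twisted product \<open>\<Sum> \<tau>(x\<^sub>2, y\<^sub>2) x\<^sub>1
  y\<^sub>1\<close>.\<close>

abbreviation "half \<equiv> conv2 k H \<Delta> \<Delta> (smult_right H) (mult H) \<tau>"

lemma half_bilinear: "bilinear_map k H H H half"
  by (rule selfp.conv2_bilinear[OF pairing_smult_right[OF self.H] mult_bilinear tau])

text \<open>The product of the twist is \<open>\<sigma> * \<mu> * \<tau>\<close>. The definition sums
  over all legs of \<open>x\<close> before those of \<open>y\<close>, whereas a convolution alternates;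
  the sums are interchanged and the scalar \<open>\<sigma>(x\<^sub>1, y\<^sub>1)\<close> is moved to the
  front.\<close>

lemma star_conv:
  assumes xy: "x \<in> carrier H" "y \<in> carrier H"
  shows "x \<star> y = conv2 k H \<Delta> \<Delta> (smult H) \<sigma> half x y"
proof -
  note ps = pairing_smult[OF self.H]
  note R = self.m_rules K_mult bilinear_in_left[OF sigma] bilinear_in_right[OF sigma] bilinear_closed[OF sigma]
    bilinear_in_left[OF tau] bilinear_in_right[OF tau] bilinear_closed[OF tau]
    bilinear_in_left[OF pairingD(4)[OF ps]] bilinear_in_right[OF pairingD(4)[OF ps]] bilinear_closed[OF pairingD(4)[OF ps]]
    xy
  have "x \<star> y = tensor_lift k H (\<lambda>x1 x'. tensor_lift k H (\<lambda>x2 x3.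
      tensor_lift k H (\<lambda>y1 y'. tensor_lift k H (\<lambda>y2 y3.
        (\<sigma> x1 y1 \<otimes>\<^bsub>k\<^esub> \<tau> x3 y3) \<odot>\<^bsub>H\<^esub> (x2 \<otimes>\<^bsub>H\<^esub> y2)) (\<Delta> y')) (\<Delta> y)) (\<Delta> x')) (\<Delta> x)"
    by (simp add: cocycle_twist_def)
  also have "\<dots> = tensor_lift k H (\<lambda>x1 x'. tensor_lift k H (\<lambda>y1 y'.
      tensor_lift k H (\<lambda>x2 x3. tensor_lift k H (\<lambda>y2 y3.
        (\<sigma> x1 y1 \<otimes>\<^bsub>k\<^esub> \<tau> x3 y3) \<odot>\<^bsub>H\<^esub> (x2 \<otimes>\<^bsub>H\<^esub> y2)) (\<Delta> y')) (\<Delta> x')) (\<Delta> y)) (\<Delta> x)"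
    by (rule tensor_ext[OF self.H self.H]) ((rule tensor_lift_swap | assumption | rule R)+)
  also have "\<dots> = tensor_lift k H (\<lambda>x1 x'. tensor_lift k H (\<lambda>y1 y'. \<sigma> x1 y1 \<odot>\<^bsub>H\<^esub>
      tensor_lift k H (\<lambda>x2 x3. tensor_lift k H (\<lambda>y2 y3.
        \<tau> x3 y3 \<odot>\<^bsub>H\<^esub> (x2 \<otimes>\<^bsub>H\<^esub> y2)) (\<Delta> y')) (\<Delta> x')) (\<Delta> y)) (\<Delta> x)"
  proof (rule tensor_ext[OF self.H self.H], rule tensor_ext[OF self.H self.H])
    fix x1 x' y1 y' assume h: "x1 \<in> carrier H" "x' \<in> carrier H" "y1 \<in> carrier H" "y' \<in> carrier H"
    have L: "linear_map k H H (smult H (\<sigma> x1 y1))"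
      by (rule bilinear_right[OF pairingD(4)[OF ps]]) (rule bilinear_closed[OF sigma h(1,3)])
    have "\<sigma> x1 y1 \<odot>\<^bsub>H\<^esub> tensor_lift k H (\<lambda>x2 x3. tensor_lift k H (\<lambda>y2 y3.
        \<tau> x3 y3 \<odot>\<^bsub>H\<^esub> (x2 \<otimes>\<^bsub>H\<^esub> y2)) (\<Delta> y')) (\<Delta> x')
      = tensor_lift k H (\<lambda>x2 x3. \<sigma> x1 y1 \<odot>\<^bsub>H\<^esub> tensor_lift k H (\<lambda>y2 y3.
        \<tau> x3 y3 \<odot>\<^bsub>H\<^esub> (x2 \<otimes>\<^bsub>H\<^esub> y2)) (\<Delta> y')) (\<Delta> x')"
      by (rule tensor_lift_comp[OF self.H self.H self.H self.H L] | assumption | rule R h)+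
    also have "\<dots> = tensor_lift k H (\<lambda>x2 x3. tensor_lift k H (\<lambda>y2 y3.
        \<sigma> x1 y1 \<odot>\<^bsub>H\<^esub> (\<tau> x3 y3 \<odot>\<^bsub>H\<^esub> (x2 \<otimes>\<^bsub>H\<^esub> y2))) (\<Delta> y')) (\<Delta> x')"
      by (rule tensor_ext[OF self.H self.H] tensor_lift_comp[OF self.H self.H self.H self.H L] | assumption | rule R h)+
    also have "\<dots> = tensor_lift k H (\<lambda>x2 x3. tensor_lift k H (\<lambda>y2 y3.
        (\<sigma> x1 y1 \<otimes>\<^bsub>k\<^esub> \<tau> x3 y3) \<odot>\<^bsub>H\<^esub> (x2 \<otimes>\<^bsub>H\<^esub> y2)) (\<Delta> y')) (\<Delta> x')"
      by (rule tensor_ext[OF self.H self.H])+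
        (use h bilinear_closed[OF sigma] bilinear_closed[OF tau] in
          \<open>simp_all add: self_module_simps smult_assoc1 self.coaction_closed\<close>)
    finally show "tensor_lift k H (\<lambda>x2 x3. tensor_lift k H (\<lambda>y2 y3.
        (\<sigma> x1 y1 \<otimes>\<^bsub>k\<^esub> \<tau> x3 y3) \<odot>\<^bsub>H\<^esub> (x2 \<otimes>\<^bsub>H\<^esub> y2)) (\<Delta> y')) (\<Delta> x')
      = \<sigma> x1 y1 \<odot>\<^bsub>H\<^esub> tensor_lift k H (\<lambda>x2 x3. tensor_lift k H (\<lambda>y2 y3.
        \<tau> x3 y3 \<odot>\<^bsub>H\<^esub> (x2 \<otimes>\<^bsub>H\<^esub> y2)) (\<Delta> y')) (\<Delta> x')" ..
  qed (auto simp: self.coaction_closed xy)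
  also have "\<dots> = conv2 k H \<Delta> \<Delta> (smult H) \<sigma> half x y"
    by (simp add: conv2_def conv1_def smult_right_def)
  finally show ?thesis .
qed

lemma star_bilinear: "bilinear_map k H H H (\<star>)"
proof -
  have b: "bilinear_map k H H H (conv2 k H \<Delta> \<Delta> (smult H) \<sigma> half)"
    by (rule selfp.conv2_bilinear[OF pairing_smult[OF self.H] sigma half_bilinear])
  show ?thesis
    by (rule bilinearI; rule linear_cong[OF _ self.H])
      (auto simp: star_conv intro: bilinear_left[OF b] bilinear_right[OF b])
qed

text \<open>Applied with \<open>L\<close> the multiplication by a fixed element, the comultiplication or
  the counit, this reduces associativity of the twist and its compatibility with comultiplication and
  counit to the same properties of \<open>H\<close>.\<close>

lemma linear_star:
  fixes N :: "('k, 'n, 'v) module_scheme"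
  assumes N: "module k N" and L: "linear_map k H N L" and xy: "x \<in> carrier H" "y \<in> carrier H"
  shows "L (x \<star> y) = conv2 k N \<Delta> \<Delta> (smult N) \<sigma>
    (conv2 k N \<Delta> \<Delta> (smult_right N) (\<lambda>x y. L (x \<otimes>\<^bsub>H\<^esub> y)) \<tau>) x y"
proof -
  have "L (x \<star> y) = conv2 k N \<Delta> \<Delta> (smult N) \<sigma> (\<lambda>x y. L (half x y)) x y"
    using selfp.conv2_smult_comp[OF self.H N L xy sigma half_bilinear] by (simp add: star_conv xy)
  also have "\<dots> = conv2 k N \<Delta> \<Delta> (smult N) \<sigma>
    (conv2 k N \<Delta> \<Delta> (smult_right N) (\<lambda>x y. L (x \<otimes>\<^bsub>H\<^esub> y)) \<tau>) x y"
    by (rule self.conv2_cong[OF _ _ xy])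
      (simp_all add: conv2_smult_right_comp[OF self.H N L _ _ tau mult_bilinear])
  finally show ?thesis .
qed

subsection \<open>Associativity\<close>

abbreviation "A3 \<equiv> conv3 k H \<Delta> (smult H)"
abbreviation "B3 \<equiv> conv3 k H \<Delta> (smult_right H)"

text \<open>Both triple products of the twist are obtained from \<open>x y z\<close> by convolving twice
  from the left with a form in \<open>\<sigma>\<close> and twice from the right with a form in
  \<open>\<tau>\<close>; associativity of convolution collects the forms on either side.\<close>

lemma sandwich:
  assumes t: "trilinear_map k H H H K s" "trilinear_map k H H H K s'" "trilinear_map k H H H K t" "trilinear_map k H H H K t'"
    and m: "trilinear_map k H H H H m" and xyz: "x \<in> carrier H" "y \<in> carrier H" "z \<in> carrier H"
  shows "A3 s (B3 (A3 s' (B3 m t')) t) x y z = A3 (C3 s s') (B3 m (C3 t' t)) x y z"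
proof -
  note tri = t m self.conv3_trilinear[OF pK] self.conv3_trilinear[OF pairing_smult[OF self.H]]
    self.conv3_trilinear[OF pairing_smult_right[OF self.H]]
  note as = self.conv3_assoc[OF self.coaction_coassoc]
  have "A3 s (B3 (A3 s' (B3 m t')) t) x y z = A3 s (A3 s' (B3 m (C3 t' t))) x y z"
  proof (rule self.conv3_cong[OF _ _ xyz])
    fix x y z assume h: "x \<in> carrier H" "y \<in> carrier H" "z \<in> carrier H"
    have "B3 (A3 s' (B3 m t')) t x y z = A3 s' (B3 (B3 m t') t) x y z"
      by (rule as[OF _ h associative_scalar_middle[OF self.H]]) (assumption | rule tri)+
    also have "\<dots> = A3 s' (B3 m (C3 t' t)) x y z"
      by (rule self.conv3_cong[OF _ _ h]) (simp_all add: as[OF _ _ _ _ associative_right_scalars[OF self.H]] t m)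
    finally show "B3 (A3 s' (B3 m t')) t x y z = A3 s' (B3 m (C3 t' t)) x y z" .
  qed simp
  also have "\<dots> = A3 (C3 s s') (B3 m (C3 t' t)) x y z"
    by (rule as[OF _ xyz associative_scalar_scalar[OF self.H], symmetric]) (assumption | rule tri)+
  finally show ?thesis .
qed

abbreviation "mult3 \<equiv> \<lambda>x y z. (x \<otimes>\<^bsub>H\<^esub> y) \<otimes>\<^bsub>H\<^esub> z"

lemma star_mult_left:
  assumes xyz: "x \<in> carrier H" "y \<in> carrier H" "z \<in> carrier H"
  shows "(x \<otimes>\<^bsub>H\<^esub> y) \<star> z = A3 (mult12 \<sigma>) (B3 mult3 (mult12 \<tau>)) x y z"
  unfolding star_conv[OF m_closed[OF xyz(1,2)] xyz(3)]
    self.conv2_mult_left[OF pairing_smult[OF self.H] sigma half_bilinear xyz]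
  by (rule self.conv3_cong[OF _ _ xyz])
    (simp_all add: self.conv2_mult_left[OF pairing_smult_right[OF self.H] mult_bilinear tau])

lemma star_mult_right:
  assumes xyz: "x \<in> carrier H" "y \<in> carrier H" "z \<in> carrier H"
  shows "x \<star> (y \<otimes>\<^bsub>H\<^esub> z) = A3 (mult23 \<sigma>) (B3 mult3 (mult23 \<tau>)) x y z"
proof -
  have "x \<star> (y \<otimes>\<^bsub>H\<^esub> z) = A3 (mult23 \<sigma>) (B3 (\<lambda>x y z. x \<otimes>\<^bsub>H\<^esub> (y \<otimes>\<^bsub>H\<^esub> z)) (mult23 \<tau>)) x y z"
    unfolding star_conv[OF xyz(1) m_closed[OF xyz(2,3)]]
      self.conv2_mult_right[OF pairing_smult[OF self.H] sigma half_bilinear xyz]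
    by (rule self.conv3_cong[OF _ _ xyz])
      (simp_all add: self.conv2_mult_right[OF pairing_smult_right[OF self.H] mult_bilinear tau])
  also have "\<dots> = A3 (mult23 \<sigma>) (B3 mult3 (mult23 \<tau>)) x y z"
    by (rule self.conv3_cong[OF _ _ xyz]) (simp_all add: m_assoc cong: self.conv3_cong)
  finally show ?thesis .
qed

text \<open>With \<open>\<mu>\<^sub>3(x, y, z) = x y z\<close>, the left hand side is \<open>((\<sigma>
  \<otimes> \<epsilon>) * \<sigma>(\<mu> \<otimes> 1)) * \<mu>\<^sub>3 * (\<tau>(\<mu> \<otimes> 1) *
  (\<tau> \<otimes> \<epsilon>))\<close> and the right hand side is \<open>((\<epsilon> \<otimes>
  \<sigma>) * \<sigma>(1 \<otimes> \<mu>)) * \<mu>\<^sub>3 * (\<tau>(1 \<otimes> \<mu>) * (\<epsilon>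
  \<otimes> \<tau>))\<close>. They agree by the cocycle identities for \<open>\<sigma>\<close> and
  \<open>\<tau>\<close>.\<close>

lemma star_assoc:
  assumes xyz: "x \<in> carrier H" "y \<in> carrier H" "z \<in> carrier H"
  shows "(x \<star> y) \<star> z = x \<star> (y \<star> z)"
proof -
  note pA = pairing_smult[OF self.H] and pB = pairing_smult_right[OF self.H]
  have m3: "trilinear_map k H H H H mult3" by (rule self.trilinear_mult_left[OF mult_bilinear])
  note tri = tri m3 self.conv3_trilinear[OF pA] self.conv3_trilinear[OF pB]
  have sl: "bilinear_map k H H H (\<lambda>x y. (x \<otimes>\<^bsub>H\<^esub> y) \<star> z)" and sr: "bilinear_map k H H H (\<lambda>y z. x \<star> (y \<otimes>\<^bsub>H\<^esub> z))"
    if "x \<in> carrier H" "z \<in> carrier H" for x z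
    using that by (auto intro!: bilinearI self.H_mult linear_id bilinear_in_left[OF star_bilinear] bilinear_in_right[OF star_bilinear])
  have "(x \<star> y) \<star> z = conv2 k H \<Delta> \<Delta> (smult H) \<sigma>
    (conv2 k H \<Delta> \<Delta> (smult_right H) (\<lambda>x y. (x \<otimes>\<^bsub>H\<^esub> y) \<star> z) \<tau>) x y"
    by (rule linear_star[OF self.H bilinear_left[OF star_bilinear xyz(3)] xyz(1,2)])
  also have "\<dots> = conv2 k H \<Delta> \<Delta> (smult H) \<sigma>
      (\<lambda>x y. B3 (A3 (mult12 \<sigma>) (B3 mult3 (mult12 \<tau>))) (on12 \<tau>) x y z) x y"
  proof (rule self.conv2_cong[OF _ _ xyz(1,2)])
    fix x y assume h: "x \<in> carrier H" "y \<in> carrier H"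
    have "conv2 k H \<Delta> \<Delta> (smult_right H) (\<lambda>x y. (x \<otimes>\<^bsub>H\<^esub> y) \<star> z) \<tau> x y
      = conv2 k H \<Delta> \<Delta> (smult_right H) (\<lambda>x y. A3 (mult12 \<sigma>) (B3 mult3 (mult12 \<tau>)) x y z) \<tau> x y"
      by (rule self.conv2_cong[OF _ _ h]) (simp_all add: star_mult_left xyz)
    also have "\<dots> = B3 (A3 (mult12 \<sigma>) (B3 mult3 (mult12 \<tau>))) (on12 \<tau>) x y z"
      by (rule conv3_counit_right_right[OF self.H h xyz(3) tau, symmetric]) (assumption | rule tri)+
    finally show "conv2 k H \<Delta> \<Delta> (smult_right H) (\<lambda>x y. (x \<otimes>\<^bsub>H\<^esub> y) \<star> z) \<tau> x y = \<dots>" .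
  qed simp
  also have "\<dots> = A3 (on12 \<sigma>) (B3 (A3 (mult12 \<sigma>) (B3 mult3 (mult12 \<tau>))) (on12 \<tau>)) x y z"
    by (rule self.conv3_counit_right[OF self.H xyz sigma, symmetric]) (assumption | rule tri)+
  also have "\<dots> = A3 (C3 (on12 \<sigma>) (mult12 \<sigma>)) (B3 mult3 (C3 (mult12 \<tau>) (on12 \<tau>))) x y z"
    by (rule sandwich[OF _ _ _ _ m3 xyz]) (rule tri)+
  also have "\<dots> = A3 (C3 (on23 \<sigma>) (mult23 \<sigma>)) (B3 mult3 (C3 (mult23 \<tau>) (on23 \<tau>))) x y z"
    by (rule self.conv3_cong[OF sigma_cocycle self.conv3_cong[OF _ tau_cocycle] xyz]) auto
  also have "\<dots> = A3 (on23 \<sigma>) (B3 (A3 (mult23 \<sigma>) (B3 mult3 (mult23 \<tau>))) (on23 \<tau>)) x y z"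
    by (rule sandwich[OF _ _ _ _ m3 xyz, symmetric]) (rule tri)+
  also have "\<dots> = conv2 k H \<Delta> \<Delta> (smult H) \<sigma> (B3 (A3 (mult23 \<sigma>) (B3 mult3 (mult23 \<tau>))) (on23 \<tau>) x) y z"
    by (rule self.conv3_counit_left[OF self.H xyz sigma]) (assumption | rule tri)+
  also have "\<dots> = conv2 k H \<Delta> \<Delta> (smult H) \<sigma>
    (conv2 k H \<Delta> \<Delta> (smult_right H) (\<lambda>y z. x \<star> (y \<otimes>\<^bsub>H\<^esub> z)) \<tau>) y z"
  proof (rule self.conv2_cong[OF _ _ xyz(2,3)])
    fix y z assume h: "y \<in> carrier H" "z \<in> carrier H"
    have "B3 (A3 (mult23 \<sigma>) (B3 mult3 (mult23 \<tau>))) (on23 \<tau>) x y z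
      = conv2 k H \<Delta> \<Delta> (smult_right H) (A3 (mult23 \<sigma>) (B3 mult3 (mult23 \<tau>)) x) \<tau> y z"
      by (rule conv3_counit_left_right[OF self.H xyz(1) h tau]) (assumption | rule tri)+
    also have "\<dots> = conv2 k H \<Delta> \<Delta> (smult_right H) (\<lambda>y z. x \<star> (y \<otimes>\<^bsub>H\<^esub> z)) \<tau> y z"
      by (rule self.conv2_cong[OF _ _ h]) (simp_all add: star_mult_right xyz)
    finally show "B3 (A3 (mult23 \<sigma>) (B3 mult3 (mult23 \<tau>))) (on23 \<tau>) x y z = \<dots>" .
  qed simp
  also have "\<dots> = x \<star> (y \<star> z)"
    by (rule linear_star[OF self.H bilinear_right[OF star_bilinear xyz(1)] xyz(2,3), symmetric])
  finally show ?thesis .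
qed

end

lemma k_algebraI:
  assumes A: "module k A" and m: "bilinear_map k A A A (mult A)" and one: "\<one>\<^bsub>A\<^esub> \<in> carrier A"
    and assoc: "\<And>a b c. \<lbrakk>a \<in> carrier A; b \<in> carrier A; c \<in> carrier A\<rbrakk> \<Longrightarrow> a \<otimes>\<^bsub>A\<^esub> b \<otimes>\<^bsub>A\<^esub> c = a \<otimes>\<^bsub>A\<^esub> (b \<otimes>\<^bsub>A\<^esub> c)"
    and unit: "\<And>a. a \<in> carrier A \<Longrightarrow> \<one>\<^bsub>A\<^esub> \<otimes>\<^bsub>A\<^esub> a = a" "\<And>a. a \<in> carrier A \<Longrightarrow> a \<otimes>\<^bsub>A\<^esub> \<one>\<^bsub>A\<^esub> = a"
  shows "k_algebra k A"
proof -
  interpret A: module k A by (rule A)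
  have "ring A"
    by (intro ringI A.M.abelian_group_axioms monoidI)
      (use assoc unit one in \<open>simp_all add: bilinear_closed[OF m] linear_add[OF bilinear_left[OF m]]
        linear_add[OF bilinear_right[OF m]]\<close>)
  then show ?thesis
    using A linear_smult[OF bilinear_left[OF m]] linear_smult[OF bilinear_right[OF m]]
    by (simp add: k_algebra_def k_algebra_axioms_def)
qed

context coaction_pair
begin

lemma conv2_pair_cong:
  assumes "\<And>x y. x \<in> carrier H \<Longrightarrow> y \<in> carrier H \<Longrightarrow> F x y = F' x y"
    "\<And>x y. x \<in> carrier A \<Longrightarrow> y \<in> carrier B \<Longrightarrow> G x y = G' x y"
    and "a \<in> carrier A" "b \<in> carrier B"
  shows "conv2 k N \<delta> \<delta>' p F G a b = conv2 k N \<delta> \<delta>' p F' G' a b"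
  unfolding conv2_def conv1_def
  by (rule tensor_ext[OF A.H A.A] tensor_ext[OF A.H B.A])+
    (use assms in \<open>auto intro: linear_closed[OF A.\<delta>] linear_closed[OF B.\<delta>]\<close>)

text \<open>Convolving with \<open>t\<close> and then with an inverse of \<open>t\<close> is the
  identity. Here \<open>s\<close> and \<open>t\<close> are \<open>\<sigma>\<close> and
  \<open>\<tau>\<close> in either order, so twisting with \<open>\<tau>\<close> undoes twisting with
  \<open>\<sigma>\<close>.\<close>

lemma conv2_cancel:
  assumes N: "module k N" and s: "bilinear_map k H H (self_module k) s" and t: "bilinear_map k H H (self_module k) t"
    and inv: "\<And>x y. x \<in> carrier H \<Longrightarrow> y \<in> carrier H \<Longrightarrow>
      conv2 k (self_module k) (comult H) (comult H) (mult k) s t x y = counit H x \<otimes>\<^bsub>k\<^esub> counit H y"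
    and G: "bilinear_map k A B N G" and ab: "a \<in> carrier A" "b \<in> carrier B"
  shows "conv2 k N \<delta> \<delta>' (smult N) s (conv2 k N \<delta> \<delta>' (smult N) t G) a b = G a b"
proof -
  have "conv2 k N \<delta> \<delta>' (smult N) s (conv2 k N \<delta> \<delta>' (smult N) t G) a b
    = conv2 k N \<delta> \<delta>' (smult N) (conv2 k (self_module k) (comult H) (comult H) (mult k) s t) G a b"
    by (rule conv2_assoc[OF A.coaction_coassoc[OF ab(1)] ab(1) B.coaction_coassoc[OF ab(2)] ab(2)
          associative_scalar_scalar[OF N] s t G, symmetric])
  also have "\<dots> = conv2 k N \<delta> \<delta>' (smult N) (\<lambda>x y. counit H x \<otimes>\<^bsub>k\<^esub> counit H y) G a b"
    by (rule conv2_pair_cong[OF _ _ ab]) (simp_all add: inv)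
  also have "\<dots> = G a b" by (rule conv2_counit[OF N ab G])
  finally show ?thesis .
qed

end

context cocycle
begin

interpretation self: coaction_algebra k H H \<Delta> by (rule self_coaction_algebra)
interpretation selfp: coaction_pair k H H \<Delta> H \<Delta>
  by (rule coaction_pair.intro[OF self_coaction self_coaction])

text \<open>The key identity relating the twisted product of \<open>H\<close> to twisted operations on
  comodules, written \<open>(\<sigma> * \<mu> * \<tau>) \<otimes> (\<sigma> * G) = \<sigma> * (\<mu>
  \<otimes> G)\<close>: the factor \<open>\<tau>\<close> at the end of the twisted product meets the
  \<open>\<sigma>\<close> in the twist of \<open>G\<close> and cancels. It yields the multiplicativity
  of the comultiplication and of coactions for the twisted products.\<close>

lemma conv2_star_twist:
  assumes AB: "coaction_pair k H A \<delta> B \<delta>'" and N: "module k N" and G: "bilinear_map k A B N G"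
    and ab: "a \<in> carrier A" "b \<in> carrier B"
  shows "conv2 k (tensor k H N) \<delta> \<delta>' (pure_tensor k H N) (\<star>) (conv2 k N \<delta> \<delta>' (smult N) \<sigma> G) a b
    = conv2 k (tensor k H N) \<delta> \<delta>' (smult (tensor k H N)) \<sigma>
        (conv2 k (tensor k H N) \<delta> \<delta>' (pure_tensor k H N) (mult H) G) a b"
proof -
  interpret AB: coaction_pair k H A \<delta> B \<delta>' by (rule AB)
  note HN = tensor_module[OF self.H N]
  note assoc = AB.conv2_assoc[OF AB.A.coaction_coassoc _ AB.B.coaction_coassoc]
  let ?G = "conv2 k N \<delta> \<delta>' (smult N) \<sigma> G"
  have G': "bilinear_map k A B N ?G"
    by (rule AB.conv2_bilinear[OF pairing_smult[OF N] sigma G])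
  have "conv2 k (tensor k H N) \<delta> \<delta>' (pure_tensor k H N) (\<star>) ?G a b
    = conv2 k (tensor k H N) \<delta> \<delta>' (pure_tensor k H N) (conv2 k H \<Delta> \<Delta> (smult H) \<sigma> half) ?G a b"
    by (rule AB.conv2_pair_cong[OF _ _ ab]) (simp_all add: star_conv)
  also have "\<dots> = conv2 k (tensor k H N) \<delta> \<delta>' (smult (tensor k H N)) \<sigma>
      (conv2 k (tensor k H N) \<delta> \<delta>' (pure_tensor k H N) half ?G) a b"
    by (rule assoc[OF ab(1) ab(1) ab(2) ab(2) associative_scalar_pure[OF self.H N] sigma half_bilinear G'])
  also have "\<dots> = conv2 k (tensor k H N) \<delta> \<delta>' (smult (tensor k H N)) \<sigma>
        (conv2 k (tensor k H N) \<delta> \<delta>' (pure_tensor k H N) (mult H) G) a b"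
  proof (rule AB.conv2_pair_cong[OF _ _ ab])
    fix a b assume ab: "a \<in> carrier A" "b \<in> carrier B"
    have "conv2 k (tensor k H N) \<delta> \<delta>' (pure_tensor k H N) half ?G a b
      = conv2 k (tensor k H N) \<delta> \<delta>' (pure_tensor k H N) (mult H) (conv2 k N \<delta> \<delta>' (smult N) \<tau> ?G) a b"
      by (rule assoc[OF ab(1) ab(1) ab(2) ab(2) associative_pure_middle[OF self.H N] mult_bilinear tau G'])
    also have "\<dots> = conv2 k (tensor k H N) \<delta> \<delta>' (pure_tensor k H N) (mult H) G a b"
      by (rule AB.conv2_pair_cong[OF _ _ ab]) (simp_all add: AB.conv2_cancel[OF N tau sigma tau_sigma G])
    finally show "conv2 k (tensor k H N) \<delta> \<delta>' (pure_tensor k H N) half ?G a b = \<dots>" .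
  qed simp
  finally show ?thesis .
qed

lemma star_one_left:
  assumes y: "y \<in> carrier H" shows "\<one>\<^bsub>H\<^esub> \<star> y = y"
proof -
  have "\<one>\<^bsub>H\<^esub> \<star> y = conv1 k H \<Delta> (smult H) (\<sigma> \<one>\<^bsub>H\<^esub>) (half \<one>\<^bsub>H\<^esub>) y"
    by (simp add: star_conv y self.conv2_one_left[OF pairing_smult[OF self.H] sigma half_bilinear y])
  also have "\<dots> = conv1 k H \<Delta> (smult H) (\<lambda>x. \<sigma> \<one>\<^bsub>H\<^esub> \<one>\<^bsub>H\<^esub> \<otimes>\<^bsub>k\<^esub> \<epsilon> x) (\<lambda>x. \<tau> \<one>\<^bsub>H\<^esub> \<one>\<^bsub>H\<^esub> \<odot>\<^bsub>H\<^esub> x) y"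
  proof (rule self.conv1_cong[OF sigma_one_left _ y])
    fix x assume x: "x \<in> carrier H"
    have "half \<one>\<^bsub>H\<^esub> x = conv1 k H \<Delta> (smult_right H) (mult H \<one>\<^bsub>H\<^esub>) (\<tau> \<one>\<^bsub>H\<^esub>) x"
      by (rule self.conv2_one_left[OF pairing_smult_right[OF self.H] mult_bilinear tau x])
    also have "\<dots> = conv1 k H \<Delta> (smult_right H) (\<lambda>x. x) (\<lambda>x. \<tau> \<one>\<^bsub>H\<^esub> \<one>\<^bsub>H\<^esub> \<otimes>\<^bsub>k\<^esub> \<epsilon> x) x"
      by (rule self.conv1_cong[OF _ tau_one_left x]) simp_all
    also have "\<dots> = \<tau> \<one>\<^bsub>H\<^esub> \<one>\<^bsub>H\<^esub> \<odot>\<^bsub>H\<^esub> x"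
      by (simp add: conv1_scale_right[OF self.H x closed11(2) counit_linear linear_id] conv1_counit_right[OF self.H x linear_id])
    finally show "half \<one>\<^bsub>H\<^esub> x = \<tau> \<one>\<^bsub>H\<^esub> \<one>\<^bsub>H\<^esub> \<odot>\<^bsub>H\<^esub> x" .
  qed
  also have "\<dots> = \<sigma> \<one>\<^bsub>H\<^esub> \<one>\<^bsub>H\<^esub> \<odot>\<^bsub>H\<^esub> (\<tau> \<one>\<^bsub>H\<^esub> \<one>\<^bsub>H\<^esub> \<odot>\<^bsub>H\<^esub> y)"
    using linear_scale[OF self.H linear_id closed11(2)]
    by (simp add: self.conv1_scale_left[OF self.H y closed11(1) counit_linear] self.conv1_counit[OF self.H y])
  also have "\<dots> = y"
    using closed11 y sigma_tau_one by (simp flip: smult_assoc1)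
  finally show ?thesis .
qed

lemma star_one_right:
  assumes y: "y \<in> carrier H" shows "y \<star> \<one>\<^bsub>H\<^esub> = y"
proof -
  have "y \<star> \<one>\<^bsub>H\<^esub> = conv1 k H \<Delta> (smult H) (\<lambda>x. \<sigma> x \<one>\<^bsub>H\<^esub>) (\<lambda>x. half x \<one>\<^bsub>H\<^esub>) y"
    by (simp add: star_conv y self.conv2_one_right[OF pairing_smult[OF self.H] sigma half_bilinear y])
  also have "\<dots> = conv1 k H \<Delta> (smult H) (\<lambda>x. \<sigma> \<one>\<^bsub>H\<^esub> \<one>\<^bsub>H\<^esub> \<otimes>\<^bsub>k\<^esub> \<epsilon> x) (\<lambda>x. \<tau> \<one>\<^bsub>H\<^esub> \<one>\<^bsub>H\<^esub> \<odot>\<^bsub>H\<^esub> x) y"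
  proof (rule self.conv1_cong[OF sigma_one_right _ y])
    fix x assume x: "x \<in> carrier H"
    have "half x \<one>\<^bsub>H\<^esub> = conv1 k H \<Delta> (smult_right H) (\<lambda>x. x \<otimes>\<^bsub>H\<^esub> \<one>\<^bsub>H\<^esub>) (\<lambda>x. \<tau> x \<one>\<^bsub>H\<^esub>) x"
      by (rule self.conv2_one_right[OF pairing_smult_right[OF self.H] mult_bilinear tau x])
    also have "\<dots> = conv1 k H \<Delta> (smult_right H) (\<lambda>x. x) (\<lambda>x. \<tau> \<one>\<^bsub>H\<^esub> \<one>\<^bsub>H\<^esub> \<otimes>\<^bsub>k\<^esub> \<epsilon> x) x"
      by (rule self.conv1_cong[OF _ tau_one_right x]) simp_all
    also have "\<dots> = \<tau> \<one>\<^bsub>H\<^esub> \<one>\<^bsub>H\<^esub> \<odot>\<^bsub>H\<^esub> x"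
      by (simp add: conv1_scale_right[OF self.H x closed11(2) counit_linear linear_id] conv1_counit_right[OF self.H x linear_id])
    finally show "half x \<one>\<^bsub>H\<^esub> = \<tau> \<one>\<^bsub>H\<^esub> \<one>\<^bsub>H\<^esub> \<odot>\<^bsub>H\<^esub> x" .
  qed
  also have "\<dots> = \<sigma> \<one>\<^bsub>H\<^esub> \<one>\<^bsub>H\<^esub> \<odot>\<^bsub>H\<^esub> (\<tau> \<one>\<^bsub>H\<^esub> \<one>\<^bsub>H\<^esub> \<odot>\<^bsub>H\<^esub> y)"
    using linear_scale[OF self.H linear_id closed11(2)]
    by (simp add: self.conv1_scale_left[OF self.H y closed11(1) counit_linear] self.conv1_counit[OF self.H y])
  also have "\<dots> = y"
    using closed11 y sigma_tau_one by (simp flip: smult_assoc1)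
  finally show ?thesis .
qed

lemma counit_star:
  assumes xy: "x \<in> carrier H" "y \<in> carrier H" shows "\<epsilon> (x \<star> y) = \<epsilon> x \<otimes>\<^bsub>k\<^esub> \<epsilon> y"
proof -
  have "\<epsilon> (x \<star> y) = conv2 k K \<Delta> \<Delta> (smult K) \<sigma>
    (conv2 k K \<Delta> \<Delta> (smult_right K) (\<lambda>x y. \<epsilon> (x \<otimes>\<^bsub>H\<^esub> y)) \<tau>) x y"
    by (rule linear_star[OF K counit_linear xy])
  also have "\<dots> = conv2 k K \<Delta> \<Delta> (smult K) \<sigma> \<tau> x y"
  proof (rule self.conv2_cong[OF _ _ xy])
    fix x y assume xy: "x \<in> carrier H" "y \<in> carrier H"
    have "conv2 k K \<Delta> \<Delta> (smult_right K) (\<lambda>x y. \<epsilon> (x \<otimes>\<^bsub>H\<^esub> y)) \<tau> x y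
      = conv2 k K \<Delta> \<Delta> (smult_right K) (\<lambda>x y. \<epsilon> x \<otimes>\<^bsub>k\<^esub> \<epsilon> y) \<tau> x y"
      by (rule self.conv2_cong[OF _ _ xy]) (simp_all add: counit_mult)
    also have "\<dots> = conv2 k K \<Delta> \<Delta> (smult K) (\<lambda>x y. \<epsilon> x \<otimes>\<^bsub>k\<^esub> \<epsilon> y) \<tau> x y"
      by (simp add: conv2_smult_right_scalars[OF counit2 tau xy] self_module_simps)
    also have "\<dots> = \<tau> x y" by (rule selfp.conv2_counit[OF K xy tau])
    finally show "conv2 k K \<Delta> \<Delta> (smult_right K) (\<lambda>x y. \<epsilon> (x \<otimes>\<^bsub>H\<^esub> y)) \<tau> x y = \<tau> x y" .
  qed simp
  also have "\<dots> = \<epsilon> x \<otimes>\<^bsub>k\<^esub> \<epsilon> y" using sigma_tau[OF xy] by (simp add: self_module_simps)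
  finally show ?thesis .
qed

text \<open>Convolve \<open>\<Delta>(x y) = \<Delta>(x) \<Delta>(y)\<close> with \<open>\<sigma>\<close>
  and \<open>\<tau>\<close>: the factor \<open>\<tau>\<close> is absorbed into the second tensor factor,
  and the lemma \<open>conv2_star_twist\<close> distributes \<open>\<sigma>\<close> over both.\<close>

lemma comult_star:
  assumes xy: "x \<in> carrier H" "y \<in> carrier H"
  shows "\<Delta> (x \<star> y) = conv2 k (tensor k H H) \<Delta> \<Delta> (pure_tensor k H H) (\<star>) (\<star>) x y"
proof -
  note HH = tensor_module[OF self.H self.H]
  let ?D = "conv2 k (tensor k H H) \<Delta> \<Delta> (pure_tensor k H H) (mult H) (mult H)"
  have cm: "\<Delta> (x \<otimes>\<^bsub>H\<^esub> y) = ?D x y" if "x \<in> carrier H" "y \<in> carrier H" for x y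
    using comult_mult[OF that] by (simp add: conv2_def conv1_def)
  have "\<Delta> (x \<star> y) = conv2 k (tensor k H H) \<Delta> \<Delta> (smult (tensor k H H)) \<sigma>
      (conv2 k (tensor k H H) \<Delta> \<Delta> (smult_right (tensor k H H)) (\<lambda>x y. \<Delta> (x \<otimes>\<^bsub>H\<^esub> y)) \<tau>) x y"
    by (rule linear_star[OF HH comult_linear xy])
  also have "\<dots> = conv2 k (tensor k H H) \<Delta> \<Delta> (smult (tensor k H H)) \<sigma>
      (conv2 k (tensor k H H) \<Delta> \<Delta> (pure_tensor k H H) (mult H) half) x y"
  proof (rule self.conv2_cong[OF _ _ xy])
    fix x y assume xy: "x \<in> carrier H" "y \<in> carrier H"
    have "conv2 k (tensor k H H) \<Delta> \<Delta> (smult_right (tensor k H H)) (\<lambda>x y. \<Delta> (x \<otimes>\<^bsub>H\<^esub> y)) \<tau> x y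
      = conv2 k (tensor k H H) \<Delta> \<Delta> (smult_right (tensor k H H)) ?D \<tau> x y"
      by (rule self.conv2_cong[OF _ _ xy]) (simp_all add: cm)
    also have "\<dots> = conv2 k (tensor k H H) \<Delta> \<Delta> (pure_tensor k H H) (mult H) half x y"
      by (rule selfp.conv2_assoc[OF self.coaction_coassoc[OF xy(1)] xy(1) self.coaction_coassoc[OF xy(2)] xy(2)
            associative_pure_scalar[OF self.H self.H] mult_bilinear mult_bilinear tau])
    finally show "conv2 k (tensor k H H) \<Delta> \<Delta> (smult_right (tensor k H H)) (\<lambda>x y. \<Delta> (x \<otimes>\<^bsub>H\<^esub> y)) \<tau> x y = \<dots>" .
  qed simp
  also have "\<dots> = conv2 k (tensor k H H) \<Delta> \<Delta> (pure_tensor k H H) (\<star>) (conv2 k H \<Delta> \<Delta> (smult H) \<sigma> half) x y"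
    by (rule conv2_star_twist[OF selfp.coaction_pair_axioms self.H half_bilinear xy, symmetric])
  also have "\<dots> = conv2 k (tensor k H H) \<Delta> \<Delta> (pure_tensor k H H) (\<star>) (\<star>) x y"
    by (rule self.conv2_cong[OF _ _ xy]) (simp_all add: star_conv)
  finally show ?thesis .
qed

lemma twist_module: "module k H'"
  by (rule same_module_module[OF same_twist self.H])

lemma twist_coalgebra: "coalgebra k H'"
  using twist_module comult_linear counit_linear coassoc counit_left counit_right
  by (simp add: coalgebra_def coalgebra_axioms_def twist_module_simps)

theorem twist_bialgebra: "bialgebra k H'"
proof -
  have "k_algebra k H'"
    by (rule k_algebraI[OF twist_module])
      (use star_bilinear star_assoc star_one_left star_one_right in
        \<open>simp_all add: bilinear_map_def twist_module_simps\<close>)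
  then show ?thesis
    using twist_coalgebra comult_one counit_one counit_star comult_star
    by (simp add: bialgebra_def bialgebra_axioms_def twist_module_simps conv2_def conv1_def)
qed

lemma twist_coaction:
  assumes "coaction k H A \<delta>" shows "coaction k H' A \<delta>"
proof -
  interpret coaction k H A \<delta> by fact
  show ?thesis
    using twist_coalgebra A.module_axioms coaction_linear coaction_coassoc coaction_counit
    by (simp add: coaction_def coaction_axioms_def twist_module_simps coassociative_at_def)
qed

end

section \<open>Twisting comodule algebras\<close>

lemma left_comodule_iff: "left_comodule k H M \<longleftrightarrow> coaction k H M (coact M)"
  by (auto simp: left_comodule_def left_comodule_axioms_def coaction_def coaction_axioms_def coassociative_at_def)

lemma left_comodule_algebra_iff: "left_comodule_algebra k H A \<longleftrightarrow> coaction_algebra k H A (coact A)"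
  by (auto simp: left_comodule_algebra_def left_comodule_algebra_axioms_def left_comodule_iff
      coaction_algebra_def coaction_algebra_axioms_def)

context cocycle
begin

interpretation self: coaction_algebra k H H \<Delta> by (rule self_coaction_algebra)

context
  fixes A :: "('k, 'a, 'x) module_scheme" and \<delta>
  assumes A: "coaction_algebra k H A \<delta>"
begin

interpretation A: coaction_algebra k H A \<delta> by (rule A)
interpretation AA: coaction_pair k H A \<delta> A \<delta>
  by (rule coaction_pair.intro[OF A.coaction_axioms A.coaction_axioms])

abbreviation twisted_mult where
  "twisted_mult \<equiv> conv2 k A \<delta> \<delta> (smult A) \<sigma> (mult A)"

lemma twisted_mult_bilinear: "bilinear_map k A A A twisted_mult"
  by (rule AA.conv2_bilinear[OF pairing_smult[OF A.A] sigma A.AA.mult_bilinear])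

text \<open>The two bracketings are the convolutions of \<open>a b c\<close> with the two sides of the
  cocycle identity.\<close>

lemma twisted_mult_assoc:
  assumes abc: "a \<in> carrier A" "b \<in> carrier A" "c \<in> carrier A"
  shows "twisted_mult (twisted_mult a b) c = twisted_mult a (twisted_mult b c)"
proof -
  let ?E = "conv3 k A \<delta> (smult A)" and ?m = "\<lambda>a b c. (a \<otimes>\<^bsub>A\<^esub> b) \<otimes>\<^bsub>A\<^esub> c"
  note p = pairing_smult[OF A.A] and m = A.AA.mult_bilinear
  have m3: "trilinear_map k A A A A ?m" by (rule A.trilinear_mult_left[OF m])
  note tri = tri m3 A.conv3_trilinear[OF p]
  have "twisted_mult (twisted_mult a b) c = conv2 k A \<delta> \<delta> (smult A) \<sigma> (\<lambda>a b. twisted_mult (a \<otimes>\<^bsub>A\<^esub> b) c) a b"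
    by (rule AA.conv2_smult_comp[OF A.A A.A bilinear_left[OF twisted_mult_bilinear abc(3)] abc(1,2) sigma m])
  also have "\<dots> = conv2 k A \<delta> \<delta> (smult A) \<sigma> (\<lambda>a b. ?E (mult12 \<sigma>) ?m a b c) a b"
    by (rule A.conv2_cong[OF _ _ abc(1,2)]) (simp_all add: A.conv2_mult_left[OF p sigma m] abc)
  also have "\<dots> = ?E (on12 \<sigma>) (?E (mult12 \<sigma>) ?m) a b c"
    by (rule A.conv3_counit_right[OF A.A abc sigma, symmetric]) (rule tri)+
  also have "\<dots> = ?E (C3 (on12 \<sigma>) (mult12 \<sigma>)) ?m a b c"
    by (rule A.conv3_assoc[OF A.coaction_coassoc abc associative_scalar_scalar[OF A.A], symmetric]) (assumption | rule tri)+
  also have "\<dots> = ?E (C3 (on23 \<sigma>) (mult23 \<sigma>)) ?m a b c"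
    by (rule A.conv3_cong[OF sigma_cocycle _ abc]) auto
  also have "\<dots> = ?E (on23 \<sigma>) (?E (mult23 \<sigma>) ?m) a b c"
    by (rule A.conv3_assoc[OF A.coaction_coassoc abc associative_scalar_scalar[OF A.A]]) (assumption | rule tri)+
  also have "\<dots> = conv2 k A \<delta> \<delta> (smult A) \<sigma> (?E (mult23 \<sigma>) ?m a) b c"
    by (rule A.conv3_counit_left[OF A.A abc sigma]) (rule tri)+
  also have "\<dots> = conv2 k A \<delta> \<delta> (smult A) \<sigma> (\<lambda>b c. twisted_mult a (b \<otimes>\<^bsub>A\<^esub> c)) b c"
  proof (rule A.conv2_cong[OF _ _ abc(2,3)])
    fix b c assume bc: "b \<in> carrier A" "c \<in> carrier A"
    show "?E (mult23 \<sigma>) ?m a b c = twisted_mult a (b \<otimes>\<^bsub>A\<^esub> c)"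
      unfolding A.conv2_mult_right[OF p sigma m abc(1) bc]
      by (rule A.conv3_cong[OF _ _ abc(1) bc]) (simp_all add: A.AA.m_assoc)
  qed simp
  also have "\<dots> = twisted_mult a (twisted_mult b c)"
    by (rule AA.conv2_smult_comp[OF A.A A.A bilinear_right[OF twisted_mult_bilinear abc(1)] abc(2,3) sigma m, symmetric])
  finally show ?thesis .
qed

lemma twisted_mult_one_left:
  assumes a: "a \<in> carrier A"
  shows "twisted_mult \<one>\<^bsub>A\<^esub> a = \<sigma> \<one>\<^bsub>H\<^esub> \<one>\<^bsub>H\<^esub> \<odot>\<^bsub>A\<^esub> a"
proof -
  have "twisted_mult \<one>\<^bsub>A\<^esub> a = conv1 k A \<delta> (smult A) (\<sigma> \<one>\<^bsub>H\<^esub>) (mult A \<one>\<^bsub>A\<^esub>) a"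
    by (rule A.conv2_one_left[OF pairing_smult[OF A.A] sigma A.AA.mult_bilinear a])
  also have "\<dots> = conv1 k A \<delta> (smult A) (\<lambda>x. \<sigma> \<one>\<^bsub>H\<^esub> \<one>\<^bsub>H\<^esub> \<otimes>\<^bsub>k\<^esub> \<epsilon> x) (\<lambda>a. a) a"
    by (rule A.conv1_cong[OF sigma_one_left _ a]) simp_all
  finally show ?thesis
    by (simp add: A.conv1_scale_left[OF A.A a closed11(1) counit_linear linear_id] A.conv1_counit[OF A.A a linear_id])
qed

lemma twisted_mult_one_right:
  assumes a: "a \<in> carrier A"
  shows "twisted_mult a \<one>\<^bsub>A\<^esub> = \<sigma> \<one>\<^bsub>H\<^esub> \<one>\<^bsub>H\<^esub> \<odot>\<^bsub>A\<^esub> a"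
proof -
  have "twisted_mult a \<one>\<^bsub>A\<^esub> = conv1 k A \<delta> (smult A) (\<lambda>x. \<sigma> x \<one>\<^bsub>H\<^esub>) (\<lambda>a. a \<otimes>\<^bsub>A\<^esub> \<one>\<^bsub>A\<^esub>) a"
    by (rule A.conv2_one_right[OF pairing_smult[OF A.A] sigma A.AA.mult_bilinear a])
  also have "\<dots> = conv1 k A \<delta> (smult A) (\<lambda>x. \<sigma> \<one>\<^bsub>H\<^esub> \<one>\<^bsub>H\<^esub> \<otimes>\<^bsub>k\<^esub> \<epsilon> x) (\<lambda>a. a) a"
    by (rule A.conv1_cong[OF sigma_one_right _ a]) simp_all
  finally show ?thesis
    by (simp add: A.conv1_scale_left[OF A.A a closed11(1) counit_linear linear_id] A.conv1_counit[OF A.A a linear_id])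
qed

text \<open>The coaction is multiplicative for the original products; the lemma
  \<open>conv2_star_twist\<close> transports this to the twisted ones.\<close>

lemma coaction_twisted_mult:
  assumes ab: "a \<in> carrier A" "b \<in> carrier A"
  shows "\<delta> (twisted_mult a b) = conv2 k (tensor k H A) \<delta> \<delta> (pure_tensor k H A) (\<star>) twisted_mult a b"
proof -
  note HA = tensor_module[OF self.H A.A]
  have "\<delta> (twisted_mult a b) = conv2 k (tensor k H A) \<delta> \<delta> (smult (tensor k H A)) \<sigma> (\<lambda>a b. \<delta> (a \<otimes>\<^bsub>A\<^esub> b)) a b"
    by (rule AA.conv2_smult_comp[OF A.A HA A.coaction_linear ab sigma A.AA.mult_bilinear])
  also have "\<dots> = conv2 k (tensor k H A) \<delta> \<delta> (smult (tensor k H A)) \<sigma>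
      (conv2 k (tensor k H A) \<delta> \<delta> (pure_tensor k H A) (mult H) (mult A)) a b"
    by (rule A.conv2_cong[OF _ _ ab]) (simp_all add: A.coaction_mult conv2_def conv1_def)
  also have "\<dots> = conv2 k (tensor k H A) \<delta> \<delta> (pure_tensor k H A) (\<star>) twisted_mult a b"
    by (rule conv2_star_twist[OF AA.coaction_pair_axioms A.A A.AA.mult_bilinear ab, symmetric])
  finally show ?thesis .
qed

text \<open>The record \<open>B\<close> is only required to have the right module, product and unit, so
  that the result applies to the comodule algebra twist whatever further fields it carries.\<close>

lemma twisted_coaction_algebra:
  fixes B :: "('k, 'a, 'w) module_scheme"
  assumes same: "same_module B A" and mult: "\<And>a b. a \<in> carrier A \<Longrightarrow> b \<in> carrier A \<Longrightarrow> a \<otimes>\<^bsub>B\<^esub> b = twisted_mult a b"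
    and one: "\<one>\<^bsub>B\<^esub> = inv\<^bsub>k\<^esub> (\<sigma> \<one>\<^bsub>H\<^esub> \<one>\<^bsub>H\<^esub>) \<odot>\<^bsub>A\<^esub> \<one>\<^bsub>A\<^esub>"
  shows "coaction_algebra k H' B \<delta>"
proof -
  have c: "carrier B = carrier A" "smult B = smult A" using same by (simp_all add: same_module_def)
  note sm = same_module_linear_dom[OF same] same_module_linear_cod[OF same] same_module_tensor_right[OF same]
    same_module_pure_right[OF same] same_module_tensor_lift[OF same]
  have modB: "module k B" by (rule same_module_module[OF same A.A])
  have lin1: "linear_map k A A (\<lambda>a. a \<otimes>\<^bsub>B\<^esub> b)" if "b \<in> carrier A" for b
    by (rule linear_cong[OF bilinear_left[OF twisted_mult_bilinear that] A.A]) (simp add: mult that)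
  have lin2: "linear_map k A A (\<lambda>a. b \<otimes>\<^bsub>B\<^esub> a)" if "b \<in> carrier A" for b
    by (rule linear_cong[OF bilinear_right[OF twisted_mult_bilinear that] A.A]) (simp add: mult that)
  have one': "\<one>\<^bsub>B\<^esub> = \<tau> \<one>\<^bsub>H\<^esub> \<one>\<^bsub>H\<^esub> \<odot>\<^bsub>A\<^esub> \<one>\<^bsub>A\<^esub>" by (simp add: one tau_one_one)
  have onec: "\<one>\<^bsub>B\<^esub> \<in> carrier A" using closed11 by (simp add: one')
  have ts: "\<tau> \<one>\<^bsub>H\<^esub> \<one>\<^bsub>H\<^esub> \<odot>\<^bsub>A\<^esub> (\<sigma> \<one>\<^bsub>H\<^esub> \<one>\<^bsub>H\<^esub> \<odot>\<^bsub>A\<^esub> a) = a" if "a \<in> carrier A" for a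
    using closed11 sigma_tau_one that by (simp flip: A.A.smult_assoc1 add: R.m_comm)
  have "k_algebra k B"
  proof (rule k_algebraI[OF modB])
    show "bilinear_map k B B B (mult B)"
      using lin1 lin2 by (auto simp: bilinear_map_def c sm)
    fix a b d assume "a \<in> carrier B" "b \<in> carrier B" "d \<in> carrier B"
    then show "a \<otimes>\<^bsub>B\<^esub> b \<otimes>\<^bsub>B\<^esub> d = a \<otimes>\<^bsub>B\<^esub> (b \<otimes>\<^bsub>B\<^esub> d)"
      by (simp add: c mult bilinear_closed[OF twisted_mult_bilinear] twisted_mult_assoc)
  next
    show "\<one>\<^bsub>B\<^esub> \<in> carrier B" using onec by (simp add: c)
    fix a assume a: "a \<in> carrier B"
    show "\<one>\<^bsub>B\<^esub> \<otimes>\<^bsub>B\<^esub> a = a"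
      using a onec linear_smult[OF bilinear_left[OF twisted_mult_bilinear] closed11(2), of a "\<one>\<^bsub>A\<^esub>"]
      by (simp add: c mult) (simp add: one' twisted_mult_one_left ts)
    show "a \<otimes>\<^bsub>B\<^esub> \<one>\<^bsub>B\<^esub> = a"
      using a onec linear_smult[OF bilinear_right[OF twisted_mult_bilinear] closed11(2), of a "\<one>\<^bsub>A\<^esub>"]
      by (simp add: c mult) (simp add: one' twisted_mult_one_right ts)
  qed
  moreover have "coaction k H' B \<delta>"
    using twist_coalgebra modB A.coaction_linear A.coaction_coassoc A.coaction_counit
    by (simp add: coaction_def coaction_axioms_def coassociative_at_def twist_module_simps sm c)
  moreover have "coaction_algebra_axioms k H' B \<delta>"
  proof
    fix a b assume "a \<in> carrier B" "b \<in> carrier B"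
    then have ab: "a \<in> carrier A" "b \<in> carrier A" by (simp_all add: c)
    have "\<delta> (twisted_mult a b) = conv2 k (tensor k H A) \<delta> \<delta> (pure_tensor k H A) (\<star>) (mult B) a b"
      unfolding coaction_twisted_mult[OF ab] by (rule A.conv2_cong[OF _ _ ab]) (simp_all add: mult)
    then show "\<delta> (a \<otimes>\<^bsub>B\<^esub> b) = tensor_lift k (tensor k H' B) (\<lambda>h a0. tensor_lift k (tensor k H' B)
         (\<lambda>g b0. pure_tensor k H' B (h \<star> g) (a0 \<otimes>\<^bsub>B\<^esub> b0)) (\<delta> b)) (\<delta> a)"
      by (simp add: mult ab twist_module_simps sm conv2_def conv1_def)
  next
    show "\<delta> \<one>\<^bsub>B\<^esub> = pure_tensor k H' B \<one>\<^bsub>H'\<^esub> \<one>\<^bsub>B\<^esub>"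
      using closed11
      by (simp add: one' twist_module_simps sm linear_smult[OF A.coaction_linear] A.coaction_one
          pure_tensor_smult_right[OF self.H A.A])
  qed
  ultimately show ?thesis
    using twist_bialgebra by (simp add: coaction_algebra_def)
qed

end

lemma comodule_algebra_twist_coaction_algebra:
  fixes A :: "('k, 'h, 'a, 'x) comodule_scheme"
  assumes "left_comodule_algebra k H A"
  shows "left_comodule_algebra k H' (comodule_algebra_twist k H \<sigma> A)"
proof -
  have A: "coaction_algebra k H A (coact A)" using assms by (simp add: left_comodule_algebra_iff)
  have "coact (comodule_algebra_twist k H \<sigma> A) = coact A" by (simp add: comodule_algebra_twist_def)
  moreover have "coaction_algebra k H' (comodule_algebra_twist k H \<sigma> A) (coact A)"
    by (rule twisted_coaction_algebra[OF A])
      (simp_all add: same_module_def comodule_algebra_twist_def conv2_def conv1_def)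
  ultimately show ?thesis by (simp add: left_comodule_algebra_iff)
qed

end

section \<open>The tensor algebra\<close>

text \<open>A family of multilinear maps, one for each length of words.\<close>

definition multilinear_on_words ::
  "('k, 'z) ring_scheme \<Rightarrow> ('k, 'm, 'y) module_scheme \<Rightarrow> ('k, 'n, 'x) module_scheme \<Rightarrow> ('m list \<Rightarrow> 'n) \<Rightarrow> bool"
  where "multilinear_on_words k M N f \<longleftrightarrow> (\<forall>w\<in>lists (carrier M). f w \<in> carrier N) \<and>
    (\<forall>u\<in>lists (carrier M). \<forall>v\<in>lists (carrier M). linear_map k M N (\<lambda>x. f (u @ x # v)))"

locale tensor_alg = M: module k M
  for k :: "('k, 'z) ring_scheme" and M :: "('k, 'm, 'x) module_scheme"
begin

abbreviation "W \<equiv> lists (carrier M)"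
abbreviation "FW \<equiv> free_module k W"
abbreviation "T \<equiv> tensor_algebra k M"
abbreviation "wc \<equiv> word_class k M"

lemma module_M: "module k M" by (rule M.module_axioms)

interpretation F: module k FW by (rule M.R.free_module_module)

lemma word_gen_closed: "u \<in> W \<Longrightarrow> v \<in> W \<Longrightarrow> x \<in> carrier M \<Longrightarrow> free_gen k (u @ x # v) \<in> carrier FW"
  by (rule M.R.free_gen_closed) simp

lemma word_relations_subset: "word_relations k M \<subseteq> carrier FW"
  unfolding word_relations_def Let_def by (auto simp: word_gen_closed del: in_listsD in_listsI)

abbreviation "V \<equiv> quotient FW (word_null k M)"

lemma same_T_V: "same_module T V"
  by (simp add: same_module_def tensor_algebra_def Let_def)

lemma module_V: "module k V"
  unfolding word_null_def by (rule presented_module[OF M.R.is_cring word_relations_subset])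

lemma module_T: "module k T"
  by (rule same_module_module[OF same_T_V module_V])

lemmas T_simps = same_module_linear_dom[OF same_T_V] same_module_linear_cod[OF same_T_V] same_module_carrier[OF same_T_V]

lemma word_class_closed: "w \<in> W \<Longrightarrow> wc w \<in> carrier T"
  unfolding word_class_def T_simps(3) word_null_def by (rule presented_gen[OF M.R.is_cring word_relations_subset])

lemma word_class_multilinear: "multilinear_on_words k M T wc"
proof -
  have S: "submodule (word_null k M) k FW"
    unfolding word_null_def by (rule submodule_span(1)[OF F.module_axioms word_relations_subset])
  note pi = quotient_linear[OF F.module_axioms S]
  note rel = presented_rel[OF M.R.is_cring word_relations_subset, folded word_null_def]
  have 1: "wc (u @ (x \<oplus>\<^bsub>M\<^esub> y) # v) = wc (u @ x # v) \<oplus>\<^bsub>V\<^esub> wc (u @ y # v)"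
    if "u \<in> W" "v \<in> W" "x \<in> carrier M" "y \<in> carrier M" for u v x y
    unfolding word_class_def
    by (insert that, subst linear_add[OF pi, symmetric]; (rule rel)?)
      (auto simp: word_gen_closed word_relations_def Let_def del: in_listsD in_listsI)
  have 2: "wc (u @ (c \<odot>\<^bsub>M\<^esub> x) # v) = c \<odot>\<^bsub>V\<^esub> wc (u @ x # v)"
    if "u \<in> W" "v \<in> W" "x \<in> carrier M" "c \<in> carrier k" for u v x c
    unfolding word_class_def
    by (insert that, subst linear_smult[OF pi, symmetric]; (rule rel)?)
      (auto simp: word_gen_closed word_relations_def Let_def del: in_listsD in_listsI)
  show ?thesis
    unfolding multilinear_on_words_def
    using 1 2 word_class_closed by (auto simp: T_simps intro!: linear_mapI del: in_listsD in_listsI equalityI subsetI)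
qed

lemma word_induct:
  assumes "submodule U k T" "\<And>w. w \<in> W \<Longrightarrow> wc w \<in> U"
  shows "carrier T \<subseteq> U"
proof -
  have "submodule U k V"
    using assms(1) same_T_V by (simp add: submodule_def submodule_axioms_def same_module_def subgroup_def m_inv_def)
  then show ?thesis
    using presented_induct[OF M.R.is_cring word_relations_subset] assms(2)
    by (auto simp: T_simps word_class_def word_null_def)
qed

lemma word_eqI:
  assumes "module k N" "linear_map k T N L" "linear_map k T N L'"
    and "\<And>w. w \<in> W \<Longrightarrow> L (wc w) = L' (wc w)" and "t \<in> carrier T"
  shows "L t = L' t"
proof -
  have "carrier T \<subseteq> {x \<in> carrier T. L x = L' x}"
    by (rule word_induct[OF equalizer_submodule[OF module_T assms(1-3)]]) (use assms(4) word_class_closed in auto)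
  then show ?thesis using assms(5) by blast
qed

context
  fixes N :: "('k, 'n, 'w) module_scheme" and f
  assumes N: "module k N" and f: "multilinear_on_words k M N f"
begin

interpretation N: module k N by (rule N)

lemma word_lift_kill:
  assumes "r \<in> word_relations k M"
  shows "free_lift k N f r = \<zero>\<^bsub>N\<^esub>"
proof -
  have fc: "w \<in> W \<Longrightarrow> f w \<in> carrier N" for w using f by (auto simp: multilinear_on_words_def)
  have fl: "u \<in> W \<Longrightarrow> v \<in> W \<Longrightarrow> linear_map k M N (\<lambda>x. f (u @ x # v))" for u v
    using f by (auto simp: multilinear_on_words_def)
  note lin = M.R.free_lift_linear[OF N fc] and gen = M.R.free_lift_gen[OF N fc]
  note simps = linear_minus[OF F.module_axioms N lin] linear_add[OF lin] linear_smult[OF lin] gen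
    linear_add[OF fl] linear_smult[OF fl] fc M.R.free_gen_closed a_minus_def[of N] N.M.r_neg
  show ?thesis
    using assms unfolding word_relations_def Let_def by (auto simp: simps word_gen_closed del: in_listsD in_listsI)
qed

lemma word_lift_linear: "linear_map k T N (coset_lift k N f)"
  unfolding T_simps word_null_def
  by (rule presented_lift_linear[OF M.R.is_cring word_relations_subset N])
    (use f word_lift_kill in \<open>auto simp: multilinear_on_words_def\<close>)

lemma word_lift_class: "w \<in> W \<Longrightarrow> coset_lift k N f (wc w) = f w"
  unfolding word_class_def word_null_def
  by (rule presented_lift_gen[OF M.R.is_cring word_relations_subset N])
    (use f word_lift_kill in \<open>auto simp: multilinear_on_words_def\<close>)

end

lemma word_lift_param:
  assumes N: "module k N" and X: "module k X"
    and lin: "\<And>w. w \<in> W \<Longrightarrow> linear_map k X N (\<lambda>x. f x w)"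
    and mul: "\<And>x. x \<in> carrier X \<Longrightarrow> multilinear_on_words k M N (f x)"
    and t: "t \<in> carrier T"
  shows "linear_map k X N (\<lambda>x. coset_lift k N (f x) t)"
proof (rule linear_mapI)
  interpret N: module k N by (rule N)
  interpret X: module k X by (rule X)
  note TL = word_lift_linear[OF N] and cl = word_lift_class[OF N]
  fix x assume x: "x \<in> carrier X"
  show "coset_lift k N (f x) t \<in> carrier N"
    by (rule linear_closed[OF TL[OF mul[OF x]] t])
  show "coset_lift k N (f (c \<odot>\<^bsub>X\<^esub> x)) t = c \<odot>\<^bsub>N\<^esub> coset_lift k N (f x) t" if c: "c \<in> carrier k" for c
    by (rule word_eqI[OF N TL[OF mul] linear_scale[OF N TL[OF mul[OF x]] c] _ t])
      (use x c in \<open>auto simp: cl[OF mul] linear_smult[OF lin]\<close>)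
  fix y assume y: "y \<in> carrier X"
  show "coset_lift k N (f (x \<oplus>\<^bsub>X\<^esub> y)) t = coset_lift k N (f x) t \<oplus>\<^bsub>N\<^esub> coset_lift k N (f y) t"
    by (rule word_eqI[OF N TL[OF mul] linear_sum[OF N TL[OF mul[OF x]] TL[OF mul[OF y]]] _ t])
      (use x y in \<open>auto simp: cl[OF mul] linear_add[OF lin]\<close>)
qed

lemma multilinear_wc_append: "u \<in> W \<Longrightarrow> multilinear_on_words k M V (\<lambda>v. wc (u @ v))"
  using word_class_multilinear unfolding multilinear_on_words_def T_simps
  by (auto simp flip: append_assoc)

lemma mult_T: "a \<otimes>\<^bsub>T\<^esub> b = coset_lift k V (\<lambda>u. coset_lift k V (\<lambda>v. wc (u @ v)) b) a"
  by (simp add: tensor_algebra_def Let_def)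

lemma one_T: "\<one>\<^bsub>T\<^esub> = wc []"
  by (simp add: tensor_algebra_def Let_def)

lemma multilinear_mult:
  assumes b: "b \<in> carrier T"
  shows "multilinear_on_words k M V (\<lambda>u. coset_lift k V (\<lambda>v. wc (u @ v)) b)"
proof -
  have "linear_map k M V (\<lambda>x. coset_lift k V (\<lambda>v. wc ((p @ x # q) @ v)) b)" if pq: "p \<in> W" "q \<in> W" for p q
  proof (rule word_lift_param[OF module_V module_M _ _ b])
    show "linear_map k M V (\<lambda>x. wc ((p @ x # q) @ w))" if "w \<in> W" for w
      using word_class_multilinear pq that by (simp add: multilinear_on_words_def T_simps)
    show "multilinear_on_words k M V (\<lambda>v. wc ((p @ x # q) @ v))" if "x \<in> carrier M" for x
      by (rule multilinear_wc_append) (use pq that in auto)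
  qed
  then show ?thesis
    using linear_closed[OF word_lift_linear[OF module_V multilinear_wc_append] b]
    by (auto simp: multilinear_on_words_def)
qed

lemma mult_word_class:
  assumes "u \<in> W" "v \<in> W" shows "wc u \<otimes>\<^bsub>T\<^esub> wc v = wc (u @ v)"
  unfolding mult_T
  using word_lift_class[OF module_V multilinear_mult[OF word_class_closed[OF assms(2)]] assms(1)]
    word_lift_class[OF module_V multilinear_wc_append[OF assms(1)] assms(2)] by simp

lemma T_mult_bilinear: "bilinear_map k T T T (mult T)"
proof (rule bilinearI)
  fix b assume b: "b \<in> carrier T"
  show "linear_map k T T (\<lambda>a. a \<otimes>\<^bsub>T\<^esub> b)"
    using word_lift_linear[OF module_V multilinear_mult[OF b]]
    by (simp add: mult_T same_module_linear_cod[OF same_T_V])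
next
  fix a assume a: "a \<in> carrier T"
  have "linear_map k T V (\<lambda>b. coset_lift k V (\<lambda>u. coset_lift k V (\<lambda>v. wc (u @ v)) b) a)"
    by (rule word_lift_param[OF module_V module_T _ _ a])
      (auto intro: word_lift_linear[OF module_V multilinear_wc_append] multilinear_mult)
  then show "linear_map k T T (\<lambda>b. a \<otimes>\<^bsub>T\<^esub> b)"
    by (simp add: mult_T same_module_linear_cod[OF same_T_V])
qed

lemmas T_mult_rules = bilinear_in_left[OF T_mult_bilinear] bilinear_in_right[OF T_mult_bilinear]
  bilinear_closed[OF T_mult_bilinear]

lemma T_algebra: "k_algebra k T"
proof (rule k_algebraI[OF module_T T_mult_bilinear])
  show one: "\<one>\<^bsub>T\<^esub> \<in> carrier T" by (simp add: one_T word_class_closed)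
  show "\<one>\<^bsub>T\<^esub> \<otimes>\<^bsub>T\<^esub> a = a" if "a \<in> carrier T" for a
    by (rule word_eqI[OF module_T bilinear_right[OF T_mult_bilinear one] linear_id _ that])
      (simp add: one_T mult_word_class)
  show "a \<otimes>\<^bsub>T\<^esub> \<one>\<^bsub>T\<^esub> = a" if "a \<in> carrier T" for a
    by (rule word_eqI[OF module_T bilinear_left[OF T_mult_bilinear one] linear_id _ that])
      (simp add: one_T mult_word_class)
  fix a b c assume abc: "a \<in> carrier T" "b \<in> carrier T" "c \<in> carrier T"
  have 1: "wc u \<otimes>\<^bsub>T\<^esub> wc v \<otimes>\<^bsub>T\<^esub> c = wc u \<otimes>\<^bsub>T\<^esub> (wc v \<otimes>\<^bsub>T\<^esub> c)" if "u \<in> W" "v \<in> W" for u v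
    by (rule word_eqI[OF module_T _ _ _ abc(3), of "\<lambda>c. wc u \<otimes>\<^bsub>T\<^esub> wc v \<otimes>\<^bsub>T\<^esub> c"])
      (rule T_mult_rules linear_id word_class_closed that | simp add: mult_word_class that)+
  have 2: "wc u \<otimes>\<^bsub>T\<^esub> b \<otimes>\<^bsub>T\<^esub> c = wc u \<otimes>\<^bsub>T\<^esub> (b \<otimes>\<^bsub>T\<^esub> c)" if "u \<in> W" for u
    by (rule word_eqI[OF module_T _ _ _ abc(2), of "\<lambda>b. wc u \<otimes>\<^bsub>T\<^esub> b \<otimes>\<^bsub>T\<^esub> c"])
      (rule T_mult_rules linear_id word_class_closed that abc 1 | assumption)+
  show "a \<otimes>\<^bsub>T\<^esub> b \<otimes>\<^bsub>T\<^esub> c = a \<otimes>\<^bsub>T\<^esub> (b \<otimes>\<^bsub>T\<^esub> c)"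
    by (rule word_eqI[OF module_T _ _ _ abc(1), of "\<lambda>a. a \<otimes>\<^bsub>T\<^esub> b \<otimes>\<^bsub>T\<^esub> c"])
      (rule T_mult_rules linear_id word_class_closed abc 2 | assumption)+
qed

text \<open>Left multiplication by a generator. The pair of \<open>\<one>\<close> and this operation
  makes \<open>T(M)\<close> the free module with a distinguished point and a bilinear operation of
  \<open>M\<close>; the remaining lemmas on the tensor algebra spell this out.\<close>

definition "act x t = wc [x] \<otimes>\<^bsub>T\<^esub> t"

lemma wc_Cons: "x \<in> carrier M \<Longrightarrow> w \<in> W \<Longrightarrow> wc (x # w) = act x (wc w)"
  unfolding act_def by (subst mult_word_class) auto

lemma act_bilinear: "bilinear_map k M T T act"
proof -
  have "linear_map k M T (\<lambda>x. wc ([] @ x # []))"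
    using word_class_multilinear unfolding multilinear_on_words_def by blast
  then have "linear_map k M T (\<lambda>x. wc [x])" by simp
  then show ?thesis
    unfolding act_def
    by (intro bilinearI bilinear_in_left[OF T_mult_bilinear] bilinear_right[OF T_mult_bilinear])
      (auto intro: word_class_closed)
qed

text \<open>The set where \<open>L\<close> and \<open>L'\<close> agree is a submodule that contains
  \<open>\<one>\<close> and is stable under left multiplication by generators, hence contains all words.\<close>

lemma act_eqI:
  assumes N: "module k N" and L: "linear_map k T N L" "linear_map k T N L'"
    and one: "L \<one>\<^bsub>T\<^esub> = L' \<one>\<^bsub>T\<^esub>"
    and step: "\<And>x t. \<lbrakk>x \<in> carrier M; t \<in> carrier T; L t = L' t\<rbrakk> \<Longrightarrow> L (act x t) = L' (act x t)"
    and t: "t \<in> carrier T"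
  shows "L t = L' t"
proof (rule word_eqI[OF N L _ t])
  fix w assume "w \<in> W"
  then show "L (wc w) = L' (wc w)"
    by (induction w) (use one step word_class_closed in \<open>auto simp: one_T wc_Cons\<close>)
qed

context
  fixes N :: "('k, 'n, 'w) module_scheme" and B n0
  assumes N: "module k N" and B: "bilinear_map k M N N B" and n0: "n0 \<in> carrier N"
begin

text \<open>Iterating \<open>B\<close> along a word gives the linear map out of \<open>T(M)\<close> with
  \<open>\<one> \<mapsto> n0\<close> and \<open>x t \<mapsto> B x t'\<close>, where \<open>t'\<close> is
  the image of \<open>t\<close>.\<close>

lemma foldr_multilinear: "multilinear_on_words k M N (\<lambda>w. foldr B w n0)"
proof -
  have c: "foldr B w n0 \<in> carrier N" if "w \<in> W" for w
    using that by (induction w) (auto simp: n0 bilinear_closed[OF B])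
  have "linear_map k M N (\<lambda>x. foldr B (u @ x # v) n0)" if "u \<in> W" "v \<in> W" for u v
    using that
  proof (induction u)
    case Nil then show ?case using bilinear_left[OF B c] by simp
  next
    case (Cons a u) then show ?case using bilinear_in_right[OF B] by simp
  qed
  with c show ?thesis by (simp add: multilinear_on_words_def)
qed

lemma fold_linear: "linear_map k T N (coset_lift k N (\<lambda>w. foldr B w n0))"
  by (rule word_lift_linear[OF N foldr_multilinear])

lemma fold_one: "coset_lift k N (\<lambda>w. foldr B w n0) \<one>\<^bsub>T\<^esub> = n0"
  unfolding one_T by (subst word_lift_class[OF N foldr_multilinear]) auto

lemma fold_act:
  assumes x: "x \<in> carrier M" and t: "t \<in> carrier T"
  shows "coset_lift k N (\<lambda>w. foldr B w n0) (act x t) = B x (coset_lift k N (\<lambda>w. foldr B w n0) t)"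
  by (rule word_eqI[OF N linear_comp[OF fold_linear bilinear_right[OF act_bilinear x]]
        bilinear_in_right[OF B fold_linear x] _ t])
    (use x in \<open>simp add: word_lift_class[OF N foldr_multilinear] flip: wc_Cons\<close>)

end

end

section \<open>The coaction on the tensor algebra\<close>

text \<open>The bialgebra and the comodule enter as separate assumptions, so that the locale may be
  interpreted a second time with the twisted bialgebra and the same comodule.\<close>

locale tensor_coaction = H: bialgebra k H + Mc: coaction k H M "coact M"
  for k :: "('k, 'z) ring_scheme" and H :: "('k, 'h, 'y) coalgebra_scheme"
    and M :: "('k, 'h, 'm, 'x) comodule_scheme"
begin

sublocale tensor_alg k M
  by (rule tensor_alg.intro[OF Mc.A.module_axioms])

interpretation T: k_algebra k T by (rule T_algebra)
interpretation Hs: coaction_algebra k H H "comult H" by (rule H.self_coaction_algebra)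

abbreviation "HT \<equiv> tensor k H T"
abbreviation "pureT \<equiv> pure_tensor k H T"

definition "\<delta>T = coset_lift k HT (word_coact k H M)"

lemma module_HT: "module k HT" by (rule tensor_module[OF Mc.H module_T])

lemmas H_mult = bilinear_in_left[OF H.mult_bilinear] bilinear_in_right[OF H.mult_bilinear] bilinear_closed[OF H.mult_bilinear]
lemmas act_rules = bilinear_in_left[OF act_bilinear] bilinear_in_right[OF act_bilinear] bilinear_closed[OF act_bilinear]
lemmas pureT_rules = bilinear_in_left[OF pure_tensor_bilinear[OF Mc.H module_T]]
  bilinear_in_right[OF pure_tensor_bilinear[OF Mc.H module_T]] bilinear_closed[OF pure_tensor_bilinear[OF Mc.H module_T]]
lemmas t_rules = Mc.H_rules module_T H_mult act_rules T_mult_rules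

text \<open>The operation of \<open>M\<close> on \<open>H \<otimes> T(M)\<close> that corresponds under
  the coaction to left multiplication by a generator.\<close>

definition "prepend x s = tensor_lift k HT (\<lambda>h x0. tensor_lift k HT (\<lambda>g t0. pureT (h \<otimes>\<^bsub>H\<^esub> g) (act x0 t0)) s) (coact M x)"

lemma prepend_bilinear: "bilinear_map k M HT HT prepend"
  unfolding prepend_def by (assumption | rule t_rules pureT_rules)+

lemma one_HT: "pureT \<one>\<^bsub>H\<^esub> \<one>\<^bsub>T\<^esub> \<in> carrier HT"
  by (intro pureT_rules) simp_all

lemma word_coact_foldr: "word_coact k H M = (\<lambda>w. foldr prepend w (pureT \<one>\<^bsub>H\<^esub> \<one>\<^bsub>T\<^esub>))"
proof
  show "word_coact k H M w = foldr prepend w (pureT \<one>\<^bsub>H\<^esub> \<one>\<^bsub>T\<^esub>)" for w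
    by (induction w) (simp_all add: prepend_def act_def)
qed

lemma \<delta>T_linear: "linear_map k T HT \<delta>T"
  unfolding \<delta>T_def word_coact_foldr by (rule fold_linear[OF module_HT prepend_bilinear one_HT])

lemma \<delta>T_one: "\<delta>T \<one>\<^bsub>T\<^esub> = pureT \<one>\<^bsub>H\<^esub> \<one>\<^bsub>T\<^esub>"
  unfolding \<delta>T_def word_coact_foldr by (rule fold_one[OF module_HT prepend_bilinear one_HT])

lemma \<delta>T_act: "x \<in> carrier M \<Longrightarrow> t \<in> carrier T \<Longrightarrow> \<delta>T (act x t) = prepend x (\<delta>T t)"
  unfolding \<delta>T_def word_coact_foldr by (rule fold_act[OF module_HT prepend_bilinear one_HT])

sublocale Tm: comodule_map k H T \<delta>T
  by (rule comodule_map.intro[OF Mc.H module_T Mc.comult \<delta>T_linear])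

sublocale MT: comodule_map_pair k H M "coact M" T \<delta>T ..

lemma \<delta>T_closed: "t \<in> carrier T \<Longrightarrow> \<delta>T t \<in> carrier HT"
  by (rule linear_closed[OF \<delta>T_linear])

lemma lift_act:
  assumes N: "module k N" and f: "bilinear_map k H T N f" and x: "x \<in> carrier M" and t: "t \<in> carrier T"
  shows "tensor_lift k N f (\<delta>T (act x t)) =
    tensor_lift k N (\<lambda>h x0. tensor_lift k N (\<lambda>g t0. f (h \<otimes>\<^bsub>H\<^esub> g) (act x0 t0)) (\<delta>T t)) (coact M x)"
proof -
  note R = t_rules pureT_rules Tm.H_rules x t
  note L = tensor_lift_linear[OF Mc.H module_T N f]
  have "tensor_lift k N f (\<delta>T (act x t)) = tensor_lift k N (\<lambda>h x0. tensor_lift k N f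
      (tensor_lift k HT (\<lambda>g t0. pureT (h \<otimes>\<^bsub>H\<^esub> g) (act x0 t0)) (\<delta>T t))) (coact M x)"
    unfolding \<delta>T_act[OF x t] prepend_def
    by (rule tensor_lift_comp[OF Mc.H Mc.A module_HT N L]) (assumption | rule R)+
  also have "\<dots> = tensor_lift k N (\<lambda>h x0. tensor_lift k N (\<lambda>g t0. tensor_lift k N f (pureT (h \<otimes>\<^bsub>H\<^esub> g) (act x0 t0))) (\<delta>T t)) (coact M x)"
    by (rule tensor_ext[OF Mc.H Mc.A] tensor_lift_comp[OF Mc.H module_T module_HT N L] | assumption | rule R)+
  also have "\<dots> = tensor_lift k N (\<lambda>h x0. tensor_lift k N (\<lambda>g t0. f (h \<otimes>\<^bsub>H\<^esub> g) (act x0 t0)) (\<delta>T t)) (coact M x)"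
    by (rule tensor_ext[OF Mc.H Mc.A] tensor_ext[OF Mc.H module_T] tensor_lift_pure[OF Mc.H module_T N f] | assumption | rule R)+
  finally show ?thesis .
qed

text \<open>The first pairing of \<open>H \<otimes> H\<close> with \<open>T(M)\<close> is the
  associativity isomorphism, written as a lift.\<close>

lemma tensor_HT_assoc_pairings:
  "associative_pairings k H H T (tensor k H H) HT (tensor k H HT) (pure_tensor k H H)
    (\<lambda>s t. tensor_lift k (tensor k H HT) (\<lambda>h1 h2. pure_tensor k H HT h1 (pureT h2 t)) s)
    pureT (pure_tensor k H HT)"
proof -
  note p = pure_tensor_bilinear[OF Mc.H module_HT]
  note R = t_rules pureT_rules bilinear_in_left[OF p] bilinear_in_right[OF p] module_HT bilinear_closed[OF p]
  have b: "bilinear_map k H H (tensor k H HT) (\<lambda>h1 h2. pure_tensor k H HT h1 (pureT h2 t))" if "t \<in> carrier T" for t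
    by (insert that, (assumption | rule R)+)
  have "pairing k (tensor k H H) T (tensor k H HT)
    (\<lambda>s t. tensor_lift k (tensor k H HT) (\<lambda>h1 h2. pure_tensor k H HT h1 (pureT h2 t)) s)"
    unfolding pairing_def
    by (intro conjI module_T tensor_module[OF Mc.H] module_HT Mc.H) (assumption | rule R)+
  then show ?thesis
    unfolding associative_pairings_def
    by (auto intro: pairing_pure Mc.H module_T module_HT
        simp: tensor_lift_pure[OF Mc.H Mc.H tensor_module[OF Mc.H module_HT] b])
qed

text \<open>By induction along left multiplication by generators. The induction step is the
  associativity of the convolution of the two multiplications of \<open>H\<close>, inside
  \<open>\<Delta>(h g) = \<Delta>(h) \<Delta>(g)\<close>, with left multiplication by generators.\<close>

lemma \<delta>T_coassoc:
  assumes "t \<in> carrier T" shows "coassociative_at k H T \<delta>T t"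
  unfolding coassociative_at_def
proof (rule act_eqI[OF tensor_module[OF Mc.H module_HT] _ _ _ _ assms])
  let ?N = "tensor k H HT"
  note N = tensor_module[OF Mc.H module_HT]
  note p = pure_tensor_bilinear[OF Mc.H module_HT]
  note R = t_rules pureT_rules Tm.H_rules bilinear_in_left[OF p] bilinear_in_right[OF p] module_HT N bilinear_closed[OF p]
  have b1: "bilinear_map k H T ?N (\<lambda>h a0. tensor_lift k ?N (\<lambda>h1 h2. pure_tensor k H HT h1 (pureT h2 a0)) (comult H h))"
    by (assumption | rule R)+
  have b2: "bilinear_map k H T ?N (\<lambda>h a0. pure_tensor k H HT h (\<delta>T a0))"
    by (assumption | rule R)+
  have b3: "bilinear_map k H H ?N (\<lambda>h1 h2. pure_tensor k H HT h1 (pureT h2 t))" if "t \<in> carrier T" for t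
    by (insert that, (assumption | rule R)+)
  show "linear_map k T ?N (\<lambda>t. tensor_lift k ?N (\<lambda>h a0. tensor_lift k ?N (\<lambda>h1 h2. pure_tensor k H HT h1 (pureT h2 a0)) (comult H h)) (\<delta>T t))"
    by (rule linear_comp[OF tensor_lift_linear[OF Mc.H module_T N b1] \<delta>T_linear])
  show "linear_map k T ?N (\<lambda>t. tensor_lift k ?N (\<lambda>h a0. pure_tensor k H HT h (\<delta>T a0)) (\<delta>T t))"
    by (rule linear_comp[OF tensor_lift_linear[OF Mc.H module_T N b2] \<delta>T_linear])
  show "tensor_lift k ?N (\<lambda>h a0. tensor_lift k ?N (\<lambda>h1 h2. pure_tensor k H HT h1 (pureT h2 a0)) (comult H h)) (\<delta>T \<one>\<^bsub>T\<^esub>)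
    = tensor_lift k ?N (\<lambda>h a0. pure_tensor k H HT h (\<delta>T a0)) (\<delta>T \<one>\<^bsub>T\<^esub>)"
    by (simp add: \<delta>T_one tensor_lift_pure[OF Mc.H module_T N b1] tensor_lift_pure[OF Mc.H module_T N b2]
        H.comult_one tensor_lift_pure[OF Mc.H Mc.H N b3])
  fix x t assume x: "x \<in> carrier M" and t: "t \<in> carrier T"
  assume "tensor_lift k ?N (\<lambda>h a0. tensor_lift k ?N (\<lambda>h1 h2. pure_tensor k H HT h1 (pureT h2 a0)) (comult H h)) (\<delta>T t)
    = tensor_lift k ?N (\<lambda>h a0. pure_tensor k H HT h (\<delta>T a0)) (\<delta>T t)"
  then have IH: "coassociative_at k H T \<delta>T t" by (simp add: coassociative_at_def)
  let ?p = "\<lambda>s t. tensor_lift k ?N (\<lambda>h1 h2. pure_tensor k H HT h1 (pureT h2 t)) s"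
  have "tensor_lift k ?N (\<lambda>h a0. ?p (comult H h) a0) (\<delta>T (act x t))
    = conv2 k ?N (coact M) \<delta>T ?p (\<lambda>h g. comult H (h \<otimes>\<^bsub>H\<^esub> g)) act x t"
    unfolding lift_act[OF N b1 x t] by (simp add: conv2_def conv1_def)
  also have "\<dots> = conv2 k ?N (coact M) \<delta>T ?p (conv2 k (tensor k H H) (comult H) (comult H) (pure_tensor k H H) (mult H) (mult H)) act x t"
    unfolding conv2_def[of k ?N] conv1_def[of k ?N]
    by (rule tensor_ext[OF Mc.H Mc.A] tensor_ext[OF Mc.H module_T])+
      (simp_all add: H.comult_mult conv2_def conv1_def \<delta>T_closed t Mc.coaction_closed x)
  also have "\<dots> = conv2 k ?N (coact M) \<delta>T (pure_tensor k H HT) (mult H) (conv2 k HT (coact M) \<delta>T pureT (mult H) act) x t"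
    by (rule MT.conv2_assoc[OF Mc.coaction_coassoc[OF x] x IH t tensor_HT_assoc_pairings
          H.mult_bilinear H.mult_bilinear act_bilinear])
  also have "\<dots> = conv2 k ?N (coact M) \<delta>T (pure_tensor k H HT) (mult H) (\<lambda>x t. \<delta>T (act x t)) x t"
    unfolding conv2_def[of k ?N] conv1_def[of k ?N]
    by (rule tensor_ext[OF Mc.H Mc.A] tensor_ext[OF Mc.H module_T])+
      (simp_all add: \<delta>T_act prepend_def conv2_def conv1_def \<delta>T_closed t Mc.coaction_closed x)
  also have "\<dots> = tensor_lift k ?N (\<lambda>h a0. pure_tensor k H HT h (\<delta>T a0)) (\<delta>T (act x t))"
    unfolding lift_act[OF N b2 x t] by (simp add: conv2_def conv1_def)
  finally show "tensor_lift k ?N (\<lambda>h a0. ?p (comult H h) a0) (\<delta>T (act x t)) = \<dots>" .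
qed

lemma \<delta>T_counit:
  assumes "t \<in> carrier T" shows "tensor_lift k T (\<lambda>h t0. counit H h \<odot>\<^bsub>T\<^esub> t0) (\<delta>T t) = t"
proof (rule act_eqI[OF module_T _ linear_id _ _ assms])
  note ps = pairing_smult[OF module_T]
  note R = t_rules Tm.H_rules linear_comp[OF H.counit_linear] linear_closed[OF H.counit_linear]
    bilinear_in_left[OF pairingD(4)[OF ps]] bilinear_in_right[OF pairingD(4)[OF ps]] bilinear_closed[OF pairingD(4)[OF ps]]
  have b: "bilinear_map k H T T (\<lambda>h t0. counit H h \<odot>\<^bsub>T\<^esub> t0)"
    by (assumption | rule R)+
  show "linear_map k T T (\<lambda>t. tensor_lift k T (\<lambda>h t0. counit H h \<odot>\<^bsub>T\<^esub> t0) (\<delta>T t))"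
    by (rule linear_comp[OF tensor_lift_linear[OF Mc.H module_T module_T b] \<delta>T_linear])
  show "tensor_lift k T (\<lambda>h t0. counit H h \<odot>\<^bsub>T\<^esub> t0) (\<delta>T \<one>\<^bsub>T\<^esub>) = \<one>\<^bsub>T\<^esub>"
    by (simp add: \<delta>T_one tensor_lift_pure[OF Mc.H module_T module_T b] H.counit_one)
  fix x t assume x: "x \<in> carrier M" and t: "t \<in> carrier T"
    and IH: "tensor_lift k T (\<lambda>h t0. counit H h \<odot>\<^bsub>T\<^esub> t0) (\<delta>T t) = t"
  have c: "linear_map k T T (\<lambda>u. c \<odot>\<^bsub>T\<^esub> act y u)" if "c \<in> carrier k" "y \<in> carrier M" for c y
    by (rule linear_scale[OF module_T bilinear_right[OF act_bilinear that(2)] that(1)])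
  have bM: "bilinear_map k H M M (\<lambda>h x0. counit H h \<odot>\<^bsub>M\<^esub> x0)"
    by (assumption | rule R bilinear_in_left[OF pairingD(4)[OF pairing_smult[OF Mc.A]]]
        bilinear_in_right[OF pairingD(4)[OF pairing_smult[OF Mc.A]]])+
  have "tensor_lift k T (\<lambda>h t0. counit H h \<odot>\<^bsub>T\<^esub> t0) (\<delta>T (act x t))
    = tensor_lift k T (\<lambda>h x0. act (counit H h \<odot>\<^bsub>M\<^esub> x0) t) (coact M x)"
    unfolding lift_act[OF module_T b x t]
  proof (rule tensor_ext[OF Mc.H Mc.A _ Mc.coaction_closed[OF x]])
    fix h x0 assume h: "h \<in> carrier H" "x0 \<in> carrier M"
    have "tensor_lift k T (\<lambda>g t0. counit H (h \<otimes>\<^bsub>H\<^esub> g) \<odot>\<^bsub>T\<^esub> act x0 t0) (\<delta>T t)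
      = tensor_lift k T (\<lambda>g t0. counit H h \<odot>\<^bsub>T\<^esub> act x0 (counit H g \<odot>\<^bsub>T\<^esub> t0)) (\<delta>T t)"
      by (rule tensor_ext[OF Mc.H module_T _ \<delta>T_closed[OF t]])
        (use h in \<open>simp add: H.counit_mult Mc.counit_closed T.smult_assoc1 bilinear_closed[OF act_bilinear]
          linear_smult[OF bilinear_right[OF act_bilinear]]\<close>)
    also have "\<dots> = counit H h \<odot>\<^bsub>T\<^esub> act x0 (tensor_lift k T (\<lambda>g t0. counit H g \<odot>\<^bsub>T\<^esub> t0) (\<delta>T t))"
      by (rule tensor_lift_comp[OF Mc.H module_T module_T module_T c[OF Mc.counit_closed[OF h(1)] h(2)] b \<delta>T_closed[OF t], symmetric])
    also have "\<dots> = act (counit H h \<odot>\<^bsub>M\<^esub> x0) t"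
      using h t by (simp add: IH linear_smult[OF bilinear_left[OF act_bilinear]] Mc.counit_closed)
    finally show "tensor_lift k T (\<lambda>g t0. counit H (h \<otimes>\<^bsub>H\<^esub> g) \<odot>\<^bsub>T\<^esub> act x0 t0) (\<delta>T t) = \<dots>" .
  qed
  also have "\<dots> = act (tensor_lift k M (\<lambda>h x0. counit H h \<odot>\<^bsub>M\<^esub> x0) (coact M x)) t"
    by (rule tensor_lift_comp[OF Mc.H Mc.A Mc.A module_T bilinear_left[OF act_bilinear t] bM Mc.coaction_closed[OF x], symmetric])
  finally show "tensor_lift k T (\<lambda>h t0. counit H h \<odot>\<^bsub>T\<^esub> t0) (\<delta>T (act x t)) = act x t"
    by (simp add: Mc.coaction_counit x)
qed

lemma act_mult: "x \<in> carrier M \<Longrightarrow> t \<in> carrier T \<Longrightarrow> s \<in> carrier T \<Longrightarrow> act x t \<otimes>\<^bsub>T\<^esub> s = act x (t \<otimes>\<^bsub>T\<^esub> s)"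
  by (simp add: act_def T.m_assoc word_class_closed)

lemma \<delta>T_mult:
  assumes a: "a \<in> carrier T" and b: "b \<in> carrier T"
  shows "\<delta>T (a \<otimes>\<^bsub>T\<^esub> b) = tensor_lift k HT (\<lambda>h a0. tensor_lift k HT (\<lambda>g b0. pureT (h \<otimes>\<^bsub>H\<^esub> g) (a0 \<otimes>\<^bsub>T\<^esub> b0)) (\<delta>T b)) (\<delta>T a)"
proof (rule act_eqI[OF module_HT _ _ _ _ a])
  note R = t_rules pureT_rules Tm.H_rules b module_HT
  have bil: "bilinear_map k H T HT (\<lambda>h a0. tensor_lift k HT (\<lambda>g b0. pureT (h \<otimes>\<^bsub>H\<^esub> g) (a0 \<otimes>\<^bsub>T\<^esub> b0)) (\<delta>T b))"
    by (assumption | rule R)+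
  show "linear_map k T HT (\<lambda>a. \<delta>T (a \<otimes>\<^bsub>T\<^esub> b))"
    by (assumption | rule R)+
  show "linear_map k T HT (\<lambda>a. tensor_lift k HT (\<lambda>h a0. tensor_lift k HT (\<lambda>g b0. pureT (h \<otimes>\<^bsub>H\<^esub> g) (a0 \<otimes>\<^bsub>T\<^esub> b0)) (\<delta>T b)) (\<delta>T a))"
    by (rule linear_comp[OF tensor_lift_linear[OF Mc.H module_T module_HT bil] \<delta>T_linear])
  have "tensor_lift k HT (\<lambda>g b0. pureT (\<one>\<^bsub>H\<^esub> \<otimes>\<^bsub>H\<^esub> g) (\<one>\<^bsub>T\<^esub> \<otimes>\<^bsub>T\<^esub> b0)) (\<delta>T b) = tensor_lift k HT pureT (\<delta>T b)"
    by (rule tensor_ext[OF Mc.H module_T _ \<delta>T_closed[OF b]]) simp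
  then show "\<delta>T (\<one>\<^bsub>T\<^esub> \<otimes>\<^bsub>T\<^esub> b) = tensor_lift k HT (\<lambda>h a0. tensor_lift k HT (\<lambda>g b0. pureT (h \<otimes>\<^bsub>H\<^esub> g) (a0 \<otimes>\<^bsub>T\<^esub> b0)) (\<delta>T b)) (\<delta>T \<one>\<^bsub>T\<^esub>)"
    using b by (simp add: \<delta>T_one tensor_lift_pure[OF Mc.H module_T module_HT bil] tensor_lift_pure_id[OF Mc.H module_T] \<delta>T_closed)
  fix x t assume x: "x \<in> carrier M" and t: "t \<in> carrier T"
    and IH: "\<delta>T (t \<otimes>\<^bsub>T\<^esub> b) = tensor_lift k HT (\<lambda>h a0. tensor_lift k HT (\<lambda>g b0. pureT (h \<otimes>\<^bsub>H\<^esub> g) (a0 \<otimes>\<^bsub>T\<^esub> b0)) (\<delta>T b)) (\<delta>T t)"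
  have tb: "t \<otimes>\<^bsub>T\<^esub> b \<in> carrier T" using t b by simp
  have L: "linear_map k HT HT (tensor_lift k HT (\<lambda>g u. pureT (h \<otimes>\<^bsub>H\<^esub> g) (act x0 u)))"
    if "h \<in> carrier H" "x0 \<in> carrier M" for h x0
    by (rule tensor_lift_linear[OF Mc.H module_T module_HT]) (insert that, (assumption | rule R)+)
  have in1: "bilinear_map k H T HT (\<lambda>g u. pureT (h \<otimes>\<^bsub>H\<^esub> g) (act x0 u))" if "h \<in> carrier H" "x0 \<in> carrier M" for h x0
    by (insert that, (assumption | rule R)+)
  have "\<delta>T (act x t \<otimes>\<^bsub>T\<^esub> b) = tensor_lift k HT (\<lambda>h x0. tensor_lift k HT (\<lambda>g u. pureT (h \<otimes>\<^bsub>H\<^esub> g) (act x0 u))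
    (tensor_lift k HT (\<lambda>h a0. tensor_lift k HT (\<lambda>g b0. pureT (h \<otimes>\<^bsub>H\<^esub> g) (a0 \<otimes>\<^bsub>T\<^esub> b0)) (\<delta>T b)) (\<delta>T t))) (coact M x)"
    by (simp add: act_mult[OF x t b] \<delta>T_act[OF x tb] prepend_def IH)
  also have "\<dots> = tensor_lift k HT (\<lambda>h x0. tensor_lift k HT (\<lambda>g t0. tensor_lift k HT (\<lambda>g u. pureT (h \<otimes>\<^bsub>H\<^esub> g) (act x0 u))
    (tensor_lift k HT (\<lambda>l b0. pureT (g \<otimes>\<^bsub>H\<^esub> l) (t0 \<otimes>\<^bsub>T\<^esub> b0)) (\<delta>T b))) (\<delta>T t)) (coact M x)"
    by (rule tensor_ext[OF Mc.H Mc.A] tensor_lift_comp[OF Mc.H module_T module_HT module_HT L] bil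
        Mc.coaction_closed \<delta>T_closed x t | assumption)+
  also have "\<dots> = tensor_lift k HT (\<lambda>h x0. tensor_lift k HT (\<lambda>g t0.
    (tensor_lift k HT (\<lambda>l b0. tensor_lift k HT (\<lambda>g u. pureT (h \<otimes>\<^bsub>H\<^esub> g) (act x0 u)) (pureT (g \<otimes>\<^bsub>H\<^esub> l) (t0 \<otimes>\<^bsub>T\<^esub> b0))) (\<delta>T b))) (\<delta>T t)) (coact M x)"
    by (rule tensor_ext[OF Mc.H Mc.A] tensor_ext[OF Mc.H module_T] tensor_lift_comp[OF Mc.H module_T module_HT module_HT L]
        Mc.coaction_closed \<delta>T_closed x t | assumption | rule R)+
  also have "\<dots> = tensor_lift k HT (\<lambda>h x0. tensor_lift k HT (\<lambda>g t0.
    (tensor_lift k HT (\<lambda>l b0. pureT ((h \<otimes>\<^bsub>H\<^esub> g) \<otimes>\<^bsub>H\<^esub> l) (act x0 t0 \<otimes>\<^bsub>T\<^esub> b0)) (\<delta>T b))) (\<delta>T t)) (coact M x)"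
    by (rule tensor_ext[OF Mc.H Mc.A] tensor_ext[OF Mc.H module_T])+
      (simp_all add: tensor_lift_pure[OF Mc.H module_T module_HT in1] H.m_assoc act_mult Mc.coaction_closed \<delta>T_closed x t b)
  also have "\<dots> = tensor_lift k HT (\<lambda>h a0. tensor_lift k HT (\<lambda>g b0. pureT (h \<otimes>\<^bsub>H\<^esub> g) (a0 \<otimes>\<^bsub>T\<^esub> b0)) (\<delta>T b)) (\<delta>T (act x t))"
    by (rule lift_act[OF module_HT bil x t, symmetric])
  finally show "\<delta>T (act x t \<otimes>\<^bsub>T\<^esub> b) = \<dots>" .
qed

theorem T_coaction_algebra: "coaction_algebra k H T \<delta>T"
proof -
  have "coaction k H T \<delta>T"
    by (intro coaction.intro coaction_axioms.intro H.coalgebra_axioms module_T \<delta>T_linear \<delta>T_coassoc \<delta>T_counit)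
  then show ?thesis
    by (intro coaction_algebra.intro coaction_algebra_axioms.intro H.bialgebra_axioms T_algebra \<delta>T_mult \<delta>T_one)
qed

end

section \<open>Quotients of comodule algebras\<close>

lemma tensor_lift_zero:
  assumes P: "module k P" and Q: "module k Q" and N: "module k N" and t: "t \<in> carrier (tensor k P Q)"
    and f: "\<And>x y. x \<in> carrier P \<Longrightarrow> y \<in> carrier Q \<Longrightarrow> f x y = \<zero>\<^bsub>N\<^esub>"
  shows "tensor_lift k N f t = \<zero>\<^bsub>N\<^esub>"
proof -
  have b: "bilinear_map k P Q N (\<lambda>_ _. \<zero>\<^bsub>N\<^esub>)"
    by (intro bilinearI zero_linear P Q N)
  have "tensor_lift k N f t = tensor_lift k N (\<lambda>_ _. \<zero>\<^bsub>N\<^esub>) t"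
    by (rule tensor_ext[OF P Q _ t]) (rule f)
  also have "\<dots> = \<zero>\<^bsub>N\<^esub>"
    by (rule tensor_eqI[OF P Q N tensor_lift_linear[OF P Q N b] zero_linear[OF tensor_module[OF P Q] N] _ t])
      (rule tensor_lift_pure[OF P Q N b])
  finally show ?thesis .
qed

context comodule_map
begin

text \<open>The map \<open>a \<mapsto> \<Sum> a\<^sub>-\<^sub>1 \<otimes> f(a\<^sub>0)\<close>. For a
  projection \<open>f\<close> modulo an ideal this is the map that has to vanish on the ideal for the
  coaction to descend.\<close>

definition push where
  "push B f a = tensor_lift k (tensor k H B) (\<lambda>h a0. pure_tensor k H B h (f a0)) (\<delta> a)"

context
  fixes B :: "('k, 'b, 'v) module_scheme" and f
  assumes B: "module k B" and f: "linear_map k A B f"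
begin

lemmas push_rules = H_rules B linear_comp[OF f] linear_closed[OF f] bilinear_in_left[OF pure_tensor_bilinear[OF H B]]
  bilinear_in_right[OF pure_tensor_bilinear[OF H B]] bilinear_closed[OF pure_tensor_bilinear[OF H B]]

lemma push_bilinear: "bilinear_map k H A (tensor k H B) (\<lambda>h a0. pure_tensor k H B h (f a0))"
  by (assumption | rule push_rules)+

lemma push_linear: "linear_map k A (tensor k H B) (push B f)"
  unfolding push_def
  by (rule linear_comp[OF tensor_lift_linear[OF H A tensor_module[OF H B] push_bilinear] \<delta>])

text \<open>Change of variables along \<open>f\<close>.\<close>

lemma lift_push:
  assumes N: "module k N" and g: "bilinear_map k H B N g" and a: "a \<in> carrier A"
  shows "tensor_lift k N g (push B f a) = tensor_lift k N (\<lambda>h a0. g h (f a0)) (\<delta> a)"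
proof -
  have "tensor_lift k N g (push B f a)
      = tensor_lift k N (\<lambda>h a0. tensor_lift k N g (pure_tensor k H B h (f a0))) (\<delta> a)"
    unfolding push_def
    by (rule tensor_lift_comp[OF H A tensor_module[OF H B] N tensor_lift_linear[OF H B N g] push_bilinear
          linear_closed[OF \<delta> a]])
  also have "\<dots> = tensor_lift k N (\<lambda>h a0. g h (f a0)) (\<delta> a)"
    by (rule tensor_ext[OF H A _ linear_closed[OF \<delta> a]])
      (rule tensor_lift_pure[OF H B N g _ linear_closed[OF f]])
  finally show ?thesis .
qed

end

end

context coaction_algebra
begin

context
  fixes Q :: "('k, 'q, 'v) module_scheme" and \<pi>
  assumes Q: "k_algebra k Q" and \<pi>: "linear_map k A Q \<pi>"
    and \<pi>_mult: "\<And>a b. a \<in> carrier A \<Longrightarrow> b \<in> carrier A \<Longrightarrow> \<pi> (a \<otimes>\<^bsub>A\<^esub> b) = \<pi> a \<otimes>\<^bsub>Q\<^esub> \<pi> b"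
begin

interpretation Q: k_algebra k Q by (rule Q)

lemmas Q_mod = Q.self_module
lemmas HQ_mod = tensor_module[OF H Q.self_module]

lemmas q_rules = m_rules push_rules[OF Q.self_module \<pi>] bilinear_in_left[OF Q.mult_bilinear]
  bilinear_in_right[OF Q.mult_bilinear] bilinear_closed[OF Q.mult_bilinear] HQ_mod

lemma push_mult:
  assumes ab: "a \<in> carrier A" "b \<in> carrier A"
  shows "push Q \<pi> (a \<otimes>\<^bsub>A\<^esub> b) = tensor_lift k (tensor k H Q) (\<lambda>h a0. tensor_lift k (tensor k H Q)
    (\<lambda>g b0. pure_tensor k H Q (h \<otimes>\<^bsub>H\<^esub> g) (\<pi> a0 \<otimes>\<^bsub>Q\<^esub> \<pi> b0)) (\<delta> b)) (\<delta> a)"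
proof -
  have "push Q \<pi> (a \<otimes>\<^bsub>A\<^esub> b) = tensor_lift k (tensor k H Q) (\<lambda>h a0. tensor_lift k (tensor k H Q)
    (\<lambda>g b0. pure_tensor k H Q (h \<otimes>\<^bsub>H\<^esub> g) (\<pi> (a0 \<otimes>\<^bsub>A\<^esub> b0))) (\<delta> b)) (\<delta> a)"
    unfolding push_def
    by (rule lift_coaction_mult[OF HQ_mod push_bilinear[OF Q_mod \<pi>] ab])
  also have "\<dots> = tensor_lift k (tensor k H Q) (\<lambda>h a0. tensor_lift k (tensor k H Q)
    (\<lambda>g b0. pure_tensor k H Q (h \<otimes>\<^bsub>H\<^esub> g) (\<pi> a0 \<otimes>\<^bsub>Q\<^esub> \<pi> b0)) (\<delta> b)) (\<delta> a)"
    by (rule tensor_ext[OF H A])+ (simp_all add: \<pi>_mult coaction_closed ab)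
  finally show ?thesis .
qed

text \<open>By the lemma \<open>push_mult\<close>, the map \<open>(id \<otimes> \<pi>) \<delta>\<close>
  on a product is a sum to which either factor contributes only through its own image under \<open>(id
  \<otimes> \<pi>) \<delta>\<close>; so it vanishes as soon as one of the two images does. The coideal
  condition for an ideal may therefore be checked on generators.\<close>

lemma push_kernel_ideal:
  "ideal {a \<in> carrier A. push Q \<pi> a = \<zero>\<^bsub>tensor k H Q\<^esub>} A"
proof (rule idealI)
  let ?K = "{a \<in> carrier A. push Q \<pi> a = \<zero>\<^bsub>tensor k H Q\<^esub>}"
  show "ring A" by (rule AA.ring_axioms)
  show "subgroup ?K (add_monoid A)"
    using kernel_submodule[OF A HQ_mod push_linear[OF Q_mod \<pi>]] by (simp add: submodule_def)
  fix b a assume b: "b \<in> ?K" and a: "a \<in> carrier A"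
  then have b': "b \<in> carrier A" "push Q \<pi> b = \<zero>\<^bsub>tensor k H Q\<^esub>" by auto
  have "push Q \<pi> (a \<otimes>\<^bsub>A\<^esub> b) = \<zero>\<^bsub>tensor k H Q\<^esub>"
    unfolding push_mult[OF a b'(1)]
  proof (rule tensor_lift_zero[OF H A HQ_mod coaction_closed[OF a]])
    fix h a0 assume h: "h \<in> carrier H" "a0 \<in> carrier A"
    have bil: "bilinear_map k H Q (tensor k H Q) (\<lambda>g q. pure_tensor k H Q (h \<otimes>\<^bsub>H\<^esub> g) (\<pi> a0 \<otimes>\<^bsub>Q\<^esub> q))"
      by (insert h, (assumption | rule q_rules)+)
    show "tensor_lift k (tensor k H Q) (\<lambda>g b0. pure_tensor k H Q (h \<otimes>\<^bsub>H\<^esub> g) (\<pi> a0 \<otimes>\<^bsub>Q\<^esub> \<pi> b0)) (\<delta> b) = \<zero>\<^bsub>tensor k H Q\<^esub>"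
      unfolding lift_push[OF Q_mod \<pi> HQ_mod bil b'(1), symmetric] b'(2)
      by (rule linear_zero[OF HQ_mod HQ_mod tensor_lift_linear[OF H Q_mod HQ_mod bil]])
  qed
  then show "a \<otimes>\<^bsub>A\<^esub> b \<in> ?K" using a b' by simp
  have "push Q \<pi> (b \<otimes>\<^bsub>A\<^esub> a) = tensor_lift k (tensor k H Q) (\<lambda>g b0. tensor_lift k (tensor k H Q)
    (\<lambda>h a0. pure_tensor k H Q (h \<otimes>\<^bsub>H\<^esub> g) (\<pi> a0 \<otimes>\<^bsub>Q\<^esub> \<pi> b0)) (\<delta> b)) (\<delta> a)"
    unfolding push_mult[OF b'(1) a]
    by (rule tensor_lift_swap | assumption | rule q_rules a b'(1))+
  also have "\<dots> = \<zero>\<^bsub>tensor k H Q\<^esub>"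
  proof (rule tensor_lift_zero[OF H A HQ_mod coaction_closed[OF a]])
    fix g b0 assume h: "g \<in> carrier H" "b0 \<in> carrier A"
    have bil: "bilinear_map k H Q (tensor k H Q) (\<lambda>h q. pure_tensor k H Q (h \<otimes>\<^bsub>H\<^esub> g) (q \<otimes>\<^bsub>Q\<^esub> \<pi> b0))"
      by (insert h, (assumption | rule q_rules)+)
    show "tensor_lift k (tensor k H Q) (\<lambda>h a0. pure_tensor k H Q (h \<otimes>\<^bsub>H\<^esub> g) (\<pi> a0 \<otimes>\<^bsub>Q\<^esub> \<pi> b0)) (\<delta> b) = \<zero>\<^bsub>tensor k H Q\<^esub>"
      unfolding lift_push[OF Q_mod \<pi> HQ_mod bil b'(1), symmetric] b'(2)
      by (rule linear_zero[OF HQ_mod HQ_mod tensor_lift_linear[OF H Q_mod HQ_mod bil]])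
  qed
  finally show "b \<otimes>\<^bsub>A\<^esub> a \<in> ?K" using a b' by simp
qed

text \<open>All axioms descend along the surjection \<open>\<pi>\<close>, because
  \<open>\<delta>Q\<close> is induced by \<open>\<delta>\<close>.\<close>

lemma quotient_coaction_algebra:
  assumes surj: "\<And>q. q \<in> carrier Q \<Longrightarrow> \<exists>a\<in>carrier A. q = \<pi> a" and one: "\<pi> \<one>\<^bsub>A\<^esub> = \<one>\<^bsub>Q\<^esub>"
    and \<delta>Q: "linear_map k Q (tensor k H Q) \<delta>Q" and \<delta>Q_\<pi>: "\<And>a. a \<in> carrier A \<Longrightarrow> \<delta>Q (\<pi> a) = push Q \<pi> a"
  shows "coaction_algebra k H Q \<delta>Q"
proof -
  let ?HQ = "tensor k H Q" and ?N = "tensor k H (tensor k H Q)"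
  note N = tensor_module[OF H HQ_mod]
  note p = pure_tensor_bilinear[OF H HQ_mod]
  note R = q_rules trilinearI bilinear_in_left[OF p] bilinear_in_right[OF p] bilinear_closed[OF p] N linear_comp[OF \<delta>Q] linear_closed[OF \<delta>Q]
  have "coassociative_at k H Q \<delta>Q q" if "q \<in> carrier Q" for q
  proof -
    obtain a where a: "a \<in> carrier A" "q = \<pi> a" using surj \<open>q \<in> carrier Q\<close> by blast
    have b1: "bilinear_map k H Q ?N (\<lambda>h q. tensor_lift k ?N (\<lambda>h1 h2. pure_tensor k H ?HQ h1 (pure_tensor k H Q h2 q)) (comult H h))"
      by (assumption | rule R)+
    have b2: "bilinear_map k H Q ?N (\<lambda>h q. pure_tensor k H ?HQ h (\<delta>Q q))"
      by (assumption | rule R)+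
    have "tensor_lift k ?N (\<lambda>h q. tensor_lift k ?N (\<lambda>h1 h2. pure_tensor k H ?HQ h1 (pure_tensor k H Q h2 q)) (comult H h)) (push Q \<pi> a)
      = tensor_lift k ?N (\<lambda>h a0. tensor_lift k ?N (\<lambda>h1 h2. pure_tensor k H ?HQ h1 (pure_tensor k H Q h2 (\<pi> a0))) (comult H h)) (\<delta> a)"
      by (rule lift_push[OF Q_mod \<pi> N b1 a(1)])
    also have "\<dots> = tensor_lift k ?N (\<lambda>h a0. tensor_lift k ?N (\<lambda>h2 a1. pure_tensor k H ?HQ h (pure_tensor k H Q h2 (\<pi> a1))) (\<delta> a0)) (\<delta> a)"
      by (rule sweedler_coassoc[OF coaction_coassoc[OF a(1)] a(1) N] | assumption | rule R)+
    also have "\<dots> = tensor_lift k ?N (\<lambda>h a0. pure_tensor k H ?HQ h (push Q \<pi> a0)) (\<delta> a)"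
      unfolding push_def
      by (rule tensor_ext[OF H A] tensor_lift_comp[OF H A HQ_mod N, symmetric] coaction_closed a(1) | assumption | rule R)+
    also have "\<dots> = tensor_lift k ?N (\<lambda>h a0. pure_tensor k H ?HQ h (\<delta>Q (\<pi> a0))) (\<delta> a)"
      by (rule tensor_ext[OF H A _ coaction_closed[OF a(1)]]) (simp add: \<delta>Q_\<pi>)
    also have "\<dots> = tensor_lift k ?N (\<lambda>h q. pure_tensor k H ?HQ h (\<delta>Q q)) (push Q \<pi> a)"
      by (rule lift_push[OF Q_mod \<pi> N b2 a(1), symmetric])
    finally show ?thesis by (simp add: coassociative_at_def a \<delta>Q_\<pi>)
  qed
  moreover have "tensor_lift k Q (\<lambda>h q. counit H h \<odot>\<^bsub>Q\<^esub> q) (\<delta>Q q) = q" if "q \<in> carrier Q" for q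
  proof -
    obtain a where a: "a \<in> carrier A" "q = \<pi> a" using surj \<open>q \<in> carrier Q\<close> by blast
    note ps = pairing_smult[OF Q_mod]
    have "bilinear_map k H Q Q (\<lambda>h q. counit H h \<odot>\<^bsub>Q\<^esub> q)"
      by (assumption | rule R linear_comp[OF H.counit_linear] linear_closed[OF H.counit_linear]
        bilinear_in_left[OF pairingD(4)[OF ps]] bilinear_in_right[OF pairingD(4)[OF ps]])+
    then have "tensor_lift k Q (\<lambda>h q. counit H h \<odot>\<^bsub>Q\<^esub> q) (push Q \<pi> a) = conv1 k Q \<delta> (smult Q) (counit H) \<pi> a"
      unfolding conv1_def by (rule lift_push[OF Q_mod \<pi> Q_mod _ a(1)])
    then show ?thesis by (simp add: a \<delta>Q_\<pi> conv1_counit[OF Q_mod a(1) \<pi>])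
  qed
  ultimately have "coaction k H Q \<delta>Q"
    by (intro coaction.intro coaction_axioms.intro H.coalgebra_axioms Q_mod \<delta>Q)
  moreover have "\<delta>Q (q \<otimes>\<^bsub>Q\<^esub> r) = tensor_lift k ?HQ (\<lambda>h q0. tensor_lift k ?HQ
      (\<lambda>g r0. pure_tensor k H Q (h \<otimes>\<^bsub>H\<^esub> g) (q0 \<otimes>\<^bsub>Q\<^esub> r0)) (\<delta>Q r)) (\<delta>Q q)"
    if "q \<in> carrier Q" "r \<in> carrier Q" for q r
  proof -
    obtain a b where a: "a \<in> carrier A" "q = \<pi> a" and b: "b \<in> carrier A" "r = \<pi> b"
      using surj \<open>q \<in> carrier Q\<close> \<open>r \<in> carrier Q\<close> by meson
    have b1: "bilinear_map k H Q ?HQ (\<lambda>g r0. pure_tensor k H Q (h \<otimes>\<^bsub>H\<^esub> g) (q0 \<otimes>\<^bsub>Q\<^esub> r0))"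
      if "h \<in> carrier H" "q0 \<in> carrier Q" for h q0
      by (insert that, (assumption | rule R)+)
    have b2: "bilinear_map k H Q ?HQ (\<lambda>h q0. tensor_lift k ?HQ
      (\<lambda>g r0. pure_tensor k H Q (h \<otimes>\<^bsub>H\<^esub> g) (q0 \<otimes>\<^bsub>Q\<^esub> r0)) (\<delta>Q r))"
      by (insert that, (assumption | rule R)+)
    have "tensor_lift k ?HQ (\<lambda>h q0. tensor_lift k ?HQ
        (\<lambda>g r0. pure_tensor k H Q (h \<otimes>\<^bsub>H\<^esub> g) (q0 \<otimes>\<^bsub>Q\<^esub> r0)) (\<delta>Q r)) (push Q \<pi> a)
      = tensor_lift k ?HQ (\<lambda>h a0. tensor_lift k ?HQ
        (\<lambda>g r0. pure_tensor k H Q (h \<otimes>\<^bsub>H\<^esub> g) (\<pi> a0 \<otimes>\<^bsub>Q\<^esub> r0)) (\<delta>Q r)) (\<delta> a)"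
      by (rule lift_push[OF Q_mod \<pi> HQ_mod b2 a(1)])
    also have "\<dots> = tensor_lift k ?HQ (\<lambda>h a0. tensor_lift k ?HQ
        (\<lambda>g b0. pure_tensor k H Q (h \<otimes>\<^bsub>H\<^esub> g) (\<pi> a0 \<otimes>\<^bsub>Q\<^esub> \<pi> b0)) (\<delta> b)) (\<delta> a)"
      by (rule tensor_ext[OF H A _ coaction_closed[OF a(1)]])
        (simp add: b \<delta>Q_\<pi> lift_push[OF Q_mod \<pi> HQ_mod b1 b(1)] linear_closed[OF \<pi>])
    also have "\<dots> = push Q \<pi> (a \<otimes>\<^bsub>A\<^esub> b)" by (rule push_mult[OF a(1) b(1), symmetric])
    also have "\<dots> = \<delta>Q (q \<otimes>\<^bsub>Q\<^esub> r)" by (simp add: a b \<pi>_mult flip: \<delta>Q_\<pi>)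
    finally show ?thesis by (simp add: a \<delta>Q_\<pi>)
  qed
  moreover have "\<delta>Q \<one>\<^bsub>Q\<^esub> = pure_tensor k H Q \<one>\<^bsub>H\<^esub> \<one>\<^bsub>Q\<^esub>"
    by (simp add: \<delta>Q_\<pi> one flip: one)
      (simp add: push_def coaction_one tensor_lift_pure[OF H A HQ_mod push_bilinear[OF Q_mod \<pi>]])
  ultimately show ?thesis
    by (intro coaction_algebra.intro coaction_algebra_axioms.intro H.bialgebra_axioms Q)
qed

end

end

context k_algebra
begin

lemma ideal_submodule:
  assumes "ideal I A" shows "submodule I k A"
proof -
  interpret I: ideal I A by fact
  show ?thesis
  proof (rule submoduleI)
    fix c x assume c: "c \<in> carrier k" and x: "x \<in> I"
    then have "c \<odot>\<^bsub>A\<^esub> x = (c \<odot>\<^bsub>A\<^esub> \<one>\<^bsub>A\<^esub>) \<otimes>\<^bsub>A\<^esub> x"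
      using I.a_subset by (subst smult_mult_left) auto
    also have "\<dots> \<in> I" using c x by (intro I.I_l_closed) auto
    finally show "c \<odot>\<^bsub>A\<^esub> x \<in> I" .
  qed (use I.a_subset I.a_closed I.a_inv_closed in auto)
qed

context
  fixes I assumes I: "ideal I A"
begin

interpretation I: ideal I A by (rule I)

abbreviation "proj a \<equiv> I +>\<^bsub>A\<^esub> a"

lemmas I_sub = ideal_submodule[OF I]

lemma proj_linear: "linear_map k A (quotient A I) (\<lambda>a. proj a)"
  by (rule quotient_linear[OF self_module I_sub])

lemma proj_mult: "a \<in> carrier A \<Longrightarrow> b \<in> carrier A \<Longrightarrow> proj (a \<otimes>\<^bsub>A\<^esub> b) = proj a \<otimes>\<^bsub>quotient A I\<^esub> proj b"
  using I.rcoset_mult_add by (simp add: quotient_simps FactRing_def)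

lemma proj_one: "proj \<one>\<^bsub>A\<^esub> = \<one>\<^bsub>quotient A I\<^esub>"
  by (simp add: quotient_simps FactRing_def)

lemma proj_surj: "q \<in> carrier (quotient A I) \<Longrightarrow> \<exists>a\<in>carrier A. q = proj a"
  using quotient_elim[OF self_module I_sub] by metis

lemma quotient_k_algebra: "k_algebra k (quotient A I)"
proof -
  interpret Q: ring "A Quot I" by (rule I.quotient_is_ring)
  have c: "carrier (quotient A I) = carrier (A Quot I)" "mult (quotient A I) = mult (A Quot I)"
    "one (quotient A I) = one (A Quot I)" "zero (quotient A I) = zero (A Quot I)" "add (quotient A I) = add (A Quot I)"
    by (simp_all add: quotient_def)
  note Q = quotient_module[OF self_module I_sub]
  note L = linear_smult[OF proj_linear] linear_closed[OF proj_linear]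
  show ?thesis
  proof (rule k_algebraI[OF Q])
    show "bilinear_map k (quotient A I) (quotient A I) (quotient A I) (mult (quotient A I))"
    proof (intro bilinearI linear_mapI)
      fix q r s d assume d: "d \<in> carrier k"
      assume "q \<in> carrier (quotient A I)" and "r \<in> carrier (quotient A I)"
      then obtain a b where "a \<in> carrier A" "q = proj a" "b \<in> carrier A" "r = proj b"
        using proj_surj by meson
      then show "q \<otimes>\<^bsub>quotient A I\<^esub> (d \<odot>\<^bsub>quotient A I\<^esub> r) = d \<odot>\<^bsub>quotient A I\<^esub> (q \<otimes>\<^bsub>quotient A I\<^esub> r)"
        "(d \<odot>\<^bsub>quotient A I\<^esub> r) \<otimes>\<^bsub>quotient A I\<^esub> q = d \<odot>\<^bsub>quotient A I\<^esub> (r \<otimes>\<^bsub>quotient A I\<^esub> q)"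
        using d by (simp_all flip: proj_mult L(1) add: smult_mult_left smult_mult_right)
    qed (simp_all add: c Q.l_distr Q.r_distr)
  qed (simp_all add: c Q.m_assoc)
qed

end

end

lemma quotient_comodule_algebra_simps:
  "mult (quotient_comodule_algebra k H A I) = mult (quotient A I)"
  "one (quotient_comodule_algebra k H A I) = one (quotient A I)"
  "carrier (quotient_comodule_algebra k H A I) = carrier (quotient A I)"
  "add (quotient_comodule_algebra k H A I) = add (quotient A I)"
  "zero (quotient_comodule_algebra k H A I) = zero (quotient A I)"
  "smult (quotient_comodule_algebra k H A I) = smult (quotient A I)"
  by (simp_all add: quotient_comodule_algebra_def with_coact_def)

lemma same_module_quotient_comodule_algebra:
  "same_module (quotient_comodule_algebra k H A I) (quotient A I)"
  by (simp add: same_module_def quotient_comodule_algebra_simps)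

lemma left_comodule_algebraD: "left_comodule_algebra k H A \<Longrightarrow> coaction_algebra k H A (coact A)"
  by (simp add: left_comodule_algebra_iff)

context
  fixes k :: "('k, 'z) ring_scheme" and H :: "('k, 'h, 'y) coalgebra_scheme"
    and A :: "('k, 'h, 'a, 'x) comodule_scheme"
  assumes A: "left_comodule_algebra k H A"
begin

interpretation A: coaction_algebra k H A "coact A" by (rule left_comodule_algebraD[OF A])

text \<open>Lift \<open>\<delta>(r)\<close> to an element \<open>t\<close> of \<open>H \<otimes>
  R\<close>. On \<open>t\<close> the map \<open>id \<otimes> g\<close> vanishes factor by factor.\<close>

lemma subcomodule_push_zero:
  fixes N :: "('k, 'n, 'v) module_scheme"
  assumes R: "subcomodule k H A R" and N: "module k N" and g: "linear_map k A N g"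
    and zero: "\<And>r. r \<in> R \<Longrightarrow> g r = \<zero>\<^bsub>N\<^esub>" and r: "r \<in> R"
  shows "A.push N g r = \<zero>\<^bsub>tensor k H N\<^esub>"
proof -
  have sub: "submodule R k A" using R by (simp add: subcomodule_def)
  let ?R = "A\<lparr>carrier := R\<rparr>"
  have R': "module k ?R" by (rule submodule.submodule_is_module[OF sub A.A])
  have incl: "linear_map k ?R A (\<lambda>x. x)"
    using submodule_subset[OF sub] by (auto simp: linear_map_def)
  note HN = tensor_module[OF A.H N] and HA = tensor_module[OF A.H A.A]
  obtain t where t: "t \<in> carrier (tensor k H ?R)" "coact A r = tensor_lift k (tensor k H A) (pure_tensor k H A) t"
    using R r by (auto simp: subcomodule_def)
  have pb: "bilinear_map k H ?R (tensor k H A) (pure_tensor k H A)"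
    using bilinear_in_right[OF pure_tensor_bilinear[OF A.H A.A] incl] bilinear_left[OF pure_tensor_bilinear[OF A.H A.A]]
      submodule_subset[OF sub] by (intro bilinearI) auto
  have "A.push N g r = tensor_lift k (tensor k H N) (\<lambda>h a. tensor_lift k (tensor k H N)
      (\<lambda>h a0. pure_tensor k H N h (g a0)) (pure_tensor k H A h a)) t"
    unfolding A.push_def t(2)
    by (rule tensor_lift_comp[OF A.H R' HA HN tensor_lift_linear[OF A.H A.A HN A.push_bilinear[OF N g]] pb t(1)])
  also have "\<dots> = \<zero>\<^bsub>tensor k H N\<^esub>"
  proof (rule tensor_lift_zero[OF A.H R' HN t(1)])
    fix h a assume h: "h \<in> carrier H" "a \<in> carrier ?R"
    then have "a \<in> R" "a \<in> carrier A" using submodule_subset[OF sub] by auto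
    then show "tensor_lift k (tensor k H N) (\<lambda>h a0. pure_tensor k H N h (g a0)) (pure_tensor k H A h a) = \<zero>\<^bsub>tensor k H N\<^esub>"
      using linear_zero[OF N HN bilinear_right[OF pure_tensor_bilinear[OF A.H N] h(1)]] h(1)
      by (simp add: tensor_lift_pure[OF A.H A.A HN A.push_bilinear[OF N g]] zero)
  qed
  finally show ?thesis .
qed

context
  fixes I assumes I: "ideal I A"
    and co: "\<And>i. i \<in> I \<Longrightarrow> A.push (quotient A I) (\<lambda>a. I +>\<^bsub>A\<^esub> a) i = \<zero>\<^bsub>tensor k H (quotient A I)\<^esub>"
begin

abbreviation "cquot \<equiv> quotient_comodule_algebra k H A I"

lemma Q_coact: "coact cquot = (\<lambda>X. A.push (quotient A I) (\<lambda>a. I +>\<^bsub>A\<^esub> a) (SOME a. a \<in> X))"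
  by (simp add: quotient_comodule_algebra_def with_coact_def A.push_def)

lemmas Q_alg = A.AA.quotient_k_algebra[OF I]
lemmas Q_proj = A.AA.proj_linear[OF I]
lemmas Q_push = A.push_linear[OF k_algebra.self_module[OF Q_alg] Q_proj]
lemmas HQ_module = tensor_module[OF A.H k_algebra.self_module[OF Q_alg]]

lemma Q_coact_proj: "a \<in> carrier A \<Longrightarrow> coact cquot (I +>\<^bsub>A\<^esub> a) = A.push (quotient A I) (\<lambda>a. I +>\<^bsub>A\<^esub> a) a"
  unfolding Q_coact
  by (rule quotient_lift(1)[OF A.A A.AA.ideal_submodule[OF I] HQ_module Q_push co])

lemma Q_coact_linear: "linear_map k (quotient A I) (tensor k H (quotient A I)) (coact cquot)"
  unfolding Q_coact
  by (rule quotient_lift(2)[OF A.A A.AA.ideal_submodule[OF I] HQ_module Q_push co])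

lemma quotient_coaction: "coaction_algebra k H (quotient A I) (coact cquot)"
  by (rule A.quotient_coaction_algebra[OF Q_alg Q_proj _ _ _ Q_coact_linear Q_coact_proj])
    (auto simp: A.AA.proj_mult[OF I] A.AA.proj_one[OF I] A.AA.proj_surj[OF I])

end

end

lemma coaction_algebra_same:
  fixes A :: "('k, 'a, 'x) module_scheme" and B :: "('k, 'a, 'w) module_scheme"
  assumes A: "coaction_algebra k H A \<delta>" and same: "same_module B A"
    and mo: "mult B = mult A" "one B = one A"
  shows "coaction_algebra k H B \<delta>"
proof -
  interpret A: coaction_algebra k H A \<delta> by (rule A)
  have c: "carrier B = carrier A" "smult B = smult A" using same by (simp_all add: same_module_def)
  note sm = same_module_linear_dom[OF same] same_module_linear_cod[OF same] same_module_tensor_right[OF same]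
    same_module_pure_right[OF same] same_module_tensor_lift[OF same]
  have B: "module k B" by (rule same_module_module[OF same A.A])
  have "k_algebra k B"
    by (rule k_algebraI[OF B])
      (use A.AA.mult_bilinear in \<open>simp_all add: bilinear_map_def sm c mo A.AA.m_assoc\<close>)
  moreover have "coaction k H B \<delta>"
    using A.H.coalgebra_axioms B A.coaction_linear A.coaction_coassoc A.coaction_counit
    by (simp add: coaction_def coaction_axioms_def coassociative_at_def sm c)
  ultimately show ?thesis
    using A.H.bialgebra_axioms A.coaction_mult A.coaction_one
    by (simp add: coaction_algebra_def coaction_algebra_axioms_def sm c mo)
qed

lemma quotient_left_comodule_algebra:
  fixes A :: "('k, 'h, 'a, 'x) comodule_scheme"
  assumes "left_comodule_algebra k H A" "ideal I A"
    and "\<And>i. i \<in> I \<Longrightarrow> comodule_map.push k H (coact A) (quotient A I) (\<lambda>a. I +>\<^bsub>A\<^esub> a) i = \<zero>\<^bsub>tensor k H (quotient A I)\<^esub>"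
  shows "left_comodule_algebra k H (quotient_comodule_algebra k H A I)"
  unfolding left_comodule_algebra_iff
  by (rule coaction_algebra_same[OF quotient_coaction[OF assms] same_module_quotient_comodule_algebra])
    (simp_all add: quotient_comodule_algebra_simps)

section \<open>The comparison map and its inverse\<close>

lemma (in tensor_alg) word_lift_ext:
  assumes "\<And>w. w \<in> W \<Longrightarrow> f w = g w" "t \<in> carrier T"
  shows "coset_lift k N f t = coset_lift k N g t"
  by (rule presented_ext[OF M.R.is_cring word_relations_subset])
    (use assms in \<open>auto simp: T_simps word_null_def\<close>)

text \<open>The comodule axioms do not involve the multiplication of the Hopf algebra, so
  \<open>\<delta>T'\<close> may be used in convolutions over \<open>H\<close> as well.\<close>

lemma (in cocycle) untwist_coaction:
  assumes "coaction k H' A \<delta>" shows "coaction k H A \<delta>"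
proof -
  interpret coaction k H' A \<delta> by fact
  show ?thesis
    using coalgebra_axioms A.module_axioms coaction_linear coaction_coassoc coaction_counit
    by (simp add: coaction_def coaction_axioms_def twist_module_simps coassociative_at_def)
qed

text \<open>If \<open>f\<close> intertwines the coactions, then \<open>\<Sum> f(t)\<^sub>-\<^sub>1
  \<otimes> f(t)\<^sub>0 = \<Sum> t\<^sub>-\<^sub>1 \<otimes> f(t\<^sub>0)\<close>, and convolution at
  \<open>f(t)\<close> becomes convolution at \<open>t\<close>. Colinearity is assumed at the one element
  \<open>t\<close>, as an induction hypothesis provides it.\<close>

lemma (in comodule_map_pair) conv2_push:
  assumes T: "comodule_map k H C \<gamma>" and p: "pairing k N1 N2 N p" and F: "bilinear_map k H H N1 F"
    and G: "bilinear_map k A B N2 G" and f: "linear_map k C B f"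
    and col: "\<delta>' (f t) = comodule_map.push k H \<gamma> B f t" and a: "a \<in> carrier A" and t: "t \<in> carrier C"
  shows "conv2 k N \<delta> \<delta>' p F G a (f t) = conv2 k N \<delta> \<gamma> p F (\<lambda>a c. G a (f c)) a t"
proof -
  interpret C: comodule_map k H C \<gamma> by (rule T)
  note R = bilinearI B.A A.H A.A pairingD(1-3)[OF p] bilinear_in_left[OF pairingD(4)[OF p]]
    bilinear_in_right[OF pairingD(4)[OF p]] bilinear_left[OF F] bilinear_right[OF F] bilinear_left[OF G] bilinear_right[OF G]
    bilinear_closed[OF F] bilinear_closed[OF G]
  show ?thesis
    unfolding conv2_def conv1_def col
    by (rule tensor_ext[OF A.H A.A] C.lift_push[OF B.A f pairingD(3)[OF p]] linear_closed[OF A.\<delta>] a t | assumption | rule R)+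
qed

context tensor_coaction
begin

abbreviation "TC \<equiv> tensor_comodule_algebra k H M"

lemma same_TC: "same_module TC T"
  by (simp add: same_module_def tensor_comodule_algebra_def with_coact_def)

lemma TC_simps [simp]: "carrier TC = carrier T" "mult TC = mult T" "one TC = one T" "add TC = add T"
  "zero TC = zero T" "smult TC = smult T" "coact TC = \<delta>T"
  by (simp_all add: tensor_comodule_algebra_def with_coact_def \<delta>T_def)

lemma TC_algebra: "coaction_algebra k H TC \<delta>T"
  by (rule coaction_algebra_same[OF T_coaction_algebra same_TC]) simp_all

lemma TC_left_comodule_algebra: "left_comodule_algebra k H TC"
  by (simp add: left_comodule_algebra_iff TC_algebra)

end

text \<open>The tensor algebra depends on the module underlying \<open>M\<close> only. Thus
  \<open>T(\<^sub>\<sigma>M)\<close> and \<open>T(M)\<close> are the same algebra \<open>T\<close>, with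
  two coactions \<open>\<delta>T'\<close> and \<open>\<delta>T\<close>, over
  \<open>\<^sub>\<sigma>H\<^sub>\<sigma>\<^sub>-\<^sub>1\<close> and over \<open>H\<close>.\<close>

locale twisted_tensor = cocycle k H \<sigma> + tensor_coaction k H M
  for k :: "('k, 'z) ring_scheme" and H :: "('k, 'h, 'y) coalgebra_scheme" and \<sigma>
    and M :: "('k, 'h, 'm, 'x) comodule_scheme"
begin

lemma twisted_tensor_coaction: "tensor_coaction k H' M"
  by (rule tensor_coaction.intro[OF twist_bialgebra twist_coaction[OF Mc.coaction_axioms]])

interpretation T': tensor_coaction k H' M by (rule twisted_tensor_coaction)
interpretation self: coaction_algebra k H H \<Delta> by (rule self_coaction_algebra)

abbreviation "\<delta>M \<equiv> coact M"
abbreviation "\<delta>T' \<equiv> tensor_coaction.\<delta>T k H' M"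

interpretation Ta: coaction_algebra k H T \<delta>T by (rule T_coaction_algebra)
interpretation Ta': coaction k H T \<delta>T'
proof -
  interpret X: coaction_algebra k H' T \<delta>T' by (rule T'.T_coaction_algebra)
  show "coaction k H T \<delta>T'" by (rule untwist_coaction[OF X.coaction_axioms])
qed
interpretation MT: coaction_pair k H M \<delta>M T \<delta>T
  by (rule coaction_pair.intro[OF Mc.coaction_axioms Ta.coaction_axioms])
interpretation MT': coaction_pair k H M \<delta>M T \<delta>T'
  by (rule coaction_pair.intro[OF Mc.coaction_axioms Ta'.coaction_axioms])
interpretation TT: coaction_pair k H T \<delta>T T \<delta>T
  by (rule coaction_pair.intro[OF Ta.coaction_axioms Ta.coaction_axioms])

lemma lift_act':
  assumes "module k N" "bilinear_map k H T N f" "x \<in> carrier M" "t \<in> carrier T"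
  shows "tensor_lift k N f (\<delta>T' (act x t)) =
    tensor_lift k N (\<lambda>h x0. tensor_lift k N (\<lambda>g t0. f (h \<star> g) (act x0 t0)) (\<delta>T' t)) (\<delta>M x)"
proof (rule T'.lift_act[OF assms(1) _ assms(3,4)])
  show "bilinear_map k H' T N f"
    using assms(2) by (simp add: bilinear_map_def twist_module_simps)
qed

lemma \<delta>T'_act:
  assumes "x \<in> carrier M" "t \<in> carrier T"
  shows "\<delta>T' (act x t) = conv2 k HT \<delta>M \<delta>T' pureT (\<star>) act x t"
  using T'.\<delta>T_act[OF assms] by (simp add: T'.prepend_def twist_module_simps conv2_def conv1_def)

lemma \<delta>T_act_conv: "x \<in> carrier M \<Longrightarrow> t \<in> carrier T \<Longrightarrow> \<delta>T (act x t) = conv2 k HT \<delta>M \<delta>T pureT (mult H) act x t"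
  by (simp add: \<delta>T_act prepend_def conv2_def conv1_def)

lemma \<delta>T'_one: "\<delta>T' \<one>\<^bsub>T\<^esub> = pureT \<one>\<^bsub>H\<^esub> \<one>\<^bsub>T\<^esub>"
  using T'.\<delta>T_one by (simp add: twist_module_simps)

subsection \<open>The comparison map on words\<close>

abbreviation "tm \<equiv> conv2 k T \<delta>T \<delta>T (smult T) \<sigma> (mult T)"

text \<open>Left multiplication by a generator, twisted by \<open>\<sigma>\<close> with respect to the
  coaction of \<open>T(M)\<close>, and twisted by \<open>\<tau>\<close> with respect to the coaction of
  \<open>T(\<^sub>\<sigma>M)\<close>. They define \<open>\<xi>\<close> and its inverse
  \<open>\<eta>\<close>.\<close>

definition "sact = conv2 k T \<delta>M \<delta>T (smult T) \<sigma> act"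
definition "tact = conv2 k T \<delta>M \<delta>T' (smult T) \<tau> act"

lemma sact_bilinear: "bilinear_map k M T T sact"
  unfolding sact_def by (rule MT.conv2_bilinear[OF pairing_smult[OF module_T] sigma act_bilinear])

lemma tact_bilinear: "bilinear_map k M T T tact"
  unfolding tact_def by (rule MT'.conv2_bilinear[OF pairing_smult[OF module_T] tau act_bilinear])

lemmas tm_bilinear = twisted_mult_bilinear[OF T_coaction_algebra]

lemma act_one: "x \<in> carrier M \<Longrightarrow> act x \<one>\<^bsub>T\<^esub> = wc [x]"
  by (simp add: act_def word_class_closed)

lemma lift_wc:
  assumes N: "module k N" and f: "bilinear_map k H T N f" and x: "x \<in> carrier M"
  shows "tensor_lift k N f (\<delta>T (wc [x])) = tensor_lift k N (\<lambda>h x0. f h (wc [x0])) (\<delta>M x)"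
proof -
  have one: "\<one>\<^bsub>T\<^esub> \<in> carrier T" by (rule Ta.AA.one_closed)
  have b: "bilinear_map k H T N (\<lambda>g t0. f (h \<otimes>\<^bsub>H\<^esub> g) (act x0 t0))" if "h \<in> carrier H" "x0 \<in> carrier M" for h x0
    by (insert that, (assumption | rule t_rules bilinear_in_left[OF f] bilinear_in_right[OF f])+)
  have "tensor_lift k N f (\<delta>T (wc [x])) = tensor_lift k N f (\<delta>T (act x \<one>\<^bsub>T\<^esub>))"
    by (simp add: act_one x)
  also have "\<dots> = tensor_lift k N (\<lambda>h x0. tensor_lift k N (\<lambda>g t0. f (h \<otimes>\<^bsub>H\<^esub> g) (act x0 t0)) (\<delta>T \<one>\<^bsub>T\<^esub>)) (\<delta>M x)"
    by (rule lift_act[OF N f x one])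
  also have "\<dots> = tensor_lift k N (\<lambda>h x0. f h (wc [x0])) (\<delta>M x)"
    by (rule tensor_ext[OF Mc.H Mc.A _ Mc.coaction_closed[OF x]])
      (simp add: \<delta>T_one tensor_lift_pure[OF Mc.H module_T N b] one act_one)
  finally show ?thesis .
qed

lemma tm_wc:
  assumes x: "x \<in> carrier M" and t: "t \<in> carrier T"
  shows "tm (wc [x]) t = sact x t"
proof -
  have "bilinear_map k H T T (\<lambda>h a0. conv1 k T \<delta>T (smult T) (\<sigma> h) (mult T a0) t)"
    by (assumption | rule bilinearI Tm.conv1_left[OF pairing_smult[OF module_T] t] Tm.conv1_right[OF pairing_smult[OF module_T] t]
      Mc.H module_T bilinear_left[OF sigma] bilinear_right[OF sigma] bilinear_left[OF T_mult_bilinear] bilinear_right[OF T_mult_bilinear])+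
  then show ?thesis
    unfolding conv2_def sact_def by (subst lift_wc[OF module_T _ x]) (simp_all add: act_def[abs_def])
qed

lemma twist_TC_mult: "a \<otimes>\<^bsub>comodule_algebra_twist k H \<sigma> TC\<^esub> b = tm a b"
  by (simp add: comodule_algebra_twist_def same_module_tensor_lift[OF same_TC] conv2_def conv1_def)

text \<open>The unit of the twisted algebra \<open>\<^sub>\<sigma>T(M)\<close>, since \<open>\<tau>(1,
  1) = \<sigma>(1, 1)\<^sup>-\<^sup>1\<close>.\<close>

definition "unit' = \<tau> \<one>\<^bsub>H\<^esub> \<one>\<^bsub>H\<^esub> \<odot>\<^bsub>T\<^esub> \<one>\<^bsub>T\<^esub>"

lemma unit'_closed: "unit' \<in> carrier T"
  unfolding unit'_def using closed11 by simp

lemma tau_sigma_smult: "t \<in> carrier T \<Longrightarrow> \<tau> \<one>\<^bsub>H\<^esub> \<one>\<^bsub>H\<^esub> \<odot>\<^bsub>T\<^esub> (\<sigma> \<one>\<^bsub>H\<^esub> \<one>\<^bsub>H\<^esub> \<odot>\<^bsub>T\<^esub> t) = t"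
  and sigma_tau_smult: "t \<in> carrier T \<Longrightarrow> \<sigma> \<one>\<^bsub>H\<^esub> \<one>\<^bsub>H\<^esub> \<odot>\<^bsub>T\<^esub> (\<tau> \<one>\<^bsub>H\<^esub> \<one>\<^bsub>H\<^esub> \<odot>\<^bsub>T\<^esub> t) = t"
  using closed11 sigma_tau_one R.m_comm by (simp_all flip: Ta.A.smult_assoc1)

lemma tm_unit:
  assumes t: "t \<in> carrier T" shows "tm unit' t = t" "tm t unit' = t"
  unfolding unit'_def
  using linear_smult[OF bilinear_left[OF tm_bilinear t] closed11(2) Ta.AA.one_closed]
    linear_smult[OF bilinear_right[OF tm_bilinear t] closed11(2) Ta.AA.one_closed] t
  by (simp_all add: twisted_mult_one_left[OF T_coaction_algebra] twisted_mult_one_right[OF T_coaction_algebra] tau_sigma_smult)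

text \<open>The recursion on words stops at a single letter. Continuing it to the empty word amounts to
  multiplying by the unit \<open>unit'\<close> of the twisted product.\<close>

lemma xi_word_foldr: "w \<in> W \<Longrightarrow> xi_word k H \<sigma> M w = foldr sact w unit'"
proof (induction w rule: induct_list012)
  case 1 show ?case by (simp add: unit'_def tau_one_one)
next
  case (2 x)
  then show ?case using tm_unit(2)[OF word_class_closed[of "[x]"]] by (simp flip: tm_wc add: unit'_closed)
next
  case (3 x y w)
  have c: "foldr sact w unit' \<in> carrier T" if "w \<in> W" for w
    using foldr_multilinear[OF module_T sact_bilinear unit'_closed] that by (simp add: multilinear_on_words_def)
  have "xi_word k H \<sigma> M (x # y # w) = tm (wc [x]) (xi_word k H \<sigma> M (y # w))"
    by (simp add: twist_TC_mult)
  also have "\<dots> = sact x (foldr sact (y # w) unit')"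
    using 3 c[of "y # w"] by (subst tm_wc[symmetric]) auto
  finally show ?case by simp
qed

definition "\<xi> = coset_lift k T (\<lambda>w. foldr sact w unit')"

lemma xi_eq: "t \<in> carrier T \<Longrightarrow> xi k H \<sigma> M t = \<xi> t"
  unfolding xi_def \<xi>_def by (rule word_lift_ext[OF xi_word_foldr])

lemma \<xi>_linear: "linear_map k T T \<xi>"
  unfolding \<xi>_def by (rule fold_linear[OF module_T sact_bilinear unit'_closed])

lemma \<xi>_one: "\<xi> \<one>\<^bsub>T\<^esub> = unit'"
  unfolding \<xi>_def by (rule fold_one[OF module_T sact_bilinear unit'_closed])

lemma \<xi>_act: "x \<in> carrier M \<Longrightarrow> t \<in> carrier T \<Longrightarrow> \<xi> (act x t) = sact x (\<xi> t)"
  unfolding \<xi>_def by (rule fold_act[OF module_T sact_bilinear unit'_closed])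

lemma \<xi>_closed: "t \<in> carrier T \<Longrightarrow> \<xi> t \<in> carrier T"
  by (rule linear_closed[OF \<xi>_linear])

lemma \<xi>_wc: "x \<in> carrier M \<Longrightarrow> \<xi> (wc [x]) = wc [x]"
  using \<xi>_act[OF _ Ta.AA.one_closed, of x] tm_unit(2)[OF word_class_closed[of "[x]"]] tm_wc[OF _ unit'_closed, of x]
  by (simp add: act_one \<xi>_one)

text \<open>Induction along left multiplication by generators: \<open>\<xi>\<close> turns it into left
  multiplication in the twisted algebra, which is associative.\<close>

lemma \<xi>_mult:
  assumes t: "t \<in> carrier T" and s: "s \<in> carrier T"
  shows "\<xi> (t \<otimes>\<^bsub>T\<^esub> s) = tm (\<xi> t) (\<xi> s)"
proof (rule act_eqI[OF module_T _ _ _ _ t])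
  show "linear_map k T T (\<lambda>t. \<xi> (t \<otimes>\<^bsub>T\<^esub> s))"
    by (rule linear_comp[OF \<xi>_linear bilinear_left[OF T_mult_bilinear s]])
  show "linear_map k T T (\<lambda>t. tm (\<xi> t) (\<xi> s))"
    by (rule bilinear_in_left[OF tm_bilinear \<xi>_linear \<xi>_closed[OF s]])
  show "\<xi> (\<one>\<^bsub>T\<^esub> \<otimes>\<^bsub>T\<^esub> s) = tm (\<xi> \<one>\<^bsub>T\<^esub>) (\<xi> s)"
    using s by (simp add: \<xi>_one tm_unit \<xi>_closed)
  fix x t assume x: "x \<in> carrier M" and t: "t \<in> carrier T" and IH: "\<xi> (t \<otimes>\<^bsub>T\<^esub> s) = tm (\<xi> t) (\<xi> s)"
  have w: "wc [x] \<in> carrier T" using x by (simp add: word_class_closed)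
  have "\<xi> (act x t \<otimes>\<^bsub>T\<^esub> s) = tm (wc [x]) (tm (\<xi> t) (\<xi> s))"
    using x t s by (simp add: act_mult \<xi>_act IH flip: tm_wc IH add: \<xi>_closed)
  also have "\<dots> = tm (tm (wc [x]) (\<xi> t)) (\<xi> s)"
    using twisted_mult_assoc[OF T_coaction_algebra w \<xi>_closed[OF t] \<xi>_closed[OF s]] by simp
  also have "\<dots> = tm (\<xi> (act x t)) (\<xi> s)"
    using x t by (simp add: \<xi>_act tm_wc \<xi>_closed)
  finally show "\<xi> (act x t \<otimes>\<^bsub>T\<^esub> s) = tm (\<xi> (act x t)) (\<xi> s)" .
qed

lemma push_act:
  assumes f: "linear_map k T T f" and x: "x \<in> carrier M" and t: "t \<in> carrier T"
  shows "Tm.push T f (act x t) = tensor_lift k HT (\<lambda>h x0. tensor_lift k HT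
      (\<lambda>g t0. pureT (h \<otimes>\<^bsub>H\<^esub> g) (f (act x0 t0))) (\<delta>T t)) (\<delta>M x)"
    "Ta'.push T f (act x t) = tensor_lift k HT (\<lambda>h x0. tensor_lift k HT
      (\<lambda>g t0. pureT (h \<star> g) (f (act x0 t0))) (\<delta>T' t)) (\<delta>M x)"
  unfolding Tm.push_def Ta'.push_def
  by (rule lift_act[OF module_HT Tm.push_bilinear[OF module_T f] x t])
    (rule lift_act'[OF module_HT Tm.push_bilinear[OF module_T f] x t])

text \<open>Convolve the formula for the coaction of \<open>x t\<close> with \<open>\<sigma>\<close>,
  and distribute \<open>\<sigma>\<close> by the lemma \<open>conv2_star_twist\<close>.\<close>

lemma \<delta>T_sact:
  assumes x: "x \<in> carrier M" and t: "t \<in> carrier T"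
  shows "\<delta>T (sact x t) = conv2 k HT \<delta>M \<delta>T pureT (\<star>) sact x t"
proof -
  have "\<delta>T (sact x t) = conv2 k HT \<delta>M \<delta>T (smult HT) \<sigma> (\<lambda>x t. \<delta>T (act x t)) x t"
    unfolding sact_def
    by (rule MT.conv2_smult_comp[OF module_T module_HT \<delta>T_linear x t sigma act_bilinear])
  also have "\<dots> = conv2 k HT \<delta>M \<delta>T (smult HT) \<sigma> (conv2 k HT \<delta>M \<delta>T pureT (mult H) act) x t"
    by (rule MT.conv2_pair_cong[OF _ _ x t]) (simp_all add: \<delta>T_act_conv)
  also have "\<dots> = conv2 k HT \<delta>M \<delta>T pureT (\<star>) sact x t"
    unfolding sact_def by (rule conv2_star_twist[OF MT.coaction_pair_axioms module_T act_bilinear x t, symmetric])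
  finally show ?thesis .
qed

text \<open>Both sides satisfy the same recursion along left multiplication by generators: by the lemma
  \<open>\<delta>T_sact\<close> for the left hand side, and by the construction of
  \<open>\<delta>T'\<close> from the twisted product of \<open>H\<close> for the right hand side.\<close>

lemma \<xi>_colinear:
  assumes "t \<in> carrier T" shows "\<delta>T (\<xi> t) = Ta'.push T \<xi> t"
proof (rule act_eqI[OF module_HT linear_comp[OF \<delta>T_linear \<xi>_linear] Ta'.push_linear[OF module_T \<xi>_linear] _ _ assms])
  show "\<delta>T (\<xi> \<one>\<^bsub>T\<^esub>) = Ta'.push T \<xi> \<one>\<^bsub>T\<^esub>"
    using closed11
    by (simp add: Ta'.push_def \<delta>T'_one tensor_lift_pure[OF Mc.H module_T module_HT Tm.push_bilinear[OF module_T \<xi>_linear]]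
        \<xi>_one unit'_def linear_smult[OF \<delta>T_linear] \<delta>T_one pure_tensor_smult_right[OF Mc.H module_T])
  fix x t assume x: "x \<in> carrier M" and t: "t \<in> carrier T" and IH: "\<delta>T (\<xi> t) = Ta'.push T \<xi> t"
  have "\<delta>T (\<xi> (act x t)) = conv2 k HT \<delta>M \<delta>T pureT (\<star>) sact x (\<xi> t)"
    using x t by (simp add: \<xi>_act \<delta>T_sact \<xi>_closed)
  also have "\<dots> = conv2 k HT \<delta>M \<delta>T' pureT (\<star>) (\<lambda>x t. sact x (\<xi> t)) x t"
    by (rule MT.conv2_push[OF Ta'.comodule_map_axioms pairing_pure[OF Mc.H module_T] star_bilinear sact_bilinear \<xi>_linear IH x t])
  also have "\<dots> = Ta'.push T \<xi> (act x t)"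
    unfolding push_act(2)[OF \<xi>_linear x t] conv2_def conv1_def
    by (rule tensor_ext[OF Mc.H Mc.A] tensor_ext[OF Mc.H module_T])+
      (simp_all add: \<xi>_act Mc.coaction_closed Ta'.coaction_closed x t)
  finally show "\<delta>T (\<xi> (act x t)) = Ta'.push T \<xi> (act x t)" .
qed

subsection \<open>The inverse\<close>

text \<open>The preimage of \<open>\<one>\<close> under \<open>\<xi>\<close>.\<close>

definition "unit'' = \<sigma> \<one>\<^bsub>H\<^esub> \<one>\<^bsub>H\<^esub> \<odot>\<^bsub>T\<^esub> \<one>\<^bsub>T\<^esub>"

lemma unit''_closed: "unit'' \<in> carrier T"
  unfolding unit''_def using closed11 by simp

definition "\<eta> = coset_lift k T (\<lambda>w. foldr tact w unit'')"

lemma \<eta>_linear: "linear_map k T T \<eta>"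
  unfolding \<eta>_def by (rule fold_linear[OF module_T tact_bilinear unit''_closed])

lemma \<eta>_one: "\<eta> \<one>\<^bsub>T\<^esub> = unit''"
  unfolding \<eta>_def by (rule fold_one[OF module_T tact_bilinear unit''_closed])

lemma \<eta>_act: "x \<in> carrier M \<Longrightarrow> t \<in> carrier T \<Longrightarrow> \<eta> (act x t) = tact x (\<eta> t)"
  unfolding \<eta>_def by (rule fold_act[OF module_T tact_bilinear unit''_closed])

lemma \<eta>_closed: "t \<in> carrier T \<Longrightarrow> \<eta> t \<in> carrier T"
  by (rule linear_closed[OF \<eta>_linear])

text \<open>Here \<open>conv2_star_twist\<close> is used backwards: left multiplication by a generator
  is the \<open>\<sigma>\<close>-twist of \<open>tact\<close>, so its coaction is the
  \<open>\<sigma>\<close>-twist of the asserted expression, and the convolution with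
  \<open>\<tau>\<close> cancels that \<open>\<sigma>\<close>.\<close>

lemma \<delta>T'_tact:
  assumes x: "x \<in> carrier M" and t: "t \<in> carrier T"
  shows "\<delta>T' (tact x t) = conv2 k HT \<delta>M \<delta>T' pureT (mult H) tact x t"
proof -
  have act_eq: "act x t = conv2 k T \<delta>M \<delta>T' (smult T) \<sigma> tact x t" if "x \<in> carrier M" "t \<in> carrier T" for x t
    unfolding tact_def
    by (rule MT'.conv2_cancel[OF module_T sigma tau sigma_tau act_bilinear that, symmetric])
  have "\<delta>T' (tact x t) = conv2 k HT \<delta>M \<delta>T' (smult HT) \<tau> (\<lambda>x t. \<delta>T' (act x t)) x t"
    unfolding tact_def
    by (rule MT'.conv2_smult_comp[OF module_T module_HT Ta'.coaction_linear x t tau act_bilinear])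
  also have "\<dots> = conv2 k HT \<delta>M \<delta>T' (smult HT) \<tau> (conv2 k HT \<delta>M \<delta>T' (smult HT) \<sigma>
      (conv2 k HT \<delta>M \<delta>T' pureT (mult H) tact)) x t"
  proof (rule MT'.conv2_pair_cong[OF _ _ x t])
    fix x t assume xt: "x \<in> carrier M" "t \<in> carrier T"
    have "\<delta>T' (act x t) = conv2 k HT \<delta>M \<delta>T' pureT (\<star>) (conv2 k T \<delta>M \<delta>T' (smult T) \<sigma> tact) x t"
      unfolding \<delta>T'_act[OF xt] by (rule MT'.conv2_pair_cong[OF _ _ xt]) (simp_all add: act_eq)
    also have "\<dots> = conv2 k HT \<delta>M \<delta>T' (smult HT) \<sigma> (conv2 k HT \<delta>M \<delta>T' pureT (mult H) tact) x t"
      by (rule conv2_star_twist[OF MT'.coaction_pair_axioms module_T tact_bilinear xt])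
    finally show "\<delta>T' (act x t) = \<dots>" .
  qed simp
  also have "\<dots> = conv2 k HT \<delta>M \<delta>T' pureT (mult H) tact x t"
    by (rule MT'.conv2_cancel[OF module_HT tau sigma tau_sigma
        MT'.conv2_bilinear[OF pairing_pure[OF Mc.H module_T] mult_bilinear tact_bilinear] x t])
  finally show ?thesis .
qed

lemma \<eta>_colinear:
  assumes "t \<in> carrier T" shows "\<delta>T' (\<eta> t) = Tm.push T \<eta> t"
proof (rule act_eqI[OF module_HT linear_comp[OF Ta'.coaction_linear \<eta>_linear] Tm.push_linear[OF module_T \<eta>_linear] _ _ assms])
  show "\<delta>T' (\<eta> \<one>\<^bsub>T\<^esub>) = Tm.push T \<eta> \<one>\<^bsub>T\<^esub>"
    using closed11
    by (simp add: Tm.push_def \<delta>T_one tensor_lift_pure[OF Mc.H module_T module_HT Tm.push_bilinear[OF module_T \<eta>_linear]]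
        \<eta>_one unit''_def linear_smult[OF Ta'.coaction_linear] \<delta>T'_one pure_tensor_smult_right[OF Mc.H module_T])
  fix x t assume x: "x \<in> carrier M" and t: "t \<in> carrier T" and IH: "\<delta>T' (\<eta> t) = Tm.push T \<eta> t"
  have "\<delta>T' (\<eta> (act x t)) = conv2 k HT \<delta>M \<delta>T' pureT (mult H) tact x (\<eta> t)"
    using x t by (simp add: \<eta>_act \<delta>T'_tact \<eta>_closed)
  also have "\<dots> = conv2 k HT \<delta>M \<delta>T pureT (mult H) (\<lambda>x t. tact x (\<eta> t)) x t"
    by (rule MT'.conv2_push[OF Tm.comodule_map_axioms pairing_pure[OF Mc.H module_T] mult_bilinear tact_bilinear \<eta>_linear IH x t])
  also have "\<dots> = Tm.push T \<eta> (act x t)"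
    unfolding push_act(1)[OF \<eta>_linear x t] conv2_def conv1_def
    by (rule tensor_ext[OF Mc.H Mc.A] tensor_ext[OF Mc.H module_T])+
      (simp_all add: \<eta>_act Mc.coaction_closed Ta.coaction_closed x t)
  finally show "\<delta>T' (\<eta> (act x t)) = Tm.push T \<eta> (act x t)" .
qed

text \<open>By colinearity of \<open>\<xi>\<close>, \<open>\<xi>(x s)\<close> is the
  \<open>\<sigma>\<close>-twist of \<open>x \<xi>(s)\<close> for the coaction of
  \<open>T(\<^sub>\<sigma>M)\<close>, the one used in the \<open>\<tau>\<close>-twist that defines
  \<open>\<eta>\<close>. The two twists cancel.\<close>

lemma \<xi>_\<eta>:
  assumes "t \<in> carrier T" shows "\<xi> (\<eta> t) = t"
proof (rule act_eqI[OF module_T linear_comp[OF \<xi>_linear \<eta>_linear] linear_id _ _ assms])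
  show "\<xi> (\<eta> \<one>\<^bsub>T\<^esub>) = \<one>\<^bsub>T\<^esub>"
    using closed11 by (simp add: \<eta>_one unit''_def linear_smult[OF \<xi>_linear] \<xi>_one unit'_def sigma_tau_smult)
  fix x t assume x: "x \<in> carrier M" and t: "t \<in> carrier T" and IH: "\<xi> (\<eta> t) = t"
  note \<eta>t = \<eta>_closed[OF t]
  have b: "bilinear_map k M T T (\<lambda>x s. act x (\<xi> s))"
    by (intro bilinearI bilinear_in_right[OF act_bilinear \<xi>_linear] bilinear_left[OF act_bilinear] \<xi>_closed)
  have "\<xi> (\<eta> (act x t)) = conv2 k T \<delta>M \<delta>T' (smult T) \<tau> (\<lambda>x s. \<xi> (act x s)) x (\<eta> t)"
    unfolding \<eta>_act[OF x t] tact_def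
    by (rule MT'.conv2_smult_comp[OF module_T module_T \<xi>_linear x \<eta>t tau act_bilinear])
  also have "\<dots> = conv2 k T \<delta>M \<delta>T' (smult T) \<tau> (conv2 k T \<delta>M \<delta>T' (smult T) \<sigma> (\<lambda>x s. act x (\<xi> s))) x (\<eta> t)"
  proof (rule MT'.conv2_pair_cong[OF _ _ x \<eta>t])
    fix x s assume xs: "x \<in> carrier M" "s \<in> carrier T"
    show "\<xi> (act x s) = conv2 k T \<delta>M \<delta>T' (smult T) \<sigma> (\<lambda>x s. act x (\<xi> s)) x s"
      unfolding \<xi>_act[OF xs] sact_def
      by (rule MT.conv2_push[OF Ta'.comodule_map_axioms pairing_smult[OF module_T] sigma act_bilinear \<xi>_linear \<xi>_colinear[OF xs(2)] xs])
  qed simp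
  also have "\<dots> = act x (\<xi> (\<eta> t))"
    by (rule MT'.conv2_cancel[OF module_T tau sigma tau_sigma b x \<eta>t])
  finally show "\<xi> (\<eta> (act x t)) = act x t" by (simp add: IH)
qed

text \<open>The same argument with the colinearity of \<open>\<eta>\<close>.\<close>

lemma \<eta>_\<xi>:
  assumes "t \<in> carrier T" shows "\<eta> (\<xi> t) = t"
proof (rule act_eqI[OF module_T linear_comp[OF \<eta>_linear \<xi>_linear] linear_id _ _ assms])
  show "\<eta> (\<xi> \<one>\<^bsub>T\<^esub>) = \<one>\<^bsub>T\<^esub>"
    using closed11 by (simp add: \<xi>_one unit'_def linear_smult[OF \<eta>_linear] \<eta>_one unit''_def tau_sigma_smult)
  fix x t assume x: "x \<in> carrier M" and t: "t \<in> carrier T" and IH: "\<eta> (\<xi> t) = t"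
  note \<xi>t = \<xi>_closed[OF t]
  have b: "bilinear_map k M T T (\<lambda>x s. act x (\<eta> s))"
    by (intro bilinearI bilinear_in_right[OF act_bilinear \<eta>_linear] bilinear_left[OF act_bilinear] \<eta>_closed)
  have "\<eta> (\<xi> (act x t)) = conv2 k T \<delta>M \<delta>T (smult T) \<sigma> (\<lambda>x s. \<eta> (act x s)) x (\<xi> t)"
    unfolding \<xi>_act[OF x t] sact_def
    by (rule MT.conv2_smult_comp[OF module_T module_T \<eta>_linear x \<xi>t sigma act_bilinear])
  also have "\<dots> = conv2 k T \<delta>M \<delta>T (smult T) \<sigma> (conv2 k T \<delta>M \<delta>T (smult T) \<tau> (\<lambda>x s. act x (\<eta> s))) x (\<xi> t)"
  proof (rule MT.conv2_pair_cong[OF _ _ x \<xi>t])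
    fix x s assume xs: "x \<in> carrier M" "s \<in> carrier T"
    show "\<eta> (act x s) = conv2 k T \<delta>M \<delta>T (smult T) \<tau> (\<lambda>x s. act x (\<eta> s)) x s"
      unfolding \<eta>_act[OF xs] tact_def
      by (rule MT'.conv2_push[OF Tm.comodule_map_axioms pairing_smult[OF module_T] tau act_bilinear \<eta>_linear \<eta>_colinear[OF xs(2)] xs])
  qed simp
  also have "\<dots> = act x (\<eta> (\<xi> t))"
    by (rule MT.conv2_cancel[OF module_T sigma tau sigma_tau b x \<xi>t])
  finally show "\<eta> (\<xi> (act x t)) = act x t" by (simp add: IH)
qed

end

section \<open>The isomorphism\<close>

lemma multiplicative_kernel_ideal:
  assumes A: "k_algebra k A" and B: "k_algebra k B" and L: "linear_map k A B L"
    and mult: "\<And>a b. a \<in> carrier A \<Longrightarrow> b \<in> carrier A \<Longrightarrow> L (a \<otimes>\<^bsub>A\<^esub> b) = L a \<otimes>\<^bsub>B\<^esub> L b"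
  shows "ideal {a \<in> carrier A. L a = \<zero>\<^bsub>B\<^esub>} A"
proof -
  interpret A: k_algebra k A by (rule A)
  interpret B: k_algebra k B by (rule B)
  show ?thesis
  proof (rule idealI[OF A.ring_axioms])
    show "subgroup {a \<in> carrier A. L a = \<zero>\<^bsub>B\<^esub>} (add_monoid A)"
      using kernel_submodule[OF A.self_module B.self_module L] by (simp add: submodule_def)
  qed (auto simp: mult linear_closed[OF L])
qed

context coaction_algebra
begin

interpretation AAp: coaction_pair k H A \<delta> A \<delta>
  by (rule coaction_pair.intro[OF coaction_axioms coaction_axioms])

text \<open>If \<open>f(b) = 0\<close> then \<open>\<Sum> b\<^sub>-\<^sub>1 \<otimes> f(b\<^sub>0) =
  0\<close> by the last hypothesis, and the twisted expression for \<open>f(a b)\<close> or \<open>f(b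
  a)\<close> depends on \<open>b\<close> only through this element.\<close>

lemma twisted_kernel_ideal:
  assumes Q: "k_algebra k Q" and f: "linear_map k A Q f" and s: "bilinear_map k H H (self_module k) s"
    and mult: "\<And>a b. a \<in> carrier A \<Longrightarrow> b \<in> carrier A \<Longrightarrow>
      f (a \<otimes>\<^bsub>A\<^esub> b) = conv2 k Q \<delta> \<delta> (smult Q) s (\<lambda>a b. f a \<otimes>\<^bsub>Q\<^esub> f b) a b"
    and push: "\<And>a. a \<in> carrier A \<Longrightarrow> f a = \<zero>\<^bsub>Q\<^esub> \<Longrightarrow> push Q f a = \<zero>\<^bsub>tensor k H Q\<^esub>"
  shows "ideal {a \<in> carrier A. f a = \<zero>\<^bsub>Q\<^esub>} A"
proof (rule idealI)
  interpret Q: k_algebra k Q by (rule Q)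
  let ?K = "{a \<in> carrier A. f a = \<zero>\<^bsub>Q\<^esub>}"
  note Qm = Q.self_module
  note HQ = tensor_module[OF H Qm]
  note ps = pairingD(4)[OF pairing_smult[OF Qm]]
  note R = m_rules linear_comp[OF f] linear_closed[OF f] bilinear_in_left[OF Q.mult_bilinear]
    bilinear_in_right[OF Q.mult_bilinear] bilinear_closed[OF Q.mult_bilinear] Qm HQ
    bilinear_in_left[OF s] bilinear_in_right[OF s] bilinear_closed[OF s]
    bilinear_in_left[OF ps] bilinear_in_right[OF ps] bilinear_closed[OF ps]
  show "ring A" by (rule AA.ring_axioms)
  show "subgroup ?K (add_monoid A)"
    using kernel_submodule[OF A Qm f] by (simp add: submodule_def)
  fix b a assume b: "b \<in> ?K" and a: "a \<in> carrier A"
  then have b': "b \<in> carrier A" "f b = \<zero>\<^bsub>Q\<^esub>" and pb: "push Q f b = \<zero>\<^bsub>tensor k H Q\<^esub>"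
    using push by auto
  have "f (a \<otimes>\<^bsub>A\<^esub> b) = tensor_lift k Q (\<lambda>h a0. tensor_lift k Q (\<lambda>g b0. s h g \<odot>\<^bsub>Q\<^esub> (f a0 \<otimes>\<^bsub>Q\<^esub> f b0)) (\<delta> b)) (\<delta> a)"
    by (simp add: mult a b' conv2_def conv1_def)
  also have "\<dots> = \<zero>\<^bsub>Q\<^esub>"
  proof (rule tensor_lift_zero[OF H A Qm coaction_closed[OF a]])
    fix h a0 assume h: "h \<in> carrier H" "a0 \<in> carrier A"
    have bil: "bilinear_map k H Q Q (\<lambda>g q. s h g \<odot>\<^bsub>Q\<^esub> (f a0 \<otimes>\<^bsub>Q\<^esub> q))"
      by (insert h, (assumption | rule R)+)
    show "tensor_lift k Q (\<lambda>g b0. s h g \<odot>\<^bsub>Q\<^esub> (f a0 \<otimes>\<^bsub>Q\<^esub> f b0)) (\<delta> b) = \<zero>\<^bsub>Q\<^esub>"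
      unfolding lift_push[OF Qm f Qm bil b'(1), symmetric] pb
      by (rule linear_zero[OF HQ Qm tensor_lift_linear[OF H Qm Qm bil]])
  qed
  finally show "a \<otimes>\<^bsub>A\<^esub> b \<in> ?K" using a b' by simp
  have "f (b \<otimes>\<^bsub>A\<^esub> a) = tensor_lift k Q (\<lambda>h b0. tensor_lift k Q (\<lambda>g a0. s h g \<odot>\<^bsub>Q\<^esub> (f b0 \<otimes>\<^bsub>Q\<^esub> f a0)) (\<delta> a)) (\<delta> b)"
    by (simp add: mult a b' conv2_def conv1_def)
  also have "\<dots> = tensor_lift k Q (\<lambda>g a0. tensor_lift k Q (\<lambda>h b0. s h g \<odot>\<^bsub>Q\<^esub> (f b0 \<otimes>\<^bsub>Q\<^esub> f a0)) (\<delta> b)) (\<delta> a)"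
    by (rule tensor_lift_swap | assumption | rule R a b'(1))+
  also have "\<dots> = \<zero>\<^bsub>Q\<^esub>"
  proof (rule tensor_lift_zero[OF H A Qm coaction_closed[OF a]])
    fix g a0 assume h: "g \<in> carrier H" "a0 \<in> carrier A"
    have bil: "bilinear_map k H Q Q (\<lambda>h q. s h g \<odot>\<^bsub>Q\<^esub> (q \<otimes>\<^bsub>Q\<^esub> f a0))"
      by (insert h, (assumption | rule R)+)
    show "tensor_lift k Q (\<lambda>h b0. s h g \<odot>\<^bsub>Q\<^esub> (f b0 \<otimes>\<^bsub>Q\<^esub> f a0)) (\<delta> b) = \<zero>\<^bsub>Q\<^esub>"
      unfolding lift_push[OF Qm f Qm bil b'(1), symmetric] pb
      by (rule linear_zero[OF HQ Qm tensor_lift_linear[OF H Qm Qm bil]])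
  qed
  finally show "b \<otimes>\<^bsub>A\<^esub> a \<in> ?K" using a b' by simp
qed

text \<open>Convolution with respect to a quotient coaction, evaluated at images, is convolution
  upstairs.\<close>

lemma conv2_push_both:
  fixes Q :: "('k, 'q, 'v) module_scheme"
  assumes Q: "module k Q" and f: "linear_map k A Q f" and \<gamma>: "linear_map k Q (tensor k H Q) \<gamma>"
    and col: "\<And>a. a \<in> carrier A \<Longrightarrow> \<gamma> (f a) = push Q f a"
    and p: "pairing k N1 N2 N p" and F: "bilinear_map k H H N1 F" and G: "bilinear_map k Q Q N2 G"
    and ab: "a \<in> carrier A" "b \<in> carrier A"
  shows "conv2 k N \<gamma> \<gamma> p F G (f a) (f b) = conv2 k N \<delta> \<delta> p F (\<lambda>a b. G (f a) (f b)) a b"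
proof -
  interpret Q: comodule_map k H Q \<gamma> by (rule comodule_map.intro[OF H Q comult \<gamma>])
  interpret P: comodule_map_pair k H A \<delta> Q \<gamma> ..
  have G': "bilinear_map k A Q N2 (\<lambda>a q. G (f a) q)"
    by (intro bilinearI bilinear_right[OF G] bilinear_in_left[OF G f] linear_closed[OF f])
  have "conv2 k N \<gamma> \<gamma> p F G (f a) (f b) = tensor_lift k N (\<lambda>h q. conv1 k N \<gamma> p (F h) (G q) (f b)) (push Q f a)"
    by (simp add: conv2_def col ab)
  also have "\<dots> = conv2 k N \<delta> \<gamma> p F (\<lambda>a q. G (f a) q) a (f b)"
    unfolding conv2_def
    by (rule lift_push[OF Q f pairingD(3)[OF p] _ ab(1)])
      (assumption | rule bilinearI Q.conv1_left[OF p] Q.conv1_right[OF p] H Q linear_closed[OF f] ab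
        bilinear_left[OF F] bilinear_right[OF F] bilinear_left[OF G] bilinear_right[OF G])+
  also have "\<dots> = conv2 k N \<delta> \<delta> p F (\<lambda>a b. G (f a) (f b)) a b"
    by (rule P.conv2_push[OF comodule_map_axioms p F G' f col[OF ab(2)] ab])
  finally show ?thesis .
qed

end

context twisted_tensor
begin

interpretation T': tensor_coaction k H' M by (rule twisted_tensor_coaction)

abbreviation "TC' \<equiv> tensor_comodule_algebra k H' M"

interpretation C: coaction_algebra k H TC \<delta>T by (rule TC_algebra)
interpretation C': coaction_algebra k H' TC' \<delta>T' by (rule T'.TC_algebra)

definition "relation_ideal R = genideal TC R"

definition "preimage_ideal R = genideal TC' {t \<in> carrier TC'. xi k H \<sigma> M t \<in> R}"

context
  fixes R assumes R: "subcomodule k H TC R"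
begin

abbreviation "preR \<equiv> {t \<in> carrier T. \<xi> t \<in> R}"
abbreviation "idI \<equiv> relation_ideal R"
abbreviation "idJ \<equiv> preimage_ideal R"
abbreviation "QI \<equiv> quotient TC idI"
abbreviation "QJ \<equiv> quotient TC' idJ"
abbreviation "prI t \<equiv> idI +>\<^bsub>TC\<^esub> t"
abbreviation "prJ t \<equiv> idJ +>\<^bsub>TC'\<^esub> t"
abbreviation "cQI \<equiv> quotient_comodule_algebra k H TC idI"
abbreviation "cB \<equiv> comodule_algebra_twist k H \<sigma> cQI"
abbreviation "cA \<equiv> quotient_comodule_algebra k H' TC' idJ"

lemma R_subset: "R \<subseteq> carrier T"
  using R submodule_subset[of R k TC] by (simp add: subcomodule_def)

lemma idJ_eq: "idJ = genideal TC' preR"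
  unfolding preimage_ideal_def
  by (rule arg_cong[of _ _ "genideal TC'"]) (auto simp: xi_eq)

lemma idI: "ideal idI TC"
  unfolding relation_ideal_def by (rule C.AA.genideal_ideal) (simp add: R_subset)

lemma idJ: "ideal idJ TC'"
  unfolding idJ_eq by (rule C'.AA.genideal_ideal) auto

lemma idI_self: "r \<in> R \<Longrightarrow> r \<in> idI"
  unfolding relation_ideal_def using C.AA.genideal_self[of R] R_subset by auto

lemma idJ_self: "t \<in> carrier T \<Longrightarrow> \<xi> t \<in> R \<Longrightarrow> t \<in> idJ"
  unfolding idJ_eq using C'.AA.genideal_self[of preR] by auto

lemma idI_minimal: "ideal P TC \<Longrightarrow> R \<subseteq> P \<Longrightarrow> idI \<subseteq> P"
  unfolding relation_ideal_def by (rule C.AA.genideal_minimal)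

lemma idJ_minimal: "ideal P TC' \<Longrightarrow> preR \<subseteq> P \<Longrightarrow> idJ \<subseteq> P"
  unfolding idJ_eq by (rule C'.AA.genideal_minimal)

lemmas QI_alg = C.AA.quotient_k_algebra[OF idI]
lemmas QJ_alg = C'.AA.quotient_k_algebra[OF idJ]
lemmas QI_module = k_algebra.self_module[OF QI_alg]
lemmas QJ_module = k_algebra.self_module[OF QJ_alg]

lemma prI_linear: "linear_map k T QI (\<lambda>t. prI t)"
  using C.AA.proj_linear[OF idI] by (simp add: same_module_linear_dom[OF same_TC])

lemma prJ_linear: "linear_map k T QJ (\<lambda>t. prJ t)"
  using C'.AA.proj_linear[OF idJ] by (simp add: same_module_linear_dom[OF T'.same_TC])

lemma prI_zero: "t \<in> carrier T \<Longrightarrow> prI t = \<zero>\<^bsub>QI\<^esub> \<longleftrightarrow> t \<in> idI"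
  using coset_eq_zero_iff[OF C.A C.AA.ideal_submodule[OF idI]] by (simp add: quotient_simps)

lemma prJ_zero: "t \<in> carrier T \<Longrightarrow> prJ t = \<zero>\<^bsub>QJ\<^esub> \<longleftrightarrow> t \<in> idJ"
  using coset_eq_zero_iff[OF C'.A C'.AA.ideal_submodule[OF idJ]] by (simp add: quotient_simps)

text \<open>The elements satisfying the coideal condition form an ideal, which contains \<open>R\<close>
  since \<open>R\<close> is a subcomodule.\<close>

lemma idI_coideal:
  assumes "i \<in> idI" shows "C.push QI (\<lambda>t. prI t) i = \<zero>\<^bsub>tensor k H QI\<^esub>"
proof -
  have "idI \<subseteq> {a \<in> carrier TC. C.push QI (\<lambda>t. prI t) a = \<zero>\<^bsub>tensor k H QI\<^esub>}"
  proof (rule idI_minimal[OF C.push_kernel_ideal[OF QI_alg]])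
    show lin: "linear_map k TC QI (\<lambda>t. prI t)" by (rule C.AA.proj_linear[OF idI])
    show "prI (a \<otimes>\<^bsub>TC\<^esub> b) = prI a \<otimes>\<^bsub>QI\<^esub> prI b" if "a \<in> carrier TC" "b \<in> carrier TC" for a b
      by (rule C.AA.proj_mult[OF idI that])
    show "R \<subseteq> {a \<in> carrier TC. C.push QI (\<lambda>t. prI t) a = \<zero>\<^bsub>tensor k H QI\<^esub>}"
    proof
      fix r assume r: "r \<in> R"
      have "comodule_map.push k H (coact TC) QI (\<lambda>t. prI t) r = \<zero>\<^bsub>tensor k H QI\<^esub>"
      proof (rule subcomodule_push_zero[OF TC_left_comodule_algebra R QI_module lin _ r])
        fix r assume "r \<in> R"
        then have "r \<in> idI" "r \<in> carrier T" using idI_self R_subset by auto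
        then show "prI r = \<zero>\<^bsub>QI\<^esub>" by (simp add: prI_zero)
      qed
      then show "r \<in> {a \<in> carrier TC. C.push QI (\<lambda>t. prI t) a = \<zero>\<^bsub>tensor k H QI\<^esub>}"
        using r R_subset by auto
    qed
  qed
  then show ?thesis using assms by blast
qed

lemma \<eta>_R: "r \<in> R \<Longrightarrow> \<eta> r \<in> idJ"
  using R_subset by (intro idJ_self) (auto simp: \<eta>_closed \<xi>_\<eta> subset_iff)

lemma push'_prJ_\<eta>:
  assumes t: "t \<in> carrier T"
  shows "C'.push QJ (\<lambda>t. prJ t) (\<eta> t) = C.push QJ (\<lambda>t. prJ (\<eta> t)) t"
proof -
  have b: "bilinear_map k H T (tensor k H QJ) (\<lambda>h a0. pure_tensor k H QJ h (prJ a0))"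
    by (rule Tm.push_bilinear[OF QJ_module prJ_linear])
  have "C'.push QJ (\<lambda>t. prJ t) (\<eta> t) = tensor_lift k (tensor k H QJ) (\<lambda>h a0. pure_tensor k H QJ h (prJ a0)) (Tm.push T \<eta> t)"
    by (simp add: C'.push_def Tm.push_def twist_module_simps \<eta>_colinear t)
  also have "\<dots> = C.push QJ (\<lambda>t. prJ (\<eta> t)) t"
    using Tm.lift_push[OF module_T \<eta>_linear tensor_module[OF Mc.H QJ_module] b t] by (simp add: C.push_def)
  finally show ?thesis .
qed

text \<open>Here the generators are the preimages \<open>s\<close> of elements of \<open>R\<close>.
  Since \<open>\<eta>\<close> is colinear, the condition at \<open>s = \<eta>(\<xi>(s))\<close> is a
  condition at \<open>\<xi>(s)\<close> for the map induced by \<open>\<eta>\<close>, where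
  \<open>R\<close> being a subcomodule applies.\<close>

lemma idJ_coideal:
  assumes "j \<in> idJ" shows "C'.push QJ (\<lambda>t. prJ t) j = \<zero>\<^bsub>tensor k H' QJ\<^esub>"
proof -
  have "idJ \<subseteq> {a \<in> carrier TC'. C'.push QJ (\<lambda>t. prJ t) a = \<zero>\<^bsub>tensor k H' QJ\<^esub>}"
  proof (rule idJ_minimal[OF C'.push_kernel_ideal[OF QJ_alg]])
    show "linear_map k TC' QJ (\<lambda>t. prJ t)" by (rule C'.AA.proj_linear[OF idJ])
    show "prJ (a \<otimes>\<^bsub>TC'\<^esub> b) = prJ a \<otimes>\<^bsub>QJ\<^esub> prJ b" if "a \<in> carrier TC'" "b \<in> carrier TC'" for a b
      by (rule C'.AA.proj_mult[OF idJ that])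
    show "preR \<subseteq> {a \<in> carrier TC'. C'.push QJ (\<lambda>t. prJ t) a = \<zero>\<^bsub>tensor k H' QJ\<^esub>}"
    proof
      fix s assume "s \<in> preR"
      then have s: "s \<in> carrier T" "\<xi> s \<in> R" by auto
      have lin: "linear_map k TC QJ (\<lambda>t. prJ (\<eta> t))"
        using linear_comp[OF prJ_linear \<eta>_linear] by (simp add: same_module_linear_dom[OF same_TC])
      have "comodule_map.push k H (coact TC) QJ (\<lambda>t. prJ (\<eta> t)) (\<xi> s) = \<zero>\<^bsub>tensor k H QJ\<^esub>"
      proof (rule subcomodule_push_zero[OF TC_left_comodule_algebra R QJ_module lin _ s(2)])
        fix r assume "r \<in> R"
        then show "prJ (\<eta> r) = \<zero>\<^bsub>QJ\<^esub>" using \<eta>_R R_subset by (subst prJ_zero) (auto intro: \<eta>_closed)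
      qed
      then have "C'.push QJ (\<lambda>t. prJ t) s = \<zero>\<^bsub>tensor k H QJ\<^esub>"
        using push'_prJ_\<eta>[OF \<xi>_closed[OF s(1)]] s by (simp add: \<eta>_\<xi>)
      then show "s \<in> {a \<in> carrier TC'. C'.push QJ (\<lambda>t. prJ t) a = \<zero>\<^bsub>tensor k H' QJ\<^esub>}"
        using s by (simp add: twist_module_simps)
    qed
  qed
  then show ?thesis using assms by blast
qed

lemma QI_coideal: "i \<in> idI \<Longrightarrow> comodule_map.push k H (coact TC) QI (\<lambda>t. prI t) i = \<zero>\<^bsub>tensor k H QI\<^esub>"
  using idI_coideal by simp

lemma QJ_coideal: "j \<in> idJ \<Longrightarrow> comodule_map.push k H' (coact TC') QJ (\<lambda>t. prJ t) j = \<zero>\<^bsub>tensor k H' QJ\<^esub>"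
  using idJ_coideal by simp

lemma cQI_algebra: "left_comodule_algebra k H cQI"
  by (rule quotient_left_comodule_algebra[OF TC_left_comodule_algebra idI QI_coideal])

lemma cB_algebra: "left_comodule_algebra k H' cB"
  by (rule comodule_algebra_twist_coaction_algebra[OF cQI_algebra])

lemma cA_algebra: "left_comodule_algebra k H' cA"
  by (rule quotient_left_comodule_algebra[OF T'.TC_left_comodule_algebra idJ QJ_coideal])

lemmas cQI_simps = quotient_comodule_algebra_simps[of k H TC idI]
lemmas cA_simps = quotient_comodule_algebra_simps[of k H' TC' idJ]
lemmas same_cQI = same_module_quotient_comodule_algebra[of k H TC idI]
lemmas same_cA = same_module_quotient_comodule_algebra[of k H' TC' idJ]

lemma cB_simps: "carrier cB = carrier QI" "add cB = add QI" "zero cB = zero QI" "smult cB = smult QI" "coact cB = coact cQI"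
  "one cB = \<tau> \<one>\<^bsub>H\<^esub> \<one>\<^bsub>H\<^esub> \<odot>\<^bsub>QI\<^esub> \<one>\<^bsub>QI\<^esub>"
  by (simp_all add: comodule_algebra_twist_def cQI_simps tau_one_one)

lemma same_cB: "same_module cB QI"
  by (simp add: same_module_def cB_simps)

lemma cB_mult: "a \<otimes>\<^bsub>cB\<^esub> b = conv2 k QI (coact cQI) (coact cQI) (smult QI) \<sigma> (mult QI) a b"
  by (simp add: comodule_algebra_twist_def same_module_tensor_lift[OF same_cQI] cQI_simps conv2_def conv1_def)

lemma cB_alg: "k_algebra k cB"
  by (rule coaction_algebra.axioms(3)[OF left_comodule_algebraD[OF cB_algebra]])

lemma coact_prI: "t \<in> carrier T \<Longrightarrow> coact cQI (prI t) = Tm.push QI (\<lambda>t. prI t) t"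
  using Q_coact_proj[OF TC_left_comodule_algebra idI QI_coideal] by simp

lemma coact_prJ: "t \<in> carrier T \<Longrightarrow> coact cA (prJ t) = C'.push QJ (\<lambda>t. prJ t) t"
  using Q_coact_proj[OF T'.TC_left_comodule_algebra idJ QJ_coideal] by simp

lemma coact_cQI_linear: "linear_map k QI (tensor k H QI) (coact cQI)"
  by (rule Q_coact_linear[OF TC_left_comodule_algebra idI QI_coideal])

interpretation Ta: coaction_algebra k H T \<delta>T by (rule T_coaction_algebra)
interpretation TT: coaction_pair k H T \<delta>T T \<delta>T
  by (rule coaction_pair.intro[OF Ta.coaction_axioms Ta.coaction_axioms])

lemma prI_mult: "a \<in> carrier T \<Longrightarrow> b \<in> carrier T \<Longrightarrow> prI (a \<otimes>\<^bsub>T\<^esub> b) = prI a \<otimes>\<^bsub>QI\<^esub> prI b"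
  using C.AA.proj_mult[OF idI] by simp

lemma prJ_mult: "a \<in> carrier T \<Longrightarrow> b \<in> carrier T \<Longrightarrow> prJ (a \<otimes>\<^bsub>T\<^esub> b) = prJ a \<otimes>\<^bsub>QJ\<^esub> prJ b"
  using C'.AA.proj_mult[OF idJ] by simp

text \<open>The projection is an algebra map and is colinear for the coaction of the quotient.\<close>

lemma prI_tm:
  assumes ab: "a \<in> carrier T" "b \<in> carrier T"
  shows "prI (tm a b) = prI a \<otimes>\<^bsub>cB\<^esub> prI b"
proof -
  have "prI (tm a b) = conv2 k QI \<delta>T \<delta>T (smult QI) \<sigma> (\<lambda>a b. prI (a \<otimes>\<^bsub>T\<^esub> b)) a b"
    by (rule TT.conv2_smult_comp[OF module_T QI_module prI_linear ab sigma T_mult_bilinear])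
  also have "\<dots> = conv2 k QI \<delta>T \<delta>T (smult QI) \<sigma> (\<lambda>a b. prI a \<otimes>\<^bsub>QI\<^esub> prI b) a b"
    by (rule TT.conv2_pair_cong[OF _ _ ab]) (simp_all add: prI_mult)
  also have "\<dots> = prI a \<otimes>\<^bsub>cB\<^esub> prI b"
    unfolding cB_mult
    by (rule Ta.conv2_push_both[OF QI_module prI_linear coact_cQI_linear coact_prI pairing_smult[OF QI_module] sigma
          k_algebra.mult_bilinear[OF QI_alg] ab, symmetric])
  finally show ?thesis .
qed

definition "\<Theta> t = prI (\<xi> t)"

lemma \<Theta>_linear: "linear_map k T QI \<Theta>"
  unfolding \<Theta>_def by (rule linear_comp[OF prI_linear \<xi>_linear])

lemma \<Theta>_mult: "a \<in> carrier T \<Longrightarrow> b \<in> carrier T \<Longrightarrow> \<Theta> (a \<otimes>\<^bsub>T\<^esub> b) = \<Theta> a \<otimes>\<^bsub>cB\<^esub> \<Theta> b"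
  by (simp add: \<Theta>_def \<xi>_mult prI_tm \<xi>_closed)

lemma \<Theta>_one: "\<Theta> \<one>\<^bsub>T\<^esub> = \<one>\<^bsub>cB\<^esub>"
  using closed11 C.AA.proj_one[OF idI]
  by (simp add: \<Theta>_def \<xi>_one unit'_def linear_smult[OF prI_linear] Ta.AA.one_closed cB_simps)

text \<open>Being multiplicative, \<open>\<Theta>\<close> has an ideal for its kernel, so it suffices to
  look at the generators of \<open>J\<close>.\<close>

lemma \<Theta>_idJ: "j \<in> idJ \<Longrightarrow> \<Theta> j = \<zero>\<^bsub>QI\<^esub>"
proof -
  have "idJ \<subseteq> {t \<in> carrier TC'. \<Theta> t = \<zero>\<^bsub>cB\<^esub>}"
  proof (rule idJ_minimal[OF multiplicative_kernel_ideal[OF C'.AA.k_algebra_axioms cB_alg]])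
    show "linear_map k TC' cB \<Theta>"
      using \<Theta>_linear by (simp add: same_module_linear_dom[OF T'.same_TC] same_module_linear_cod[OF same_cB])
    show "\<Theta> (a \<otimes>\<^bsub>TC'\<^esub> b) = \<Theta> a \<otimes>\<^bsub>cB\<^esub> \<Theta> b" if "a \<in> carrier TC'" "b \<in> carrier TC'" for a b
      using that by (simp add: \<Theta>_mult)
    show "preR \<subseteq> {t \<in> carrier TC'. \<Theta> t = \<zero>\<^bsub>cB\<^esub>}"
    proof
      fix s assume "s \<in> preR"
      then have "s \<in> carrier T" "\<xi> s \<in> idI" using idI_self by auto
      then have "\<Theta> s = \<zero>\<^bsub>QI\<^esub>" unfolding \<Theta>_def by (subst prI_zero) (auto intro: \<xi>_closed)
      then show "s \<in> {t \<in> carrier TC'. \<Theta> t = \<zero>\<^bsub>cB\<^esub>}" using \<open>s \<in> carrier T\<close> by (simp add: cB_simps)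
    qed
  qed
  then show "j \<in> idJ \<Longrightarrow> \<Theta> j = \<zero>\<^bsub>QI\<^esub>" by (auto simp: cB_simps)
qed

definition "\<Phi> X = \<Theta> (SOME t. t \<in> X)"

lemma \<Phi>_lin: "linear_map k QJ QI \<Phi>"
  unfolding \<Phi>_def
  by (rule quotient_lift(2)[OF C'.A C'.AA.ideal_submodule[OF idJ] QI_module])
    (use \<Theta>_linear in \<open>simp_all add: same_module_linear_dom[OF T'.same_TC] \<Theta>_idJ\<close>)

lemma \<Phi>_prJ: "t \<in> carrier T \<Longrightarrow> \<Phi> (prJ t) = \<Theta> t"
  unfolding \<Phi>_def
  by (rule quotient_lift(1)[OF C'.A C'.AA.ideal_submodule[OF idJ] QI_module])
    (use \<Theta>_linear in \<open>simp_all add: same_module_linear_dom[OF T'.same_TC] \<Theta>_idJ\<close>)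

lemma QJ_elim: "X \<in> carrier QJ \<Longrightarrow> \<exists>t\<in>carrier T. X = prJ t"
  using C'.AA.proj_surj[OF idJ] by simp

lemma QI_elim: "X \<in> carrier QI \<Longrightarrow> \<exists>t\<in>carrier T. X = prI t"
  using C.AA.proj_surj[OF idI] by simp

lemma \<Phi>_hom: "\<Phi> \<in> k_algebra_hom k cA cB"
proof -
  have "\<Phi> \<in> ring_hom cA cB"
  proof (rule ring_hom_memI)
    fix X Y assume "X \<in> carrier cA" "Y \<in> carrier cA"
    then have "X \<in> carrier QJ" "Y \<in> carrier QJ" by (simp_all only: cA_simps)
    then obtain t s where ts: "t \<in> carrier T" "X = prJ t" "s \<in> carrier T" "Y = prJ s"
      using QJ_elim[of X] QJ_elim[of Y] by auto
    then show "\<Phi> (X \<otimes>\<^bsub>cA\<^esub> Y) = \<Phi> X \<otimes>\<^bsub>cB\<^esub> \<Phi> Y"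
      by (simp add: cA_simps \<Phi>_prJ \<Theta>_mult T_mult_rules(3) flip: prJ_mult)
    show "\<Phi> (X \<oplus>\<^bsub>cA\<^esub> Y) = \<Phi> X \<oplus>\<^bsub>cB\<^esub> \<Phi> Y"
      using linear_add[OF \<Phi>_lin] ts linear_closed[OF prJ_linear] by (simp add: cA_simps cB_simps)
    show "\<Phi> X \<in> carrier cB"
      using linear_closed[OF \<Phi>_lin] ts linear_closed[OF prJ_linear] by (simp add: cB_simps)
  next
    have "\<one>\<^bsub>cA\<^esub> = prJ \<one>\<^bsub>T\<^esub>" using C'.AA.proj_one[OF idJ] by (simp add: cA_simps)
    then show "\<Phi> \<one>\<^bsub>cA\<^esub> = \<one>\<^bsub>cB\<^esub>" by (simp add: \<Phi>_prJ \<Theta>_one Ta.AA.one_closed)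
  qed
  then show ?thesis
    using \<Phi>_lin by (simp add: k_algebra_hom_def same_module_linear_dom[OF same_cA] same_module_linear_cod[OF same_cB])
qed

text \<open>Along the projections this is the colinearity of \<open>\<xi>\<close>.\<close>

lemma \<Phi>_colinear: "colinear_map k H' cA cB \<Phi>"
  unfolding colinear_map_def
proof (intro conjI ballI)
  show "linear_map k cA cB \<Phi>" using \<Phi>_hom by (simp add: k_algebra_hom_def)
  fix X assume "X \<in> carrier cA"
  then have "X \<in> carrier QJ" by (simp only: cA_simps)
  then obtain t where t: "t \<in> carrier T" "X = prJ t" using QJ_elim[of X] by auto
  have HQI: "module k (tensor k H QI)" by (rule tensor_module[OF Mc.H QI_module])
  have b1: "bilinear_map k H T (tensor k H QI) (\<lambda>h a0. pure_tensor k H QI h (prI a0))"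
    by (rule Tm.push_bilinear[OF QI_module prI_linear])
  have b2: "bilinear_map k H QJ (tensor k H QI) (\<lambda>h a0. pure_tensor k H QI h (\<Phi> a0))"
    by (intro bilinearI bilinear_in_right[OF pure_tensor_bilinear[OF Mc.H QI_module] \<Phi>_lin]
        bilinear_left[OF pure_tensor_bilinear[OF Mc.H QI_module]] linear_closed[OF \<Phi>_lin])
  have d: "\<delta>T' t \<in> carrier HT" using C'.coaction_closed[of t] t
    by (simp add: twist_module_simps same_module_tensor_right[OF T'.same_TC])
  have "coact cB (\<Phi> X) = tensor_lift k (tensor k H QI) (\<lambda>h a0. pure_tensor k H QI h (prI a0)) (comodule_map.push k H \<delta>T' T \<xi> t)"
    using t by (simp add: \<Phi>_prJ \<Theta>_def cB_simps coact_prI \<xi>_closed Tm.push_def \<xi>_colinear)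
  also have "\<dots> = tensor_lift k (tensor k H QI) (\<lambda>h a0. pure_tensor k H QI h (prI (\<xi> a0))) (\<delta>T' t)"
  proof (rule comodule_map.lift_push[OF _ module_T \<xi>_linear HQI b1 t(1)])
    show "comodule_map k H T \<delta>T'"
      using C'.coaction_linear by (intro comodule_map.intro[OF Mc.H module_T Mc.comult])
        (simp add: twist_module_simps same_module_tensor_right[OF T'.same_TC] same_module_linear_dom[OF T'.same_TC])
  qed
  also have "\<dots> = tensor_lift k (tensor k H QI) (\<lambda>h a0. pure_tensor k H QI h (\<Phi> (prJ a0))) (\<delta>T' t)"
    by (rule tensor_ext[OF Mc.H module_T _ d]) (simp add: \<Phi>_prJ \<Theta>_def)
  also have "\<dots> = tensor_lift k (tensor k H QI) (\<lambda>h a0. pure_tensor k H QI h (\<Phi> a0)) (C'.push QJ (\<lambda>t. prJ t) t)"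
  proof (rule C'.lift_push[OF QJ_module _ HQI _ , symmetric])
    show "linear_map k TC' QJ (\<lambda>t. prJ t)" by (rule C'.AA.proj_linear[OF idJ])
    show "bilinear_map k H' QJ (tensor k H QI) (\<lambda>h a0. pure_tensor k H QI h (\<Phi> a0))"
      using b2 by (simp add: bilinear_map_def twist_module_simps)
  qed (use t in simp)
  finally show "coact cB (\<Phi> X) = tensor_lift k (tensor k H' cB) (\<lambda>h m0. pure_tensor k H' cB h (\<Phi> m0)) (coact cA X)"
    using t by (simp add: coact_prJ twist_module_simps same_module_tensor_right[OF same_cB] same_module_pure_right[OF same_cB])
qed

text \<open>The map \<open>?\<theta>\<close> is not multiplicative on \<open>T(M)\<close>: a product in
  \<open>T(M)\<close> is the \<open>\<tau>\<close>-twist of the twisted product, and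
  \<open>\<eta>\<close> is multiplicative for the latter. The lemma \<open>twisted_kernel_ideal\<close>
  still shows that its kernel is an ideal, and this ideal contains \<open>R\<close>.\<close>

lemma idI_\<eta>: "\<And>i. i \<in> idI \<Longrightarrow> \<eta> i \<in> idJ"
proof -
  let ?\<theta> = "\<lambda>t. prJ (\<eta> t)"
  have lin: "linear_map k T QJ ?\<theta>" by (rule linear_comp[OF prJ_linear \<eta>_linear])
  have "ideal {a \<in> carrier T. ?\<theta> a = \<zero>\<^bsub>QJ\<^esub>} T"
  proof (rule Ta.twisted_kernel_ideal[OF QJ_alg lin tau])
    fix a b assume ab: "a \<in> carrier T" "b \<in> carrier T"
    \<comment> \<open>Untwisting: the product of \<open>T(M)\<close> is recovered from the twisted
      product by convolution with \<open>\<tau>\<close>.\<close>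
    have "?\<theta> (a \<otimes>\<^bsub>T\<^esub> b) = ?\<theta> (conv2 k T \<delta>T \<delta>T (smult T) \<tau> tm a b)"
      by (subst TT.conv2_cancel[OF module_T tau sigma _ T_mult_bilinear ab]) (rule tau_sigma, assumption+, rule refl)
    also have "\<dots> = conv2 k QJ \<delta>T \<delta>T (smult QJ) \<tau> (\<lambda>a b. ?\<theta> (tm a b)) a b"
      by (rule TT.conv2_smult_comp[OF module_T QJ_module lin ab tau tm_bilinear])
    also have "\<dots> = conv2 k QJ \<delta>T \<delta>T (smult QJ) \<tau> (\<lambda>a b. ?\<theta> a \<otimes>\<^bsub>QJ\<^esub> ?\<theta> b) a b"
    proof (rule TT.conv2_pair_cong[OF _ _ ab])
      fix a b assume ab: "a \<in> carrier T" "b \<in> carrier T"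
      have "tm a b = \<xi> (\<eta> a \<otimes>\<^bsub>T\<^esub> \<eta> b)" using ab by (simp add: \<xi>_mult \<eta>_closed \<xi>_\<eta>)
      then show "?\<theta> (tm a b) = ?\<theta> a \<otimes>\<^bsub>QJ\<^esub> ?\<theta> b"
        using ab by (simp add: \<eta>_\<xi> \<eta>_closed prJ_mult T_mult_rules(3))
    qed simp
    finally show "?\<theta> (a \<otimes>\<^bsub>T\<^esub> b) = \<dots>" .
  next
    fix a assume a: "a \<in> carrier T" and z: "?\<theta> a = \<zero>\<^bsub>QJ\<^esub>"
    have "Tm.push QJ ?\<theta> a = coact cA (?\<theta> a)"
      using push'_prJ_\<eta>[OF a] coact_prJ[OF \<eta>_closed[OF a]] by simp
    also have "\<dots> = \<zero>\<^bsub>tensor k H' QJ\<^esub>"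
      unfolding z
      by (rule linear_zero[OF QJ_module tensor_module[OF twist_module QJ_module]
            Q_coact_linear[OF T'.TC_left_comodule_algebra idJ QJ_coideal]])
    finally show "Tm.push QJ ?\<theta> a = \<zero>\<^bsub>tensor k H QJ\<^esub>" by (simp add: twist_module_simps)
  qed
  then interpret K: ideal "{a \<in> carrier T. ?\<theta> a = \<zero>\<^bsub>QJ\<^esub>}" T .
  have "linear_map k TC QJ ?\<theta>" by (rule iffD2[OF same_module_linear_dom[OF same_TC] lin])
  from kernel_submodule[OF C.A QJ_module this]
  have subgroup_kernel: "subgroup {a \<in> carrier TC. ?\<theta> a = \<zero>\<^bsub>QJ\<^esub>} (add_monoid TC)"
    unfolding submodule_def by (rule conjunct1)
  \<comment> \<open>The ideals were formed in the record carrying the coaction, which has the same ring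
    structure.\<close>
  have "ideal {a \<in> carrier T. ?\<theta> a = \<zero>\<^bsub>QJ\<^esub>} TC"
  proof (rule idealI[OF C.AA.ring_axioms])
    show "subgroup {a \<in> carrier T. ?\<theta> a = \<zero>\<^bsub>QJ\<^esub>} (add_monoid TC)"
      using subgroup_kernel by (simp only: TC_simps)
    fix a x assume "a \<in> {a \<in> carrier T. ?\<theta> a = \<zero>\<^bsub>QJ\<^esub>}" and x: "x \<in> carrier TC"
    then show "x \<otimes>\<^bsub>TC\<^esub> a \<in> {a \<in> carrier T. ?\<theta> a = \<zero>\<^bsub>QJ\<^esub>}" "a \<otimes>\<^bsub>TC\<^esub> x \<in> {a \<in> carrier T. ?\<theta> a = \<zero>\<^bsub>QJ\<^esub>}"
      using K.I_l_closed[of a x] K.I_r_closed[of a x] by (simp_all only: TC_simps)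
  qed
  moreover have "R \<subseteq> {a \<in> carrier T. ?\<theta> a = \<zero>\<^bsub>QJ\<^esub>}"
  proof
    fix r assume r: "r \<in> R"
    have rT: "r \<in> carrier T" by (rule subsetD[OF R_subset r])
    have "?\<theta> r = \<zero>\<^bsub>QJ\<^esub>" by (rule iffD2[OF prJ_zero[OF \<eta>_closed[OF rT]] \<eta>_R[OF r]])
    then show "r \<in> {a \<in> carrier T. ?\<theta> a = \<zero>\<^bsub>QJ\<^esub>}" using rT by (intro CollectI conjI)
  qed
  ultimately have sub: "idI \<subseteq> {a \<in> carrier T. ?\<theta> a = \<zero>\<^bsub>QJ\<^esub>}" by (rule idI_minimal)
  fix i assume "i \<in> idI"
  then have i: "i \<in> {a \<in> carrier T. ?\<theta> a = \<zero>\<^bsub>QJ\<^esub>}" by (rule subsetD[OF sub])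
  have iT: "i \<in> carrier T" and z: "?\<theta> i = \<zero>\<^bsub>QJ\<^esub>"
    by (rule CollectD[OF i, THEN conjunct1], rule CollectD[OF i, THEN conjunct2])
  show "\<eta> i \<in> idJ" by (rule iffD1[OF prJ_zero[OF \<eta>_closed[OF iT]] z])
qed

text \<open>Preimages under \<open>\<Phi>\<close> are computed by \<open>\<eta>\<close>; injectivity is
  the inclusion \<open>\<eta>(I) \<subseteq> J\<close>.\<close>

lemma \<Phi>_bij: "bij_betw \<Phi> (carrier cA) (carrier cB)"
  unfolding cA_simps cB_simps
proof (rule bij_betw_imageI)
  interpret QJ: module k QJ by (rule QJ_module)
  interpret QI: module k QI by (rule QI_module)
  show "inj_on \<Phi> (carrier QJ)"
  proof (rule inj_onI)
    fix X Y assume XY: "X \<in> carrier QJ" "Y \<in> carrier QJ" and eq: "\<Phi> X = \<Phi> Y"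
    then obtain t where t: "t \<in> carrier T" "X \<ominus>\<^bsub>QJ\<^esub> Y = prJ t" using QJ_elim[of "X \<ominus>\<^bsub>QJ\<^esub> Y"] by auto
    have "\<Phi> (X \<ominus>\<^bsub>QJ\<^esub> Y) = \<zero>\<^bsub>QI\<^esub>"
      using linear_minus[OF QJ_module QI_module \<Phi>_lin XY] eq linear_closed[OF \<Phi>_lin XY(2)]
      by (simp add: a_minus_def QI.M.r_neg)
    then have "\<xi> t \<in> idI" using t by (simp add: \<Phi>_prJ \<Theta>_def prI_zero \<xi>_closed)
    then have "t \<in> idJ" using idI_\<eta> t by (metis \<eta>_\<xi>)
    then have z: "X \<ominus>\<^bsub>QJ\<^esub> Y = \<zero>\<^bsub>QJ\<^esub>" using t prJ_zero by simp
    have "X = (X \<ominus>\<^bsub>QJ\<^esub> Y) \<oplus>\<^bsub>QJ\<^esub> Y" using XY by (simp add: a_minus_def QJ.M.a_assoc QJ.M.l_neg)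
    then show "X = Y" using XY z by simp
  qed
  show "\<Phi> ` carrier QJ = carrier QI"
  proof
    show "carrier QI \<subseteq> \<Phi> ` carrier QJ"
    proof
      fix Y assume "Y \<in> carrier QI"
      then obtain t where t: "t \<in> carrier T" "Y = prI t" using QI_elim by blast
      then have "Y = \<Phi> (prJ (\<eta> t))" by (simp add: \<Phi>_prJ \<eta>_closed \<Theta>_def \<xi>_\<eta>)
      then show "Y \<in> \<Phi> ` carrier QJ" using linear_closed[OF prJ_linear \<eta>_closed[OF t(1)]] by blast
    qed
    show "\<Phi> ` carrier QJ \<subseteq> carrier QI" by (rule image_subsetI) (rule linear_closed[OF \<Phi>_lin])
  qed
qed

lemma \<Phi>_iso: "comodule_algebra_iso k H' cA cB \<Phi>"
  unfolding comodule_algebra_iso_def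
  by (intro conjI cA_algebra cB_algebra \<Phi>_hom \<Phi>_colinear \<Phi>_bij)

lemma \<Phi>_generators: "m \<in> carrier M \<Longrightarrow> \<Phi> (prJ (wc [m])) = prI (wc [m])"
  by (simp add: \<Phi>_prJ word_class_closed \<Theta>_def \<xi>_wc)

text \<open>An algebra map out of a quotient of the tensor algebra is determined on generators.\<close>

lemma \<Phi>_unique:
  assumes \<Psi>: "\<Psi> \<in> k_algebra_hom k cA cB" and gen: "\<And>m. m \<in> carrier M \<Longrightarrow> \<Psi> (prJ (wc [m])) = prI (wc [m])"
    and X: "X \<in> carrier cA"
  shows "\<Psi> X = \<Phi> X"
proof -
  have hom: "\<Psi> \<in> ring_hom cA cB" and "linear_map k cA cB \<Psi>"
    using \<Psi> unfolding k_algebra_hom_def by blast+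
  then have lin: "linear_map k QJ QI \<Psi>"
    by (simp only: same_module_linear_dom[OF same_cA] same_module_linear_cod[OF same_cB])
  have homP: "\<Phi> \<in> ring_hom cA cB" using \<Phi>_hom by (simp add: k_algebra_hom_def)
  have "X \<in> carrier QJ" using X by (simp only: cA_simps)
  then obtain t where t: "t \<in> carrier T" "X = prJ t" using QJ_elim[of X] by auto
  have "\<Psi> (prJ t) = \<Phi> (prJ t)"
  proof (rule act_eqI[OF QI_module linear_comp[OF lin prJ_linear] linear_comp[OF \<Phi>_lin prJ_linear] _ _ t(1)])
    have "\<one>\<^bsub>cA\<^esub> = prJ \<one>\<^bsub>T\<^esub>" using C'.AA.proj_one[OF idJ] by (simp add: cA_simps)
    then show "\<Psi> (prJ \<one>\<^bsub>T\<^esub>) = \<Phi> (prJ \<one>\<^bsub>T\<^esub>)" using ring_hom_one[OF hom] ring_hom_one[OF homP] by simp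
    fix x t assume x: "x \<in> carrier M" and t: "t \<in> carrier T" and IH: "\<Psi> (prJ t) = \<Phi> (prJ t)"
    have w: "wc [x] \<in> carrier T" using x by (simp add: word_class_closed)
    have c: "prJ (wc [x]) \<in> carrier cA" "prJ t \<in> carrier cA"
      using linear_closed[OF prJ_linear] w t by (simp_all add: cA_simps)
    have "prJ (act x t) = prJ (wc [x]) \<otimes>\<^bsub>cA\<^esub> prJ t"
      using w t by (simp add: act_def prJ_mult cA_simps)
    then show "\<Psi> (prJ (act x t)) = \<Phi> (prJ (act x t))"
      using ring_hom_mult[OF hom c] ring_hom_mult[OF homP c] IH gen[OF x] \<Phi>_generators[OF x] by simp
  qed
  then show ?thesis by (simp add: t)
qed

end

end

theorem theorem3p3:
  fixes k :: "('k, 'z) ring_scheme"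
    and H :: "('k, 'h, 'y) coalgebra_scheme"
    and \<sigma> :: "'h \<Rightarrow> 'h \<Rightarrow> 'k"
    and M :: "('k, 'h, 'm, 'x) comodule_scheme"
    and R :: "('m list \<Rightarrow> 'k) set set"
  assumes "cring k" and "\<one>\<^bsub>k\<^esub> \<noteq> \<zero>\<^bsub>k\<^esub>"
    and "hopf_algebra k H"
    and "two_cocycle k H \<sigma>"
    and "left_comodule k H M"
    and "subcomodule k H (tensor_comodule_algebra k H M) R"
  shows "let H' = cocycle_twist k \<sigma> H;
      T = tensor_comodule_algebra k H M;
      I = genideal T R;
      B = comodule_algebra_twist k H \<sigma> (quotient_comodule_algebra k H T I);
      T' = tensor_comodule_algebra k H' M;
      J = genideal T' {t \<in> carrier T'. xi k H \<sigma> M t \<in> R};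
      A = quotient_comodule_algebra k H' T' J
    in \<exists>\<Phi>. comodule_algebra_iso k H' A B \<Phi> \<and>
      (\<forall>m\<in>carrier M. \<Phi> (J +>\<^bsub>T'\<^esub> word_class k M [m]) = I +>\<^bsub>T\<^esub> word_class k M [m]) \<and>
      (\<forall>\<Psi>\<in>k_algebra_hom k A B.
        (\<forall>m\<in>carrier M. \<Psi> (J +>\<^bsub>T'\<^esub> word_class k M [m]) = I +>\<^bsub>T\<^esub> word_class k M [m]) \<longrightarrow>
        (\<forall>a\<in>carrier A. \<Psi> a = \<Phi> a))"
proof -
  have "bialgebra k H" using assms(3) by (rule hopf_algebra.axioms(1))
  moreover have "coaction k H M (coact M)" using assms(5) by (simp add: left_comodule_iff)
  ultimately interpret twisted_tensor k H \<sigma> M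
    using assms(4) by (intro twisted_tensor.intro cocycle.intro cocycle_axioms.intro tensor_coaction.intro)
  show ?thesis
    unfolding Let_def relation_ideal_def[symmetric] preimage_ideal_def[symmetric]
  proof (intro exI conjI ballI impI)
    show "comodule_algebra_iso k H' (cA R) (cB R) (\<Phi> R)" by (rule \<Phi>_iso[OF assms(6)])
    show "\<Phi> R (prJ R (wc [m])) = prI R (wc [m])" if "m \<in> carrier M" for m
      by (rule \<Phi>_generators[OF assms(6) that])
    show "\<Psi> a = \<Phi> R a"
      if "\<Psi> \<in> k_algebra_hom k (cA R) (cB R)" "\<forall>m\<in>carrier M. \<Psi> (prJ R (wc [m])) = prI R (wc [m])" "a \<in> carrier (cA R)" for \<Psi> a
      by (rule \<Phi>_unique[OF assms(6) that(1) _ that(3)]) (rule bspec[OF that(2)])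
  qed
qed

end
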